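(* Let $r\ge 2$ and let $\Gamma$ be a finitely generated Zariski dense subgroup of an irreducible arithmetic subgroup of $\mathrm{PSL}(2,\mathbb{R})^r$. Let $m$ be the number of indices $i\in\{1,\ldots,r\}$ for which $p_i(\Gamma)$ is not discrete. (i) If there is $j\in\{1,\ldots,r\}$ such that $p_j(\Gamma)$ is discrete, then $F_\Gamma$ is homeomorphic to $\mathcal{L}_{p_j(\Gamma)}\times(\partial\mathbb{H}^2)^m$. (ii) If $p_i(\Gamma)$ is not discrete for all $i=1,\ldots,r$, then $F_\Gamma=(\partial\mathbb{H}^2)^r$.
   Context: $\mathrm{PSL}(2,\mathbb{R})^r$ acts on $(\mathbb{H}^2)^r$ componentwise by fractional linear transformations; $p_i$ denotes the projection onto the $i$-th factor (of points or of group elements). The geometric boundary $\partial((\mathbb{H}^2)^r)$ is the set of asymptoticity classes of unit speed geodesic rays, with the cone topology; $(\mathbb{H}^2)^r\cup\partial((\mathbb{H}^2)^r)$ is the corresponding compactification. A geodesic is regular if all its projections $p_i\circ\gamma$ are nonconstant; the regular boundary (classes of regular geodesic rays) is identified with $(\partial\mathbb{H}^2)^r\times\mathbb{RP}^{r-1}_+$, where $\mathbb{RP}^{r-1}_+=\{(w_1:\cdots:w_r): w_i>0\}$, via $\gamma\mapsto ((p_1\circ\gamma(+\infty),\ldots,p_r\circ\gamma(+\infty)),(d(p_1\gamma(0),p_1\gamma(1)):\cdots:d(p_r\gamma(0),p_r\gamma(1))))$; $(\partial\mathbb{H}^2)^r$ is the Furstenberg boundary. For a subgroup $\Gamma$ and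 $x\in(\mathbb{H}^2)^r$, the limit set is $\mathcal{L}_\Gamma=\overline{\Gamma(x)}\cap\partial((\mathbb{H}^2)^r)$ (independent of $x$); the regular limit set $\mathcal{L}^{reg}_\Gamma$ is its intersection with the regular boundary; the Furstenberg limit set $F_\Gamma$ is the projection of $\mathcal{L}^{reg}_\Gamma$ to $(\partial\mathbb{H}^2)^r$ and the projective limit set $P_\Gamma$ is its projection to $\mathbb{RP}^{r-1}_+$. For a subgroup $G\le\mathrm{PSL}(2,\mathbb{R})$, $\mathcal{L}_G\subset\partial\mathbb{H}^2$ is its usual limit set. Irreducible arithmetic subgroups of $\mathrm{PSL}(2,\mathbb{R})^r$ are the subgroups commensurable with a group $\Gamma(A,\mathcal{O})^*=\{(\phi_1(\varepsilon),\ldots,\phi_r(\varepsilon)):\varepsilon\in\mathcal{O}^1\}$ (mod $\pm1$), where $A$ is a quaternion algebra over a totally real number field $K$ with real embeddings $\phi_1=\mathrm{id},\ldots,\phi_n$, unramified exactly at $\phi_1,\ldots,\phi_r$, these extended to embeddings $A\to M(2,\mathbb{R})$, $\mathcal{O}$ an order of $A$, $\mathcal{O}^1$ its norm-one units. *)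

theory Defs
  imports "HOL-Analysis.Analysis"
begin

section \<open>The group PSL(2,R)^r, represented through its preimage in SL(2,R)^r\<close>

type_synonym mat2 = "real^2^2"

definition Gr :: "nat \<Rightarrow> (nat \<Rightarrow> mat2) set" where
  "Gr r = {g. (\<forall>i<r. det (g i) = 1) \<and> (\<forall>i\<ge>r. g i = mat 1)}"

definition gmul :: "(nat \<Rightarrow> mat2) \<Rightarrow> (nat \<Rightarrow> mat2) \<Rightarrow> (nat \<Rightarrow> mat2)" where
  "gmul g h = (\<lambda>i. g i ** h i)"

definition ginv :: "(nat \<Rightarrow> mat2) \<Rightarrow> (nat \<Rightarrow> mat2)" where
  "ginv g = (\<lambda>i. matrix_inv (g i))"

(* kernel {\<plusminus>1}^r of SL(2,R)^r \<rightarrow> PSL(2,R)^r *)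
definition signs :: "nat \<Rightarrow> (nat \<Rightarrow> mat2) set" where
  "signs r = {g. (\<forall>i<r. g i = mat 1 \<or> g i = - mat 1) \<and> (\<forall>i\<ge>r. g i = mat 1)}"

(* a subgroup of PSL(2,R)^r, given by its full preimage in SL(2,R)^r *)
definition psub :: "nat \<Rightarrow> (nat \<Rightarrow> mat2) set \<Rightarrow> bool" where
  "psub r G \<longleftrightarrow> G \<subseteq> Gr r \<and> signs r \<subseteq> G \<and>
     (\<forall>g\<in>G. \<forall>h\<in>G. gmul g h \<in> G) \<and> (\<forall>g\<in>G. ginv g \<in> G)"

definition fin_gen :: "nat \<Rightarrow> (nat \<Rightarrow> mat2) set \<Rightarrow> bool" where
  "fin_gen r G \<longleftrightarrow> (\<exists>S. finite S \<and> S \<subseteq> G \<and> G = \<Inter>{H. psub r H \<and> S \<subseteq> H})"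

definition fin_index :: "(nat \<Rightarrow> mat2) set \<Rightarrow> (nat \<Rightarrow> mat2) set \<Rightarrow> bool" where
  "fin_index H G \<longleftrightarrow> H \<subseteq> G \<and> finite ((\<lambda>g. gmul g ` H) ` G)"

definition commensurable :: "(nat \<Rightarrow> mat2) set \<Rightarrow> (nat \<Rightarrow> mat2) set \<Rightarrow> bool" where
  "commensurable G H \<longleftrightarrow> fin_index (G \<inter> H) G \<and> fin_index (G \<inter> H) H"

definition proj :: "nat \<Rightarrow> (nat \<Rightarrow> mat2) set \<Rightarrow> mat2 set" where
  "proj i G = (\<lambda>g. g i) ` G"

(* discreteness of a subgroup of SL(2,R) (equivalently of its image in PSL(2,R)) *)
definition discrete_grp :: "mat2 set \<Rightarrow> bool" where
  "discrete_grp G \<longleftrightarrow> (\<exists>e>0. \<forall>M\<in>G. dist M (mat 1) < e \<longrightarrow> M = mat 1)"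

inductive_set polyfun :: "nat \<Rightarrow> ((nat \<Rightarrow> mat2) \<Rightarrow> real) set" for r where
  pconst: "(\<lambda>g. c) \<in> polyfun r"
| pcoord: "i < r \<Longrightarrow> (\<lambda>g. g i $ k $ l) \<in> polyfun r"
| padd: "p \<in> polyfun r \<Longrightarrow> q \<in> polyfun r \<Longrightarrow> (\<lambda>g. p g + q g) \<in> polyfun r"
| pmul: "p \<in> polyfun r \<Longrightarrow> q \<in> polyfun r \<Longrightarrow> (\<lambda>g. p g * q g) \<in> polyfun r"

definition zariski_dense :: "nat \<Rightarrow> (nat \<Rightarrow> mat2) set \<Rightarrow> bool" where
  "zariski_dense r G \<longleftrightarrow>
     (\<forall>p\<in>polyfun r. (\<forall>g\<in>G. p g = 0) \<longrightarrow> (\<forall>g\<in>Gr r. p g = 0))"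

(* a number field, given as a subfield of R (its identity embedding) *)
definition number_field :: "real set \<Rightarrow> bool" where
  "number_field K \<longleftrightarrow> 0 \<in> K \<and> 1 \<in> K \<and>
     (\<forall>x\<in>K. \<forall>y\<in>K. x + y \<in> K \<and> x - y \<in> K \<and> x * y \<in> K) \<and>
     (\<forall>x\<in>K. x \<noteq> 0 \<longrightarrow> inverse x \<in> K) \<and>
     (\<exists>B. finite B \<and> B \<subseteq> K \<and> K = {x. \<exists>q. x = (\<Sum>b\<in>B. of_rat (q b) * b)})"

definition field_emb :: "real set \<Rightarrow> (real \<Rightarrow> 'a::field) \<Rightarrow> bool" where
  "field_emb K \<sigma> \<longleftrightarrow> \<sigma> 1 = 1 \<and>
     (\<forall>x\<in>K. \<forall>y\<in>K. \<sigma> (x + y) = \<sigma> x + \<sigma> y \<and> \<sigma> (x * y) = \<sigma> x * \<sigma> y)"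

definition totally_real :: "real set \<Rightarrow> bool" where
  "totally_real K \<longleftrightarrow> (\<forall>\<tau>::real \<Rightarrow> complex. field_emb K \<tau> \<longrightarrow> \<tau> ` K \<subseteq> \<real>)"

(* The quaternion algebra (a,b)_K with basis 1,i,j,k; i^2=a, j^2=b, k=ij=-ji.
   Elements are quadruples of elements of K. *)
type_synonym quat = "real \<times> real \<times> real \<times> real"

definition qalg :: "real set \<Rightarrow> quat set" where
  "qalg K = {(x0,x1,x2,x3). x0 \<in> K \<and> x1 \<in> K \<and> x2 \<in> K \<and> x3 \<in> K}"

definition qone :: quat where "qone = (1,0,0,0)"

definition qadd :: "quat \<Rightarrow> quat \<Rightarrow> quat" where
  "qadd x y = (case x of (x0,x1,x2,x3) \<Rightarrow> case y of (y0,y1,y2,y3) \<Rightarrow>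
      (x0+y0, x1+y1, x2+y2, x3+y3))"

definition qneg :: "quat \<Rightarrow> quat" where
  "qneg x = (case x of (x0,x1,x2,x3) \<Rightarrow> (-x0,-x1,-x2,-x3))"

definition qscal :: "real \<Rightarrow> quat \<Rightarrow> quat" where
  "qscal c x = (case x of (x0,x1,x2,x3) \<Rightarrow> (c*x0, c*x1, c*x2, c*x3))"

definition qmul :: "real \<Rightarrow> real \<Rightarrow> quat \<Rightarrow> quat \<Rightarrow> quat" where
  "qmul a b x y = (case x of (x0,x1,x2,x3) \<Rightarrow> case y of (y0,y1,y2,y3) \<Rightarrow>
      (x0*y0 + a*x1*y1 + b*x2*y2 - a*b*x3*y3,
       x0*y1 + x1*y0 - b*x2*y3 + b*x3*y2,
       x0*y2 + x2*y0 + a*x1*y3 - a*x3*y1,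
       x0*y3 + x3*y0 + x1*y2 - x2*y1))"

definition qnrd :: "real \<Rightarrow> real \<Rightarrow> quat \<Rightarrow> real" where
  "qnrd a b x = (case x of (x0,x1,x2,x3) \<Rightarrow> x0^2 - a*x1^2 - b*x2^2 + a*b*x3^2)"

definition alg_emb :: "real set \<Rightarrow> real \<Rightarrow> real \<Rightarrow> (real \<Rightarrow> real) \<Rightarrow> (quat \<Rightarrow> mat2) \<Rightarrow> bool" where
  "alg_emb K a b \<sigma> \<rho> \<longleftrightarrow> \<rho> qone = mat 1 \<and>
     (\<forall>x\<in>qalg K. \<forall>y\<in>qalg K. \<rho> (qadd x y) = \<rho> x + \<rho> y \<and> \<rho> (qmul a b x y) = \<rho> x ** \<rho> y) \<and>
     (\<forall>c\<in>K. \<forall>x\<in>qalg K. \<rho> (qscal c x) = \<sigma> c *\<^sub>R \<rho> x)"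

(* A is unramified at sigma iff A \<otimes>_\<sigma> R \<cong> M(2,R), i.e. such an extension exists *)
definition unramified :: "real set \<Rightarrow> real \<Rightarrow> real \<Rightarrow> (real \<Rightarrow> real) \<Rightarrow> bool" where
  "unramified K a b \<sigma> \<longleftrightarrow> (\<exists>\<rho>. alg_emb K a b \<sigma> \<rho>)"

definition is_order :: "real set \<Rightarrow> real \<Rightarrow> real \<Rightarrow> quat set \<Rightarrow> bool" where
  "is_order K a b Ord \<longleftrightarrow> Ord \<subseteq> qalg K \<and> qone \<in> Ord \<and>
     (\<forall>x\<in>Ord. \<forall>y\<in>Ord. qadd x y \<in> Ord \<and> qmul a b x y \<in> Ord) \<and> (\<forall>x\<in>Ord. qneg x \<in> Ord) \<and>
     (\<exists>bs::quat list. set bs \<subseteq> Ord \<and>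
        Ord = {x. \<exists>zs::int list. length zs = length bs \<and>
                 x = foldr qadd (map2 (\<lambda>z v. qscal (of_int z) v) zs bs) (0,0,0,0)}) \<and>
     (\<forall>x\<in>qalg K. \<exists>d::nat. d > 0 \<and> qscal (real d) x \<in> Ord)"

(* Gamma(A,O)^*, as a subset of SL(2,R)^r closed under the kernel {\<plusminus>1}^r *)
definition Gamma_AO :: "nat \<Rightarrow> real \<Rightarrow> real \<Rightarrow> quat set \<Rightarrow> (nat \<Rightarrow> quat \<Rightarrow> mat2) \<Rightarrow> (nat \<Rightarrow> mat2) set" where
  "Gamma_AO r a b Ord \<rho> = {gmul s (\<lambda>i. if i < r then \<rho> i \<epsilon> else mat 1) | s \<epsilon>.
       s \<in> signs r \<and> \<epsilon> \<in> Ord \<and> qnrd a b \<epsilon> = 1}"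

definition irr_arith :: "nat \<Rightarrow> (nat \<Rightarrow> mat2) set \<Rightarrow> bool" where
  "irr_arith r \<Delta> \<longleftrightarrow> psub r \<Delta> \<and>
    (\<exists>K a b Ord (\<sigma>::nat \<Rightarrow> real \<Rightarrow> real) \<rho>.
       number_field K \<and> totally_real K \<and> a \<in> K \<and> b \<in> K \<and> a \<noteq> 0 \<and> b \<noteq> 0 \<and>
       (\<forall>i<r. field_emb K (\<sigma> i)) \<and> (\<forall>x\<in>K. \<sigma> 0 x = x) \<and>
       (\<forall>i<r. \<forall>j<r. i \<noteq> j \<longrightarrow> (\<exists>x\<in>K. \<sigma> i x \<noteq> \<sigma> j x)) \<and>
       (\<forall>i<r. alg_emb K a b (\<sigma> i) (\<rho> i)) \<and>
       (\<forall>\<tau>::real \<Rightarrow> real. field_emb K \<tau> \<and> (\<forall>i<r. \<exists>x\<in>K. \<tau> x \<noteq> \<sigma> i x)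
            \<longrightarrow> \<not> unramified K a b \<tau>) \<and>
       is_order K a b Ord \<and>
       commensurable \<Delta> (Gamma_AO r a b Ord \<rho>))"

definition cayley :: "complex \<Rightarrow> complex" where
  "cayley z = (z - \<i>) / (z + \<i>)"

definition moeb :: "mat2 \<Rightarrow> complex \<Rightarrow> complex" where
  "moeb M z = (of_real (M$1$1) * z + of_real (M$1$2)) / (of_real (M$2$1) * z + of_real (M$2$2))"

definition orb :: "mat2 \<Rightarrow> complex" where
  "orb M = cayley (moeb M \<i>)"

definition hdist :: "complex \<Rightarrow> complex \<Rightarrow> real" where
  "hdist z w = arcosh (1 + 2 * (cmod (z - w))^2 / ((1 - (cmod z)^2) * (1 - (cmod w)^2)))"

definition limset :: "mat2 set \<Rightarrow> complex set" where
  "limset G = closure (orb ` G) \<inter> sphere 0 1"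

(* Furstenberg limit set: points \<xi> of (\<partial>H^2)^r such that some regular boundary point
   (\<xi>, [w]) is a cone-topology limit of an orbit sequence g_n(o), o = (0,...,0). *)
definition furst_limset :: "nat \<Rightarrow> (nat \<Rightarrow> mat2) set \<Rightarrow> (nat \<Rightarrow> complex) set" where
  "furst_limset r G = {\<xi>. (\<forall>i\<ge>r. \<xi> i = 0) \<and>
     (\<exists>w::nat \<Rightarrow> real. (\<forall>i<r. w i > 0) \<and>
      (\<exists>g::nat \<Rightarrow> nat \<Rightarrow> mat2. (\<forall>n. g n \<in> G) \<and>
         (let d = (\<lambda>n i. hdist 0 (orb (g n i)));
              D = (\<lambda>n. sqrt (\<Sum>i<r. (d n i)^2));
              W = sqrt (\<Sum>i<r. (w i)^2)
          in filterlim D at_top sequentially \<and>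
             (\<forall>i<r. ((\<lambda>n. d n i / D n) \<longlongrightarrow> w i / W) sequentially) \<and>
             (\<forall>i<r. ((\<lambda>n. orb (g n i)) \<longlongrightarrow> \<xi> i) sequentially))))}"

definition torus :: "nat \<Rightarrow> (nat \<Rightarrow> complex) set" where
  "torus k = {f. (\<forall>i<k. f i \<in> sphere 0 1) \<and> (\<forall>i\<ge>k. f i = 0)}"

end

theory Submission
  imports Defs "HOL-Analysis.Analysis"
begin

text \<open>
  By Zariski density, products in \<open>\<Gamma>\<close> can be corrected by finitely many elements so that all
  component norms multiply; hence the Furstenberg limit set is the set \<open>lam r \<Gamma>\<close> of limits in
  the torus of orbit points all of whose components go to infinity. If \<open>proj i \<Gamma>\<close> is not
  discrete, a bound on the \<open>i\<close>-th components cannot force a bound on the \<open>k\<close>-th ones: otherwise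
  limits of conjugates would give pairs of unipotents making all traces agree up to sign.
  So there are elements bounded in component \<open>i\<close> and unbounded in all others, and \<open>lam r \<Gamma>\<close> is
  saturated in coordinate \<open>i\<close>. For two discrete projections \<open>j\<close> and \<open>l\<close>, a geodesic in the
  \<open>j\<close>-th factor is shadowed by elements of \<open>\<Gamma>\<close> whose successive quotients are powers of
  finitely many parabolic or hyperbolic elements times bounded ones; arithmeticity transfers the
  type of these to the \<open>l\<close>-th factor. This gives a Hoelder estimate, by which
  coordinate \<open>j\<close> of a point of \<open>lam r \<Gamma>\<close> determines coordinate \<open>l\<close>. The projection of
  \<open>lam r \<Gamma>\<close> to the \<open>j\<close>-th and the non-discrete coordinates is therefore a continuous
  bijection of compact spaces.
\<close>

section \<open>Real 2x2 matrices\<close>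

text \<open>Distances are replaced by matrix norms: \<open>(norm M)^2\<close> is twice the
  hyperbolic cosine of the displacement of \<open>\<i>\<close>. Regularity of limits comes for free,
  since a huge power of an element that is hyperbolic in every component, multiplied on the right,
  prescribes the direction of escape without moving the limit point. The main obstacle is a pair of
  discrete projections. They are isomorphic up to signs, but they may have cusps and infinite
  covolume, so a map between their limit sets has to be built by hand. Finite generation makes a
  neighbourhood of the orbit of \<open>\<i>\<close> connected. A path in it blocks every path
  outside, so the stabiliser of a component of the complement has no crossing axes and is virtually
  cyclic: this is the origin of the finitely many parabolic or hyperbolic elements. Arithmeticity
  acts through traces. A power of each element comes from a unit x of a quaternion order, its trace
  in component i is plus or minus twice the i-th conjugate of one number x0, and x0^2 = 1 holds in
  all embeddings or in none. If a parabolic element could become hyperbolic elsewhere, the norms of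
  two components would not be polynomially comparable.\<close>

definition mk2 :: "real \<Rightarrow> real \<Rightarrow> real \<Rightarrow> real \<Rightarrow> mat2" where
  "mk2 a b c d = (\<chi> i j. if i = 1 then (if j = 1 then a else b) else (if j = 1 then c else d))"

lemma mk2_nth [simp]:
  "mk2 a b c d $ 1 $ 1 = a" "mk2 a b c d $ 1 $ 2 = b"
  "mk2 a b c d $ 2 $ 1 = c" "mk2 a b c d $ 2 $ 2 = d"
  by (simp_all add: mk2_def)

lemma mat2_eq_iff:
  fixes A B :: mat2
  shows "A = B \<longleftrightarrow> A$1$1 = B$1$1 \<and> A$1$2 = B$1$2 \<and> A$2$1 = B$2$1 \<and> A$2$2 = B$2$2"
  by (auto simp: vec_eq_iff forall_2)

lemma mat2_mult_nth [simp]: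
  fixes A B :: mat2
  shows "(A ** B)$i$j = A$i$1 * B$1$j + A$i$2 * B$2$j"
  by (simp add: matrix_matrix_mult_def sum_2)

lemma mat2_one_nth [simp]:
  "(mat x :: mat2)$1$1 = x" "(mat x :: mat2)$1$2 = 0"
  "(mat x :: mat2)$2$1 = 0" "(mat x :: mat2)$2$2 = x"
  by (simp_all add: mat_def)

lemma det2: "det (A::mat2) = A$1$1 * A$2$2 - A$1$2 * A$2$1"
  by (simp add: det_2)

text \<open>The adjugate. It is the inverse when the determinant is 1, and rules such as
  \<open>inv2_mult\<close> hold for it without any side condition.\<close>

definition inv2 :: "mat2 \<Rightarrow> mat2" where
  "inv2 A = mk2 (A$2$2) (- A$1$2) (- A$2$1) (A$1$1)"

lemma inv2_nth [simp]:
  "inv2 A $ 1 $ 1 = A$2$2" "inv2 A $ 1 $ 2 = - A$1$2"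
  "inv2 A $ 2 $ 1 = - A$2$1" "inv2 A $ 2 $ 2 = A$1$1"
  by (simp_all add: inv2_def)

lemma det_inv2 [simp]: "det (inv2 A) = det A"
  by (simp add: det2)

lemma inv2_inv2 [simp]: "inv2 (inv2 A) = A"
  by (simp add: mat2_eq_iff)

lemma inv2_mult: "inv2 (A ** B) = inv2 B ** inv2 A"
  by (simp add: mat2_eq_iff)

lemma inv2_one [simp]: "inv2 (mat 1) = mat 1"
  by (simp add: mat2_eq_iff)

lemma inv2_left: "det A = 1 \<Longrightarrow> inv2 A ** A = mat 1"
  and inv2_right: "det A = 1 \<Longrightarrow> A ** inv2 A = mat 1"
  by (simp_all add: mat2_eq_iff det2 algebra_simps)

lemma inv2_cancel_left: "det A = 1 \<Longrightarrow> inv2 A ** (A ** B) = B"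
  and inv2_cancel_left': "det A = 1 \<Longrightarrow> A ** (inv2 A ** B) = B"
  by (simp_all add: matrix_mul_assoc inv2_left inv2_right matrix_mul_lid)

lemma inv2_cancel_right: "det A = 1 \<Longrightarrow> (B ** A) ** inv2 A = B"
  and inv2_cancel_right': "det A = 1 \<Longrightarrow> (B ** inv2 A) ** A = B"
  by (simp_all add: matrix_mul_assoc[symmetric] inv2_left inv2_right matrix_mul_rid)

lemma matrix_inv_eq_inv2:
  assumes "det A = 1" shows "matrix_inv A = inv2 A"
proof -
  have "A ** matrix_inv A = mat 1 \<and> matrix_inv A ** A = mat 1"
    unfolding matrix_inv_def by (rule someI[of _ "inv2 A"]) (simp add: assms inv2_left inv2_right)
  then have "inv2 A ** (A ** matrix_inv A) = inv2 A" by (simp add: matrix_mul_rid)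
  then show ?thesis by (simp only: inv2_cancel_left[OF assms])
qed

lemma matrix_mul_minus_left [simp]: "(- A) ** B = - (A ** B)" for A B :: mat2
  by (simp add: mat2_eq_iff)

lemma matrix_mul_minus_right [simp]: "A ** (- B) = - (A ** B)" for A B :: mat2
  by (simp add: mat2_eq_iff)

lemma det_minus2 [simp]: "det (- A :: mat2) = det A"
  by (simp add: det2)

lemma inv2_minus [simp]: "inv2 (- A) = - inv2 A"
  by (simp add: mat2_eq_iff)

lemma det_mult1: "det A = 1 \<Longrightarrow> det B = 1 \<Longrightarrow> det (A ** B :: mat2) = 1"
  by (simp add: det_mul)

lemma norm_mat2_sq: "(norm (A::mat2))\<^sup>2 = (A$1$1)\<^sup>2 + (A$1$2)\<^sup>2 + (A$2$1)\<^sup>2 + (A$2$2)\<^sup>2"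
  by (simp add: norm_vec_def L2_set_def sum_2)

lemma norm_mat2: "norm (A::mat2) = sqrt ((A$1$1)\<^sup>2 + (A$1$2)\<^sup>2 + (A$2$1)\<^sup>2 + (A$2$2)\<^sup>2)"
  by (metis norm_mat2_sq norm_ge_zero real_sqrt_unique)

lemma norm_inv2 [simp]: "norm (inv2 A) = norm A"
  by (simp add: norm_mat2 add_ac)

lemma norm_mult2: "norm (A ** B) \<le> norm A * norm B" for A B :: mat2
proof (rule power2_le_imp_le)
  have *: "(a*e+b*g)\<^sup>2 \<le> (a\<^sup>2+b\<^sup>2) * (e\<^sup>2+g\<^sup>2)" for a b e g :: real
  proof -
    have "(a\<^sup>2+b\<^sup>2) * (e\<^sup>2+g\<^sup>2) - (a*e+b*g)\<^sup>2 = (a*g - b*e)\<^sup>2"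
      by (simp add: power2_eq_square algebra_simps)
    then show ?thesis by (smt (verit) zero_le_power2)
  qed
  show "(norm (A ** B))\<^sup>2 \<le> (norm A * norm B)\<^sup>2"
    unfolding power_mult_distrib norm_mat2_sq mat2_mult_nth
    using *[of "A$1$1" "B$1$1" "A$1$2" "B$2$1"] *[of "A$1$1" "B$1$2" "A$1$2" "B$2$2"]
      *[of "A$2$1" "B$1$1" "A$2$2" "B$2$1"] *[of "A$2$1" "B$1$2" "A$2$2" "B$2$2"]
    by (simp add: algebra_simps)
qed simp

lemma norm_entry: "\<bar>A$i$j\<bar> \<le> norm A" for A :: mat2
  by (metis Finite_Cartesian_Product.norm_nth_le order_trans real_norm_def)

lemma norm_mat2_le_sum: "norm (A::mat2) \<le> \<bar>A$1$1\<bar> + \<bar>A$1$2\<bar> + \<bar>A$2$1\<bar> + \<bar>A$2$2\<bar>"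
proof (rule power2_le_imp_le)
  show "(norm A)\<^sup>2 \<le> (\<bar>A$1$1\<bar> + \<bar>A$1$2\<bar> + \<bar>A$2$1\<bar> + \<bar>A$2$2\<bar>)\<^sup>2"
    unfolding norm_mat2_sq by (simp add: power2_eq_square algebra_simps)
qed simp

lemma norm_sq_ge2: "det A = 1 \<Longrightarrow> (norm A)\<^sup>2 \<ge> 2" for A :: mat2
proof -
  assume "det A = 1"
  then have "(norm A)\<^sup>2 - 2 = (A$1$1 - A$2$2)\<^sup>2 + (A$1$2 + A$2$1)\<^sup>2"
    unfolding norm_mat2_sq det2 by (simp add: power2_eq_square algebra_simps)
  then show ?thesis by (smt (verit) zero_le_power2)
qed

lemma norm_ge1: "det A = 1 \<Longrightarrow> norm A \<ge> 1" for A :: mat2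
  using norm_sq_ge2[of A] by (smt (verit) norm_ge_zero one_power2 power2_le_imp_le)

lemma norm_one2: "(norm (mat 1 :: mat2))\<^sup>2 = 2"
  by (simp add: norm_mat2_sq)

lemma norm_mult2_ge: "det B = 1 \<Longrightarrow> norm A \<le> norm (A ** B) * norm B" for A B :: mat2
  using norm_mult2[of "A ** B" "inv2 B"] by (simp add: inv2_cancel_right)

lemma norm_mult2_ge': "det A = 1 \<Longrightarrow> norm B \<le> norm A * norm (A ** B)" for A B :: mat2
  using norm_mult2[of "inv2 A" "A ** B"] by (simp add: inv2_cancel_left)

definition tr2 :: "mat2 \<Rightarrow> real" where "tr2 A = A$1$1 + A$2$2"

lemma tr2_conj: "det S = 1 \<Longrightarrow> tr2 (S ** A ** inv2 S) = tr2 A"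
proof -
  assume "det S = 1"
  moreover have "tr2 (S ** A ** inv2 S) = det S * tr2 A"
    by (simp add: tr2_def det2 algebra_simps)
  ultimately show ?thesis by simp
qed

lemma tr2_commute: "tr2 (A ** B) = tr2 (B ** A)"
  by (simp add: tr2_def algebra_simps)

primrec mpow :: "mat2 \<Rightarrow> nat \<Rightarrow> mat2" where
  "mpow A 0 = mat 1"
| "mpow A (Suc n) = A ** mpow A n"

lemma mpow_add: "mpow A (m + n) = mpow A m ** mpow A n"
  by (induction m) (simp_all add: matrix_mul_lid matrix_mul_assoc)

lemma mpow_Suc2: "mpow A (Suc n) = mpow A n ** A"
  using mpow_add[of A n 1] by (simp add: matrix_mul_rid)

lemma mpow_1 [simp]: "mpow A (Suc 0) = A"
  by (simp add: matrix_mul_rid)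

lemma mpow_mult: "mpow A (m * n) = mpow (mpow A m) n"
  by (induction n) (simp_all add: mpow_add)

lemma det_mpow: "det A = 1 \<Longrightarrow> det (mpow A n) = 1"
  by (induction n) (simp_all add: det_mul)

lemma mpow_inv2: "mpow (inv2 A) n = inv2 (mpow A n)"
proof (induction n)
  case (Suc n)
  then show ?case by (simp only: mpow_Suc2[of A] inv2_mult mpow.simps(2)[of "inv2 A"])
qed simp

lemma mpow_conj: "det S = 1 \<Longrightarrow> mpow (S ** A ** inv2 S) n = S ** mpow A n ** inv2 S"
proof (induction n)
  case (Suc n)
  have "mpow (S ** A ** inv2 S) (Suc n) = S ** A ** (inv2 S ** (S ** (mpow A n ** inv2 S)))"
    using Suc by (simp only: mpow.simps matrix_mul_assoc)
  then show ?case unfolding inv2_cancel_left[OF Suc.prems] by (simp add: matrix_mul_assoc)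
qed (simp add: matrix_mul_rid inv2_right)

lemma norm_mpow_le: "det A = 1 \<Longrightarrow> norm (mpow A n) \<le> 2 * norm A ^ n"
proof (induction n)
  case 0
  have "norm (mat 1 :: mat2) \<le> 2" by (rule power2_le_imp_le) (simp_all add: norm_one2)
  then show ?case by simp
next
  case (Suc n)
  have "norm (mpow A (Suc n)) \<le> norm A * norm (mpow A n)" by (simp add: norm_mult2)
  also have "\<dots> \<le> norm A * (2 * norm A ^ n)" using Suc by (intro mult_left_mono) auto
  finally show ?case by simp
qed

lemma tendsto_mat2_mult [tendsto_intros]:
  fixes f g :: "_ \<Rightarrow> mat2"
  assumes "(f \<longlongrightarrow> A) F" "(g \<longlongrightarrow> B) F"
  shows "((\<lambda>x. f x ** g x) \<longlongrightarrow> A ** B) F"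
proof (intro vec_tendstoI)
  fix i j
  show "((\<lambda>x. (f x ** g x) $ i $ j) \<longlongrightarrow> (A ** B) $ i $ j) F"
    unfolding mat2_mult_nth using assms by (intro tendsto_intros)
qed

lemma tendsto_mat2_iff:
  fixes f :: "_ \<Rightarrow> mat2"
  shows "(f \<longlongrightarrow> A) F \<longleftrightarrow> ((\<lambda>x. f x $1$1) \<longlongrightarrow> A$1$1) F \<and> ((\<lambda>x. f x $1$2) \<longlongrightarrow> A$1$2) F
     \<and> ((\<lambda>x. f x $2$1) \<longlongrightarrow> A$2$1) F \<and> ((\<lambda>x. f x $2$2) \<longlongrightarrow> A$2$2) F" (is "?l \<longleftrightarrow> ?r")
proof
  assume ?l then show ?r by (intro conjI tendsto_intros)
next
  assume r: ?r
  show ?l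
  proof (intro vec_tendstoI)
    fix i j :: 2
    show "((\<lambda>x. f x $ i $ j) \<longlongrightarrow> A $ i $ j) F"
      using r exhaust_2[of i] exhaust_2[of j] by auto
  qed
qed

lemma tendsto_inv2 [tendsto_intros]:
  assumes "(f \<longlongrightarrow> A) F" shows "((\<lambda>x. inv2 (f x)) \<longlongrightarrow> inv2 A) F"
  unfolding tendsto_mat2_iff inv2_nth using assms by (intro conjI tendsto_intros)

section \<open>The disc model\<close>

text \<open>Conjugation by the Cayley transform takes \<open>M\<close> to the matrix with rows
  \<open>(al M, be M)\<close> and \<open>(cnj (be M), cnj (al M))\<close>.\<close>

definition al :: "mat2 \<Rightarrow> complex" where
  "al M = Complex ((M$1$1 + M$2$2) / 2) ((M$1$2 - M$2$1) / 2)"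

definition be :: "mat2 \<Rightarrow> complex" where
  "be M = Complex ((M$1$1 - M$2$2) / 2) (- (M$1$2 + M$2$1) / 2)"

lemma al_mult: "al (A ** B) = al A * al B + be A * cnj (be B)"
  and be_mult: "be (A ** B) = al A * be B + be A * cnj (al B)"
  by (simp_all add: al_def be_def complex_eq_iff field_simps)

lemma al_inv2: "al (inv2 A) = cnj (al A)"
  and be_inv2: "be (inv2 A) = - be A"
  by (simp_all add: al_def be_def complex_eq_iff field_simps)

lemma cmod_al_sq: "det A = 1 \<Longrightarrow> (cmod (al A))\<^sup>2 = ((norm A)\<^sup>2 + 2) / 4"
proof -
  assume "det A = 1"
  have "(cmod (al A))\<^sup>2 = ((norm A)\<^sup>2 + 2 * det A) / 4"
    unfolding cmod_power2 norm_mat2_sq det2 al_def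
    by (simp add: power2_eq_square field_simps)
  with \<open>det A = 1\<close> show ?thesis by simp
qed

lemma cmod_be_sq: "det A = 1 \<Longrightarrow> (cmod (be A))\<^sup>2 = ((norm A)\<^sup>2 - 2) / 4"
proof -
  assume "det A = 1"
  have "(cmod (be A))\<^sup>2 = ((norm A)\<^sup>2 - 2 * det A) / 4"
    unfolding cmod_power2 norm_mat2_sq det2 be_def
    by (simp add: power2_eq_square field_simps)
  with \<open>det A = 1\<close> show ?thesis by simp
qed

lemma cmod_al_be: "det A = 1 \<Longrightarrow> (cmod (al A))\<^sup>2 = 1 + (cmod (be A))\<^sup>2"
  by (simp add: cmod_al_sq cmod_be_sq field_simps)

lemma cmod_al_ge1: "det A = 1 \<Longrightarrow> 1 \<le> cmod (al A)"
  using cmod_al_be[of A] by (smt (verit) norm_ge_zero one_power2 power2_le_imp_le zero_le_power2)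

lemma al_nz: "det A = 1 \<Longrightarrow> al A \<noteq> 0"
  using cmod_al_ge1[of A] by auto

lemma cmod_be_less: "det A = 1 \<Longrightarrow> cmod (be A) < cmod (al A)"
  using cmod_al_be[of A] by (smt (verit) norm_ge_zero power_mono)

lemma cmod_al_le: "det A = 1 \<Longrightarrow> cmod (al A) \<le> norm A"
proof -
  assume d: "det A = 1"
  show ?thesis
  proof (rule power2_le_imp_le)
    show "(cmod (al A))\<^sup>2 \<le> (norm A)\<^sup>2" using norm_sq_ge2[OF d] by (simp add: cmod_al_sq d)
  qed simp
qed

lemma cmod_be_le: "det A = 1 \<Longrightarrow> cmod (be A) \<le> norm A"
  using cmod_be_less[of A] cmod_al_le[of A] by simp

lemma norm_le_al: "det A = 1 \<Longrightarrow> norm A \<le> 2 * cmod (al A)"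
proof -
  assume d: "det A = 1"
  show ?thesis
  proof (rule power2_le_imp_le)
    show "(norm A)\<^sup>2 \<le> (2 * cmod (al A))\<^sup>2"
      unfolding power_mult_distrib cmod_al_sq[OF d] by simp
  qed simp
qed

text \<open>The Cayley transform takes \<open>\<i>\<close> to 0, and the matrix with rows
  \<open>(al A, be A)\<close> and \<open>(cnj (be A), cnj (al A))\<close> takes 0 to this
  quotient.\<close>

lemma orb_eq:
  assumes "det A = 1" shows "orb A = be A / cnj (al A)"
proof -
  let ?w = "of_real (A$2$1) * \<i> + of_real (A$2$2) :: complex"
  have w: "?w \<noteq> 0" using assms by (auto simp: complex_eq_iff det2)
  have "orb A = ((of_real (A$1$1) * \<i> + of_real (A$1$2)) - \<i> * ?w) / ((of_real (A$1$1) * \<i> + of_real (A$1$2)) + \<i> * ?w)"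
    unfolding orb_def cayley_def moeb_def using w
    by (simp add: divide_simps)
  also have "\<dots> = (2 * \<i> * be A) / (2 * \<i> * cnj (al A))"
    by (rule arg_cong2[of _ _ _ _ "(/)"]) (simp_all add: complex_eq_iff al_def be_def field_simps)
  finally show ?thesis by simp
qed

lemma cmod_orb: "det A = 1 \<Longrightarrow> cmod (orb A) = cmod (be A) / cmod (al A)"
  by (simp add: orb_eq norm_divide)

lemma cmod_orb_less1: "det A = 1 \<Longrightarrow> cmod (orb A) < 1"
  using cmod_be_less[of A] cmod_al_ge1[of A] by (simp add: cmod_orb divide_less_eq)

lemma one_minus_orb:
  assumes "det A = 1" shows "1 - (cmod (orb A))\<^sup>2 = 1 / (cmod (al A))\<^sup>2"
proof -
  have nz: "(cmod (al A))\<^sup>2 \<noteq> 0" using al_nz[OF assms] by simp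
  have "1 - (cmod (orb A))\<^sup>2 = ((cmod (al A))\<^sup>2 - (cmod (be A))\<^sup>2) / (cmod (al A))\<^sup>2"
    using nz by (simp add: cmod_orb assms power_divide diff_divide_distrib)
  then show ?thesis using cmod_al_be[OF assms] by simp
qed

text \<open>Invariance of the metric: the numerator depends only on the hyperbolic distance of the
  two points, and the factors 1 / \<open>cmod (al _)\<close> are the square roots of the conformal
  factors \<open>1 - (cmod (orb _))^2\<close>.\<close>

lemma orb_diff:
  assumes "det A = 1" "det B = 1"
  shows "cmod (orb A - orb B) = cmod (be (inv2 A ** B)) / (cmod (al A) * cmod (al B))"
proof -
  have "orb A - orb B = (be A * cnj (al B) - cnj (al A) * be B) / (cnj (al A) * cnj (al B))"
    using assms al_nz[of A] al_nz[of B] by (simp add: orb_eq field_simps)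
  also have "be A * cnj (al B) - cnj (al A) * be B = - be (inv2 A ** B)"
    by (simp add: be_mult al_inv2 be_inv2)
  finally show ?thesis by (simp add: norm_divide norm_mult)
qed

lemma hdist_orb:
  assumes "det A = 1" shows "hdist 0 (orb A) = arcosh ((norm A)\<^sup>2 / 2)"
proof -
  have "(cmod (orb A))\<^sup>2 / (1 - (cmod (orb A))\<^sup>2) = (cmod (be A))\<^sup>2"
    using al_nz[OF assms] by (simp add: one_minus_orb assms) (simp add: cmod_orb assms power_divide)
  then have "1 + 2 * ((cmod (orb A))\<^sup>2 / (1 - (cmod (orb A))\<^sup>2)) = (norm A)\<^sup>2 / 2"
    by (simp add: cmod_be_sq assms field_simps)
  then have "1 + 2 * (cmod (0 - orb A))\<^sup>2 / ((1 - (cmod 0)\<^sup>2) * (1 - (cmod (orb A))\<^sup>2)) = (norm A)\<^sup>2 / 2"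
    by simp
  then show ?thesis unfolding hdist_def by (rule arg_cong)
qed

lemma tendsto_al [tendsto_intros]: "(f \<longlongrightarrow> A) F \<Longrightarrow> ((\<lambda>x. al (f x)) \<longlongrightarrow> al A) F"
  unfolding al_def by (intro tendsto_Complex tendsto_intros) auto

lemma tendsto_be [tendsto_intros]: "(f \<longlongrightarrow> A) F \<Longrightarrow> ((\<lambda>x. be (f x)) \<longlongrightarrow> be A) F"
  unfolding be_def by (intro tendsto_Complex tendsto_intros) auto

lemma tendsto_orb:
  assumes "det A = 1" "\<And>x. det (f x) = 1" "(f \<longlongrightarrow> A) F"
  shows "((\<lambda>x. orb (f x)) \<longlongrightarrow> orb A) F"
proof -
  have "((\<lambda>x. be (f x) / cnj (al (f x))) \<longlongrightarrow> be A / cnj (al A)) F"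
    using al_nz[OF assms(1)] assms(3) by (intro tendsto_intros) auto
  then show ?thesis using assms(1,2) by (simp add: orb_eq)
qed

text \<open>A proxy for the visual distance, from the origin, of the points \<open>v\<close> and \<open>v ** w\<close>.\<close>

definition vis :: "mat2 \<Rightarrow> mat2 \<Rightarrow> real" where
  "vis v w = norm w / (norm v * norm (v ** w))"

lemma vis_nonneg: "vis v w \<ge> 0"
  by (simp add: vis_def)

lemma vis_le:
  assumes "det v = 1" "det w = 1" shows "vis v w \<le> norm w / norm v"
proof -
  have "norm v \<ge> 1" "norm (v ** w) \<ge> 1" using assms by (auto intro: norm_ge1 det_mult1)
  then have "norm w / (norm v * norm (v ** w)) \<le> norm w / (norm v * 1)" by (intro divide_left_mono mult_left_mono) (auto simp: zero_less_mult_iff)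
  then show ?thesis by (simp add: vis_def)
qed

lemma vis_scale: "\<bar>s\<bar> = 1 \<Longrightarrow> vis v (s *\<^sub>R w) = vis v w"
proof -
  assume s: "\<bar>s\<bar> = 1"
  have "v ** (s *\<^sub>R w) = s *\<^sub>R (v ** w)" by (simp add: mat2_eq_iff algebra_simps)
  then show ?thesis using s by (simp add: vis_def)
qed

lemma vis_mult_le:
  assumes "det v = 1" "det w = 1" "det e = 1"
  shows "vis v (w ** e) \<le> (norm e)\<^sup>2 * vis v w"
proof -
  have pos: "norm v > 0" "norm (v ** w) > 0" "norm (v ** (w ** e)) > 0" "norm e > 0"
    using norm_ge1[OF assms(1)] norm_ge1[OF det_mult1[OF assms(1,2)]] norm_ge1[OF det_mult1[OF assms(1) det_mult1[OF assms(2,3)]]] norm_ge1[OF assms(3)]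
    by linarith+
  have a: "norm (w ** e) \<le> norm w * norm e" by (rule norm_mult2)
  have b: "norm (v ** w) \<le> norm (v ** (w ** e)) * norm e"
    using norm_mult2_ge[OF assms(3), of "v ** w"] by (simp add: matrix_mul_assoc)
  have "norm (w ** e) * norm (v ** w) \<le> (norm w * norm e) * (norm (v ** (w ** e)) * norm e)"
    by (rule mult_mono[OF a b]) simp_all
  then show ?thesis using pos by (simp add: vis_def divide_simps power2_eq_square mult_ac)
qed

lemma vis_mult_ge:
  assumes "det v = 1" "det w = 1" "det e = 1"
  shows "vis v w \<le> (norm e)\<^sup>2 * vis v (w ** e)"
  using vis_mult_le[OF assms(1) det_mult1[OF assms(2,3)], of "inv2 e"] assms(3) by (simp add: inv2_cancel_right det_inv2)

text \<open>The factor 4 arises because \<open>norm\<close> is at most twice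
  \<open>cmod (al _)\<close> at each of the two points.\<close>

lemma orb_diff_le_vis:
  assumes "det v = 1" "det v' = 1"
  shows "cmod (orb v - orb v') \<le> 4 * vis v (inv2 v ** v')"
proof -
  have d: "det (inv2 v ** v') = 1" using assms by (simp add: det_mult1 det_inv2)
  have pos: "norm v > 0" "norm v' > 0" "cmod (al v) > 0" "cmod (al v') > 0"
    using norm_ge1[OF assms(1)] norm_ge1[OF assms(2)] al_nz[OF assms(1)] al_nz[OF assms(2)] by auto
  have "norm v * norm v' \<le> (2 * cmod (al v)) * (2 * cmod (al v'))" by (intro mult_mono norm_le_al assms) auto
  then have h: "norm v * norm v' \<le> 4 * (cmod (al v) * cmod (al v'))" by simp
  have "cmod (be (inv2 v ** v')) * (norm v * norm v') \<le> norm (inv2 v ** v') * (4 * (cmod (al v) * cmod (al v')))"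
    by (rule mult_mono[OF cmod_be_le[OF d] h]) simp_all
  then have "cmod (be (inv2 v ** v')) / (cmod (al v) * cmod (al v')) \<le> 4 * (norm (inv2 v ** v') / (norm v * norm v'))"
    using pos by (simp add: divide_simps mult_ac)
  then show ?thesis unfolding orb_diff[OF assms] vis_def using assms by (simp add: inv2_cancel_left')
qed

text \<open>The norm of the quotient is at most 2 (1 + |be|); the summand 1 causes the additive
  error, which vanishes along sequences that tend to the circle. There \<open>vis\<close> and the
  Euclidean distance are equivalent.\<close>

lemma vis_le_orb_diff:
  assumes "det v = 1" "det v' = 1"
  shows "vis v (inv2 v ** v') \<le> 2 * cmod (orb v - orb v') + 2 / (norm v * norm v')"
proof -
  have d: "det (inv2 v ** v') = 1" using assms by (simp add: det_mult1 det_inv2)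
  define b where "b = cmod (be (inv2 v ** v'))"
  have b0: "b \<ge> 0" by (simp add: b_def)
  have pos: "norm v > 0" "norm v' > 0" "cmod (al v) > 0" "cmod (al v') > 0"
    using norm_ge1[OF assms(1)] norm_ge1[OF assms(2)] al_nz[OF assms(1)] al_nz[OF assms(2)] by auto
  have "(cmod (al (inv2 v ** v')))\<^sup>2 \<le> (1 + b)\<^sup>2"
    unfolding cmod_al_be[OF d] using b0 by (simp add: b_def[symmetric] power2_sum)
  then have "cmod (al (inv2 v ** v')) \<le> 1 + b" by (rule power2_le_imp_le) (use b0 in simp)
  then have n: "norm (inv2 v ** v') \<le> 2 * (1 + b)" by (intro order_trans[OF norm_le_al[OF d]]) simp
  have "vis v (inv2 v ** v') = norm (inv2 v ** v') / (norm v * norm v')" using assms by (simp add: vis_def inv2_cancel_left')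
  also have "\<dots> \<le> (2 * (1 + b)) / (norm v * norm v')" using n pos by (intro divide_right_mono) auto
  also have "\<dots> = 2 * (b / (norm v * norm v')) + 2 / (norm v * norm v')" by (simp add: add_divide_distrib)
  also have "b / (norm v * norm v') \<le> b / (cmod (al v) * cmod (al v'))"
    using pos b0 by (intro divide_left_mono mult_mono cmod_al_le assms) auto
  finally show ?thesis unfolding orb_diff[OF assms] b_def by simp
qed

text \<open>When norms multiply up to the factor c, the norm of \<open>h\<close> cancels in
  \<open>vis\<close>. So a factor on the right, however large, moves the orbit point of
  \<open>g\<close> only by O(1 / norm g).\<close>

lemma orb_product_diff:
  assumes "det g = 1" "det f = 1" "det h = 1" "c > 0" "c * (norm g * norm h) \<le> norm (g ** f ** h)"
  shows "cmod (orb g - orb (g ** f ** h)) \<le> (4 * norm f / c) / norm g"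
proof -
  have n1: "norm g \<ge> 1" "norm h \<ge> 1" using norm_ge1 assms by auto
  then have pos: "norm g > 0" "norm h > 0" by linarith+
  have "inv2 g ** (g ** f ** h) = f ** h" unfolding matrix_mul_assoc[symmetric] by (rule inv2_cancel_left[OF assms(1)])
  then have "vis g (inv2 g ** (g ** f ** h)) = norm (f ** h) / (norm g * norm (g ** f ** h))"
    by (simp add: vis_def matrix_mul_assoc)
  also have "\<dots> \<le> (norm f * norm h) / (norm g * (c * (norm g * norm h)))"
    using pos assms(4) by (intro frac_le mult_left_mono norm_mult2 assms(5)) auto
  also have "\<dots> = (norm f / c) / (norm g * norm g)" using pos by simp
  also have "\<dots> \<le> (norm f / c) / (1 * norm g)" using pos assms(4) n1 by (intro divide_left_mono mult_right_mono) auto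
  finally have "4 * vis g (inv2 g ** (g ** f ** h)) \<le> (4 * norm f / c) / norm g" by simp
  then show ?thesis using orb_diff_le_vis[OF assms(1), of "g ** f ** h"] assms by (simp add: det_mult1)
qed

section \<open>Hyperbolic matrices\<close>

definition diag2 :: "real \<Rightarrow> mat2" where "diag2 x = mk2 x 0 0 (1 / x)"

lemma diag2_nth [simp]: "diag2 x $1$1 = x" "diag2 x $1$2 = 0" "diag2 x $2$1 = 0" "diag2 x $2$2 = 1 / x"
  by (simp_all add: diag2_def)

lemma det_diag2: "x \<noteq> 0 \<Longrightarrow> det (diag2 x) = 1"
  by (simp add: det2)

lemma mpow_diag2: "x \<noteq> 0 \<Longrightarrow> mpow (diag2 x) n = diag2 (x ^ n)"
  by (induction n) (simp_all add: mat2_eq_iff)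

lemma hyperbolic_diag:
  assumes d: "det A = 1" and t: "\<bar>tr2 A\<bar> > 2"
  obtains S x where "det S = 1" "\<bar>x\<bar> > 1" "A = S ** diag2 x ** inv2 S" "tr2 A = x + 1 / x"
proof -
  define a b c e where "a = A$1$1" "b = A$1$2" "c = A$2$1" "e = A$2$2"
  note abce = this
  have det: "a * e - b * c = 1" using d by (simp add: det2 abce)
  define t where "t = a + e"
  have t2: "\<bar>t\<bar> > 2" using t by (simp add: t_def abce tr2_def)
  then have "2\<^sup>2 < \<bar>t\<bar>\<^sup>2" by (intro power_strict_mono) auto
  then have t4: "t\<^sup>2 > 4" by simp
  \<comment> \<open>The root of the characteristic polynomial of larger modulus; the sign of the
    trace selects it.\<close>
  define x where "x = (t + sgn t * sqrt (t\<^sup>2 - 4)) / 2"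
  have sq: "(sqrt (t\<^sup>2 - 4))\<^sup>2 = t\<^sup>2 - 4" using t4 by simp
  have st: "(sgn t)\<^sup>2 = 1" using t2 by (auto simp: sgn_if)
  have char: "x * x - t * x + 1 = 0"
  proof -
    have "x * x - t * x + 1 = (((sgn t)\<^sup>2 * (sqrt (t\<^sup>2 - 4))\<^sup>2) - t\<^sup>2 + 4) / 4"
      unfolding x_def by (simp add: power2_eq_square field_simps)
    then show ?thesis by (simp add: sq st)
  qed
  have ax: "\<bar>x\<bar> > 1"
  proof -
    define w where "w = sqrt (t\<^sup>2 - 4)"
    have q: "w \<ge> 0" using t4 by (simp add: w_def)
    show ?thesis
    proof (cases "t > 0")
      case True
      then have "x = (t + w) / 2" by (simp add: x_def w_def)
      then have "x > 1" using q t2 True by (simp add: field_simps)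
      then show ?thesis by simp
    next
      case False
      then have "t < -2" using t2 by simp
      then have "x = (t - w) / 2" by (simp add: x_def w_def)
      then have "x < -1" using q \<open>t < -2\<close> by (simp add: field_simps)
      then show ?thesis by simp
    qed
  qed
  then have x0: "x \<noteq> 0" by auto
  have tx: "t = x + 1 / x" using char x0 by (simp add: field_simps)
  have xx: "x \<noteq> 1 / x"
  proof
    assume "x = 1 / x" then have "\<bar>x\<bar> * \<bar>x\<bar> = 1" using x0 by (simp add: abs_mult[symmetric] field_simps)
    then show False using ax by (metis abs_ge_zero less_irrefl less_1_mult)
  qed
  note outer = that
  \<comment> \<open>Any invertible matrix of eigenvectors will do: rescaling its second column makes
    the determinant 1.\<close>
  have fin: thesis if S: "det T \<noteq> 0" "A ** T = T ** diag2 x" for T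
  proof -
    define S where "S = T ** mk2 1 0 0 (1 / det T)"
    have dS: "det S = 1" using that(1) by (simp add: S_def det_mul det2[of "mk2 _ _ _ _"])
    have "A ** S = S ** diag2 x"
    proof -
      have "A ** S = T ** diag2 x ** mk2 1 0 0 (1 / det T)" by (simp add: S_def matrix_mul_assoc that(2))
      also have "\<dots> = S ** diag2 x" by (simp add: S_def mat2_eq_iff)
      finally show ?thesis .
    qed
    then have "A = S ** diag2 x ** inv2 S" by (metis inv2_cancel_right dS)
    moreover have "tr2 A = x + 1 / x" using tx by (simp add: tr2_def t_def abce)
    ultimately show thesis using dS ax outer by blast
  qed
  define y where "y = 1 / x"
  have xy: "x * y = 1" using x0 by (simp add: y_def)
  have e: "e = x + y - a" using tx by (simp add: t_def y_def)
  have D: "diag2 x = mk2 x 0 0 y" by (simp add: diag2_def y_def)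
  have M: "A = mk2 a b c e" by (simp add: mat2_eq_iff abce)
  \<comment> \<open>Eigenvectors can be read off the first row if b is not 0 and off the second row
    if c is not 0; a diagonal matrix needs at most an exchange of the two axes.\<close>
  show thesis
  proof (cases "b = 0")
    case False
    let ?T = "mk2 b b (x - a) (y - a)"
    have "det ?T = b * (y - x)" by (simp add: det2 algebra_simps)
    then have "det ?T \<noteq> 0" using False xx by (simp add: y_def)
    moreover have "c * b + e * (x - a) = (x - a) * x" "c * b + e * (y - a) = (y - a) * y"
      using xy det unfolding e by algebra+
    then have "A ** ?T = ?T ** diag2 x"
      unfolding D M by (simp add: mat2_eq_iff algebra_simps)
    ultimately show ?thesis by (rule fin)
  next
    case b0: True
    show ?thesis
    proof (cases "c = 0")
      case False
      let ?T = "mk2 (x - e) (y - e) c c"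
      have "det ?T = c * (x - y)" by (simp add: det2 algebra_simps)
      then have "det ?T \<noteq> 0" using False xx by (simp add: y_def)
      moreover have "a * (x - e) = (x - e) * x" "a * (y - e) = (y - e) * y" "c * (x - e) + e * c = c * x"
        "c * (y - e) + e * c = c * y"
        using xy det b0 unfolding e by algebra+
      then have "A ** ?T = ?T ** diag2 x"
        unfolding D M by (simp add: mat2_eq_iff b0)
      ultimately show ?thesis by (rule fin)
    next
      case True
      have ae: "a * e = 1" using det b0 by simp
      have "(x - a) * (x - e) = x * x - t * x + a * e" by (simp add: t_def algebra_simps)
      then have "(x - a) * (x - e) = 0" using char ae by simp
      then consider "x = a" | "x = e" by auto
      then show ?thesis
      proof cases
        case 1
        then have "e = y" using ae x0 by (simp add: y_def field_simps)
        then have "A ** mat 1 = mat 1 ** diag2 x" using True b0 1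
          unfolding D M by (simp add: mat2_eq_iff)
        then show ?thesis by (rule fin[rotated]) (simp add: det2)
      next
        case 2
        then have "a = y" using ae x0 by (simp add: y_def field_simps)
        then have "A ** mk2 0 (-1) 1 0 = mk2 0 (-1) 1 0 ** diag2 x" using True b0 2
          unfolding D M by (simp add: mat2_eq_iff)
        then show ?thesis by (rule fin[rotated]) (simp add: det2)
      qed
    qed
  qed
qed

lemma mpow_hyperbolic:
  assumes "det S = 1" "x \<noteq> 0"
  shows "mpow (S ** diag2 x ** inv2 S) n = S ** diag2 (x ^ n) ** inv2 S"
  by (simp add: mpow_conj assms mpow_diag2)

lemma norm_conj_ge:
  fixes A S T :: mat2
  assumes "det S = 1" "det T = 1"
  shows "norm A \<le> norm S * norm T * norm (S ** A ** inv2 T)"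
proof -
  have "norm A \<le> norm S * norm (S ** A)" by (rule norm_mult2_ge'[OF assms(1)])
  also have "norm (S ** A) \<le> norm (S ** A ** inv2 T) * norm T"
    using norm_mult2_ge[of "inv2 T" "S ** A"] assms(2) by simp
  finally show ?thesis by (simp add: mult_left_mono mult.assoc mult.commute[of "norm T"])
qed

lemma norm_conj_le:
  fixes A S T :: mat2
  shows "norm (S ** A ** inv2 T) \<le> norm S * norm T * norm A"
proof -
  have "norm (S ** A ** inv2 T) \<le> norm (S ** A) * norm (inv2 T)" by (rule norm_mult2)
  also have "\<dots> \<le> (norm S * norm A) * norm (inv2 T)" by (intro mult_right_mono norm_mult2) auto
  finally show ?thesis by (simp add: mult_ac)
qed

lemma norm_mpow_hyperbolic:
  assumes "det A = 1" "\<bar>tr2 A\<bar> > 2"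
  obtains c x where "c > 0" "x > 1" "\<And>n. c * x ^ n \<le> norm (mpow A n)"
proof -
  obtain S y where S: "det S = 1" "\<bar>y\<bar> > 1" "A = S ** diag2 y ** inv2 S"
    using hyperbolic_diag[OF assms] by metis
  have y0: "y \<noteq> 0" using S by auto
  have n0: "norm S > 0" using norm_ge1[OF S(1)] by linarith
  have "(1 / (norm S * norm S)) * \<bar>y\<bar> ^ n \<le> norm (mpow A n)" for n
  proof -
    have "\<bar>y\<bar> ^ n \<le> norm (diag2 (y ^ n))" using norm_entry[of "diag2 (y ^ n)" 1 1] by (simp add: power_abs)
    also have "\<dots> \<le> norm S * norm S * norm (mpow A n)"
      unfolding S(3) mpow_hyperbolic[OF S(1) y0] by (rule norm_conj_ge[OF S(1) S(1)])
    finally show ?thesis using n0 by (simp add: field_simps)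
  qed
  then show thesis using S(2) n0 by (intro that[of "1 / (norm S * norm S)" "\<bar>y\<bar>"]) auto
qed

lemma filterlim_norm_mpow:
  assumes "det A = 1" "\<bar>tr2 A\<bar> > 2"
  shows "filterlim (\<lambda>n. norm (mpow A n)) at_top sequentially"
proof -
  obtain c x where cx: "c > 0" "x > 1" "\<And>n. c * x ^ n \<le> norm (mpow A n)"
    using norm_mpow_hyperbolic[OF assms] by metis
  have "filterlim (\<lambda>n. x ^ n) at_top sequentially"
    using filterlim_at_infinity_imp_norm_at_top[OF filterlim_realpow_sequentially_gt1, of x] cx(2) by simp
  then have "filterlim (\<lambda>n. c * x ^ n) at_top sequentially"
    by (rule filterlim_tendsto_pos_mult_at_top[OF tendsto_const cx(1)])
  then show ?thesis by (rule filterlim_at_top_mono) (simp add: cx(3))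
qed

text \<open>The trace exceeds 2 by - det (AB - BA). The matrix AB - BA is traceless and orthogonal
  to A for the trace form, and for elliptic A the form - det is positive definite on the plane of
  such matrices.\<close>

lemma commutator_trace_gt2:
  assumes d: "det A = 1" "det B = 1" and t: "\<bar>tr2 A\<bar> < 2" and nc: "A ** B \<noteq> B ** A"
  shows "tr2 (A ** B ** inv2 A ** inv2 B) > 2"
proof -
  define a b c e where "a = A$1$1" "b = A$1$2" "c = A$2$1" "e = A$2$2"
  note A = this
  define f g h k where "f = B$1$1" "g = B$1$2" "h = B$2$1" "k = B$2$2"
  note B = this
  have dA: "a * e = 1 + b * c" and dB: "f * k = 1 + g * h" using d by (simp_all add: det2 A B)
  have bc: "(a - e)\<^sup>2 + 4 * (b * c) < 0"
  proof -
    have "(tr2 A)\<^sup>2 < 2\<^sup>2" using t by (metis abs_numeral power2_abs power_strict_mono abs_ge_zero pos2)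
    moreover have "(tr2 A)\<^sup>2 = (a - e)\<^sup>2 + 4 * (a * e)" by (simp add: tr2_def A power2_eq_square algebra_simps)
    ultimately show ?thesis using dA by simp
  qed
  then have bc0: "b * c < 0" by (smt (verit) zero_le_power2)
  then have b0: "b \<noteq> 0" by auto
  define p q s where "p = b * h - g * c" "q = g * (a - e) - b * (f - k)" "s = c * (f - k) - h * (a - e)"
  note pqs = this
  have rel: "b * s = - ((a - e) * p + c * q)" by (simp add: pqs algebra_simps)
  have "tr2 (A ** B ** inv2 A ** inv2 B) = 2 * (a * e - b * c) * (f * k - g * h) + (p\<^sup>2 + q * s)"
    by (simp add: tr2_def A[symmetric] B[symmetric] pqs power2_eq_square algebra_simps)
  then have tr: "tr2 (A ** B ** inv2 A ** inv2 B) = 2 + (p\<^sup>2 + q * s)" using dA dB by simp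
  have "b\<^sup>2 * (p\<^sup>2 + q * s) = b\<^sup>2 * p\<^sup>2 + b * q * (b * s)" by (simp add: power2_eq_square algebra_simps)
  also have "\<dots> = (b * p - (a - e) * q / 2)\<^sup>2 - q\<^sup>2 * ((a - e)\<^sup>2 + 4 * (b * c)) / 4"
    unfolding rel by (simp add: power2_eq_square field_simps)
  finally have eq: "b\<^sup>2 * (p\<^sup>2 + q * s) = (b * p - (a - e) * q / 2)\<^sup>2 + q\<^sup>2 * (- ((a - e)\<^sup>2 + 4 * (b * c))) / 4"
    by (simp only: mult_minus_right minus_divide_left[symmetric] diff_conv_add_uminus)
  have "b\<^sup>2 * (p\<^sup>2 + q * s) > 0"
  proof (cases "q = 0")
    case True
    have "p \<noteq> 0"
    proof
      assume "p = 0"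
      with True rel b0 have "s = 0" by simp
      have "A ** B = B ** A" using \<open>p = 0\<close> \<open>q = 0\<close> \<open>s = 0\<close>
        by (simp add: mat2_eq_iff A[symmetric] B[symmetric] pqs algebra_simps)
      with nc show False by simp
    qed
    then show ?thesis unfolding eq using True b0 by simp
  next
    case False
    have "q\<^sup>2 * (- ((a - e)\<^sup>2 + 4 * (b * c))) / 4 > 0" using False bc by (intro divide_pos_pos mult_pos_pos) auto
    then show ?thesis unfolding eq by (smt (verit) zero_le_power2)
  qed
  then have "p\<^sup>2 + q * s > 0" using b0 by (simp add: zero_less_mult_iff)
  with tr show ?thesis by simp
qed

section \<open>Zariski dense groups\<close>

lemma subseq_tendsto_finite:
  fixes f :: "nat \<Rightarrow> nat \<Rightarrow> 'a::heine_borel"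
  assumes "\<And>i. i < r \<Longrightarrow> bounded (range (\<lambda>n. f n i))"
  shows "\<exists>s l. strict_mono s \<and> (\<forall>i<r. (\<lambda>n. f (s n) i) \<longlonglongrightarrow> l i)"
  using assms
proof (induction r)
  case 0
  show ?case by (rule exI[of _ id]) (auto simp: strict_mono_def)
next
  case (Suc r)
  then obtain s l where s: "strict_mono s" "\<And>i. i < r \<Longrightarrow> (\<lambda>n. f (s n) i) \<longlonglongrightarrow> l i"
    by (metis less_Suc_eq)
  have "bounded (range (\<lambda>n. f (s n) r))"
    by (rule bounded_subset[OF Suc.prems[of r]]) auto
  then obtain t m where t: "strict_mono t" "(\<lambda>n. f (s (t n)) r) \<longlonglongrightarrow> m"
    using bounded_imp_convergent_subsequence[of "\<lambda>n. f (s n) r"] by (auto simp: o_def)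
  have "(\<lambda>n. f ((s \<circ> t) n) i) \<longlonglongrightarrow> (l(r := m)) i" if "i < Suc r" for i
  proof (cases "i = r")
    case False
    with that have "i < r" by simp
    from LIMSEQ_subseq_LIMSEQ[OF s(2)[OF this] t(1)] False show ?thesis by (simp add: o_def)
  qed (use t in simp)
  then show ?case using s(1) t(1) strict_mono_o by blast
qed

lemmas pf = polyfun.pconst polyfun.pcoord polyfun.padd polyfun.pmul

lemma pf_minus: "p \<in> polyfun r \<Longrightarrow> (\<lambda>g. - p g) \<in> polyfun r"
  using polyfun.pmul[OF polyfun.pconst[of "-1"], of p r] by simp

lemma pf_diff: "p \<in> polyfun r \<Longrightarrow> q \<in> polyfun r \<Longrightarrow> (\<lambda>g. p g - q g) \<in> polyfun r"
  using polyfun.padd[OF _ pf_minus, of p r q] by simp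

lemma pf_power2: "p \<in> polyfun r \<Longrightarrow> (\<lambda>g. (p g)\<^sup>2) \<in> polyfun r"
  using polyfun.pmul[of p r p] by (simp add: power2_eq_square)

lemmas pf_intros = polyfun.padd polyfun.pmul pf_diff pf_minus pf_power2 polyfun.pcoord polyfun.pconst

lemma pf_prod: fixes n :: nat shows "(\<And>i. i < n \<Longrightarrow> p i \<in> polyfun r) \<Longrightarrow> (\<lambda>g. \<Prod>i<n. p i g) \<in> polyfun r"
  by (induction n) (auto intro!: pf_intros)

locale zgroup =
  fixes r :: nat and \<Gamma> :: "(nat \<Rightarrow> mat2) set"
  assumes psub: "psub r \<Gamma>" and zdense: "zariski_dense r \<Gamma>"
begin

lemma det_G [simp]: "g \<in> \<Gamma> \<Longrightarrow> det (g i) = 1"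
  using psub by (cases "i < r") (auto simp: psub_def Gr_def)

lemma signs_G: "s \<in> signs r \<Longrightarrow> s \<in> \<Gamma>"
  using psub by (auto simp: psub_def)

lemma one_G: "(\<lambda>i. mat 1) \<in> \<Gamma>"
  by (rule signs_G) (simp add: signs_def)

lemma mult_G: "g \<in> \<Gamma> \<Longrightarrow> h \<in> \<Gamma> \<Longrightarrow> (\<lambda>i. g i ** h i) \<in> \<Gamma>"
  using psub by (auto simp: psub_def gmul_def)

lemma inv_G: "g \<in> \<Gamma> \<Longrightarrow> (\<lambda>i. inv2 (g i)) \<in> \<Gamma>"
proof -
  assume g: "g \<in> \<Gamma>"
  then have "ginv g \<in> \<Gamma>" using psub by (auto simp: psub_def)
  moreover have "ginv g = (\<lambda>i. inv2 (g i))" by (simp add: ginv_def fun_eq_iff matrix_inv_eq_inv2 g)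
  ultimately show ?thesis by simp
qed

lemma pow_G: "g \<in> \<Gamma> \<Longrightarrow> (\<lambda>i. mpow (g i) n) \<in> \<Gamma>"
  by (induction n) (auto intro: one_G mult_G)

text \<open>Each \<open>q i\<close> looks at its own component only, so points chosen for the
  components separately combine to a point of \<open>Gr r\<close> at which the product of all
  \<open>q i\<close> is non-zero. By density this product cannot vanish on the whole of
  \<open>\<Gamma>\<close>. Finitely many generic conditions are thus met by a single
  element.\<close>

lemma zariski_pick:
  assumes "\<And>i. i < r \<Longrightarrow> (\<lambda>g. q i (g i)) \<in> polyfun r"
    and "\<And>i. i < r \<Longrightarrow> \<exists>M. det M = 1 \<and> q i M \<noteq> 0"
  shows "\<exists>f\<in>\<Gamma>. \<forall>i<r. q i (f i) \<noteq> 0"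
proof (rule ccontr)
  assume neg: "\<not> ?thesis"
  let ?p = "\<lambda>g. \<Prod>i<r. q i (g i)"
  have pp: "?p \<in> polyfun r" by (rule pf_prod) (rule assms(1))
  have pz: "\<forall>g\<in>\<Gamma>. ?p g = 0" using neg by auto
  have z: "\<forall>g\<in>Gr r. ?p g = 0"
    by (rule mp[OF bspec[OF zdense[unfolded zariski_dense_def] pp] pz])
  have "\<forall>i. \<exists>M. i < r \<longrightarrow> det M = 1 \<and> q i M \<noteq> 0" using assms(2) by blast
  from choice[OF this] obtain M where M: "\<And>i. i < r \<Longrightarrow> det (M i) = 1 \<and> q i (M i) \<noteq> 0" by blast
  let ?g = "\<lambda>i. if i < r then M i else mat 1"
  have "?g \<in> Gr r" using M by (simp add: Gr_def)
  then have "?p ?g = 0" by (rule bspec[OF z])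
  then obtain i where "i < r" "q i (?g i) = 0" by (auto simp: prod_zero_iff)
  then show False using M[of i] by simp
qed

lemma zariski_pick1:
  assumes "i < r" "(\<lambda>g. q (g i)) \<in> polyfun r" "det M = 1" "q M \<noteq> 0"
  shows "\<exists>f\<in>\<Gamma>. q (f i) \<noteq> 0"
proof -
  have "\<exists>f\<in>\<Gamma>. \<forall>k<r. (if k = i then q (f k) else 1) \<noteq> 0"
  proof (rule zariski_pick[of "\<lambda>k M. if k = i then q M else 1"])
    show "(\<lambda>g. if k = i then q (g k) else 1) \<in> polyfun r" for k
      using assms(2) by (cases "k = i") (simp_all add: polyfun.pconst)
    show "\<exists>M. det M = 1 \<and> (if k = i then q M else 1) \<noteq> 0" for k
      using assms(3,4) by (intro exI[of _ M]) auto
  qed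
  then show ?thesis using assms(1) by (metis (full_types))
qed

end

text \<open>Four matrices of determinant 1 span all 2x2 matrices, so vanishing for all M would make
  every product of an entry of A and an entry of B zero.\<close>

lemma span_SL2:
  fixes A B :: mat2
  assumes "A \<noteq> 0" "B \<noteq> 0"
  shows "\<exists>M. det M = 1 \<and> A ** M ** B \<noteq> 0"
proof (rule ccontr)
  assume neg: "\<not> ?thesis"
  have z: "A ** mk2 a b c d ** B = 0" if "a * d - b * c = 1" for a d b c
    using neg that by (auto simp: det2)
  have ent: "(A ** mk2 a b c d ** B)$i$j = 0" if "a * d - b * c = 1" for a d b c i j
    using z[OF that] by simp
  have e: "A$i$1 * B$1$j = 0 \<and> A$i$1 * B$2$j = 0 \<and> A$i$2 * B$1$j = 0 \<and> A$i$2 * B$2$j = 0" for i j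
  proof -
    have "A$i$1 * B$1$j + A$i$2 * B$2$j = 0" "A$i$1 * B$1$j + A$i$1 * B$2$j + A$i$2 * B$2$j = 0"
      "A$i$1 * B$1$j + A$i$2 * B$1$j + A$i$2 * B$2$j = 0"
      "2 * (A$i$1 * B$1$j) + A$i$1 * B$2$j + A$i$2 * B$1$j + A$i$2 * B$2$j = 0"
      using ent[of 1 1 0 0 i j] ent[of 1 1 0 1 i j] ent[of 1 1 1 0 i j] ent[of 2 1 1 1 i j]
      by (simp_all add: algebra_simps)
    then show ?thesis by (intro conjI) linarith+
  qed
  have "\<exists>i k. A$i$k \<noteq> 0" "\<exists>l j. B$l$j \<noteq> 0" using assms by (auto simp: vec_eq_iff)
  then obtain i k l j where "A$i$k \<noteq> 0" "B$l$j \<noteq> 0" by blast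
  then show False using e[of i j] exhaust_2[of k] exhaust_2[of l] by auto
qed

text \<open>The trace form is nondegenerate, and the same four matrices as in
  \<open>span_SL2\<close> detect it.\<close>

lemma tr2_nondegenerate:
  assumes "A \<noteq> 0" shows "\<exists>M. det M = 1 \<and> tr2 (A ** M) \<noteq> 0"
proof (rule ccontr)
  assume neg: "\<not> ?thesis"
  have z: "tr2 (A ** mk2 a b c d) = 0" if "a * d - b * c = 1" for a d b c
    using neg that by (auto simp: det2)
  have "A$1$1 + A$2$2 = 0" "A$1$1 + A$2$1 + A$2$2 = 0" "A$1$1 + A$1$2 + A$2$2 = 0"
    "2 * A$1$1 + A$1$2 + A$2$1 + A$2$2 = 0"
    using z[of 1 1 0 0] z[of 1 1 1 0] z[of 1 1 0 1] z[of 2 1 1 1] by (simp_all add: tr2_def algebra_simps)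
  then have "A = 0" unfolding mat2_eq_iff[of _ 0] by simp
  with assms show False by simp
qed


lemma noncommuting:
  assumes "\<bar>tr2 A\<bar> \<noteq> 2" "det A = 1" shows "\<exists>M. det M = 1 \<and> A ** M - M ** A \<noteq> 0"
proof (rule ccontr)
  assume neg: "\<not> ?thesis"
  have z: "A ** mk2 a b c d = mk2 a b c d ** A" if "a * d - b * c = 1" for a d b c
    using neg that by (auto simp: det2)
  have "A$1$2 = 0" "A$2$1 = 0" "A$1$1 = A$2$2"
    using z[of 1 1 1 0] z[of 1 1 0 1] by (simp_all add: mat2_eq_iff)
  moreover from this assms(2) have "A$1$1 * A$1$1 = 1" by (simp add: det2)
  then have "\<bar>A$1$1\<bar> = 1" by (metis abs_square_eq_1 power2_eq_square)
  ultimately have "\<bar>tr2 A\<bar> = 2" by (simp add: tr2_def)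
  with assms(1) show False by simp
qed

lemma norm_diff_mat2_pf:
  fixes A B C D :: mat2
  assumes "i < r"
  shows "(\<lambda>g. (norm (A ** g i ** B - C ** g i ** D))\<^sup>2) \<in> polyfun r"
  unfolding norm_mat2_sq vector_minus_component mat2_mult_nth
  by (intro polyfun.padd polyfun.pmul pf_diff pf_power2 polyfun.pcoord polyfun.pconst assms)

section \<open>Elements that are large or hyperbolic in all components at once\<close>

context zgroup
begin

text \<open>Density yields a trace different from 2 and -2 in component i. If the element is
  elliptic there, its commutator with any element not commuting with it is hyperbolic.\<close>

lemma ex_hyperbolic_single:
  assumes i: "i < r" shows "\<exists>g\<in>\<Gamma>. \<bar>tr2 (g i)\<bar> > 2"
proof -
  have "(\<lambda>g. (tr2 (g i))\<^sup>2 - 4) \<in> polyfun r"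
    unfolding tr2_def using i by (intro pf_diff pf_power2 polyfun.padd polyfun.pcoord polyfun.pconst)
  moreover have "(tr2 (diag2 2))\<^sup>2 - 4 \<noteq> 0" by (simp add: tr2_def power2_eq_square)
  ultimately obtain g where g: "g \<in> \<Gamma>" "(tr2 (g i))\<^sup>2 - 4 \<noteq> 0"
    using zariski_pick1[OF i, of "\<lambda>M. (tr2 M)\<^sup>2 - 4" "diag2 2"] det_diag2[of 2] by auto
  have t: "\<bar>tr2 (g i)\<bar> \<noteq> 2"
  proof
    assume "\<bar>tr2 (g i)\<bar> = 2"
    then have "\<bar>tr2 (g i)\<bar>\<^sup>2 = 4" by simp
    with g(2) show False by simp
  qed
  show ?thesis
  proof (cases "\<bar>tr2 (g i)\<bar> > 2")
    case True with g show ?thesis by blast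
  next
    case False
    with t have l: "\<bar>tr2 (g i)\<bar> < 2" by simp
    obtain M where M: "det M = 1" "g i ** M - M ** g i \<noteq> 0" using noncommuting[OF t] g by auto
    have "(\<lambda>h. (norm (g i ** h i ** mat 1 - mat 1 ** h i ** g i))\<^sup>2) \<in> polyfun r"
      by (rule norm_diff_mat2_pf[OF i])
    then have "(\<lambda>h. (norm (g i ** h i - h i ** g i))\<^sup>2) \<in> polyfun r" by (simp add: matrix_mul_rid matrix_mul_lid)
    then obtain h where h: "h \<in> \<Gamma>" "g i ** h i \<noteq> h i ** g i"
      using zariski_pick1[OF i, of "\<lambda>h. (norm (g i ** h - h ** g i))\<^sup>2" M] M by auto
    have "tr2 (g i ** h i ** inv2 (g i) ** inv2 (h i)) > 2"
      by (rule commutator_trace_gt2) (use g h l in auto)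
    moreover have "(\<lambda>k. g k ** h k ** inv2 (g k) ** inv2 (h k)) \<in> \<Gamma>"
      using g h by (intro mult_G inv_G)
    ultimately show ?thesis by force
  qed
qed

text \<open>The normalised matrices subconverge to non-zero limits, and f is chosen so that (limit
  of g) f (limit of h) is non-zero in every component. The two indices n and m are independent,
  which permits fixing one factor and letting the other one go to infinity.\<close>

lemma combine:
  assumes "\<And>n. g n \<in> \<Gamma>" "\<And>n. h n \<in> \<Gamma>"
  obtains f s c where "f \<in> \<Gamma>" "strict_mono (s :: nat \<Rightarrow> nat)" "c > 0"
    "\<And>n m i. i < r \<Longrightarrow> norm (g (s n) i ** f i ** h (s m) i) \<ge> c * (norm (g (s n) i) * norm (h (s m) i))"
proof -
  \<comment> \<open>Paired, so that one subsequence serves both sequences.\<close>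
  define u where "u n i = ((1 / norm (g n i)) *\<^sub>R g n i, (1 / norm (h n i)) *\<^sub>R h n i)" for n i
  have nz: "norm (g n i) \<noteq> 0" "norm (h n i) \<noteq> 0" for n i
    using norm_ge1[of "g n i"] norm_ge1[of "h n i"] assms by auto
  have "bounded (range (\<lambda>n. u n i))" for i
  proof (rule boundedI)
    fix x assume "x \<in> range (\<lambda>n. u n i)"
    then obtain n where "x = u n i" by auto
    then show "norm x \<le> 2" using norm_Pair_le[of "fst x" "snd x"] nz by (simp add: u_def)
  qed
  then obtain s l where s: "strict_mono s" "\<And>i. i < r \<Longrightarrow> (\<lambda>n. u (s n) i) \<longlonglongrightarrow> l i"
    using subseq_tendsto_finite[of r u] by blast
  have lA: "(\<lambda>n. (1 / norm (g (s n) i)) *\<^sub>R g (s n) i) \<longlonglongrightarrow> fst (l i)"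
    and lB: "(\<lambda>n. (1 / norm (h (s n) i)) *\<^sub>R h (s n) i) \<longlonglongrightarrow> snd (l i)" if "i < r" for i
    using tendsto_fst[OF s(2)[OF that]] tendsto_snd[OF s(2)[OF that]] by (simp_all add: u_def)
  have "norm (fst (l i)) = 1" "norm (snd (l i)) = 1" if "i < r" for i
    using tendsto_norm[OF lA[OF that]] tendsto_norm[OF lB[OF that]] nz
    by (simp_all add: LIMSEQ_const_iff)
  then have l0: "fst (l i) \<noteq> 0" "snd (l i) \<noteq> 0" if "i < r" for i using that by force+
  have "\<exists>f\<in>\<Gamma>. \<forall>i<r. (norm (fst (l i) ** f i ** snd (l i) - 0 ** f i ** 0))\<^sup>2 \<noteq> 0"
  proof (rule zariski_pick[of "\<lambda>i M. (norm (fst (l i) ** M ** snd (l i) - 0 ** M ** 0))\<^sup>2"])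
    show "\<exists>M. det M = 1 \<and> (norm (fst (l i) ** M ** snd (l i) - 0 ** M ** 0))\<^sup>2 \<noteq> 0" if "i < r" for i
      using span_SL2[OF l0[OF that]] by (simp add: mat2_eq_iff[of _ 0])
  qed (rule norm_diff_mat2_pf)
  then obtain f where f: "f \<in> \<Gamma>" "\<And>i. i < r \<Longrightarrow> fst (l i) ** f i ** snd (l i) \<noteq> 0"
    by (force simp: mat2_eq_iff[of _ 0])
  \<comment> \<open>Half of the limit values leaves room for the convergence; the inserted 1 keeps
    the set non-empty for r = 0.\<close>
  define c where "c = Min (insert 1 ((\<lambda>i. norm (fst (l i) ** f i ** snd (l i)) / 2) ` {..<r}))"
  have c0: "c > 0" unfolding c_def using f(2) by (subst Min_gr_iff) auto
  have cl: "c < norm (fst (l i) ** f i ** snd (l i))" if "i < r" for i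
  proof -
    have "c \<le> norm (fst (l i) ** f i ** snd (l i)) / 2" unfolding c_def using that by (intro Min_le) auto
    then show ?thesis using f(2)[OF that] by (smt (verit) field_sum_of_halves zero_less_norm_iff)
  qed
  let ?G = "\<lambda>n i. (1 / norm (g (s n) i)) *\<^sub>R g (s n) i" and ?H = "\<lambda>n i. (1 / norm (h (s n) i)) *\<^sub>R h (s n) i"
  have "\<forall>\<^sub>F (n, m) in sequentially \<times>\<^sub>F sequentially. \<forall>i\<in>{..<r}. c < norm (?G n i ** f i ** ?H m i)"
    unfolding case_prod_beta
  proof (rule eventually_ball_finite, simp, intro ballI)
    fix i assume "i \<in> {..<r}"
    then have i: "i < r" by simp
    have "((\<lambda>p. norm (?G (fst p) i ** f i ** ?H (snd p) i)) \<longlongrightarrow> norm (fst (l i) ** f i ** snd (l i))) (sequentially \<times>\<^sub>F sequentially)"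
      by (intro tendsto_intros filterlim_compose[OF lA[OF i] filterlim_fst] filterlim_compose[OF lB[OF i] filterlim_snd])
    from order_tendstoD(1)[OF this cl[OF i]]
    show "\<forall>\<^sub>F p in sequentially \<times>\<^sub>F sequentially. c < norm (?G (fst p) i ** f i ** ?H (snd p) i)" .
  qed
  then obtain N where N: "\<And>n m i. n \<ge> N \<Longrightarrow> m \<ge> N \<Longrightarrow> i < r \<Longrightarrow> c < norm (?G n i ** f i ** ?H m i)"
    unfolding eventually_prod_sequentially by auto
  have fin: "norm (g (s n) i ** f i ** h (s m) i) \<ge> c * (norm (g (s n) i) * norm (h (s m) i))" if "n \<ge> N" "m \<ge> N" "i < r" for n m i
  proof -
    have "?G n i ** f i ** ?H m i = (1 / (norm (g (s n) i) * norm (h (s m) i))) *\<^sub>R (g (s n) i ** f i ** h (s m) i)"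
      using nz by (simp add: mat2_eq_iff field_simps)
    then have "c < norm (g (s n) i ** f i ** h (s m) i) / (norm (g (s n) i) * norm (h (s m) i))"
      using N[OF that] by simp
    then show ?thesis using nz by (simp add: field_simps zero_less_mult_iff)
  qed
  show thesis
  proof (rule that[of f "\<lambda>n. s (n + N)" c])
    show "strict_mono (\<lambda>n. s (n + N))" using s(1) by (simp add: strict_mono_def)
  qed (use f c0 fin in auto)
qed

lemma combine_at_top:
  assumes "\<And>n. g n \<in> \<Gamma>" "\<And>n. h n \<in> \<Gamma>"
  obtains u where "\<And>n. u n \<in> \<Gamma>"
    "\<And>i. i < r \<Longrightarrow> filterlim (\<lambda>n. norm (g n i)) at_top sequentially \<or> filterlim (\<lambda>n. norm (h n i)) at_top sequentially
        \<Longrightarrow> filterlim (\<lambda>n. norm (u n i)) at_top sequentially"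
    "\<And>i. i < r \<Longrightarrow> bounded (range (\<lambda>n. g n i)) \<Longrightarrow> bounded (range (\<lambda>n. h n i)) \<Longrightarrow> bounded (range (\<lambda>n. u n i))"
proof -
  obtain f s c where f: "f \<in> \<Gamma>" "strict_mono (s :: nat \<Rightarrow> nat)" "c > 0"
    "\<And>n m i. i < r \<Longrightarrow> norm (g (s n) i ** f i ** h (s m) i) \<ge> c * (norm (g (s n) i) * norm (h (s m) i))"
    by (rule combine[of g h, OF assms]) (rule that)
  let ?u = "\<lambda>n i. g (s n) i ** f i ** h (s n) i"
  have *: "c * norm (g (s n) i) \<le> norm (?u n i)" "c * norm (h (s n) i) \<le> norm (?u n i)" if "i < r" for n i
  proof -
    have "norm (g (s n) i) \<ge> 1" "norm (h (s n) i) \<ge> 1" using assms by (simp_all add: norm_ge1)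
    then have "norm (g (s n) i) \<le> norm (g (s n) i) * norm (h (s n) i)" "norm (h (s n) i) \<le> norm (g (s n) i) * norm (h (s n) i)"
      by (simp_all add: mult_le_cancel_left1 mult_le_cancel_right1)
    then show "c * norm (g (s n) i) \<le> norm (?u n i)" "c * norm (h (s n) i) \<le> norm (?u n i)"
      using f(4)[OF that, of n n] f(3) by (meson mult_left_mono less_imp_le order_trans)+
  qed
  have sub: "filterlim (\<lambda>n. c * norm (v (s n) i)) at_top sequentially"
    if "filterlim (\<lambda>n. norm (v n i)) at_top sequentially" for v :: "nat \<Rightarrow> nat \<Rightarrow> mat2" and i
    using filterlim_compose[OF that filterlim_subseq[OF f(2)]]
    by (intro filterlim_tendsto_pos_mult_at_top[OF tendsto_const f(3)])
  show thesis
  proof (rule that[of ?u])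
    show "?u n \<in> \<Gamma>" for n using assms f(1) by (intro mult_G)
    show "filterlim (\<lambda>n. norm (?u n i)) at_top sequentially"
      if i: "i < r" and "filterlim (\<lambda>n. norm (g n i)) at_top sequentially \<or> filterlim (\<lambda>n. norm (h n i)) at_top sequentially" for i
      using that(2)
    proof
      assume "filterlim (\<lambda>n. norm (g n i)) at_top sequentially"
      then show ?thesis by (rule filterlim_at_top_mono[OF sub]) (simp add: * i)
    next
      assume "filterlim (\<lambda>n. norm (h n i)) at_top sequentially"
      then show ?thesis by (rule filterlim_at_top_mono[OF sub]) (simp add: * i)
    qed
    show "bounded (range (\<lambda>n. ?u n i))" if "i < r" "bounded (range (\<lambda>n. g n i))" "bounded (range (\<lambda>n. h n i))" for i
    proof -
      from that obtain a b where ab: "\<And>n. norm (g n i) \<le> a" "\<And>n. norm (h n i) \<le> b"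
        by (auto simp: bounded_iff)
      have "norm (?u n i) \<le> (a * norm (f i)) * b" for n
      proof -
        have "norm (?u n i) \<le> norm (g (s n) i ** f i) * norm (h (s n) i)" by (rule norm_mult2)
        also have "\<dots> \<le> (norm (g (s n) i) * norm (f i)) * norm (h (s n) i)" by (intro mult_right_mono norm_mult2) simp
        also have "\<dots> \<le> (a * norm (f i)) * b"
          using ab(1)[of 0] by (intro mult_mono ab mult_nonneg_nonneg order_trans[OF norm_ge_zero ab(1)[of 0]]) auto
        finally show ?thesis .
      qed
      then show ?thesis by (auto simp: bounded_iff)
    qed
  qed
qed

text \<open>One component at a time: the sequence obtained so far is combined with the powers of an
  element that is hyperbolic in the next component.\<close>

lemma ex_unbounded_all:
  "\<exists>g. (\<forall>n. g n \<in> \<Gamma>) \<and> (\<forall>i<r. filterlim (\<lambda>n. norm (g n i)) at_top sequentially)"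
proof -
  have "\<exists>g. (\<forall>n. g n \<in> \<Gamma>) \<and> (\<forall>i<k. filterlim (\<lambda>n. norm (g n i)) at_top sequentially)" if "k \<le> r" for k
    using that
  proof (induction k)
    case 0
    show ?case using one_G by (intro exI[of _ "\<lambda>n i. mat 1"]) auto
  next
    case (Suc k)
    then obtain g where g: "\<And>n. g n \<in> \<Gamma>" "\<And>i. i < k \<Longrightarrow> filterlim (\<lambda>n. norm (g n i)) at_top sequentially" by auto
    obtain a where a: "a \<in> \<Gamma>" "\<bar>tr2 (a k)\<bar> > 2" using ex_hyperbolic_single[of k] Suc.prems by auto
    let ?h = "\<lambda>n i. mpow (a i) n"
    have h: "?h n \<in> \<Gamma>" for n using a by (intro pow_G)
    obtain u where u: "\<And>n. u n \<in> \<Gamma>"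
      "\<And>i. i < r \<Longrightarrow> filterlim (\<lambda>n. norm (g n i)) at_top sequentially \<or> filterlim (\<lambda>n. norm (?h n i)) at_top sequentially
        \<Longrightarrow> filterlim (\<lambda>n. norm (u n i)) at_top sequentially"
      by (rule combine_at_top[of g ?h, OF g(1) h]) (rule that)
    have "filterlim (\<lambda>n. norm (u n i)) at_top sequentially" if "i < Suc k" for i
      using that u(2)[of i] g(2)[of i] filterlim_norm_mpow[of "a k"] a Suc.prems
      by (cases "i = k") auto
    then show ?case using u(1) by blast
  qed
  then show ?thesis by blast
qed

text \<open>A large norm need not give a large trace. With l the limit of the normalised sequence, f
  is chosen with non-zero trace of \<open>l i ** f i\<close> for all i; then the traces of g f grow
  like the norms.\<close>

lemma ex_hyperbolic_all: "\<exists>a\<in>\<Gamma>. \<forall>i<r. \<bar>tr2 (a i)\<bar> > 2"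
proof -
  obtain g where g: "\<And>n. g n \<in> \<Gamma>" "\<And>i. i < r \<Longrightarrow> filterlim (\<lambda>n. norm (g n i)) at_top sequentially"
    using ex_unbounded_all by blast
  define u where "u n i = (1 / norm (g n i)) *\<^sub>R g n i" for n i
  have nz: "norm (g n i) > 0" for n i using norm_ge1[of "g n i"] g by (smt (verit) det_G)
  have nu: "norm (u n i) = 1" for n i using nz[of n i] by (simp add: u_def)
  have "bounded (range (\<lambda>n. u n i))" for i by (rule boundedI[of _ 1]) (use nu in auto)
  then obtain s l where s: "strict_mono s" "\<And>i. i < r \<Longrightarrow> (\<lambda>n. u (s n) i) \<longlonglongrightarrow> l i"
    using subseq_tendsto_finite[of r u] by blast
  have "norm (l i) = 1" if "i < r" for i
    using tendsto_norm[OF s(2)[OF that]] by (simp add: nu LIMSEQ_const_iff)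
  then have l0: "l i \<noteq> 0" if "i < r" for i using that by force
  have "\<exists>f\<in>\<Gamma>. \<forall>i<r. tr2 (l i ** f i) \<noteq> 0"
  proof (rule zariski_pick[of "\<lambda>i M. tr2 (l i ** M)"])
    show "(\<lambda>g. tr2 (l i ** g i)) \<in> polyfun r" if "i < r" for i
      unfolding tr2_def mat2_mult_nth using that by (intro polyfun.padd polyfun.pmul polyfun.pconst polyfun.pcoord)
  qed (use tr2_nondegenerate l0 in auto)
  then obtain f where f: "f \<in> \<Gamma>" "\<And>i. i < r \<Longrightarrow> tr2 (l i ** f i) \<noteq> 0" by blast
  have "\<forall>\<^sub>F n in sequentially. \<forall>i\<in>{..<r}. \<bar>tr2 (g (s n) i ** f i)\<bar> > 2"
  proof (rule eventually_ball_finite, simp, intro ballI)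
    fix i assume "i \<in> {..<r}"
    then have i: "i < r" by simp
    have "(\<lambda>n. \<bar>tr2 (u (s n) i ** f i)\<bar>) \<longlonglongrightarrow> \<bar>tr2 (l i ** f i)\<bar>"
      unfolding tr2_def by (intro tendsto_intros s(2) i)
    moreover have "filterlim (\<lambda>n. norm (g (s n) i)) at_top sequentially"
      by (rule filterlim_compose[OF g(2)[OF i] filterlim_subseq[OF s(1)]])
    ultimately have "filterlim (\<lambda>n. \<bar>tr2 (u (s n) i ** f i)\<bar> * norm (g (s n) i)) at_top sequentially"
      using f(2)[OF i] by (intro filterlim_tendsto_pos_mult_at_top[of _ "\<bar>tr2 (l i ** f i)\<bar>"]) auto
    moreover have "\<bar>tr2 (u (s n) i ** f i)\<bar> * norm (g (s n) i) = \<bar>tr2 (g (s n) i ** f i)\<bar>" for n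
    proof -
      have "tr2 (u (s n) i ** f i) = tr2 (g (s n) i ** f i) / norm (g (s n) i)"
        by (simp add: tr2_def u_def add_divide_distrib)
      then show ?thesis using nz[of "s n" i] by simp
    qed
    ultimately show "\<forall>\<^sub>F n in sequentially. \<bar>tr2 (g (s n) i ** f i)\<bar> > 2"
      by (simp add: filterlim_at_top_dense)
  qed
  from eventually_happens[OF this] obtain n where "\<forall>i<r. \<bar>tr2 (g (s n) i ** f i)\<bar> > 2" by auto
  then show ?thesis using mult_G[OF g(1)[of "s n"] f(1)] by (intro bexI[of _ "\<lambda>i. g (s n) i ** f i"]) auto
qed

end

section \<open>The Furstenberg limit set as an orbit closure\<close>

definition lam :: "nat \<Rightarrow> (nat \<Rightarrow> mat2) set \<Rightarrow> (nat \<Rightarrow> complex) set" where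
  "lam r G = {\<xi>\<in>torus r. \<forall>e>0. \<exists>g\<in>G. \<forall>i<r. cmod (orb (g i) - \<xi> i) < e}"

lemma torus_norm: "\<xi> \<in> torus r \<Longrightarrow> i < r \<Longrightarrow> cmod (\<xi> i) = 1"
  by (auto simp: torus_def)

lemma eventually_all_less:
  fixes r :: nat
  assumes "\<And>i. i < r \<Longrightarrow> eventually (P i) F"
  shows "eventually (\<lambda>n. \<forall>i<r. P i n) F"
  using eventually_ball_finite[of "{..<r}" "\<lambda>n i. P i n" F] assms by (auto simp: Ball_def)

lemma lam_seq:
  "\<xi> \<in> lam r G \<longleftrightarrow> \<xi> \<in> torus r \<and> (\<exists>g. (\<forall>n. g n \<in> G) \<and> (\<forall>i<r. (\<lambda>n. orb (g n i)) \<longlonglongrightarrow> \<xi> i))"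
proof (intro iffI conjI)
  assume l: "\<xi> \<in> lam r G"
  then show "\<xi> \<in> torus r" by (simp add: lam_def)
  have "\<exists>g\<in>G. \<forall>i<r. cmod (orb (g i) - \<xi> i) < 1 / real (Suc n)" for n
    using l by (simp add: lam_def)
  then obtain g where g: "\<And>n. g n \<in> G" "\<And>n i. i < r \<Longrightarrow> cmod (orb (g n i) - \<xi> i) < 1 / real (Suc n)" by metis
  have "(\<lambda>n. orb (g n i)) \<longlonglongrightarrow> \<xi> i" if "i < r" for i
  proof (rule LIM_zero_cancel, rule Lim_null_comparison[OF always_eventually])
    show "\<forall>n. cmod (orb (g n i) - \<xi> i) \<le> 1 / real (Suc n)" using g(2)[OF that] by (auto intro: less_imp_le)
  qed (rule LIMSEQ_inverse_real_of_nat[unfolded inverse_eq_divide])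
  then show "\<exists>g. (\<forall>n. g n \<in> G) \<and> (\<forall>i<r. (\<lambda>n. orb (g n i)) \<longlonglongrightarrow> \<xi> i)" using g(1) by blast
next
  assume "\<xi> \<in> torus r \<and> (\<exists>g. (\<forall>n. g n \<in> G) \<and> (\<forall>i<r. (\<lambda>n. orb (g n i)) \<longlonglongrightarrow> \<xi> i))"
  then obtain g where t: "\<xi> \<in> torus r" and g: "\<And>n. g n \<in> G" "\<And>i. i < r \<Longrightarrow> (\<lambda>n. orb (g n i)) \<longlonglongrightarrow> \<xi> i" by blast
  have "\<exists>g\<in>G. \<forall>i<r. cmod (orb (g i) - \<xi> i) < e" if "e > 0" for e
  proof -
    have "eventually (\<lambda>n. \<forall>i<r. cmod (orb (g n i) - \<xi> i) < e) sequentially"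
      using g(2) that by (intro eventually_all_less) (auto simp: tendsto_iff dist_norm)
    from eventually_happens[OF this] g(1) show ?thesis by auto
  qed
  with t show "\<xi> \<in> lam r G" by (simp add: lam_def)
qed

lemma lam_approx:
  assumes "\<xi> \<in> torus r" "\<And>e. e > 0 \<Longrightarrow> \<exists>\<eta>\<in>lam r G. \<forall>i<r. cmod (\<eta> i - \<xi> i) < e"
  shows "\<xi> \<in> lam r G"
  unfolding lam_def
proof (intro CollectI conjI allI impI assms(1))
  fix e :: real assume e: "e > 0"
  obtain \<eta> where \<eta>: "\<eta> \<in> lam r G" "\<And>i. i < r \<Longrightarrow> cmod (\<eta> i - \<xi> i) < e / 2" using assms(2)[of "e/2"] e by auto
  obtain g where g: "g \<in> G" "\<And>i. i < r \<Longrightarrow> cmod (orb (g i) - \<eta> i) < e / 2" using \<eta>(1) e half_gt_zero unfolding lam_def by blast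
  have "cmod (orb (g i) - \<xi> i) < e" if "i < r" for i
    using norm_triangle_lt[of "orb (g i) - \<eta> i" "\<eta> i - \<xi> i" e] g(2)[OF that] \<eta>(2)[OF that] by simp
  with g show "\<exists>g\<in>G. \<forall>i<r. cmod (orb (g i) - \<xi> i) < e" by blast
qed

text \<open>The function arcosh lies between ln x and ln (2 x), here at x =
  \<open>(norm A)^2 / 2\<close>.\<close>

lemma hdist_bounds:
  assumes "det A = 1"
  shows "2 * ln (norm A) - ln 2 \<le> hdist 0 (orb A)" "hdist 0 (orb A) \<le> 2 * ln (norm A)"
proof -
  let ?x = "(norm A)\<^sup>2 / 2"
  have x: "?x \<ge> 1" using norm_sq_ge2[OF assms] by simp
  have n: "norm A > 0" using norm_ge1[OF assms] by linarith
  have h: "hdist 0 (orb A) = ln (?x + sqrt (?x\<^sup>2 - 1))"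
    using x by (simp add: hdist_orb assms arcosh_real_def)
  have x2: "?x\<^sup>2 \<ge> 1" using x by (simp add: one_le_power)
  have s0: "sqrt (?x\<^sup>2 - 1) \<ge> 0" using x2 by simp
  have s1: "sqrt (?x\<^sup>2 - 1) \<le> ?x" using x by (intro real_le_lsqrt) auto
  have l: "ln ((norm A)\<^sup>2) = 2 * ln (norm A)" using n by (simp add: ln_realpow)
  have "ln ?x \<le> ln (?x + sqrt (?x\<^sup>2 - 1))" using x s0 by (intro ln_mono) linarith+
  moreover have "ln ?x = ln ((norm A)\<^sup>2) - ln 2" using n by (simp add: ln_div)
  ultimately show "2 * ln (norm A) - ln 2 \<le> hdist 0 (orb A)" using l h by simp
  have "ln (?x + sqrt (?x\<^sup>2 - 1)) \<le> ln ((norm A)\<^sup>2)" using x s0 s1 by (intro ln_mono) linarith+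
  then show "hdist 0 (orb A) \<le> 2 * ln (norm A)" using l h by simp
qed

lemma one_minus_orb_le:
  assumes "det A = 1" shows "1 - (cmod (orb A))\<^sup>2 \<le> 4 / (norm A)\<^sup>2"
proof -
  have "(norm A)\<^sup>2 > 0" using norm_sq_ge2[OF assms] by linarith
  then show ?thesis unfolding one_minus_orb[OF assms] cmod_al_sq[OF assms] by (simp add: frac_le)
qed

lemma norm_limit_circle:
  assumes "\<And>n. det (f n) = 1" "filterlim (\<lambda>n. norm (f n)) at_top sequentially" "(\<lambda>n. orb (f n)) \<longlonglongrightarrow> z"
  shows "cmod z = 1"
proof -
  have "filterlim (\<lambda>n. (norm (f n))\<^sup>2) at_top sequentially"
    using assms(2) by (intro filterlim_pow_at_top) auto
  then have four: "(\<lambda>n. 4 / (norm (f n))\<^sup>2) \<longlonglongrightarrow> 0"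
    by (intro tendsto_divide_0[OF tendsto_const] filterlim_at_top_imp_at_infinity)
  have "(\<lambda>n. 1 - (cmod (orb (f n)))\<^sup>2) \<longlonglongrightarrow> 0"
  proof (rule Lim_null_comparison[OF always_eventually four], rule allI)
    fix n
    have "0 \<le> 1 - (cmod (orb (f n)))\<^sup>2" by (simp add: one_minus_orb assms(1))
    then show "norm (1 - (cmod (orb (f n)))\<^sup>2) \<le> 4 / (norm (f n))\<^sup>2"
      using one_minus_orb_le[OF assms(1), of n] by simp
  qed
  moreover have "(\<lambda>n. 1 - (cmod (orb (f n)))\<^sup>2) \<longlonglongrightarrow> 1 - (cmod z)\<^sup>2" by (intro tendsto_intros assms(3))
  ultimately have "1 - (cmod z)\<^sup>2 = 0" using LIMSEQ_unique by blast
  then have "(cmod z)\<^sup>2 = 1" by simp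
  then show ?thesis by (simp add: power2_eq_1_iff) (use norm_ge_zero[of z] in linarith)
qed

lemma orb_limit_circle_at_top:
  assumes "\<And>n. det (f n) = 1" "(\<lambda>n. orb (f n)) \<longlonglongrightarrow> z" "cmod z = 1"
  shows "filterlim (\<lambda>n. norm (f n)) at_top sequentially"
proof -
  have "(\<lambda>n. 1 - (cmod (orb (f n)))\<^sup>2) \<longlonglongrightarrow> 1 - (cmod z)\<^sup>2" by (intro tendsto_intros assms(2))
  then have l: "(\<lambda>n. 1 - (cmod (orb (f n)))\<^sup>2) \<longlonglongrightarrow> 0" using assms(3) by simp
  have pos: "1 - (cmod (orb (f n)))\<^sup>2 > 0" for n
    using one_minus_orb[OF assms(1)] al_nz[OF assms(1)] by simp
  have inv: "filterlim (\<lambda>n. inverse (1 - (cmod (orb (f n)))\<^sup>2)) at_top sequentially"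
    using l pos by (intro filterlim_inverse_at_top) auto
  have "inverse (1 - (cmod (orb (f n)))\<^sup>2) \<le> (norm (f n))\<^sup>2" for n
    using power_mono[OF cmod_al_le[OF assms(1)[of n]], of 2] by (simp add: one_minus_orb assms(1))
  then have sq: "filterlim (\<lambda>n. (norm (f n))\<^sup>2) at_top sequentially"
    using inv by (intro filterlim_at_top_mono[OF inv]) auto
  have "filterlim (\<lambda>n. sqrt ((norm (f n))\<^sup>2)) at_top sequentially"
    by (rule filterlim_compose[OF sqrt_at_top sq])
  then show ?thesis by simp
qed

text \<open>Since every \<open>w i\<close> is positive and the total distance tends to infinity, so
  does the distance in each component, and each coordinate of the limit lies on the circle.\<close>

lemma (in zgroup) furst_subset_lam: "furst_limset r \<Gamma> \<subseteq> lam r \<Gamma>"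
proof
  fix \<xi> assume "\<xi> \<in> furst_limset r \<Gamma>"
  then obtain w g where x0: "\<forall>i\<ge>r. \<xi> i = 0" and w': "\<forall>i<r. w i > 0" and g': "\<forall>n. g n \<in> \<Gamma>"
    and D: "filterlim (\<lambda>n. sqrt (\<Sum>i<r. (hdist 0 (orb (g n i)))\<^sup>2)) at_top sequentially"
    and dD': "\<forall>i<r. (\<lambda>n. hdist 0 (orb (g n i)) / sqrt (\<Sum>i<r. (hdist 0 (orb (g n i)))\<^sup>2)) \<longlonglongrightarrow> w i / sqrt (\<Sum>i<r. (w i)\<^sup>2)"
    and o': "\<forall>i<r. (\<lambda>n. orb (g n i)) \<longlonglongrightarrow> \<xi> i"
    unfolding furst_limset_def Let_def mem_Collect_eq by (elim conjE exE)
  note w = w'[rule_format] and g = g'[rule_format] and dD = dD'[rule_format] and o = o'[rule_format]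
  have "cmod (\<xi> i) = 1" if i: "i < r" for i
  proof (rule norm_limit_circle[OF _ _ o[OF i]])
    let ?D = "\<lambda>n. sqrt (\<Sum>i<r. (hdist 0 (orb (g n i)))\<^sup>2)"
    have "(\<Sum>i<r. (w i)\<^sup>2) > 0" using w[OF i] i by (intro sum_pos2[of _ i]) auto
    then have "filterlim (\<lambda>n. hdist 0 (orb (g n i)) / ?D n * ?D n) at_top sequentially"
      using w[OF i] by (intro filterlim_tendsto_pos_mult_at_top[OF dD[OF i] _ D]) auto
    moreover have "\<forall>\<^sub>F n in sequentially. ?D n > 0" using D unfolding filterlim_at_top_dense by blast
    ultimately have h: "filterlim (\<lambda>n. hdist 0 (orb (g n i))) at_top sequentially"
      by (elim filterlim_mono_eventually[OF _ order_refl order_refl]) (auto elim!: eventually_mono)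
    have e: "filterlim (\<lambda>n. exp (hdist 0 (orb (g n i)) / 2)) at_top sequentially"
      by (rule filterlim_compose[OF exp_at_top]) (rule filterlim_at_top_mult_tendsto_pos[OF tendsto_const _ h, of "1/2", simplified])
    show "filterlim (\<lambda>n. norm (g n i)) at_top sequentially"
    proof (rule filterlim_at_top_mono[OF e always_eventually], rule allI)
      fix n
      have n: "norm (g n i) > 0" using norm_ge1[of "g n i"] g by (smt (verit) det_G)
      have "exp (hdist 0 (orb (g n i)) / 2) \<le> exp (ln (norm (g n i)))"
        unfolding exp_le_cancel_iff using hdist_bounds(2)[OF det_G[OF g], of n i] by simp
      then show "exp (hdist 0 (orb (g n i)) / 2) \<le> norm (g n i)" unfolding exp_ln[OF n] .
    qed
  qed (use g in auto)
  then have "\<xi> \<in> torus r" using x0 by (auto simp: torus_def)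
  then show "\<xi> \<in> lam r \<Gamma>" unfolding lam_seq using g o by blast
qed

text \<open>An arbitrary approximating sequence \<open>g0\<close> may escape in a singular
  direction. It is replaced by \<open>g0\<close> f a^m with a hyperbolic in all components: by
  \<open>orb_product_diff\<close> the limit is the same, and for m large compared with
  \<open>g0\<close> the direction tends to the vector of translation lengths of a, all of which are
  positive.\<close>

lemma (in zgroup) lam_subset_furst:
  assumes "r > 0"
  shows "lam r \<Gamma> \<subseteq> furst_limset r \<Gamma>"
proof
  fix \<xi> assume \<xi>: "\<xi> \<in> lam r \<Gamma>"
  obtain a where a: "a \<in> \<Gamma>" "\<And>i. i < r \<Longrightarrow> \<bar>tr2 (a i)\<bar> > 2" using ex_hyperbolic_all by blast
  have "\<forall>i. \<exists>S x. i < r \<longrightarrow> det S = 1 \<and> \<bar>x\<bar> > 1 \<and> a i = S ** diag2 x ** inv2 S"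
    using hyperbolic_diag[OF det_G[OF a(1)] a(2)] by metis
  then obtain S x where S: "\<And>i. i < r \<Longrightarrow> det (S i) = 1" "\<And>i. i < r \<Longrightarrow> \<bar>x i\<bar> > 1"
    "\<And>i. i < r \<Longrightarrow> a i = S i ** diag2 (x i) ** inv2 (S i)" by metis
  let ?a = "\<lambda>m i. mpow (a i) m"
  have aG: "?a m \<in> \<Gamma>" for m using a(1) by (rule pow_G)
  \<comment> \<open>The translation length of a in component i. By \<open>dist_a\<close> below, a^m
    adds m times this length, up to an error independent of m.\<close>
  define L where "L i = 2 * ln \<bar>x i\<bar>" for i
  have L: "L i > 0" if "i < r" for i using S(2)[OF that] by (simp add: L_def)
  define C where "C i = 2 * ln (2 * norm (S i) * norm (S i)) + ln 2" for i
  have dist_a: "\<bar>hdist 0 (orb (h ** ?a m i)) - real m * L i\<bar> \<le> 2 * ln (norm h) + C i"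
    if i: "i < r" and h: "det h = 1" for h m i
  proof -
    have x0: "x i \<noteq> 0" "\<bar>x i\<bar> ^ m \<ge> 1" using S(2)[OF i] by (auto intro: one_le_power)
    have am: "?a m i = S i ** diag2 (x i ^ m) ** inv2 (S i)"
      unfolding S(3)[OF i] by (rule mpow_hyperbolic[OF S(1)[OF i] x0(1)])
    have nS: "norm (S i) \<ge> 1" by (rule norm_ge1[OF S(1)[OF i]])
    have nh: "norm h \<ge> 1" by (rule norm_ge1[OF h])
    have dt: "det (?a m i) = 1" "det (h ** ?a m i) = 1" using aG[of m] h by (auto simp: det_mul det_mpow a)
    have lo: "\<bar>x i\<bar> ^ m \<le> norm (S i) * norm (S i) * norm (?a m i)"
      using norm_entry[of "diag2 (x i ^ m)" 1 1] norm_conj_ge[OF S(1)[OF i] S(1)[OF i], of "diag2 (x i ^ m)"]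
      unfolding am by (simp add: power_abs)
    have "norm (diag2 (x i ^ m)) \<le> \<bar>x i\<bar> ^ m + 1 / \<bar>x i\<bar> ^ m"
      using norm_mat2_le_sum[of "diag2 (x i ^ m)"] by (simp add: power_abs)
    also have "\<dots> \<le> 2 * \<bar>x i\<bar> ^ m" using x0(2) by (simp add: divide_le_eq) (smt (verit) mult_le_cancel_left1)
    finally have hi: "norm (?a m i) \<le> norm (S i) * norm (S i) * (2 * \<bar>x i\<bar> ^ m)"
      using norm_conj_le[of "S i" "diag2 (x i ^ m)" "S i"] unfolding am
      by (meson mult_left_mono mult_nonneg_nonneg norm_ge_zero order_trans)
    let ?N = "norm (h ** ?a m i)"
    have N1: "?N \<ge> 1" by (rule norm_ge1[OF dt(2)])
    have "?N \<le> norm h * norm (?a m i)" by (rule norm_mult2)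
    also have "\<dots> \<le> norm h * (norm (S i) * norm (S i) * (2 * \<bar>x i\<bar> ^ m))" by (rule mult_left_mono[OF hi]) simp
    finally have "ln ?N \<le> ln (norm h * ((2 * norm (S i) * norm (S i)) * \<bar>x i\<bar> ^ m))"
      using N1 by (intro ln_mono) (auto simp: mult_ac)
    also have "\<dots> = ln (norm h) + (ln (2 * norm (S i) * norm (S i)) + real m * ln \<bar>x i\<bar>)"
      using nh nS x0 by (subst ln_mult, simp, simp, subst ln_mult) (auto simp: ln_realpow)
    finally have up: "ln ?N \<le> ln (norm h) + ln (2 * norm (S i) * norm (S i)) + real m * ln \<bar>x i\<bar>" by simp
    have "\<bar>x i\<bar> ^ m \<le> norm (S i) * norm (S i) * (norm h * ?N)"
      using lo norm_mult2_ge'[OF h, of "?a m i"] by (meson mult_left_mono mult_nonneg_nonneg norm_ge_zero order_trans)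
    also have "\<dots> \<le> 2 * (norm (S i) * norm (S i) * (norm h * ?N))" by simp
    finally have "ln (\<bar>x i\<bar> ^ m) \<le> ln (norm h * ((2 * norm (S i) * norm (S i)) * ?N))"
      using x0 by (intro ln_mono) (auto simp: mult_ac)
    also have "\<dots> = ln (norm h) + (ln (2 * norm (S i) * norm (S i)) + ln ?N)"
      using nh nS N1 by (subst ln_mult, simp, simp, subst ln_mult) auto
    finally have low: "real m * ln \<bar>x i\<bar> \<le> ln (norm h) + ln (2 * norm (S i) * norm (S i)) + ln ?N"
      using x0 by (simp add: ln_realpow)
    show ?thesis using up low hdist_bounds[OF dt(2)] ln_ge_zero[OF nh]
      unfolding C_def L_def by (simp add: abs_le_iff algebra_simps)
  qed
  obtain g0 where g0: "\<forall>n. g0 n \<in> \<Gamma>" "\<forall>i<r. (\<lambda>n. orb (g0 n i)) \<longlonglongrightarrow> \<xi> i" and \<xi>t: "\<xi> \<in> torus r"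
    using \<xi> unfolding lam_seq by blast
  have g0G: "g0 n \<in> \<Gamma>" for n using g0(1) by simp
  \<comment> \<open>Even n + 1 times the logarithm of each component norm of \<open>g0 n\<close>
    stays below \<open>m0 n\<close>, so these norms become negligible. The second \<open>Suc\<close>
    keeps the factor positive.\<close>
  define m0 where "m0 n = Suc n * Suc (nat \<lceil>\<Sum>i<r. ln (norm (g0 n i))\<rceil>)" for n
  obtain f s c where f: "f \<in> \<Gamma>" "strict_mono (s :: nat \<Rightarrow> nat)" "c > 0"
    and fc: "\<And>n k i. i < r \<Longrightarrow> norm (g0 (s n) i ** f i ** ?a (m0 (s k)) i) \<ge> c * (norm (g0 (s n) i) * norm (?a (m0 (s k)) i))"
    by (rule combine[of g0 "\<lambda>n. ?a (m0 n)", OF g0G aG]) (rule that)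
  define m where "m n = m0 (s n)" for n
  define g where "g n i = g0 (s n) i ** f i ** ?a (m n) i" for n i
  have g: "g n \<in> \<Gamma>" for n unfolding g_def[abs_def] by (intro mult_G g0G f(1) aG)
  have m: "m n > n" for n
  proof -
    have "n \<le> s n" by (rule seq_suble[OF f(2)])
    also have "s n < Suc (s n) * Suc (nat \<lceil>\<Sum>i<r. ln (norm (g0 (s n) i))\<rceil>)" by simp
    finally show ?thesis by (simp add: m_def m0_def)
  qed
  have n1: "norm (h i) \<ge> 1" if "h \<in> \<Gamma>" for h i by (rule norm_ge1[OF det_G[OF that]])
  have o: "(\<lambda>n. orb (g n i)) \<longlonglongrightarrow> \<xi> i" if i: "i < r" for i
  proof -
    have gs: "(\<lambda>n. orb (g0 (s n) i)) \<longlonglongrightarrow> \<xi> i"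
      using LIMSEQ_subseq_LIMSEQ[OF g0(2)[rule_format, OF i] f(2)] by (simp add: o_def)
    have gn: "filterlim (\<lambda>n. norm (g0 (s n) i)) at_top sequentially"
      by (rule orb_limit_circle_at_top[OF _ gs torus_norm[OF \<xi>t i]]) (simp add: g0G)
    have "(\<lambda>n. orb (g0 (s n) i) - orb (g n i)) \<longlonglongrightarrow> 0"
    proof (rule Lim_null_comparison[OF always_eventually])
      show "\<forall>n. cmod (orb (g0 (s n) i) - orb (g n i)) \<le> (4 * norm (f i) / c) / norm (g0 (s n) i)"
        unfolding g_def m_def by (intro allI orb_product_diff fc i f(3) det_G g0G f(1) aG)
      show "(\<lambda>n. (4 * norm (f i) / c) / norm (g0 (s n) i)) \<longlonglongrightarrow> 0"
        by (intro tendsto_divide_0[OF tendsto_const] filterlim_at_top_imp_at_infinity gn)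
    qed
    from tendsto_diff[OF gs this] show ?thesis by simp
  qed
  have inv: "(\<lambda>n. 1 / real (Suc n)) \<longlonglongrightarrow> 0" by (rule LIMSEQ_inverse_real_of_nat[unfolded inverse_eq_divide])
  have d: "(\<lambda>n. hdist 0 (orb (g n i)) / real (m n)) \<longlonglongrightarrow> L i" if i: "i < r" for i
  proof (rule LIM_zero_cancel, rule Lim_null_comparison[OF always_eventually])
    define B where "B = 2 + 2 * ln (norm (f i)) + \<bar>C i\<bar>"
    show "\<forall>n. norm (hdist 0 (orb (g n i)) / real (m n) - L i) \<le> B * (1 / real (Suc n))"
    proof
      fix n
      let ?h = "g0 (s n) i ** f i" and ?l = "\<lambda>i. ln (norm (g0 (s n) i))"
      have l0: "?l i \<ge> 0" for i using n1[OF g0G] by simp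
      have mp: "real (m n) > 0" "real (Suc n) \<le> real (m n)" using m[of n] by simp_all
      have ls: "?l i * real (Suc n) \<le> real (m n)"
      proof -
        have "?l i \<le> (\<Sum>i<r. ?l i)" using i l0 by (intro member_le_sum) auto
        also have "\<dots> \<le> real (Suc (nat \<lceil>\<Sum>i<r. ?l i\<rceil>))" using real_nat_ceiling_ge[of "\<Sum>i<r. ?l i"] by simp
        finally have "?l i * real (Suc n) \<le> real (Suc (nat \<lceil>\<Sum>i<r. ?l i\<rceil>)) * real (Suc (s n))"
          using seq_suble[OF f(2), of n] by (intro mult_mono) auto
        then show ?thesis by (simp only: m_def m0_def of_nat_mult mult.commute)
      qed
      have "ln (norm ?h) \<le> ln (norm (g0 (s n) i) * norm (f i))"
        using norm_mult2[of "g0 (s n) i" "f i"] norm_ge1[of ?h] g0G f(1) by (intro ln_mono) (auto simp: det_mult1)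
      also have "\<dots> = ?l i + ln (norm (f i))" using n1[OF g0G, of "s n" i] n1[OF f(1), of i] by (intro ln_mult_pos) linarith+
      finally have lh: "ln (norm ?h) \<le> ?l i + ln (norm (f i))" .
      have "\<bar>hdist 0 (orb (g n i)) - real (m n) * L i\<bar> \<le> 2 * ln (norm ?h) + C i"
        unfolding g_def by (rule dist_a[OF i]) (simp add: det_mult1 g0G f)
      also have "\<dots> \<le> 2 * ?l i + (2 * ln (norm (f i)) + \<bar>C i\<bar>)" using lh by linarith
      finally have "\<bar>hdist 0 (orb (g n i)) - real (m n) * L i\<bar> * real (Suc n) \<le> (2 * ?l i + (2 * ln (norm (f i)) + \<bar>C i\<bar>)) * real (Suc n)"
        by (intro mult_right_mono) auto
      also have "\<dots> \<le> 2 * real (m n) + (2 * ln (norm (f i)) + \<bar>C i\<bar>) * real (m n)"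
        unfolding distrib_right using ls mp(2) n1[OF f(1), of i] by (intro add_mono mult_left_mono) auto
      finally have "\<bar>hdist 0 (orb (g n i)) - real (m n) * L i\<bar> * real (Suc n) \<le> B * real (m n)" by (simp add: B_def algebra_simps)
      then have "\<bar>hdist 0 (orb (g n i)) - real (m n) * L i\<bar> / real (m n) \<le> B / real (Suc n)"
        using mp by (simp add: field_simps)
      moreover have "hdist 0 (orb (g n i)) / real (m n) - L i = (hdist 0 (orb (g n i)) - real (m n) * L i) / real (m n)"
        using mp by (simp add: field_simps)
      ultimately show "norm (hdist 0 (orb (g n i)) / real (m n) - L i) \<le> B * (1 / real (Suc n))" using mp(1) by simp
    qed
    show "(\<lambda>n. B * (1 / real (Suc n))) \<longlonglongrightarrow> 0" by (rule tendsto_mult_right_zero[OF inv])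
  qed
  define D where "D n = sqrt (\<Sum>i<r. (hdist 0 (orb (g n i)))\<^sup>2)" for n
  define W where "W = sqrt (\<Sum>i<r. (L i)\<^sup>2)"
  have mp: "real (m n) > 0" for n using m[of n] by simp
  have Dm: "D n / real (m n) = sqrt (\<Sum>i<r. (hdist 0 (orb (g n i)) / real (m n))\<^sup>2)" for n
  proof -
    have "(\<Sum>i<r. (hdist 0 (orb (g n i)) / real (m n))\<^sup>2) = (\<Sum>i<r. (hdist 0 (orb (g n i)))\<^sup>2) / (real (m n))\<^sup>2"
      by (simp add: power_divide sum_divide_distrib)
    then show ?thesis using mp[of n] by (simp add: D_def real_sqrt_divide)
  qed
  have DW: "(\<lambda>n. D n / real (m n)) \<longlonglongrightarrow> W"
    unfolding Dm W_def by (intro tendsto_intros d) auto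
  show "\<xi> \<in> furst_limset r \<Gamma>"
  proof -
    have "(\<Sum>i<r. (L i)\<^sup>2) > 0" using assms L by (intro sum_pos2[of _ 0]) (auto simp: less_imp_neq[symmetric])
    then have W: "W > 0" by (simp add: W_def)
    have mt: "filterlim (\<lambda>n. real (m n)) at_top sequentially"
      by (rule filterlim_at_top_mono[OF filterlim_real_sequentially]) (use m in \<open>auto intro!: always_eventually less_imp_le\<close>)
    have "filterlim (\<lambda>n. D n / real (m n) * real (m n)) at_top sequentially"
      by (rule filterlim_tendsto_pos_mult_at_top[OF DW W mt])
    then have Dt: "filterlim D at_top sequentially" using mp by (simp add: less_imp_neq[symmetric])
    then have "filterlim (\<lambda>n. sqrt (\<Sum>i<r. (hdist 0 (orb (g n i)))\<^sup>2)) at_top sequentially"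
      by (simp add: D_def[abs_def])
    moreover
    have "(\<lambda>n. hdist 0 (orb (g n i)) / D n) \<longlonglongrightarrow> L i / W" if "i < r" for i
    proof -
      have "(\<lambda>n. (hdist 0 (orb (g n i)) / real (m n)) / (D n / real (m n))) \<longlonglongrightarrow> L i / W"
        using W by (intro tendsto_divide d that DW) auto
      then show ?thesis using mp by (simp add: less_imp_neq[symmetric])
    qed
    ultimately show ?thesis using \<xi> g L o unfolding furst_limset_def Let_def
      by (auto simp: lam_def torus_def D_def W_def intro!: exI[of _ L] exI[of _ g])
  qed
qed

section \<open>Non-discrete projections\<close>

definition rot2 :: "real \<Rightarrow> mat2" where "rot2 p = mk2 (cos p) (sin p) (- sin p) (cos p)"

lemma det_rot2 [simp]: "det (rot2 p) = 1"
  by (simp add: rot2_def det2 power2_eq_square[symmetric])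

lemma orb_rot2_diag2:
  assumes "x > 0"
  shows "orb (rot2 p ** diag2 x) = cis (2 * p) * of_real ((x\<^sup>2 - 1) / (x\<^sup>2 + 1))"
proof -
  have d: "det (diag2 x) = 1" using assms by (intro det_diag2) simp
  have p: "x\<^sup>2 + 1 \<noteq> 0" by (smt (verit) zero_le_power2)
  have half: "(u / 2) / (v / 2) = u / v" for u v :: real by simp
  have "orb (diag2 x) = of_real ((x - 1 / x) / 2) / of_real ((x + 1 / x) / 2)"
    unfolding orb_eq[OF d] al_def be_def by (simp add: Complex_eq)
  also have "\<dots> = of_real (((x - 1 / x) / 2) / ((x + 1 / x) / 2))" by (rule of_real_divide[symmetric])
  also have "((x - 1 / x) / 2) / ((x + 1 / x) / 2) = (x - 1 / x) / (x + 1 / x)"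
    by (rule half)
  also have "(x - 1 / x) / (x + 1 / x) = (x\<^sup>2 - 1) / (x\<^sup>2 + 1)"
    using assms p by (simp add: divide_simps power2_eq_square)
  finally have o: "orb (diag2 x) = of_real ((x\<^sup>2 - 1) / (x\<^sup>2 + 1))" .
  have a: "al (rot2 p) = cis p" "be (rot2 p) = 0" by (simp_all add: al_def be_def rot2_def complex_eq_iff)
  have "cis p / cnj (cis p) = cis p * cis p" by (simp add: cis_cnj flip: cis_divide cis_mult) (simp add: cis_divide cis_mult)
  also have "\<dots> = cis (2 * p)" by (simp add: cis_mult)
  finally have c: "cis p / cnj (cis p) = cis (2 * p)" .
  have "orb (rot2 p ** diag2 x) = (cis p * be (diag2 x)) / (cnj (cis p) * cnj (al (diag2 x)))"
    using orb_eq[OF det_mult1[OF det_rot2 d]] by (simp add: al_mult be_mult a)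
  also have "\<dots> = cis p / cnj (cis p) * orb (diag2 x)" unfolding orb_eq[OF d] by (rule times_divide_times_eq[symmetric])
  finally show ?thesis unfolding c o .
qed

lemma orb_dense:
  assumes "cmod z = 1" "e > 0"
  shows "\<exists>M. det M = 1 \<and> cmod (orb M - z) < e"
proof -
  obtain p where p: "z = cis p" using assms(1) using complex_norm_eq_1_exp[of z] unfolding cis_conv_exp by metis
  \<comment> \<open>The distance to z will be 2 / (x^2 + 1), and this x makes it less than
    e.\<close>
  define x where "x = sqrt (2 / e) + 1"
  have x: "x > 0" using assms(2) by (simp add: x_def add_nonneg_pos)
  have "2 / e < x\<^sup>2 + 1"
  proof -
    have "x\<^sup>2 = 2 / e + 2 * sqrt (2 / e) + 1" using assms(2) by (simp add: x_def power2_sum)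
    then show ?thesis using assms(2) by (smt (verit) divide_pos_pos real_sqrt_ge_zero)
  qed
  then have b: "2 / (x\<^sup>2 + 1) < e" using assms(2) by (simp add: field_simps add_pos_nonneg)
  have q: "(x\<^sup>2 - 1) / (x\<^sup>2 + 1) - 1 = - (2 / (x\<^sup>2 + 1))"
    by (simp add: divide_simps) (smt (verit) zero_le_power2)
  have "orb (rot2 (p / 2) ** diag2 x) - z = cis p * of_real ((x\<^sup>2 - 1) / (x\<^sup>2 + 1) - 1)"
    using orb_rot2_diag2[OF x, of "p / 2"] p by (simp add: algebra_simps)
  then have "cmod (orb (rot2 (p / 2) ** diag2 x) - z) = \<bar>(x\<^sup>2 - 1) / (x\<^sup>2 + 1) - 1\<bar>"
    by (simp only: norm_mult norm_of_real) simp
  also have "\<dots> = 2 / (x\<^sup>2 + 1)" unfolding q by simp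
  finally show ?thesis using b x by (intro exI[of _ "rot2 (p / 2) ** diag2 x"]) (simp add: det_mul det_diag2)
qed

text \<open>A matrix with non-zero lower left entry is a product upper-lower-upper of unipotents;
  otherwise multiplication by \<open>mk2 1 0 1 1\<close> makes that entry non-zero.\<close>

lemma SL2_generated:
  assumes U: "\<And>s. P (mk2 1 s 0 1)" and L: "\<And>s. P (mk2 1 0 s 1)"
    and mult: "\<And>A B. P A \<Longrightarrow> P B \<Longrightarrow> P (A ** B)" and d: "det M = 1"
  shows "P M"
proof -
  have c: "P (mk2 p q u v)" if "u \<noteq> 0" "p * v - q * u = 1" for p q u v
  proof -
    have "mk2 1 ((p - 1) / u) 0 1 ** mk2 1 0 u 1 ** mk2 1 ((v - 1) / u) 0 1 = mk2 p q u v"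
      using that by (simp add: mat2_eq_iff field_simps)
    then show ?thesis by (metis U L mult)
  qed
  show ?thesis
  proof (cases "M$2$1 = 0")
    case False
    have "mk2 (M$1$1) (M$1$2) (M$2$1) (M$2$2) = M" by (simp add: mat2_eq_iff)
    then show ?thesis using c[of "M$2$1" "M$1$1" "M$2$2" "M$1$2"] False d by (simp add: det2)
  next
    case True
    then have dd: "M$1$1 * M$2$2 = 1" using d by (simp add: det2)
    let ?N = "M ** mk2 1 0 1 1"
    have e: "mk2 (?N$1$1) (?N$1$2) (?N$2$1) (?N$2$2) = ?N" by (simp add: mat2_eq_iff)
    have "?N$2$1 \<noteq> 0" using True dd by auto
    moreover have "det ?N = 1" by (simp add: det_mul d) (simp add: det2)
    ultimately have "P ?N" using c[of "?N$2$1" "?N$1$1" "?N$2$2" "?N$1$2"] unfolding e by (simp add: det2)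
    then have PN: "P (?N ** mk2 1 0 (-1) 1)" by (rule mult[OF _ L])
    have "?N ** mk2 1 0 (-1) 1 = M" by (simp add: mat2_eq_iff)
    then show ?thesis using PN by metis
  qed
qed

text \<open>A binary quadratic form has at most two zeros on the projective line; the product of the
  three 2x2 determinants is, up to sign, the determinant of the linear system for a, b, c.\<close>

lemma binary_quadratic_zero:
  fixes a b c :: real
  assumes "a * s0\<^sup>2 + b * s0 * t0 + c * t0\<^sup>2 = 0" "a * s1\<^sup>2 + b * s1 * t1 + c * t1\<^sup>2 = 0"
    "a * s2\<^sup>2 + b * s2 * t2 + c * t2\<^sup>2 = 0"
    and "s0 * t1 - s1 * t0 \<noteq> 0" "s0 * t2 - s2 * t0 \<noteq> 0" "s1 * t2 - s2 * t1 \<noteq> 0"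
  shows "a = 0 \<and> b = 0 \<and> c = 0"
proof -
  let ?D = "(s0 * t1 - s1 * t0) * (s0 * t2 - s2 * t0) * (s1 * t2 - s2 * t1)"
  have "?D * a = 0" using assms(1-3) by algebra
  moreover have "?D * b = 0" using assms(1-3) by algebra
  moreover have "?D * c = 0" using assms(1-3) by algebra
  ultimately show ?thesis using assms(4-6) by simp
qed

section \<open>Closures of pairs of projections\<close>

context zgroup
begin

text \<open>The closed group generated by two components of \<open>\<Gamma>\<close> jointly. The
  case \<open>i = k\<close> is intended too: it is the diagonal of the closure of a single
  projection.\<close>

definition pcl :: "nat \<Rightarrow> nat \<Rightarrow> (mat2 \<times> mat2) set" where
  "pcl i k = closure ((\<lambda>g. (g i, g k)) ` \<Gamma>)"

lemma pcl_seq: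
  "(A, B) \<in> pcl i k \<longleftrightarrow> (\<exists>g. (\<forall>n. g n \<in> \<Gamma>) \<and> (\<lambda>n. g n i) \<longlonglongrightarrow> A \<and> (\<lambda>n. g n k) \<longlonglongrightarrow> B)"
proof
  assume "(A, B) \<in> pcl i k"
  then obtain x where x: "\<forall>n. x n \<in> (\<lambda>g. (g i, g k)) ` \<Gamma>" "x \<longlonglongrightarrow> (A, B)"
    unfolding pcl_def closure_sequential by blast
  have "\<forall>n. \<exists>h. h \<in> \<Gamma> \<and> x n = (h i, h k)" using x(1) by blast
  from choice[OF this] obtain g where g: "\<forall>n. g n \<in> \<Gamma> \<and> x n = (g n i, g n k)" by blast
  then have "x = (\<lambda>n. (g n i, g n k))" by (simp add: fun_eq_iff)
  then have "(\<lambda>n. (g n i, g n k)) \<longlonglongrightarrow> (A, B)" using x(2) by simp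
  then have "(\<lambda>n. g n i) \<longlonglongrightarrow> A" "(\<lambda>n. g n k) \<longlonglongrightarrow> B" using tendsto_fst[of "\<lambda>n. (g n i, g n k)"] tendsto_snd[of "\<lambda>n. (g n i, g n k)"] by force+
  then show "\<exists>g. (\<forall>n. g n \<in> \<Gamma>) \<and> (\<lambda>n. g n i) \<longlonglongrightarrow> A \<and> (\<lambda>n. g n k) \<longlonglongrightarrow> B"
    using g by blast
next
  assume "\<exists>g. (\<forall>n. g n \<in> \<Gamma>) \<and> (\<lambda>n. g n i) \<longlonglongrightarrow> A \<and> (\<lambda>n. g n k) \<longlonglongrightarrow> B"
  then obtain g where "\<forall>n. g n \<in> \<Gamma>" "(\<lambda>n. g n i) \<longlonglongrightarrow> A" "(\<lambda>n. g n k) \<longlonglongrightarrow> B" by blast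
  then show "(A, B) \<in> pcl i k" unfolding pcl_def closure_sequential
    by (intro exI[of _ "\<lambda>n. (g n i, g n k)"]) (auto intro: tendsto_Pair)
qed

lemma pcl_det:
  assumes "(A, B) \<in> pcl i k" shows "det A = 1" "det B = 1"
proof -
  obtain g where g: "\<forall>n. g n \<in> \<Gamma>" "(\<lambda>n. g n i) \<longlonglongrightarrow> A" "(\<lambda>n. g n k) \<longlonglongrightarrow> B" using assms unfolding pcl_seq by blast
  have *: "det C = 1" if "(\<lambda>n. g n l) \<longlonglongrightarrow> C" for C l
  proof -
    have "(\<lambda>n. det (g n l)) \<longlonglongrightarrow> det C" unfolding det2 by (intro tendsto_intros that)
    moreover have "det (g n l) = 1" for n using g(1) by simp
    ultimately show ?thesis by (simp add: LIMSEQ_const_iff)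
  qed
  show "det A = 1" by (rule *[OF g(2)])
  show "det B = 1" by (rule *[OF g(3)])
qed

lemma pcl_mult:
  assumes "(A, B) \<in> pcl i k" "(A', B') \<in> pcl i k" shows "(A ** A', B ** B') \<in> pcl i k"
proof -
  obtain g where g: "\<forall>n. g n \<in> \<Gamma>" "(\<lambda>n. g n i) \<longlonglongrightarrow> A" "(\<lambda>n. g n k) \<longlonglongrightarrow> B" using assms(1) unfolding pcl_seq by blast
  obtain h where h: "\<forall>n. h n \<in> \<Gamma>" "(\<lambda>n. h n i) \<longlonglongrightarrow> A'" "(\<lambda>n. h n k) \<longlonglongrightarrow> B'" using assms(2) unfolding pcl_seq by blast
  show ?thesis unfolding pcl_seq using g h
    by (intro exI[of _ "\<lambda>n i. g n i ** h n i"]) (auto intro!: mult_G tendsto_intros)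
qed

lemma pcl_inv:
  assumes "(A, B) \<in> pcl i k" shows "(inv2 A, inv2 B) \<in> pcl i k"
proof -
  obtain g where g: "\<forall>n. g n \<in> \<Gamma>" "(\<lambda>n. g n i) \<longlonglongrightarrow> A" "(\<lambda>n. g n k) \<longlonglongrightarrow> B" using assms(1) unfolding pcl_seq by blast
  show ?thesis unfolding pcl_seq using g
    by (intro exI[of _ "\<lambda>n i. inv2 (g n i)"]) (auto intro!: inv_G tendsto_intros)
qed

lemma pcl_G: "g \<in> \<Gamma> \<Longrightarrow> (g i, g k) \<in> pcl i k"
  unfolding pcl_def by (rule subsetD[OF closure_subset]) (rule imageI)

lemma pcl_limit:
  assumes "\<And>n. (f n, h n) \<in> pcl i k" "f \<longlonglongrightarrow> A" "h \<longlonglongrightarrow> B" shows "(A, B) \<in> pcl i k"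
  using closed_sequentially[of "pcl i k" "\<lambda>n. (f n, h n)" "(A, B)"] assms
  by (simp add: pcl_def tendsto_Pair)

text \<open>The hypothesis to be refuted in \<open>not_proper\<close> for a non-discrete i and a
  different k. For \<open>i = k\<close> it holds trivially, and then its consequences give the
  density in \<open>nondiscrete_dense\<close>.\<close>

definition proper :: "nat \<Rightarrow> nat \<Rightarrow> bool" where
  "proper i k \<longleftrightarrow> (\<forall>R. \<exists>R'. \<forall>g\<in>\<Gamma>. norm (g i) \<le> R \<longrightarrow> norm (g k) \<le> R')"

lemma pcl_proper:
  assumes "proper i k" shows "\<exists>R'. \<forall>A B. (A, B) \<in> pcl i k \<longrightarrow> norm A \<le> R \<longrightarrow> norm B \<le> R'"
proof -
  obtain R' where R': "\<And>g. g \<in> \<Gamma> \<Longrightarrow> norm (g i) \<le> R + 1 \<Longrightarrow> norm (g k) \<le> R'"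
    using assms unfolding proper_def by blast
  have "norm B \<le> R'" if AB: "(A, B) \<in> pcl i k" "norm A \<le> R" for A B
  proof -
    obtain g where g: "\<forall>n. g n \<in> \<Gamma>" "(\<lambda>n. g n i) \<longlonglongrightarrow> A" "(\<lambda>n. g n k) \<longlonglongrightarrow> B" using AB(1) unfolding pcl_seq by blast
    have "\<forall>\<^sub>F n in sequentially. norm (g n i) < R + 1"
      using tendsto_norm[OF g(2)] AB(2) by (intro order_tendstoD) auto
    then have "\<forall>\<^sub>F n in sequentially. norm (g n k) \<le> R'"
      by (rule eventually_mono) (use R' g(1) in auto)
    then show ?thesis using tendsto_upperbound[OF tendsto_norm[OF g(3)]] by simp
  qed
  then show ?thesis by blast
qed

text \<open>Along a sequence whose i-components tend to the identity, properness makes the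
  k-components subconverge. Quotients of terms by later terms then tend to the identity in both
  components, and the later term is chosen with a different i-component.\<close>

lemma nondiscrete_small:
  assumes "\<not> discrete_grp (proj i \<Gamma>)" "proper i k" "e > 0"
  shows "\<exists>g\<in>\<Gamma>. norm (g i - mat 1) < e \<and> norm (g k - mat 1) < e \<and> g i \<noteq> mat 1"
proof -
  have "\<exists>g\<in>\<Gamma>. norm (g i - mat 1) < 1 / real (Suc n) \<and> g i \<noteq> mat 1" for n
    using assms(1) unfolding discrete_grp_def proj_def dist_norm by (auto simp: not_le)
  then obtain g where g: "\<And>n. g n \<in> \<Gamma>" "\<And>n. norm (g n i - mat 1) < 1 / real (Suc n)" "\<And>n. g n i \<noteq> mat 1" by metis
  have gi: "(\<lambda>n. g n i) \<longlonglongrightarrow> mat 1"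
  proof (rule LIM_zero_cancel, rule Lim_null_comparison[OF always_eventually])
    show "\<forall>n. norm (g n i - mat 1) \<le> 1 / real (Suc n)" using g(2) by (auto intro: less_imp_le)
  qed (rule LIMSEQ_inverse_real_of_nat[unfolded inverse_eq_divide])
  have "norm (g n i) \<le> 3" for n
  proof -
    have "norm (g n i) \<le> norm (g n i - mat 1) + norm (mat 1 :: mat2)" by (metis diff_add_cancel norm_triangle_ineq)
    moreover have "1 / real (Suc n) \<le> 1" by simp
    then have "norm (g n i - mat 1) \<le> 1" using g(2)[of n] by linarith
    moreover have "norm (mat 1 :: mat2) \<le> 2" by (rule power2_le_imp_le) (simp_all add: norm_one2)
    ultimately show ?thesis by simp
  qed
  moreover obtain R where "\<forall>g\<in>\<Gamma>. norm (g i) \<le> 3 \<longrightarrow> norm (g k) \<le> R" using assms(2) unfolding proper_def by blast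
  ultimately have "norm (g n k) \<le> R" for n using g(1) by blast
  then have "bounded (range (\<lambda>n. g n k))" by (auto simp: bounded_iff)
  then obtain s B where s: "strict_mono s" "(\<lambda>n. g (s n) k) \<longlonglongrightarrow> B"
    using bounded_imp_convergent_subsequence[of "\<lambda>n. g n k"] by (auto simp: o_def)
  have B1: "det B = 1" by (rule pcl_det(2)[of B B k k]) (use g(1) s(2) in \<open>auto simp: pcl_seq intro!: exI[of _ "\<lambda>n. g (s n)"]\<close>)
  have si: "(\<lambda>n. g (s n) i) \<longlonglongrightarrow> mat 1" using LIMSEQ_subseq_LIMSEQ[OF gi s(1)] by (simp add: o_def)
  have "\<exists>m\<ge>n. g (s m) i \<noteq> g (s n) i" for n
  proof (rule ccontr)
    assume "\<not> ?thesis"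
    then have "\<forall>\<^sub>F m in sequentially. g (s m) i = g (s n) i" unfolding eventually_sequentially by blast
    from LIMSEQ_unique[OF tendsto_eventually[OF this] si] show False using g(3) by blast
  qed
  then have "\<forall>n. \<exists>m. m \<ge> n \<and> g (s m) i \<noteq> g (s n) i" by blast
  from choice[OF this] obtain m where m: "\<And>n. m n \<ge> n" "\<And>n. g (s (m n)) i \<noteq> g (s n) i" by blast
  have mt: "filterlim m sequentially sequentially"
    unfolding filterlim_at_top eventually_sequentially using m(1) by (meson order_trans)
  let ?h = "\<lambda>n j. inv2 (g (s n) j) ** g (s (m n)) j"
  have hG: "?h n \<in> \<Gamma>" for n using g(1) by (intro mult_G inv_G)
  have "(\<lambda>n. ?h n i) \<longlonglongrightarrow> inv2 (mat 1) ** mat 1"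
    by (intro tendsto_intros si filterlim_compose[OF si mt])
  then have hi: "(\<lambda>n. ?h n i) \<longlonglongrightarrow> mat 1" by (simp add: matrix_mul_lid)
  have "(\<lambda>n. ?h n k) \<longlonglongrightarrow> inv2 B ** B"
    by (intro tendsto_intros s filterlim_compose[OF s(2) mt])
  then have hk: "(\<lambda>n. ?h n k) \<longlonglongrightarrow> mat 1" by (simp add: inv2_left B1)
  have "\<forall>\<^sub>F n in sequentially. norm (?h n i - mat 1) < e \<and> norm (?h n k - mat 1) < e"
    using hi hk assms(3) by (intro eventually_conj) (auto simp: tendsto_iff dist_norm)
  then obtain n where n: "norm (?h n i - mat 1) < e" "norm (?h n k - mat 1) < e" by (auto dest: eventually_happens)
  have "?h n i \<noteq> mat 1" using m(2)[of n] using inv2_cancel_left'[of "g (s n) i" "g (s (m n)) i"] g(1) by (auto simp: matrix_mul_rid)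
  then show ?thesis using n hG[of n] by (intro bexI[of _ "?h n"]) auto
qed

text \<open>The second columns of S, h1 S and h2 S are pairwise independent. Three such vectors are
  what \<open>binary_quadratic_zero\<close> needs in \<open>small_nonfixing\<close>.\<close>

lemma ex_independent_vectors:
  assumes i: "i < r" and S: "det S = 1"
  obtains h1 h2 where "h1 \<in> \<Gamma>" "h2 \<in> \<Gamma>"
    "S$1$2 * (h1 i ** S)$2$2 - (h1 i ** S)$1$2 * S$2$2 \<noteq> 0"
    "S$1$2 * (h2 i ** S)$2$2 - (h2 i ** S)$1$2 * S$2$2 \<noteq> 0"
    "(h1 i ** S)$1$2 * (h2 i ** S)$2$2 - (h2 i ** S)$1$2 * (h1 i ** S)$2$2 \<noteq> 0"
proof -
  define D where "D = (\<lambda>x y (M::mat2). x * (M ** S)$2$2 - (M ** S)$1$2 * y)"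
  have pf: "(\<lambda>g. D x y (g i)) \<in> polyfun r" for x y
    unfolding D_def mat2_mult_nth
    by (intro pf_diff polyfun.padd polyfun.pmul polyfun.pcoord polyfun.pconst i)
  \<comment> \<open>The witnesses for density: in the basis S they take the second basis vector to
    (1, v) for any prescribed v.\<close>
  have col: "(S ** mk2 0 1 (-1) v ** inv2 S ** S) = S ** mk2 0 1 (-1) v" for v
    by (rule inv2_cancel_right'[OF S])
  have ev: "D (S$1$1 * a + S$1$2 * b) (S$2$1 * a + S$2$2 * b) (S ** mk2 0 1 (-1) v ** inv2 S) = a * v - b" for a b v
  proof -
    have "D (S$1$1 * a + S$1$2 * b) (S$2$1 * a + S$2$2 * b) (S ** mk2 0 1 (-1) v ** inv2 S) = det S * (a * v - b)"
      unfolding D_def col by (simp add: det2 algebra_simps)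
    then show ?thesis using S by simp
  qed
  have dt: "det (S ** mk2 0 1 (-1) v ** inv2 S) = 1" for v by (simp add: det_mul S) (simp add: det2)
  have "D (S$1$2) (S$2$2) (S ** mk2 0 1 (-1) 0 ** inv2 S) \<noteq> 0" using ev[of 0 1 0] by simp
  then obtain h1 where h1: "h1 \<in> \<Gamma>" "D (S$1$2) (S$2$2) (h1 i) \<noteq> 0"
    using zariski_pick1[OF i pf dt] by blast
  let ?u = "inv2 S ** (h1 i ** S)"
  have hu: "h1 i ** S = S ** ?u" by (simp add: inv2_cancel_left' S)
  define a b where "a = ?u$1$2" "b = ?u$2$2"
  have hab: "(h1 i ** S)$1$2 = S$1$1 * a + S$1$2 * b" "(h1 i ** S)$2$2 = S$2$1 * a + S$2$2 * b"
    unfolding a_b_def by (subst hu, simp)+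
  have "D (S$1$2) (S$2$2) (h1 i) = - a * det S" unfolding D_def hab det2 by (simp add: algebra_simps)
  then have a: "a \<noteq> 0" using h1 S by auto
  \<comment> \<open>With this v the value a v - b of \<open>ev\<close> is 1.\<close>
  let ?v = "(b + 1) / a"
  let ?M = "S ** mk2 0 1 (-1) ?v ** inv2 S"
  have "D (S$1$2) (S$2$2) ?M * D ((h1 i ** S)$1$2) ((h1 i ** S)$2$2) ?M \<noteq> 0"
    unfolding hab using ev[of 0 1 ?v] ev[of a b ?v] a by simp
  then obtain h2 where h2: "h2 \<in> \<Gamma>" "D (S$1$2) (S$2$2) (h2 i) * D ((h1 i ** S)$1$2) ((h1 i ** S)$2$2) (h2 i) \<noteq> 0"
    using zariski_pick1[OF i polyfun.pmul[OF pf pf] dt] by blast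
  show thesis using that[OF h1(1) h2(1)] h1(2) h2(2) unfolding D_def by simp
qed

end

section \<open>Pairs of unipotents normalised by a hyperbolic element\<close>

abbreviation upp :: "real \<Rightarrow> mat2" where "upp s \<equiv> mk2 1 s 0 1"
abbreviation lw :: "real \<Rightarrow> mat2" where "lw s \<equiv> mk2 1 0 s 1"

lemma det_upp [simp]: "det (upp s) = 1" and det_lw [simp]: "det (lw s) = 1"
  by (simp_all add: det2)

lemma conj_mult:
  assumes "det S = 1" shows "(S ** A ** inv2 S) ** (S ** B ** inv2 S) = S ** (A ** B) ** inv2 S"
proof -
  have "(S ** A ** inv2 S) ** (S ** B ** inv2 S) = S ** (A ** (inv2 S ** (S ** (B ** inv2 S))))"
    by (simp add: matrix_mul_assoc)
  then show ?thesis by (simp only: inv2_cancel_left[OF assms]) (simp add: matrix_mul_assoc)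
qed

lemma conj_inv2: "inv2 (S ** A ** inv2 S) = S ** inv2 A ** inv2 S"
  by (simp add: inv2_mult matrix_mul_assoc)

lemma unconj: "det S = 1 \<Longrightarrow> inv2 S ** (S ** A ** inv2 S) ** S = A"
  by (metis inv2_cancel_left inv2_cancel_right' matrix_mul_assoc)

lemma conj_unconj: "det S = 1 \<Longrightarrow> S ** (inv2 S ** A ** S) ** inv2 S = A"
  using unconj[of "inv2 S" A] by simp

lemma tendsto_mult_left_mat: "(f \<longlongrightarrow> A) F \<Longrightarrow> ((\<lambda>x. S ** f x ** T) \<longlongrightarrow> S ** A ** T) F" for S T :: mat2
  by (intro tendsto_intros)

lemma power_sq_swap: "(z ^ n)\<^sup>2 = (z\<^sup>2) ^ n" for z :: real
  by (simp add: power_mult[symmetric] mult.commute)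

lemma scale_up_into_interval:
  assumes "1 < (X::real)" "0 < t" "t \<le> X" shows "\<exists>m. 1 \<le> X ^ m * t \<and> X ^ m * t \<le> X"
proof -
  obtain m0 where "1 / t < X ^ m0" using real_arch_pow[OF assms(1)] by blast
  then have ex: "1 \<le> X ^ m0 * t" using assms(2) by (simp add: divide_less_eq less_imp_le)
  define m where "m = (LEAST m. 1 \<le> X ^ m * t)"
  have m1: "1 \<le> X ^ m * t" unfolding m_def by (rule LeastI[where P = "\<lambda>m. 1 \<le> X ^ m * t", OF ex])
  have "X ^ m * t \<le> X"
  proof (cases m)
    case 0 then show ?thesis using assms(3) by simp
  next
    case (Suc l)
    have "\<not> 1 \<le> X ^ l * t" using not_less_Least[of l "\<lambda>m. 1 \<le> X ^ m * t"] Suc unfolding m_def by simp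
    then have "X * (X ^ l * t) \<le> X * 1" using assms(1) by (intro mult_left_mono) auto
    then show ?thesis using Suc by (simp add: mult.assoc)
  qed
  then show ?thesis using m1 by blast
qed

locale zgroup_hyp = zgroup +
  fixes i k :: nat and a :: "nat \<Rightarrow> mat2" and S T :: mat2 and x y :: real
  assumes ik: "i < r" "k < r" and aG: "a \<in> \<Gamma>"
    and S: "det S = 1" "\<bar>x\<bar> > 1" "a i = S ** diag2 x ** inv2 S"
    and T: "det T = 1" "\<bar>y\<bar> > 1" "a k = T ** diag2 y ** inv2 T"
begin

text \<open>Written in eigenbases of a, so conjugation by a multiplies s by x^2 and t by y^2. Under
  \<open>proper\<close> with i non-discrete, every s occurs and |t| is bounded by a multiple of |s|:
  the set is the graph of a linear function.\<close>

definition Us :: "(real \<times> real) set" where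
  "Us = {(s, t). (S ** upp s ** inv2 S, T ** upp t ** inv2 T) \<in> pcl i k}"

lemma xy0: "x \<noteq> 0" "y \<noteq> 0" using S(2) T(2) by auto

lemma Us_add: "(s, t) \<in> Us \<Longrightarrow> (s', t') \<in> Us \<Longrightarrow> (s + s', t + t') \<in> Us"
proof -
  assume "(s, t) \<in> Us" "(s', t') \<in> Us"
  from pcl_mult[OF this[unfolded Us_def, simplified]]
  have "(S ** (upp s ** upp s') ** inv2 S, T ** (upp t ** upp t') ** inv2 T) \<in> pcl i k"
    by (simp add: conj_mult S T)
  moreover have "upp s ** upp s' = upp (s + s')" for s s' by (simp add: mat2_eq_iff)
  ultimately show ?thesis by (simp add: Us_def)
qed

lemma Us_minus: "(s, t) \<in> Us \<Longrightarrow> (- s, - t) \<in> Us"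
proof -
  assume "(s, t) \<in> Us"
  from pcl_inv[OF this[unfolded Us_def, simplified]]
  have "(S ** inv2 (upp s) ** inv2 S, T ** inv2 (upp t) ** inv2 T) \<in> pcl i k"
    by (simp add: conj_inv2)
  moreover have "inv2 (upp s) = upp (- s)" for s by (simp add: mat2_eq_iff)
  ultimately show ?thesis by (simp add: Us_def)
qed

lemma Us_0: "(0, 0) \<in> Us"
proof -
  have "upp 0 = mat 1" by (simp add: mat2_eq_iff)
  then show ?thesis using pcl_G[OF one_G, of i k] by (simp add: Us_def matrix_mul_rid inv2_right S T)
qed

lemma Us_nat: "(s, t) \<in> Us \<Longrightarrow> (real n * s, real n * t) \<in> Us"
proof (induction n)
  case (Suc n)
  then show ?case using Us_add[of s t "real n * s" "real n * t"] by (simp add: algebra_simps)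
qed (simp add: Us_0)

lemma Us_int: "(s, t) \<in> Us \<Longrightarrow> (of_int n * s, of_int n * t) \<in> Us"
  using Us_nat[of s t "nat n"] Us_minus[OF Us_nat[of s t "nat (- n)"]] by (cases "n \<ge> 0") auto

lemma pow_pcl:
  "(S ** diag2 (x ^ n) ** inv2 S, T ** diag2 (y ^ n) ** inv2 T) \<in> pcl i k"
  using pcl_G[OF pow_G[OF aG, of n], of i k] mpow_hyperbolic[OF S(1) xy0(1)] mpow_hyperbolic[OF T(1) xy0(2)]
  by (simp add: S(3) T(3))

lemma diag2_upp: "z \<noteq> 0 \<Longrightarrow> diag2 z ** upp s ** inv2 (diag2 z) = upp (z\<^sup>2 * s)"
  and diag2_upp': "z \<noteq> 0 \<Longrightarrow> inv2 (diag2 z) ** upp s ** diag2 z = upp (s / z\<^sup>2)"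
  by (simp_all add: mat2_eq_iff power2_eq_square)

lemma Us_scale: assumes "(s, t) \<in> Us" shows "((x ^ n)\<^sup>2 * s, (y ^ n)\<^sup>2 * t) \<in> Us"
proof -
  have "(S ** diag2 (x ^ n) ** inv2 S ** (S ** upp s ** inv2 S) ** inv2 (S ** diag2 (x ^ n) ** inv2 S),
    T ** diag2 (y ^ n) ** inv2 T ** (T ** upp t ** inv2 T) ** inv2 (T ** diag2 (y ^ n) ** inv2 T)) \<in> pcl i k"
    by (rule pcl_mult[OF pcl_mult[OF pow_pcl] pcl_inv[OF pow_pcl]]) (use assms in \<open>simp add: Us_def\<close>)
  then show ?thesis using xy0 by (simp add: Us_def conj_mult conj_inv2 S T diag2_upp)
qed

lemma Us_unscale: assumes "(s, t) \<in> Us" shows "(s / (x ^ n)\<^sup>2, t / (y ^ n)\<^sup>2) \<in> Us"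
proof -
  have "(inv2 (S ** diag2 (x ^ n) ** inv2 S) ** (S ** upp s ** inv2 S) ** (S ** diag2 (x ^ n) ** inv2 S),
    inv2 (T ** diag2 (y ^ n) ** inv2 T) ** (T ** upp t ** inv2 T) ** (T ** diag2 (y ^ n) ** inv2 T)) \<in> pcl i k"
    by (rule pcl_mult[OF pcl_mult[OF pcl_inv[OF pow_pcl]] pow_pcl]) (use assms in \<open>simp add: Us_def\<close>)
  then show ?thesis using xy0 by (simp add: Us_def conj_mult conj_inv2 S T diag2_upp')
qed

lemma Us_limit:
  assumes "\<And>n. (f n, h n) \<in> Us" "f \<longlonglongrightarrow> s" "h \<longlonglongrightarrow> t" shows "(s, t) \<in> Us"
proof -
  have "(\<lambda>n. upp (f n)) \<longlonglongrightarrow> upp s" "(\<lambda>n. upp (h n)) \<longlonglongrightarrow> upp t"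
    unfolding tendsto_mat2_iff using assms(2,3) by simp_all
  from pcl_limit[OF _ tendsto_mult_left_mat[OF this(1), of S "inv2 S"] tendsto_mult_left_mat[OF this(2), of T "inv2 T"]] assms(1)
  show ?thesis by (simp add: Us_def)
qed

lemma Us_proper:
  assumes "proper i k" shows "\<exists>R'. \<forall>s t. (s, t) \<in> Us \<longrightarrow> \<bar>s\<bar> \<le> R \<longrightarrow> \<bar>t\<bar> \<le> R'"
proof -
  obtain R' where R': "\<And>A B. (A, B) \<in> pcl i k \<Longrightarrow> norm A \<le> norm S * norm S * (2 + R) \<Longrightarrow> norm B \<le> R'"
    using pcl_proper[OF assms] by blast
  have "\<bar>t\<bar> \<le> norm T * norm T * R'" if st: "(s, t) \<in> Us" "\<bar>s\<bar> \<le> R" for s t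
  proof -
    have "norm (upp s) \<le> 2 + R" using norm_mat2_le_sum[of "upp s"] st(2) by simp
    then have "norm (S ** upp s ** inv2 S) \<le> norm S * norm S * (2 + R)"
      using norm_conj_le[of S "upp s" S] by (meson mult_left_mono mult_nonneg_nonneg norm_ge_zero order_trans)
    then have "norm (T ** upp t ** inv2 T) \<le> R'" using st(1) by (intro R') (simp add: Us_def)
    moreover have "\<bar>t\<bar> \<le> norm (upp t)" using norm_entry[of "upp t" 1 2] by simp
    moreover have "norm (upp t) \<le> norm T * norm T * norm (T ** upp t ** inv2 T)" by (rule norm_conj_ge[OF T(1) T(1)])
    ultimately show ?thesis by (meson mult_left_mono mult_nonneg_nonneg norm_ge_zero order_trans)
  qed
  then show ?thesis by blast
qed

text \<open>Conjugating elements close to the identity by powers of \<open>a\<close> expands their upper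
  right entry in the eigenbasis of \<open>a\<close> and contracts the lower left one.\<close>

lemma small_nonfixing:
  assumes nd: "\<not> discrete_grp (proj i \<Gamma>)" and pr: "proper i k" and e: "e > 0"
  shows "\<exists>g\<in>\<Gamma>. norm (inv2 S ** g i ** S - mat 1) < e \<and> norm (inv2 T ** g k ** T - mat 1) < e \<and> (inv2 S ** g i ** S)$1$2 \<noteq> 0"
proof -
  obtain h1 h2 where h: "h1 \<in> \<Gamma>" "h2 \<in> \<Gamma>"
    "S$1$2 * (h1 i ** S)$2$2 - (h1 i ** S)$1$2 * S$2$2 \<noteq> 0"
    "S$1$2 * (h2 i ** S)$2$2 - (h2 i ** S)$1$2 * S$2$2 \<noteq> 0"
    "(h1 i ** S)$1$2 * (h2 i ** S)$2$2 - (h2 i ** S)$1$2 * (h1 i ** S)$2$2 \<noteq> 0"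
    by (rule ex_independent_vectors[OF ik(1) S(1)])
  let ?hs = "{\<lambda>i. mat 1, h1, h2}"
  define C where "C = 1 + (\<Sum>h\<in>?hs. norm (h i ** S) * norm (h i ** S) + norm (h k ** T) * norm (h k ** T))"
  have Ch: "norm (h i ** S) * norm (h i ** S) \<le> C" "norm (h k ** T) * norm (h k ** T) \<le> C" if "h \<in> ?hs" for h
  proof -
    have "norm (h i ** S) * norm (h i ** S) + norm (h k ** T) * norm (h k ** T) \<le> (\<Sum>h\<in>?hs. norm (h i ** S) * norm (h i ** S) + norm (h k ** T) * norm (h k ** T))"
      by (rule member_le_sum[OF that]) auto
    moreover have "0 \<le> norm (h i ** S) * norm (h i ** S)" "0 \<le> norm (h k ** T) * norm (h k ** T)" by simp_all
    ultimately show "norm (h i ** S) * norm (h i ** S) \<le> C" "norm (h k ** T) * norm (h k ** T) \<le> C"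
      unfolding C_def by linarith+
  qed
  have "C \<ge> 1" unfolding C_def by (simp add: sum_nonneg)
  \<comment> \<open>Division by C absorbs the conjugations; the bound 1 keeps g away from
    \<open>- mat 1\<close> in component i.\<close>
  define d where "d = min 1 (e / C)"
  have d: "d > 0" "d * C \<le> e" "d \<le> 1" using e \<open>C \<ge> 1\<close> by (auto simp: d_def min_def field_simps)
  obtain g where g: "g \<in> \<Gamma>" "norm (g i - mat 1) < d" "norm (g k - mat 1) < d" "g i \<noteq> mat 1"
    using nondiscrete_small[OF nd pr d(1)] by blast
  have dg: "det (g i) = 1" using g by simp
  let ?b = "g i"
  \<comment> \<open>The upper right entry of a conjugate of b is a binary quadratic form in the
    second column of the conjugating matrix.\<close>
  define Q where "Q s t = (- ?b$2$1) * s\<^sup>2 + (?b$1$1 - ?b$2$2) * s * t + ?b$1$2 * t\<^sup>2" for s t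
  have entry: "(inv2 V ** ?b ** V)$1$2 = Q (V$1$2) (V$2$2)" for V
    by (simp add: Q_def power2_eq_square algebra_simps)
  have "\<exists>h\<in>?hs. (inv2 (h i ** S) ** ?b ** (h i ** S))$1$2 \<noteq> 0"
  proof (rule ccontr)
    assume "\<not> ?thesis"
    then have z: "Q (S$1$2) (S$2$2) = 0" "Q ((h1 i ** S)$1$2) ((h1 i ** S)$2$2) = 0" "Q ((h2 i ** S)$1$2) ((h2 i ** S)$2$2) = 0"
      unfolding entry by (auto simp: matrix_mul_lid)
    have "- ?b$2$1 = 0 \<and> ?b$1$1 - ?b$2$2 = 0 \<and> ?b$1$2 = 0"
      by (rule binary_quadratic_zero[OF z[unfolded Q_def]]) (use h in auto)
    then have "?b$2$1 = 0" "?b$1$1 = ?b$2$2" "?b$1$2 = 0" by auto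
    moreover from this dg have "(?b$1$1 - 1) * (?b$1$1 + 1) = 0" by (simp add: det2 algebra_simps)
    moreover have "\<bar>(?b - mat 1)$1$1\<bar> < 1" using norm_entry[of "?b - mat 1" 1 1] g(2) d(3) by linarith
    then have "?b$1$1 + 1 \<noteq> 0" by auto
    ultimately have "?b = mat 1" by (simp add: mat2_eq_iff)
    then show False using g(4) by simp
  qed
  then obtain h where hh: "h \<in> ?hs" "(inv2 (h i ** S) ** ?b ** (h i ** S))$1$2 \<noteq> 0" by blast
  have hG: "h \<in> \<Gamma>" using hh(1) h one_G by auto
  let ?g = "\<lambda>j. inv2 (h j) ** g j ** h j"
  have gG: "?g \<in> \<Gamma>" using hG g(1) by (intro mult_G inv_G)
  have eqn: "inv2 V ** (inv2 (h j) ** g j ** h j) ** V = inv2 (h j ** V) ** g j ** (h j ** V)" for V j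
    by (simp add: inv2_mult matrix_mul_assoc)
  have nrm: "norm (inv2 (h j ** V) ** g j ** (h j ** V) - mat 1) < e"
    if "norm (g j - mat 1) < d" "norm (h j ** V) * norm (h j ** V) \<le> C" "det V = 1" for V j
  proof -
    let ?W = "h j ** V"
    have dW: "det ?W = 1" using hG that(3) by (simp add: det_mul)
    have n0: "norm ?W > 0" using norm_ge1[OF dW] by linarith
    have "inv2 ?W ** g j ** ?W - mat 1 = inv2 ?W ** (g j - mat 1) ** inv2 (inv2 ?W)"
      using dW by (simp add: mat2_eq_iff det2 algebra_simps)
    then have "norm (inv2 ?W ** g j ** ?W - mat 1) \<le> norm (inv2 ?W) * norm (inv2 ?W) * norm (g j - mat 1)"
      by (simp only: norm_conj_le)
    also have "\<dots> < norm (inv2 ?W) * norm (inv2 ?W) * d" using that(1) n0 by (intro mult_strict_left_mono) auto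
    also have "\<dots> \<le> C * d" using that(2) d(1) by (intro mult_right_mono) auto
    also have "\<dots> \<le> e" using d(2) by (simp add: mult.commute)
    finally show ?thesis .
  qed
  show ?thesis
    using gG hh(2) nrm[OF g(2) Ch(1)[OF hh(1)] S(1)] nrm[OF g(3) Ch(2)[OF hh(1)] T(1)]
    unfolding eqn[symmetric] by (intro bexI[of _ ?g]) auto
qed


text \<open>The power of a is chosen so that the upper right entry in component i falls between 1
  and x^2. The limit there is a unipotent other than the identity; in component k the entry is
  bounded by \<open>proper\<close>, and the three other entries converge to those of a
  unipotent.\<close>

lemma Us_nonzero:
  assumes nd: "\<not> discrete_grp (proj i \<Gamma>)" and pr: "proper i k"
  shows "\<exists>s t. (s, t) \<in> Us \<and> s \<noteq> 0"
proof -
  define X where "X = x\<^sup>2"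
  have X: "X > 1" using S(2) unfolding X_def by (metis one_less_power pos2 power2_abs)
  have e: "1 / real (Suc n) > 0" for n by simp
  have "\<forall>n. \<exists>g. g \<in> \<Gamma> \<and> norm (inv2 S ** g i ** S - mat 1) < 1 / real (Suc n) \<and> norm (inv2 T ** g k ** T - mat 1) < 1 / real (Suc n)
      \<and> (inv2 S ** g i ** S)$1$2 \<noteq> 0" using small_nonfixing[OF nd pr e] by blast
  from choice[OF this] obtain g where g: "\<And>n. g n \<in> \<Gamma>" "\<And>n. norm (inv2 S ** g n i ** S - mat 1) < 1 / real (Suc n)"
    "\<And>n. norm (inv2 T ** g n k ** T - mat 1) < 1 / real (Suc n)" "\<And>n. (inv2 S ** g n i ** S)$1$2 \<noteq> 0" by blast
  define D where "D n = inv2 S ** g n i ** S" for n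
  define F where "F n = inv2 T ** g n k ** T" for n
  have inv: "(\<lambda>n. 1 / real (Suc n)) \<longlonglongrightarrow> 0" by (rule LIMSEQ_inverse_real_of_nat[unfolded inverse_eq_divide])
  have le1: "1 / real (Suc n) \<le> 1" for n by simp
  have D1: "D \<longlonglongrightarrow> mat 1"
    by (rule LIM_zero_cancel, rule Lim_null_comparison[OF always_eventually inv]) (use g(2) in \<open>auto simp: D_def intro: less_imp_le\<close>)
  have F1: "F \<longlonglongrightarrow> mat 1"
    by (rule LIM_zero_cancel, rule Lim_null_comparison[OF always_eventually inv]) (use g(3) in \<open>auto simp: F_def intro: less_imp_le\<close>)
  have Dent: "\<bar>(D n - mat 1)$u$v\<bar> \<le> 1" for n u v
    using norm_entry[of "D n - mat 1" u v] g(2)[of n] le1[of n] unfolding D_def by linarith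
  have q: "D n $1$2 \<noteq> 0" "\<bar>D n $1$2\<bar> < 1" for n
  proof -
    show "D n $1$2 \<noteq> 0" using g(4) by (simp add: D_def)
    have "\<bar>(D n - mat 1)$1$2\<bar> < 1 / real (Suc n)"
      using norm_entry[of "D n - mat 1" 1 2] g(2)[of n] unfolding D_def by linarith
    then have "\<bar>(D n - mat 1)$1$2\<bar> < 1" using le1[of n] by linarith
    then show "\<bar>D n $1$2\<bar> < 1" by simp
  qed
  have "\<exists>m. 1 \<le> X ^ m * \<bar>D n $1$2\<bar> \<and> X ^ m * \<bar>D n $1$2\<bar> \<le> X" for n
    by (rule scale_up_into_interval[OF X]) (use q[of n] X in auto)
  then have "\<forall>n. \<exists>m. 1 \<le> X ^ m * \<bar>D n $1$2\<bar> \<and> X ^ m * \<bar>D n $1$2\<bar> \<le> X" by blast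
  from choice[OF this] obtain m where m: "\<And>n. 1 \<le> X ^ m n * \<bar>D n $1$2\<bar>" "\<And>n. X ^ m n * \<bar>D n $1$2\<bar> \<le> X" by blast
  define A where "A n = diag2 (x ^ m n) ** D n ** inv2 (diag2 (x ^ m n))" for n
  define B where "B n = diag2 (y ^ m n) ** F n ** inv2 (diag2 (y ^ m n))" for n
  have Xm: "(x ^ m n)\<^sup>2 = X ^ m n" for n by (simp add: X_def power_mult[symmetric] mult.commute)
  have A: "A n $1$1 = D n $1$1" "A n $1$2 = X ^ m n * D n $1$2" "A n $2$1 = D n $2$1 / X ^ m n" "A n $2$2 = D n $2$2" for n
    using xy0 by (simp_all add: A_def Xm[symmetric] power2_eq_square)
  have B: "B n $1$1 = F n $1$1" "B n $2$1 = F n $2$1 / (y ^ m n)\<^sup>2" "B n $2$2 = F n $2$2" for n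
    using xy0 by (simp_all add: B_def power2_eq_square)
  have mem: "(S ** A n ** inv2 S, T ** B n ** inv2 T) \<in> pcl i k" for n
  proof -
    have "(S ** diag2 (x ^ m n) ** inv2 S ** (S ** D n ** inv2 S) ** inv2 (S ** diag2 (x ^ m n) ** inv2 S),
      T ** diag2 (y ^ m n) ** inv2 T ** (T ** F n ** inv2 T) ** inv2 (T ** diag2 (y ^ m n) ** inv2 T)) \<in> pcl i k"
      by (rule pcl_mult[OF pcl_mult[OF pow_pcl] pcl_inv[OF pow_pcl]])
        (use pcl_G[OF g(1)] in \<open>simp add: D_def F_def conj_unconj S T\<close>)
    then show ?thesis by (simp add: A_def B_def conj_mult conj_inv2 S T)
  qed
  have X1: "X ^ m n \<ge> 1" "(y ^ m n)\<^sup>2 \<ge> 1" for n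
  proof -
    show "X ^ m n \<ge> 1" using X by (simp add: one_le_power)
    have "\<bar>y ^ m n\<bar> \<ge> 1" using T(2) by (simp add: power_abs one_le_power)
    then show "(y ^ m n)\<^sup>2 \<ge> 1" using one_le_power[of "\<bar>y ^ m n\<bar>" 2] by simp
  qed
  have nA: "norm (A n) \<le> X + 5" for n
  proof -
    have "\<bar>A n $1$1\<bar> \<le> 2" "\<bar>A n $2$2\<bar> \<le> 2" using Dent[of n 1 1] Dent[of n 2 2] by (auto simp: A)
    moreover have "\<bar>A n $1$2\<bar> \<le> X" using m(2)[of n] X by (simp add: A abs_mult)
    moreover have "\<bar>A n $2$1\<bar> \<le> 1"
      using Dent[of n 2 1] X1(1)[of n] X by (simp add: A divide_le_eq) (smt (verit) X1(1))
    ultimately show ?thesis using norm_mat2_le_sum[of "A n"] by linarith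
  qed
  have "norm (S ** A n ** inv2 S) \<le> norm S * norm S * (X + 5)" for n
    using norm_conj_le[of S "A n" S] nA[of n] by (meson mult_left_mono mult_nonneg_nonneg norm_ge_zero order_trans)
  then obtain R' where R': "\<And>n. norm (T ** B n ** inv2 T) \<le> R'"
    using pcl_proper[OF pr, of "norm S * norm S * (X + 5)"] mem by blast
  have nB: "norm (B n) \<le> norm T * norm T * R'" for n
    using norm_conj_ge[OF T(1) T(1), of "B n"] R'[of n] by (meson mult_left_mono mult_nonneg_nonneg norm_ge_zero order_trans)
  have "bounded (range (\<lambda>n. (A n, B n)))"
  proof (rule boundedI)
    fix z assume "z \<in> range (\<lambda>n. (A n, B n))"
    then obtain n where "z = (A n, B n)" by auto
    then show "norm z \<le> (X + 5) + norm T * norm T * R'" using norm_Pair_le[of "A n" "B n"] nA[of n] nB[of n] by simp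
  qed
  then obtain L s where s: "strict_mono s" "(\<lambda>n. (A (s n), B (s n))) \<longlonglongrightarrow> L"
    using bounded_imp_convergent_subsequence[of "\<lambda>n. (A n, B n)"] by (auto simp: o_def)
  have LA: "(\<lambda>n. A (s n)) \<longlonglongrightarrow> fst L" and LB: "(\<lambda>n. B (s n)) \<longlonglongrightarrow> snd L"
    using tendsto_fst[OF s(2)] tendsto_snd[OF s(2)] by simp_all
  have Ds: "(\<lambda>n. D (s n) $u$v) \<longlonglongrightarrow> (mat 1 :: mat2)$u$v" "(\<lambda>n. F (s n) $u$v) \<longlonglongrightarrow> (mat 1 :: mat2)$u$v" for u v
    using LIMSEQ_subseq_LIMSEQ[OF D1 s(1)] LIMSEQ_subseq_LIMSEQ[OF F1 s(1)] by (auto simp: o_def intro!: tendsto_intros)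
  have Aent: "(\<lambda>n. A (s n) $u$v) \<longlonglongrightarrow> fst L $u$v" and Bent: "(\<lambda>n. B (s n) $u$v) \<longlonglongrightarrow> snd L $u$v" for u v
    using LA LB by (auto intro!: tendsto_intros)
  have z: "(\<lambda>n. D (s n)$2$1 / X ^ m (s n)) \<longlonglongrightarrow> 0" "(\<lambda>n. F (s n)$2$1 / (y ^ m (s n))\<^sup>2) \<longlonglongrightarrow> 0"
  proof -
    have *: "\<bar>u / v\<bar> \<le> \<bar>u\<bar>" if "v \<ge> 1" for u v :: real
      using that by (simp add: divide_le_eq mult_le_cancel_left1)
    have D0: "(\<lambda>n. \<bar>D (s n)$2$1\<bar>) \<longlonglongrightarrow> 0" and F0: "(\<lambda>n. \<bar>F (s n)$2$1\<bar>) \<longlonglongrightarrow> 0"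
      using tendsto_rabs[OF Ds(1)[of 2 1]] tendsto_rabs[OF Ds(2)[of 2 1]] by simp_all
    show "(\<lambda>n. D (s n)$2$1 / X ^ m (s n)) \<longlonglongrightarrow> 0"
      by (rule Lim_null_comparison[OF always_eventually D0]) (simp only: real_norm_def *[OF X1(1)] simp_thms)
    show "(\<lambda>n. F (s n)$2$1 / (y ^ m (s n))\<^sup>2) \<longlonglongrightarrow> 0"
      by (rule Lim_null_comparison[OF always_eventually F0]) (simp only: real_norm_def *[OF X1(2)] simp_thms)
  qed
  have A': "fst L = upp (fst L $1$2)"
    using LIMSEQ_unique[OF Aent[of 1 1, unfolded A] Ds(1)[of 1 1]] LIMSEQ_unique[OF Aent[of 2 1, unfolded A] z(1)]
      LIMSEQ_unique[OF Aent[of 2 2, unfolded A] Ds(1)[of 2 2]] by (simp add: mat2_eq_iff)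
  have B': "snd L = upp (snd L $1$2)"
    using LIMSEQ_unique[OF Bent[of 1 1, unfolded B] Ds(2)[of 1 1]] LIMSEQ_unique[OF Bent[of 2 1, unfolded B] z(2)]
      LIMSEQ_unique[OF Bent[of 2 2, unfolded B] Ds(2)[of 2 2]] by (simp add: mat2_eq_iff)
  have "1 \<le> \<bar>fst L $1$2\<bar>"
    by (rule tendsto_lowerbound[OF tendsto_rabs[OF Aent[of 1 2]]]) (use m(1) X in \<open>auto simp: A abs_mult\<close>)
  then have "fst L $1$2 \<noteq> 0" by auto
  moreover have "(S ** fst L ** inv2 S, T ** snd L ** inv2 T) \<in> pcl i k"
    by (rule pcl_limit[OF mem tendsto_mult_left_mat[OF LA] tendsto_mult_left_mat[OF LB]])
  then have "(fst L $1$2, snd L $1$2) \<in> Us" unfolding Us_def using A' B' by simp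
  ultimately show ?thesis by blast
qed

text \<open>Contracting one non-zero pair by powers of a gives pairs with arbitrarily small s; their
  integer multiples approximate any real number, and \<open>proper\<close> keeps the second
  coordinates bounded.\<close>

lemma Us_all:
  assumes nd: "\<not> discrete_grp (proj i \<Gamma>)" and pr: "proper i k"
  shows "\<exists>t. (s, t) \<in> Us"
proof -
  obtain s1 t1 where st: "(s1, t1) \<in> Us" "s1 \<noteq> 0" using Us_nonzero[OF nd pr] by blast
  define X where "X = x\<^sup>2"
  have X: "X > 1" using S(2) unfolding X_def by (metis one_less_power pos2 power2_abs)
  define \<sigma> where "\<sigma> m = s1 / X ^ m" for m
  have \<sigma>0: "\<sigma> m \<noteq> 0" for m using st(2) X by (simp add: \<sigma>_def)
  have \<sigma>: "\<sigma> \<longlonglongrightarrow> 0"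
  proof -
    have "(\<lambda>m. s1 * (1 / X) ^ m) \<longlonglongrightarrow> 0"
      using X by (intro tendsto_mult_right_zero LIMSEQ_realpow_zero) auto
    then show ?thesis by (simp add: \<sigma>_def[abs_def] power_divide)
  qed
  \<comment> \<open>The integer multiple of the step that comes within one step of s.\<close>
  define N where "N m = \<lfloor>s / \<sigma> m\<rfloor>" for m
  define f where "f m = of_int (N m) * \<sigma> m" for m
  define h where "h m = of_int (N m) * (t1 / (y ^ m)\<^sup>2)" for m
  have fh: "(f m, h m) \<in> Us" for m
    unfolding f_def h_def \<sigma>_def X_def power_sq_swap[symmetric] by (intro Us_int Us_unscale st)
  have fs: "\<bar>f m - s\<bar> \<le> \<bar>\<sigma> m\<bar>" for m
  proof -
    have "f m - s = - (s / \<sigma> m - of_int (N m)) * \<sigma> m" using \<sigma>0[of m] by (simp add: f_def algebra_simps)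
    then have "\<bar>f m - s\<bar> = \<bar>s / \<sigma> m - of_int (N m)\<bar> * \<bar>\<sigma> m\<bar>" by (simp add: abs_mult abs_minus_commute)
    also have "\<dots> \<le> 1 * \<bar>\<sigma> m\<bar>" unfolding N_def by (intro mult_right_mono) linarith+
    finally show ?thesis by simp
  qed
  have fl: "f \<longlonglongrightarrow> s"
    by (rule LIM_zero_cancel, rule Lim_null_comparison[OF always_eventually]) (use fs tendsto_rabs[OF \<sigma>] in auto)
  have \<sigma>b: "\<bar>\<sigma> m\<bar> \<le> \<bar>s1\<bar>" for m
  proof -
    have "X ^ m \<ge> 1" using X by (simp add: one_le_power)
    then have "\<bar>s1\<bar> / X ^ m \<le> \<bar>s1\<bar> / 1" by (intro divide_left_mono) auto
    then show ?thesis using X by (simp add: \<sigma>_def)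
  qed
  have "\<bar>f m\<bar> \<le> \<bar>s\<bar> + \<bar>s1\<bar>" for m using fs[of m] \<sigma>b[of m] by linarith
  then obtain R' where R': "\<And>m. \<bar>h m\<bar> \<le> R'" using Us_proper[OF pr, of "\<bar>s\<bar> + \<bar>s1\<bar>"] fh by blast
  then have "bounded (range h)" by (auto simp: bounded_iff)
  then obtain t u where u: "strict_mono u" "(\<lambda>n. h (u n)) \<longlonglongrightarrow> t"
    using bounded_imp_convergent_subsequence[of h] by (auto simp: o_def)
  have "(\<lambda>n. f (u n)) \<longlonglongrightarrow> s" using LIMSEQ_subseq_LIMSEQ[OF fl u(1)] by (simp add: o_def)
  then show ?thesis using Us_limit[OF fh _ u(2)] by blast
qed

text \<open>The fibre over s = 0 is trivial, because multiples of one of its elements would stay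
  bounded. The bound on the unit interval then spreads by additivity: small s are multiplied up,
  large s are divided down with \<open>Us_all\<close>.\<close>

lemma Us_linear:
  assumes nd: "\<not> discrete_grp (proj i \<Gamma>)" and pr: "proper i k"
  shows "\<exists>K>0. \<forall>s t. (s, t) \<in> Us \<longrightarrow> \<bar>t\<bar> \<le> K * \<bar>s\<bar>"
proof -
  obtain R where R: "\<And>s t. (s, t) \<in> Us \<Longrightarrow> \<bar>s\<bar> \<le> 1 \<Longrightarrow> \<bar>t\<bar> \<le> R" using Us_proper[OF pr, of 1] by blast
  have R0: "R \<ge> 0" using R[OF Us_0] by simp
  have zero: "t = 0" if "(0, t) \<in> Us" for t
  proof (rule ccontr)
    assume "t \<noteq> 0"
    then obtain n where "R < real n * \<bar>t\<bar>" using reals_Archimedean3[of "\<bar>t\<bar>"] by auto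
    moreover have "\<bar>real n * t\<bar> \<le> R" using Us_nat[OF that, of n] by (intro R) auto
    ultimately show False by (simp add: abs_mult)
  qed
  have small: "\<bar>t\<bar> \<le> 2 * R * \<bar>s\<bar>" if st: "(s, t) \<in> Us" "\<bar>s\<bar> \<le> 1" for s t
  proof (cases "s = 0")
    case True then show ?thesis using zero st by simp
  next
    case False
    \<comment> \<open>The largest multiple of s inside the unit interval; n |s| is more than
      1/2.\<close>
    define n where "n = nat \<lfloor>1 / \<bar>s\<bar>\<rfloor>"
    have i1: "1 / \<bar>s\<bar> \<ge> 1" using False st(2) by simp
    then have fl: "\<lfloor>1 / \<bar>s\<bar>\<rfloor> \<ge> 1" by (simp only: one_le_floor)
    then have "real n = of_int \<lfloor>1 / \<bar>s\<bar>\<rfloor>" by (simp only: n_def of_nat_nat)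
    then have n: "real n \<le> 1 / \<bar>s\<bar>" "1 / \<bar>s\<bar> < real n + 1" "real n \<ge> 1"
      using fl floor_correct[of "1 / \<bar>s\<bar>"] by (simp_all only: of_int_add of_int_1 of_int_1_le_iff)
    have "real n * \<bar>s\<bar> \<le> 1" using n(1) False by (simp add: field_simps)
    then have "\<bar>real n * t\<bar> \<le> R" using Us_nat[OF st(1), of n] by (intro R[of "real n * s"]) (auto simp: abs_mult)
    then have a: "real n * \<bar>t\<bar> \<le> R" by (simp add: abs_mult)
    have "1 < (real n + 1) * \<bar>s\<bar>" using n(2) False by (simp add: field_simps)
    also have "\<dots> \<le> (2 * real n) * \<bar>s\<bar>" using n(3) by (intro mult_right_mono) auto
    finally have "\<bar>t\<bar> * 1 \<le> \<bar>t\<bar> * (2 * real n * \<bar>s\<bar>)" by (intro mult_left_mono) auto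
    also have "\<dots> = 2 * \<bar>s\<bar> * (real n * \<bar>t\<bar>)" by simp
    also have "\<dots> \<le> 2 * \<bar>s\<bar> * R" using a by (intro mult_left_mono) auto
    finally show ?thesis by (simp add: mult_ac)
  qed
  have "\<bar>t\<bar> \<le> 2 * R * \<bar>s\<bar>" if st: "(s, t) \<in> Us" for s t
  proof (cases "\<bar>s\<bar> \<le> 1")
    case False
    define n where "n = nat \<lceil>\<bar>s\<bar>\<rceil>"
    have n: "real n \<ge> \<bar>s\<bar>" "n > 0" using False unfolding n_def by linarith+
    obtain t' where t': "(s / real n, t') \<in> Us" using Us_all[OF nd pr] by blast
    have "(s, real n * t') \<in> Us" using Us_nat[OF t', of n] n(2) by simp
    from Us_add[OF st Us_minus[OF this]] have "t - real n * t' = 0" by (intro zero) simp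
    moreover have "\<bar>t'\<bar> \<le> 2 * R * \<bar>s / real n\<bar>" using n by (intro small t') simp
    then have "real n * \<bar>t'\<bar> \<le> real n * (2 * R * \<bar>s / real n\<bar>)" by (intro mult_left_mono) auto
    ultimately show ?thesis using n(2) by (simp add: abs_mult)
  qed (use small st in auto)
  from order_trans[OF this] have "\<bar>t\<bar> \<le> (2 * R + 1) * \<bar>s\<bar>" if "(s, t) \<in> Us" for s t
    using that by (simp add: mult_right_mono)
  then show ?thesis using R0 by (intro exI[of _ "2 * R + 1"]) auto
qed

lemma pow_ratio_unbounded:
  fixes X Y K u v :: real
  assumes "1 < Y" "Y < X" "v > 0" "\<And>m. X ^ m * v \<le> K * (Y ^ m * u)" shows False
proof -
  have "X / Y > 1" using assms(1,2) by simp
  then obtain m where m: "K * u / v < (X / Y) ^ m" using real_arch_pow by blast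
  have "(X / Y) ^ m * v \<le> K * u" using assms(4)[of m] assms(1) by (simp add: power_divide field_simps)
  then show False using m assms(3) by (simp add: divide_less_eq)
qed

text \<open>The linear bound applied to the images of (s, t) under a^m and under its inverse bounds
  the powers of x^2 / y^2 and of y^2 / x^2, unless t = 0.\<close>

lemma Us_zero:
  assumes nd: "\<not> discrete_grp (proj i \<Gamma>)" and pr: "proper i k" and ne: "x\<^sup>2 \<noteq> y\<^sup>2"
  shows "(s, 0) \<in> Us"
proof -
  obtain t where st: "(s, t) \<in> Us" using Us_all[OF nd pr] by blast
  obtain K where K: "\<And>s t. (s, t) \<in> Us \<Longrightarrow> \<bar>t\<bar> \<le> K * \<bar>s\<bar>" using Us_linear[OF nd pr] by blast
  have X: "x\<^sup>2 > 1" using S(2) by (metis one_less_power pos2 power2_abs)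
  have Y: "y\<^sup>2 > 1" using T(2) by (metis one_less_power pos2 power2_abs)
  have up: "(y\<^sup>2) ^ m * \<bar>t\<bar> \<le> K * ((x\<^sup>2) ^ m * \<bar>s\<bar>)" for m
    using K[OF Us_scale[OF st, of m]] by (simp add: abs_mult power_sq_swap)
  have down: "(x\<^sup>2) ^ m * \<bar>t\<bar> \<le> K * ((y\<^sup>2) ^ m * \<bar>s\<bar>)" for m
  proof -
    have p: "(x\<^sup>2) ^ m > 0" "(y\<^sup>2) ^ m > 0" using xy0 by simp_all
    have "\<bar>t\<bar> / (y\<^sup>2) ^ m \<le> K * (\<bar>s\<bar> / (x\<^sup>2) ^ m)"
      using K[OF Us_unscale[OF st, of m]] by (simp add: abs_mult power_sq_swap)
    then show ?thesis using p by (simp add: field_simps)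
  qed
  have "t = 0"
  proof (rule ccontr)
    assume "t \<noteq> 0"
    then have t: "\<bar>t\<bar> > 0" by simp
    consider "x\<^sup>2 < y\<^sup>2" | "y\<^sup>2 < x\<^sup>2" using ne by linarith
    then show False
      using pow_ratio_unbounded[OF X _ t up] pow_ratio_unbounded[OF Y _ t down] by cases auto
  qed
  then show ?thesis using st by simp
qed

end

definition flip2 :: mat2 where "flip2 = mk2 0 1 (-1) 0"

lemma det_flip2 [simp]: "det flip2 = 1" by (simp add: flip2_def det2)

text \<open>Exchanging the eigenvectors puts the expanding eigenvalue of the inverse first again.
  Every result on \<open>Us\<close> thereby also holds for lower unipotents.\<close>

lemma zgroup_hyp_inverse:
  assumes "zgroup_hyp r \<Gamma> i k a S T x y"
  shows "zgroup_hyp r \<Gamma> i k (\<lambda>j. inv2 (a j)) (S ** flip2) (T ** flip2) x y"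
proof -
  interpret zgroup_hyp r \<Gamma> i k a S T x y by (rule assms)
  have fl: "V ** flip2 ** diag2 z ** inv2 (V ** flip2) = V ** inv2 (diag2 z) ** inv2 V" if "z \<noteq> 0" for V z
  proof -
    have "flip2 ** diag2 z ** inv2 flip2 = inv2 (diag2 z)" by (simp add: mat2_eq_iff flip2_def)
    then show ?thesis by (metis inv2_mult matrix_mul_assoc)
  qed
  show ?thesis
    by unfold_locales (use ik aG S(1,2) T(1,2) xy0 in \<open>auto simp: det_mul inv_G fl S(3) T(3) conj_inv2\<close>)
qed

lemma flip_upp: "S ** flip2 ** upp s ** inv2 (S ** flip2) = S ** lw (- s) ** inv2 S"
proof -
  have "flip2 ** upp s ** inv2 flip2 = lw (- s)" by (simp add: mat2_eq_iff flip2_def)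
  then show ?thesis by (metis inv2_mult matrix_mul_assoc)
qed

section \<open>Density of a non-discrete projection and its independence of the others\<close>

context zgroup
begin

lemma zgroup_axioms': "zgroup r \<Gamma>" by unfold_locales

lemma ex_zgroup_hyp:
  assumes "i < r" "k < r" "a \<in> \<Gamma>" "\<bar>tr2 (a i)\<bar> > 2" "\<bar>tr2 (a k)\<bar> > 2"
  obtains S T x y where "zgroup_hyp r \<Gamma> i k a S T x y" "tr2 (a i) = x + 1 / x" "tr2 (a k) = y + 1 / y"
proof -
  obtain S x where S: "det S = 1" "\<bar>x\<bar> > 1" "a i = S ** diag2 x ** inv2 S" "tr2 (a i) = x + 1 / x"
    by (rule hyperbolic_diag[OF det_G[OF assms(3)] assms(4)])
  obtain T y where T: "det T = 1" "\<bar>y\<bar> > 1" "a k = T ** diag2 y ** inv2 T" "tr2 (a k) = y + 1 / y"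
    by (rule hyperbolic_diag[OF det_G[OF assms(3)] assms(5)])
  show thesis
    by (rule that[of S T x y]) (unfold_locales, use assms S T in auto)
qed

text \<open>The case \<open>k = i\<close>: the closure of the projection contains all upper and all
  lower unipotents in the eigenbasis, and these generate.\<close>

lemma nondiscrete_dense:
  assumes i: "i < r" and nd: "\<not> discrete_grp (proj i \<Gamma>)" and M: "det M = 1"
  shows "(M, M) \<in> pcl i i"
proof -
  obtain a where a: "a \<in> \<Gamma>" "\<bar>tr2 (a i)\<bar> > 2" using ex_hyperbolic_single[OF i] by blast
  obtain S T x y where loc: "zgroup_hyp r \<Gamma> i i a S T x y" by (rule ex_zgroup_hyp[OF i i a(1) a(2) a(2)])
  interpret h: zgroup_hyp r \<Gamma> i i a S T x y by (rule loc)
  interpret h': zgroup_hyp r \<Gamma> i i "\<lambda>j. inv2 (a j)" "S ** flip2" "T ** flip2" x y by (rule zgroup_hyp_inverse[OF loc])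
  have pr: "proper i i" unfolding proper_def by blast
  have diag: "A = B" if "(A, B) \<in> pcl i i" for A B
    using that unfolding pcl_seq using LIMSEQ_unique by blast
  let ?P = "\<lambda>M. (S ** M ** inv2 S, S ** M ** inv2 S) \<in> pcl i i"
  have "?P (inv2 S ** M ** S)"
  proof (rule SL2_generated[of ?P])
    fix s
    obtain t where t: "(s, t) \<in> h.Us" using h.Us_all[OF nd pr] by blast
    show "?P (upp s)" using t diag unfolding h.Us_def by force
    obtain t where t: "(- s, t) \<in> h'.Us" using h'.Us_all[OF nd pr] by blast
    show "?P (lw s)" using t diag unfolding h'.Us_def flip_upp by force
  next
    fix A B assume "?P A" "?P B"
    from pcl_mult[OF this] show "?P (A ** B)" by (simp add: conj_mult h.S)
  qed (simp add: det_mul h.S M)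
  then show ?thesis by (simp add: conj_unconj h.S)
qed

text \<open>If x^2 and y^2 differed, all unipotents paired with the identity would lie in
  \<open>pcl i k\<close>, hence all matrices of determinant 1. Cancelling the i-component of a^n
  would leave the unbounded sequence of its k-components paired with the identity, against
  properness.\<close>

lemma proper_trace_eq:
  assumes ik: "i < r" "k < r" and nd: "\<not> discrete_grp (proj i \<Gamma>)" and pr: "proper i k"
    and a: "a \<in> \<Gamma>" "\<bar>tr2 (a i)\<bar> > 2" "\<bar>tr2 (a k)\<bar> > 2"
  shows "(tr2 (a i))\<^sup>2 = (tr2 (a k))\<^sup>2"
proof -
  obtain S T x y where loc: "zgroup_hyp r \<Gamma> i k a S T x y" and tr: "tr2 (a i) = x + 1 / x" "tr2 (a k) = y + 1 / y"
    by (rule ex_zgroup_hyp[OF ik a])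
  interpret h: zgroup_hyp r \<Gamma> i k a S T x y by (rule loc)
  interpret h': zgroup_hyp r \<Gamma> i k "\<lambda>j. inv2 (a j)" "S ** flip2" "T ** flip2" x y by (rule zgroup_hyp_inverse[OF loc])
  have "x\<^sup>2 = y\<^sup>2"
  proof (rule ccontr)
    assume ne: "x\<^sup>2 \<noteq> y\<^sup>2"
    let ?P = "\<lambda>M. (S ** M ** inv2 S, mat 1) \<in> pcl i k"
    have one: "V ** mat 1 ** inv2 V = mat 1" if "det V = 1" for V using that by (simp add: matrix_mul_rid inv2_right)
    have u0: "upp 0 = mat 1" by (simp add: mat2_eq_iff)
    have P: "?P M" if "det M = 1" for M
    proof (rule SL2_generated[of ?P])
      fix s
      show "?P (upp s)" using h.Us_zero[OF nd pr ne, of s] unfolding h.Us_def by (simp add: u0 inv2_right h.T)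
      show "?P (lw s)" using h'.Us_zero[OF nd pr ne, of "- s"] unfolding h'.Us_def flip_upp by (simp add: u0 inv2_right h.T)
    next
      fix A B assume "?P A" "?P B"
      from pcl_mult[OF this] show "?P (A ** B)" by (simp add: conj_mult h.S matrix_mul_rid)
    qed (rule that)
    have "(mat 1, mpow (a k) n) \<in> pcl i k" for n
    proof -
      have ai: "mpow (a i) n = S ** diag2 (x ^ n) ** inv2 S"
        unfolding h.S(3) by (rule mpow_hyperbolic[OF h.S(1) h.xy0(1)])
      have "(inv2 (mpow (a i) n), mat 1) \<in> pcl i k"
        using pcl_inv[OF P[of "diag2 (x ^ n)"]] h.xy0 by (simp add: ai det_diag2)
      from pcl_mult[OF this pcl_G[OF pow_G[OF a(1), of n], of i k]] show ?thesis
        using a(1) by (simp add: matrix_mul_lid inv2_left det_mpow)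
    qed
    then obtain R where R: "\<And>n. norm (mpow (a k) n) \<le> R" using pcl_proper[OF pr, of "norm (mat 1 :: mat2)"] by blast
    have "\<forall>\<^sub>F n in sequentially. norm (mpow (a k) n) > R"
      using filterlim_norm_mpow[OF det_G[OF a(1)] a(3)] unfolding filterlim_at_top_dense by blast
    from eventually_happens[OF this] R show False by (auto simp: not_le[symmetric])
  qed
  then show ?thesis using h.xy0 unfolding tr by (simp add: power2_sum power_divide)
qed

text \<open>Equality of squared traces for a^n g, divided by its growth, gives equality of the
  squares of the first diagonal entries of g in the two eigenbases. This is a polynomial identity on
  \<open>\<Gamma>\<close> and would persist on \<open>Gr r\<close>, where the two components are
  independent.\<close>

lemma not_proper:
  assumes ik: "i < r" "k < r" "i \<noteq> k" and nd: "\<not> discrete_grp (proj i \<Gamma>)"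
  shows "\<not> proper i k"
proof
  assume pr: "proper i k"
  obtain a where a: "a \<in> \<Gamma>" "\<bar>tr2 (a i)\<bar> > 2" "\<bar>tr2 (a k)\<bar> > 2" using ex_hyperbolic_all ik by blast
  obtain S T x y where loc: "zgroup_hyp r \<Gamma> i k a S T x y" and tr: "tr2 (a i) = x + 1 / x" "tr2 (a k) = y + 1 / y"
    by (rule ex_zgroup_hyp[OF ik(1,2) a])
  interpret h: zgroup_hyp r \<Gamma> i k a S T x y by (rule loc)
  have X: "x\<^sup>2 > 1" using h.S(2) by (metis one_less_power pos2 power2_abs)
  have Y: "y\<^sup>2 > 1" using h.T(2) by (metis one_less_power pos2 power2_abs)
  have xy: "x\<^sup>2 = y\<^sup>2"
  proof -
    have "x\<^sup>2 + 1 / x\<^sup>2 = y\<^sup>2 + 1 / y\<^sup>2"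
      using proper_trace_eq[OF ik(1,2) nd pr a] h.xy0 unfolding tr by (simp add: power2_sum power_divide)
    then have "(x\<^sup>2 - y\<^sup>2) * (x\<^sup>2 * y\<^sup>2 - 1) = 0" using h.xy0 by (simp add: field_simps)
    moreover have "x\<^sup>2 * y\<^sup>2 > 1" using X Y by (metis less_1_mult)
    ultimately show ?thesis by simp
  qed
  define p where "p g = (inv2 S ** g i ** S)$1$1" for g :: "nat \<Rightarrow> mat2"
  define p' where "p' g = (inv2 T ** g k ** T)$1$1" for g :: "nat \<Rightarrow> mat2"
  have eq: "(p g)\<^sup>2 = (p' g)\<^sup>2" if g: "g \<in> \<Gamma>" "p g \<noteq> 0" "p' g \<noteq> 0" for g
  proof -
    \<comment> \<open>The trace of a^n M is z^n times the first diagonal entry of M in the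
      eigenbasis, plus a term that decays.\<close>
    have lim: "(\<lambda>n. tr2 (V ** diag2 (z ^ n) ** inv2 V ** M) / z ^ n) \<longlonglongrightarrow> (inv2 V ** M ** V)$1$1"
      if V: "det V = 1" "\<bar>z\<bar> > 1" for V M and z :: real
    proof -
      have z0: "z \<noteq> 0" using V(2) by auto
      let ?N = "inv2 V ** M ** V"
      have "V ** diag2 (z ^ n) ** inv2 V ** M = V ** (diag2 (z ^ n) ** ?N) ** inv2 V" for n
        using conj_mult[OF V(1), of "diag2 (z ^ n)" ?N] by (simp add: conj_unconj V)
      then have "tr2 (V ** diag2 (z ^ n) ** inv2 V ** M) = z ^ n * ?N$1$1 + ?N$2$2 / z ^ n" for n
        by (simp only: tr2_conj[OF V(1)]) (simp add: tr2_def)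
      then have e: "tr2 (V ** diag2 (z ^ n) ** inv2 V ** M) / z ^ n = ?N$1$1 + ?N$2$2 * (1 / z\<^sup>2) ^ n" for n
        using z0 by (simp add: add_divide_distrib power_divide power2_eq_square power_mult_distrib)
      have "z\<^sup>2 > 1" using V(2) by (metis one_less_power pos2 power2_abs)
      then have "\<bar>1 / z\<^sup>2\<bar> < 1" by (simp add: divide_less_eq)
      then have "(\<lambda>n. ?N$1$1 + ?N$2$2 * (1 / z\<^sup>2) ^ n) \<longlonglongrightarrow> ?N$1$1 + ?N$2$2 * 0"
        by (intro tendsto_intros LIMSEQ_realpow_zero) auto
      then show ?thesis unfolding e by simp
    qed
    let ?u = "\<lambda>n. tr2 (mpow (a i) n ** g i)" and ?v = "\<lambda>n. tr2 (mpow (a k) n ** g k)"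
    have u: "(\<lambda>n. ?u n / x ^ n) \<longlonglongrightarrow> p g"
      unfolding p_def h.S(3) mpow_hyperbolic[OF h.S(1) h.xy0(1)] by (rule lim[OF h.S(1,2)])
    have v: "(\<lambda>n. ?v n / y ^ n) \<longlonglongrightarrow> p' g"
      unfolding p'_def h.T(3) mpow_hyperbolic[OF h.T(1) h.xy0(2)] by (rule lim[OF h.T(1,2)])
    have big: "\<forall>\<^sub>F n in sequentially. \<bar>f n\<bar> > 2" if "(\<lambda>n. f n / z ^ n) \<longlonglongrightarrow> c" "c \<noteq> 0" "\<bar>z\<bar> > 1" for f :: "nat \<Rightarrow> real" and z c
    proof -
      have zt: "filterlim (\<lambda>n. \<bar>z\<bar> ^ n) at_top sequentially"
        using filterlim_at_infinity_imp_norm_at_top[OF filterlim_realpow_sequentially_gt1, of "\<bar>z\<bar>"] that(3) by simp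
      have "filterlim (\<lambda>n. \<bar>f n / z ^ n\<bar> * \<bar>z\<bar> ^ n) at_top sequentially"
        by (rule filterlim_tendsto_pos_mult_at_top[OF tendsto_rabs[OF that(1)] _ zt]) (use that(2) in simp)
      moreover have "\<bar>f n / z ^ n\<bar> * \<bar>z\<bar> ^ n = \<bar>f n\<bar>" for n using that(3) by (auto simp: power_abs)
      ultimately show ?thesis unfolding filterlim_at_top_dense by simp
    qed
    have "\<forall>\<^sub>F n in sequentially. (?u n / x ^ n)\<^sup>2 = (?v n / y ^ n)\<^sup>2"
      using big[OF u g(2) h.S(2)] big[OF v g(3) h.T(2)]
    proof eventually_elim
      case (elim n)
      have "(?u n)\<^sup>2 = (?v n)\<^sup>2"
        using proper_trace_eq[OF ik(1,2) nd pr mult_G[OF pow_G[OF a(1), of n] g(1)]] elim by simp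
      then show ?case using xy by (simp add: power_divide power_sq_swap)
    qed
    moreover have "(\<lambda>n. (?u n / x ^ n)\<^sup>2) \<longlonglongrightarrow> (p g)\<^sup>2" by (intro tendsto_intros u)
    ultimately have "(\<lambda>n. (?v n / y ^ n)\<^sup>2) \<longlonglongrightarrow> (p g)\<^sup>2" by (rule Lim_transform_eventually[rotated])
    moreover have "(\<lambda>n. (?v n / y ^ n)\<^sup>2) \<longlonglongrightarrow> (p' g)\<^sup>2" by (intro tendsto_intros v)
    ultimately show ?thesis by (rule LIMSEQ_unique)
  qed
  have pp: "p \<in> polyfun r" "p' \<in> polyfun r"
    unfolding p_def[abs_def] p'_def[abs_def] mat2_mult_nth inv2_nth
    by (intro polyfun.padd polyfun.pmul polyfun.pcoord polyfun.pconst ik)+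
  \<comment> \<open>The factors p and p' cover the elements to which \<open>eq\<close> does not
    apply.\<close>
  have "(\<lambda>g. p g * p' g * ((p g)\<^sup>2 - (p' g)\<^sup>2)) \<in> polyfun r"
    by (intro polyfun.pmul pf_diff pf_power2 pp)
  moreover have "\<forall>g\<in>\<Gamma>. p g * p' g * ((p g)\<^sup>2 - (p' g)\<^sup>2) = 0" using eq by auto
  ultimately have z: "\<forall>g\<in>Gr r. p g * p' g * ((p g)\<^sup>2 - (p' g)\<^sup>2) = 0"
    using zdense[unfolded zariski_dense_def, THEN bspec] by blast
  \<comment> \<open>Trivial in all components but k, so that p is 1 and p' is 2.\<close>
  let ?g = "\<lambda>j. if j = k then T ** diag2 2 ** inv2 T else mat 1"
  have "?g \<in> Gr r" using ik by (simp add: Gr_def det_mul h.T det_diag2)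
  then have "p ?g * p' ?g * ((p ?g)\<^sup>2 - (p' ?g)\<^sup>2) = 0" by (rule bspec[OF z])
  moreover have "p ?g = 1" using ik by (simp add: p_def matrix_mul_rid inv2_left h.S del: mat2_mult_nth)
  moreover have "p' ?g = 2" by (simp add: p'_def unconj h.T del: mat2_mult_nth)
  ultimately show False by simp
qed

text \<open>The approximating element is g f u h. Here g gives the point \<open>\<xi>\<close>, u is
  bounded in component i and large elsewhere, and h is arbitrary: in component i density lets h move
  the point close to z, while in the other components the size of u hides h.\<close>

lemma lam_saturated:
  assumes i: "i < r" and nd: "\<not> discrete_grp (proj i \<Gamma>)" and \<xi>: "\<xi> \<in> lam r \<Gamma>" and z: "cmod z = 1"
  shows "\<xi>(i := z) \<in> lam r \<Gamma>"
proof -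
  have \<xi>t: "\<xi> \<in> torus r" using \<xi> by (simp add: lam_def)
  \<comment> \<open>By \<open>not_proper\<close> each other component can be made large while
    component i stays bounded; \<open>combine_at_top\<close> collects them one after the
    other.\<close>
  have "\<exists>u. (\<forall>n. u n \<in> \<Gamma>) \<and> bounded (range (\<lambda>n. u n i)) \<and> (\<forall>k<K. k \<noteq> i \<longrightarrow> filterlim (\<lambda>n. norm (u n k)) at_top sequentially)"
    if "K \<le> r" for K
    using that
  proof (induction K)
    case 0
    show ?case using one_G by (intro exI[of _ "\<lambda>n i. mat 1"]) auto
  next
    case (Suc K)
    then obtain g where g: "\<And>n. g n \<in> \<Gamma>" "bounded (range (\<lambda>n. g n i))"
      "\<And>k. k < K \<Longrightarrow> k \<noteq> i \<Longrightarrow> filterlim (\<lambda>n. norm (g n k)) at_top sequentially" by auto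
    show ?case
    proof (cases "K = i")
      case True
      then show ?thesis using g by (intro exI[of _ g]) (auto simp: less_Suc_eq)
    next
      case False
      then have "\<not> proper i K" using Suc.prems i nd by (intro not_proper) auto
      then obtain R where R: "\<And>R'. \<exists>h\<in>\<Gamma>. norm (h i) \<le> R \<and> norm (h K) > R'" unfolding proper_def by (auto simp: not_le)
      have "\<forall>n. \<exists>h. h \<in> \<Gamma> \<and> norm (h i) \<le> R \<and> norm (h K) > real n" using R by blast
      from choice[OF this] obtain h where h: "\<And>n. h n \<in> \<Gamma>" "\<And>n. norm (h n i) \<le> R" "\<And>n. norm (h n K) > real n" by blast
      have hK: "filterlim (\<lambda>n. norm (h n K)) at_top sequentially"
        by (rule filterlim_at_top_mono[OF filterlim_real_sequentially]) (use h(3) in \<open>auto intro!: always_eventually less_imp_le\<close>)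
      have hi: "bounded (range (\<lambda>n. h n i))" using h(2) by (auto simp: bounded_iff)
      obtain u where u: "\<And>n. u n \<in> \<Gamma>"
        "\<And>i. i < r \<Longrightarrow> filterlim (\<lambda>n. norm (g n i)) at_top sequentially \<or> filterlim (\<lambda>n. norm (h n i)) at_top sequentially
            \<Longrightarrow> filterlim (\<lambda>n. norm (u n i)) at_top sequentially"
        "\<And>i. i < r \<Longrightarrow> bounded (range (\<lambda>n. g n i)) \<Longrightarrow> bounded (range (\<lambda>n. h n i)) \<Longrightarrow> bounded (range (\<lambda>n. u n i))"
        by (rule combine_at_top[of g h, OF g(1) h(1)]) (rule that)
      have "filterlim (\<lambda>n. norm (u n k)) at_top sequentially" if "k < Suc K" "k \<noteq> i" for k
        using that u(2)[of k] g(3)[of k] hK Suc.prems by (cases "k = K") auto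
      then show ?thesis using u(1) u(3)[OF i g(2) hi] by blast
    qed
  qed
  then obtain u where u: "\<And>n. u n \<in> \<Gamma>" "bounded (range (\<lambda>n. u n i))"
    "\<And>k. k < r \<Longrightarrow> k \<noteq> i \<Longrightarrow> filterlim (\<lambda>n. norm (u n k)) at_top sequentially" by blast
  obtain g where g: "\<forall>n. g n \<in> \<Gamma>" "\<forall>k<r. (\<lambda>n. orb (g n k)) \<longlonglongrightarrow> \<xi> k" using \<xi> unfolding lam_seq by blast
  have gG: "g n \<in> \<Gamma>" for n using g(1) by simp
  obtain f s c where f: "f \<in> \<Gamma>" "strict_mono (s :: nat \<Rightarrow> nat)" "c > 0"
    and fc: "\<And>n m k. k < r \<Longrightarrow> norm (g (s n) k ** f k ** u (s m) k) \<ge> c * (norm (g (s n) k) * norm (u (s m) k))"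
    by (rule combine[of g u, OF gG u(1)]) (rule that)
  have "bounded (range (\<lambda>n. u (s n) i))" using u(2) by (auto simp: bounded_iff)
  then obtain t g0 where t: "strict_mono t" and lg: "(\<lambda>n. u (s (t n)) i) \<longlonglongrightarrow> g0"
    using bounded_imp_convergent_subsequence[of "\<lambda>n. u (s n) i"] by (auto simp: o_def)
  have g0: "det g0 = 1"
    by (rule pcl_det(2)[of g0 g0 i i]) (use u(1) lg in \<open>auto simp: pcl_seq intro!: exI[of _ "\<lambda>n. u (s (t n))"]\<close>)
  show ?thesis unfolding lam_def
  proof (intro CollectI conjI allI impI)
    show "\<xi>(i := z) \<in> torus r" using \<xi>t z i by (auto simp: torus_def)
    fix e :: real assume e: "e > 0"
    then have e3: "e / 3 > 0" by simp
    have "\<forall>\<^sub>F n in sequentially. \<forall>k<r. cmod (orb (g (s n) k) - \<xi> k) < e / 3 \<and> (4 * norm (f k) / c) / norm (g (s n) k) < e / 3"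
    proof (intro eventually_all_less eventually_conj)
      fix k assume k: "k < r"
      have gs: "(\<lambda>n. orb (g (s n) k)) \<longlonglongrightarrow> \<xi> k"
        using LIMSEQ_subseq_LIMSEQ[OF g(2)[rule_format, OF k] f(2)] by (simp add: o_def)
      then show "\<forall>\<^sub>F n in sequentially. cmod (orb (g (s n) k) - \<xi> k) < e / 3"
        unfolding tendsto_iff dist_norm using e3 by blast
      have "filterlim (\<lambda>n. norm (g (s n) k)) at_top sequentially"
        by (rule orb_limit_circle_at_top[OF _ gs torus_norm[OF \<xi>t k]]) (simp add: gG)
      then have "(\<lambda>n. (4 * norm (f k) / c) / norm (g (s n) k)) \<longlonglongrightarrow> 0"
        by (intro tendsto_divide_0[OF tendsto_const] filterlim_at_top_imp_at_infinity)
      then show "\<forall>\<^sub>F n in sequentially. (4 * norm (f k) / c) / norm (g (s n) k) < e / 3" by (rule order_tendstoD(2)[OF _ e3])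
    qed
    from eventually_happens[OF this] obtain N
      where N: "\<forall>k<r. cmod (orb (g (s N) k) - \<xi> k) < e / 3 \<and> (4 * norm (f k) / c) / norm (g (s N) k) < e / 3" by auto
    define P where "P k = g (s N) k ** f k" for k
    have PG: "P \<in> \<Gamma>" unfolding P_def[abs_def] by (intro mult_G gG f(1))
    obtain M where M: "det M = 1" "cmod (orb M - z) < e" using orb_dense[OF z e] by blast
    \<comment> \<open>The i-components of u converge to g0, so h can be fitted to the limit. Only
      afterwards is the index m taken large enough to outweigh h in the other components.\<close>
    let ?W = "P i ** g0"
    have W: "det ?W = 1" using PG g0 by (simp add: det_mul)
    have "(inv2 ?W ** M, inv2 ?W ** M) \<in> pcl i i" by (rule nondiscrete_dense[OF i nd]) (simp add: det_mul M g0 PG)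
    then obtain h where h: "\<And>n. h n \<in> \<Gamma>" "(\<lambda>n. h n i) \<longlonglongrightarrow> inv2 ?W ** M" unfolding pcl_seq by blast
    have "(\<lambda>n. ?W ** h n i) \<longlonglongrightarrow> ?W ** (inv2 ?W ** M)" by (intro tendsto_intros h)
    then have "(\<lambda>n. ?W ** h n i) \<longlonglongrightarrow> M" by (simp only: inv2_cancel_left'[OF W])
    then have "(\<lambda>n. orb (?W ** h n i)) \<longlonglongrightarrow> orb M" using W h(1) by (intro tendsto_orb M) (simp_all add: det_mul)
    then have "(\<lambda>n. cmod (orb (?W ** h n i) - z)) \<longlonglongrightarrow> cmod (orb M - z)" by (intro tendsto_intros)
    from eventually_happens[OF order_tendstoD(2)[OF this M(2)]] obtain n where n: "cmod (orb (?W ** h n i) - z) < e" by auto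
    let ?h = "h n"
    have "\<forall>\<^sub>F m in sequentially. \<forall>k<r. cmod (orb (P k ** u (s (t m)) k ** ?h k) - (\<xi>(i := z)) k) < e"
    proof (rule eventually_all_less)
      fix k assume k: "k < r"
      show "\<forall>\<^sub>F m in sequentially. cmod (orb (P k ** u (s (t m)) k ** ?h k) - (\<xi>(i := z)) k) < e"
      proof (cases "k = i")
        case True
        have "(\<lambda>m. P i ** u (s (t m)) i ** ?h i) \<longlonglongrightarrow> ?W ** ?h i" by (intro tendsto_intros lg)
        then have "(\<lambda>m. orb (P i ** u (s (t m)) i ** ?h i)) \<longlonglongrightarrow> orb (?W ** ?h i)"
          using PG g0 h(1) u(1) by (intro tendsto_orb) (simp_all add: det_mul)
        then have "(\<lambda>m. cmod (orb (P i ** u (s (t m)) i ** ?h i) - z)) \<longlonglongrightarrow> cmod (orb (?W ** ?h i) - z)"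
          by (intro tendsto_intros)
        from order_tendstoD(2)[OF this n] True show ?thesis by simp
      next
        case False
        have st: "filterlim (\<lambda>m. s (t m)) sequentially sequentially"
          by (rule filterlim_compose[OF filterlim_subseq[OF f(2)] filterlim_subseq[OF t]])
        let ?A = "\<lambda>m. P k ** u (s (t m)) k"
        have dA: "det (?A m) = 1" for m using PG u(1) by (simp add: det_mul)
        have "filterlim (\<lambda>m. norm (?A m)) at_top sequentially"
        proof (rule filterlim_at_top_mono[OF _ always_eventually], rule filterlim_tendsto_pos_mult_at_top[OF tendsto_const f(3)])
          show "filterlim (\<lambda>m. norm (u (s (t m)) k)) at_top sequentially" by (rule filterlim_compose[OF u(3)[OF k False] st])
          show "\<forall>m. c * norm (u (s (t m)) k) \<le> norm (?A m)"
          proof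
            fix m
            have "1 * norm (u (s (t m)) k) \<le> norm (g (s N) k) * norm (u (s (t m)) k)" using norm_ge1[OF det_G[OF gG]] by (intro mult_right_mono) auto
            then have "c * norm (u (s (t m)) k) \<le> c * (norm (g (s N) k) * norm (u (s (t m)) k))" using f(3) by simp
            then show "c * norm (u (s (t m)) k) \<le> norm (?A m)" using fc[OF k, of N "t m"] unfolding P_def by linarith
          qed
        qed
        then have "(\<lambda>m. (4 * norm (?h k)) / norm (?A m)) \<longlonglongrightarrow> 0"
          by (intro tendsto_divide_0[OF tendsto_const] filterlim_at_top_imp_at_infinity)
        from order_tendstoD(2)[OF this e3] show ?thesis
        proof eventually_elim
          case (elim m)
          have "cmod (orb (?A m) - orb (?A m ** ?h k)) \<le> 4 * vis (?A m) (?h k)"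
            using orb_diff_le_vis[OF dA det_mult1[OF dA det_G[OF h(1)]], of m m n k] unfolding inv2_cancel_left[OF dA] .
          also have "\<dots> \<le> (4 * norm (?h k)) / norm (?A m)" using vis_le[OF dA, of "?h k" m] h(1) by simp
          finally have 1: "cmod (orb (?A m) - orb (?A m ** ?h k)) < e / 3" using elim by linarith
          have "cmod (orb (g (s N) k) - orb (?A m)) \<le> (4 * norm (f k) / c) / norm (g (s N) k)"
            unfolding P_def by (intro orb_product_diff fc k f(3) det_G gG f(1) u(1))
          then have 2: "cmod (orb (g (s N) k) - orb (?A m)) < e / 3" using N k by fastforce
          have 3: "cmod (orb (g (s N) k) - \<xi> k) < e / 3" using N k by simp
          have "cmod ((orb (g (s N) k) - \<xi> k) - (orb (g (s N) k) - orb (?A m)) - (orb (?A m) - orb (?A m ** ?h k)))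
            \<le> cmod (orb (g (s N) k) - \<xi> k) + cmod (orb (g (s N) k) - orb (?A m)) + cmod (orb (?A m) - orb (?A m ** ?h k))"
            by (rule order_trans[OF norm_triangle_ineq4 add_right_mono[OF norm_triangle_ineq4]])
          then show ?case using 1 2 3 False by simp
        qed
      qed
    qed
    from eventually_happens[OF this] obtain m where m: "\<forall>k<r. cmod (orb (P k ** u (s (t m)) k ** ?h k) - (\<xi>(i := z)) k) < e" by auto
    show "\<exists>g\<in>\<Gamma>. \<forall>k<r. cmod (orb (g k) - (\<xi>(i := z)) k) < e"
      using m mult_G[OF mult_G[OF PG u(1)] h(1)] by (intro bexI[of _ "\<lambda>k. P k ** u (s (t m)) k ** ?h k"]) auto
  qed
qed

end

section \<open>Parabolic and elliptic matrices, discreteness\<close>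

text \<open>By Cayley-Hamilton, s A - 1 is nilpotent for s half the trace, so powers grow
  linearly.\<close>

lemma parabolic_form:
  assumes "det A = 1" "\<bar>tr2 A\<bar> = 2"
  obtains s N where "s = 1 \<or> s = (-1::real)" "N ** N = 0" "tr2 N = 0" "det N = 0" "A = s *\<^sub>R (mat 1 + N)"
    "\<And>n. mpow A n = s ^ n *\<^sub>R (mat 1 + real n *\<^sub>R N)"
proof -
  define s where "s = tr2 A / 2"
  have s: "s = 1 \<or> s = -1" using assms(2) by (auto simp: s_def)
  define N where "N = s *\<^sub>R A - mat 1"
  have ss: "s * s = 1" using s by auto
  have tr: "A$2$2 = 2 * s - A$1$1" by (simp add: s_def tr2_def field_simps)
  have d: "A$1$1 * (2 * s - A$1$1) - A$1$2 * A$2$1 = 1" using assms(1) by (simp add: det2 tr)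
  have A: "A = s *\<^sub>R (mat 1 + N)" using ss by (simp add: N_def scaleR_scaleR)
  have NN: "N ** N = 0"
    by (simp add: mat2_eq_iff N_def tr) (use s d in \<open>auto simp: algebra_simps\<close>)
  have "mpow A n = s ^ n *\<^sub>R (mat 1 + real n *\<^sub>R N)" for n
  proof (induction n)
    case (Suc n)
    have NN': "N$i$1 * N$1$j + N$i$2 * N$2$j = 0" for i j
      using NN by (metis mat2_mult_nth zero_index)
    have "(mat 1 + N) ** (mat 1 + real n *\<^sub>R N) = mat 1 + real (Suc n) *\<^sub>R N + real n *\<^sub>R (N ** N)"
      by (simp add: mat2_eq_iff algebra_simps)
    then have *: "(mat 1 + N) ** (mat 1 + real n *\<^sub>R N) = mat 1 + real (Suc n) *\<^sub>R N" by (simp add: NN)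
    have "mpow A (Suc n) = A ** (s ^ n *\<^sub>R (mat 1 + real n *\<^sub>R N))" by (simp only: mpow.simps Suc)
    also have "\<dots> = s *\<^sub>R (mat 1 + N) ** (s ^ n *\<^sub>R (mat 1 + real n *\<^sub>R N))" by (subst A) (rule refl)
    also have "\<dots> = s ^ Suc n *\<^sub>R ((mat 1 + N) ** (mat 1 + real n *\<^sub>R N))"
      by (simp add: mat2_eq_iff algebra_simps)
    finally show ?case by (simp only: *)
  qed simp
  moreover have "tr2 N = 0" using ss by (simp add: tr2_def N_def tr algebra_simps)
  moreover have "det N = 0"
    unfolding det2 by (simp add: N_def tr) (use s d in \<open>auto simp: algebra_simps\<close>)
  ultimately show thesis using that s NN A by blast
qed

text \<open>The matrices that are trivial in \<open>PSL(2,R)\<close>.\<close>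

definition pm1 :: "mat2 \<Rightarrow> bool" where "pm1 A \<longleftrightarrow> A = mat 1 \<or> A = - mat 1"

lemma pm1_mult: "pm1 A \<Longrightarrow> pm1 B \<Longrightarrow> pm1 (A ** B)"
  by (auto simp: pm1_def matrix_mul_lid)

lemma pm1_mpow: "pm1 A \<Longrightarrow> pm1 (mpow A n)"
  by (induction n) (auto simp: pm1_mult, simp add: pm1_def)

lemma pm1_norm: "pm1 A \<Longrightarrow> norm A \<le> 2"
proof -
  have "norm (mat 1 :: mat2) \<le> 2" by (rule power2_le_imp_le) (simp_all add: norm_one2)
  then show "pm1 A \<Longrightarrow> norm A \<le> 2" by (auto simp: pm1_def)
qed

lemma pm1_tr2: "pm1 A \<Longrightarrow> \<bar>tr2 A\<bar> = 2"
  by (auto simp: pm1_def tr2_def)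

lemma parabolic_bounded_powers:
  assumes "det A = 1" "\<bar>tr2 A\<bar> = 2" "\<And>m. norm (mpow A m) \<le> C"
  shows "pm1 A"
proof -
  obtain s N where s: "s = 1 \<or> s = (-1::real)" and A: "A = s *\<^sub>R (mat 1 + N)"
    and P: "\<And>n. mpow A n = s ^ n *\<^sub>R (mat 1 + real n *\<^sub>R N)"
    by (rule parabolic_form[OF assms(1,2)]) (rule that)
  have "N = 0"
  proof (rule ccontr)
    assume "N \<noteq> 0"
    then obtain n where n: "C + 2 < real n * norm N" using reals_Archimedean3[of "norm N"] by auto
    have "\<bar>s ^ n\<bar> = 1" using s by (auto simp: power_abs)
    then have "norm (mat 1 + real n *\<^sub>R N) \<le> C" using assms(3)[of n] P[of n] by simp
    moreover have "norm (real n *\<^sub>R N) \<le> norm (mat 1 + real n *\<^sub>R N) + norm (mat 1 :: mat2)"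
      by (metis add_diff_cancel_left' norm_triangle_ineq4)
    moreover have "norm (mat 1 :: mat2) \<le> 2" by (rule pm1_norm) (simp add: pm1_def)
    ultimately show False using n by simp
  qed
  then show ?thesis using A s by (auto simp: pm1_def)
qed

lemma parabolic_root_of_unity:
  assumes "det A = 1" "\<bar>tr2 A\<bar> = 2" "n > 0" "pm1 (mpow A n)"
  shows "pm1 A"
proof -
  obtain s N where s: "s = 1 \<or> s = (-1::real)" and A: "A = s *\<^sub>R (mat 1 + N)" and t: "tr2 N = 0"
    and P: "\<And>n. mpow A n = s ^ n *\<^sub>R (mat 1 + real n *\<^sub>R N)"
    by (rule parabolic_form[OF assms(1,2)]) (rule that)
  have sn: "s ^ n \<noteq> 0" using s by auto
  obtain c where c: "mpow A n = c *\<^sub>R mat 1"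
  proof -
    have "mpow A n = 1 *\<^sub>R mat 1 \<or> mpow A n = (-1) *\<^sub>R mat 1" using assms(4) by (simp add: pm1_def)
    then show thesis using that by blast
  qed
  define B where "B = mat 1 + real n *\<^sub>R N"
  have ent: "s ^ n * B$i$j = c * (mat 1 :: mat2)$i$j" for i j
    using c unfolding P B_def[symmetric] by (metis scaleR_conv_of_real vector_scaleR_component of_real_eq_id id_apply)
  have "s ^ n * B$1$1 = s ^ n * B$2$2" unfolding ent by simp
  then have "B$1$1 = B$2$2" unfolding mult_left_cancel[OF sn] .
  moreover have "B$1$2 = 0" "B$2$1 = 0" using ent[of 1 2] ent[of 2 1] s by auto
  ultimately have "1 + real n * N$1$1 = 1 + real n * N$2$2" "real n * N$1$2 = 0" "real n * N$2$1 = 0"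
    by (simp_all add: B_def)
  then have "N$1$2 = 0" "N$2$1 = 0" "N$1$1 = N$2$2" using assms(3) by simp_all
  then have "N = 0" using t by (simp add: tr2_def mat2_eq_iff)
  then show ?thesis using A s by (auto simp: pm1_def)
qed

text \<open>The form Q, whose zeros are the fixed points of A, is invariant under A and definite
  since A has no real fixed point. The columns of the powers stay on two of its compact level
  sets.\<close>

lemma elliptic_bounded_powers:
  assumes "det A = 1" "\<bar>tr2 A\<bar> < 2"
  shows "\<exists>C. \<forall>n. norm (mpow A n) \<le> C"
proof -
  define a b c e where "a = A$1$1" "b = A$1$2" "c = A$2$1" "e = A$2$2"
  note abce = this
  have dt: "a * e - b * c = 1" using assms(1) by (simp add: abce det2)
  define d where "d = - ((e - a)\<^sup>2 + 4 * (b * c))"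
  have d: "d > 0"
  proof -
    have "(tr2 A)\<^sup>2 < 2\<^sup>2" using assms(2) by (metis abs_numeral power2_abs power_strict_mono abs_ge_zero pos2)
    moreover have "(tr2 A)\<^sup>2 = (e - a)\<^sup>2 + 4 * (a * e)" by (simp add: tr2_def abce power2_eq_square algebra_simps)
    ultimately show ?thesis using dt by (simp add: d_def)
  qed
  define Q where "Q u v = c * u\<^sup>2 + (e - a) * u * v - b * v\<^sup>2" for u v
  have inv: "Q (a * u + b * v) (c * u + e * v) = Q u v" for u v
  proof -
    have "Q (a * u + b * v) (c * u + e * v) = (a * e - b * c) * Q u v"
      by (simp add: Q_def power2_eq_square algebra_simps)
    then show ?thesis using dt by simp
  qed
  have v: "v\<^sup>2 \<le> 4 * \<bar>c * Q u v\<bar> / d" and u: "u\<^sup>2 \<le> 4 * \<bar>b * Q u v\<bar> / d" for u v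
  proof -
    have "4 * (c * Q u v) = (2 * c * u + (e - a) * v)\<^sup>2 + v\<^sup>2 * d"
      by (simp add: Q_def d_def power2_eq_square algebra_simps)
    then have "v\<^sup>2 * d \<le> 4 * \<bar>c * Q u v\<bar>" by (smt (verit) zero_le_power2)
    then show "v\<^sup>2 \<le> 4 * \<bar>c * Q u v\<bar> / d" using d by (simp add: le_divide_eq)
    have "4 * (- b * Q u v) = (2 * b * v - (e - a) * u)\<^sup>2 + u\<^sup>2 * d"
      by (simp add: Q_def d_def power2_eq_square algebra_simps)
    then have "u\<^sup>2 * d \<le> 4 * \<bar>b * Q u v\<bar>" by (smt (verit) zero_le_power2 mult_minus_left)
    then show "u\<^sup>2 \<le> 4 * \<bar>b * Q u v\<bar> / d" using d by (simp add: le_divide_eq)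
  qed
  have q: "Q (mpow A n $1$1) (mpow A n $2$1) = Q 1 0" "Q (mpow A n $1$2) (mpow A n $2$2) = Q 0 1" for n
    by (induction n) (simp_all add: inv abce[symmetric])
  define K where "K = 4 * \<bar>c * Q 1 0\<bar> / d + 4 * \<bar>b * Q 1 0\<bar> / d + 4 * \<bar>c * Q 0 1\<bar> / d + 4 * \<bar>b * Q 0 1\<bar> / d"
  have "(norm (mpow A n))\<^sup>2 \<le> K" for n
    unfolding norm_mat2_sq K_def
    using v[of "mpow A n $2$1" "mpow A n $1$1"] u[of "mpow A n $1$1" "mpow A n $2$1"]
      v[of "mpow A n $2$2" "mpow A n $1$2"] u[of "mpow A n $1$2" "mpow A n $2$2"]
    by (simp add: q)
  then have "norm (mpow A n) \<le> sqrt K" for n by (rule real_le_rsqrt)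
  then show ?thesis by blast
qed

lemma hyperbolic_pow:
  assumes "det A = 1" "\<bar>tr2 A\<bar> > 2" "n > 0"
  shows "\<bar>tr2 (mpow A n)\<bar> > 2"
proof -
  obtain S x where S: "det S = 1" "\<bar>x\<bar> > 1" "A = S ** diag2 x ** inv2 S" by (rule hyperbolic_diag[OF assms(1,2)])
  have x0: "x \<noteq> 0" using S(2) by auto
  define y where "y = \<bar>x ^ n\<bar>"
  have y: "y > 1" using S(2) assms(3) by (simp add: y_def power_abs one_less_power)
  have "tr2 (mpow A n) = x ^ n + 1 / x ^ n"
    unfolding S(3) mpow_hyperbolic[OF S(1) x0] tr2_conj[OF S(1)] by (simp add: tr2_def)
  moreover have "\<bar>x ^ n + 1 / x ^ n\<bar> = y + 1 / y"
  proof -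
    have e: "\<bar>z + 1 / z\<bar> = \<bar>z\<bar> + 1 / \<bar>z\<bar>" for z :: real
    proof (cases "z \<ge> 0")
      case False
      then have "z + 1 / z < 0" by (intro add_neg_neg) auto
      with False show ?thesis by simp
    qed simp
    show ?thesis unfolding y_def by (rule e)
  qed
  moreover have "y + 1 / y > 2"
  proof -
    have "(y - 1)\<^sup>2 > 0" using y by simp
    then show ?thesis using y by (simp add: field_simps power2_eq_square)
  qed
  ultimately show ?thesis by simp
qed

section \<open>Discrete subgroups of one factor\<close>

locale sl2_group =
  fixes G :: "mat2 set"
  assumes det1: "A \<in> G \<Longrightarrow> det A = 1" and one: "mat 1 \<in> G"
    and mult: "A \<in> G \<Longrightarrow> B \<in> G \<Longrightarrow> A ** B \<in> G" and inv: "A \<in> G \<Longrightarrow> inv2 A \<in> G"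
begin

lemma mpow_mem: "A \<in> G \<Longrightarrow> mpow A n \<in> G"
  by (induction n) (auto intro: one mult)

end

locale discrete_sl2_group = sl2_group +
  assumes disc: "discrete_grp G"
begin

text \<open>In a convergent sequence of distinct elements, quotients of neighbouring terms tend to
  the identity without being equal to it.\<close>

lemma finite_bounded: "finite {A \<in> G. norm A \<le> R}"
proof (rule ccontr)
  assume inf: "\<not> ?thesis"
  obtain e where e: "e > 0" "\<And>M. M \<in> G \<Longrightarrow> dist M (mat 1) < e \<Longrightarrow> M = mat 1" using disc unfolding discrete_grp_def by blast
  obtain f :: "nat \<Rightarrow> mat2" where f: "inj f" "range f \<subseteq> {A \<in> G. norm A \<le> R}"
    using infinite_countable_subset[OF inf] by blast
  have fG: "f n \<in> G" "norm (f n) \<le> R" for n using f(2) by auto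
  have "bounded (range f)" using fG(2) by (auto simp: bounded_iff)
  then obtain l s where s: "strict_mono (s :: nat \<Rightarrow> nat)" "(f \<circ> s) \<longlonglongrightarrow> l"
    using bounded_imp_convergent_subsequence[of f] by blast
  have R: "R > 0" using norm_ge1[OF det1[OF fG(1)[of 0]]] fG(2)[of 0] by linarith
  have "Cauchy (f \<circ> s)" using s(2) by (rule LIMSEQ_imp_Cauchy)
  then obtain N where N: "dist ((f \<circ> s) N) ((f \<circ> s) (Suc N)) < e / R"
    using e(1) R unfolding Cauchy_def by (meson divide_pos_pos le_Suc_eq le_refl)
  let ?A = "f (s N)" and ?B = "f (s (Suc N))"
  have dA: "det ?A = 1" using det1 fG by simp
  have "inv2 ?A ** ?B - mat 1 = inv2 ?A ** (?B - ?A)" using dA by (simp add: mat2_eq_iff det2 algebra_simps)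
  then have "norm (inv2 ?A ** ?B - mat 1) \<le> norm (inv2 ?A) * norm (?B - ?A)" by (simp only: norm_mult2)
  also have "\<dots> \<le> R * norm (?B - ?A)" using fG(2) by (intro mult_right_mono) auto
  also have "\<dots> < e" using N R by (simp add: dist_norm norm_minus_commute field_simps)
  finally have "inv2 ?A ** ?B = mat 1" using fG by (intro e(2) mult inv) (simp_all add: dist_norm)
  then have "?B = ?A" using inv2_cancel_left'[OF dA, of ?B] by (simp add: matrix_mul_rid)
  then have "s (Suc N) = s N" using f(1) by (auto dest: injD)
  then show False using s(1) by (metis lessI less_irrefl strict_mono_less)
qed

lemma elliptic_finite_order:
  assumes "A \<in> G" "\<bar>tr2 A\<bar> < 2"
  shows "\<exists>n>0. mpow A n = mat 1"
proof -
  obtain C where C: "\<And>n. norm (mpow A n) \<le> C" using elliptic_bounded_powers[OF det1[OF assms(1)] assms(2)] by blast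
  have "range (mpow A) \<subseteq> {M \<in> G. norm M \<le> C}" using C mpow_mem[OF assms(1)] by auto
  then have "finite (range (mpow A))" using finite_bounded finite_subset by blast
  then have "\<not> inj (mpow A)" using finite_imageD infinite_UNIV_nat by blast
  then obtain m n where mn: "m < n" "mpow A m = mpow A n" unfolding inj_def by (metis linorder_neqE_nat)
  then have "mpow A m ** mpow A (n - m) = mpow A m ** mat 1" using mpow_add[of A m "n - m"] by (simp add: matrix_mul_rid)
  then have "mpow A (n - m) = mat 1" by (metis det_mpow det1 assms(1) inv2_cancel_left)
  then show ?thesis using mn by (intro exI[of _ "n - m"]) simp
qed

end

section \<open>Arithmetic groups\<close>

lemma field_emb_props:
  fixes \<sigma> :: "real \<Rightarrow> real"
  assumes K: "number_field K" and s: "field_emb K \<sigma>"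
  shows "\<sigma> 0 = 0" "x \<in> K \<Longrightarrow> \<sigma> x = 0 \<Longrightarrow> x = 0" "\<sigma> (-1) = -1"
proof -
  have k: "0 \<in> K" "1 \<in> K" "\<And>x y. x \<in> K \<Longrightarrow> y \<in> K \<Longrightarrow> x - y \<in> K" "\<And>x. x \<in> K \<Longrightarrow> x \<noteq> 0 \<Longrightarrow> inverse x \<in> K"
    using K unfolding number_field_def by blast+
  have add: "\<And>x y. x \<in> K \<Longrightarrow> y \<in> K \<Longrightarrow> \<sigma> (x + y) = \<sigma> x + \<sigma> y"
    and mult: "\<And>x y. x \<in> K \<Longrightarrow> y \<in> K \<Longrightarrow> \<sigma> (x * y) = \<sigma> x * \<sigma> y" and one: "\<sigma> 1 = 1"
    using s unfolding field_emb_def by blast+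
  show z: "\<sigma> 0 = 0" using add[OF k(1) k(1)] by simp
  show "x \<in> K \<Longrightarrow> \<sigma> x = 0 \<Longrightarrow> x = 0"
    using mult[of x "inverse x"] k(4)[of x] one by (cases "x = 0") auto
  have "-1 \<in> K" using k(3)[OF k(1,2)] by simp
  then show "\<sigma> (-1) = -1" using add[of 1 "-1"] k(2) one z by (simp add: eq_neg_iff_add_eq_0 add.commute)
qed

lemma anticommuting_trace:
  fixes A B :: mat2
  assumes "A ** B = - (B ** A)" "B ** B = c *\<^sub>R mat 1" "c \<noteq> 0"
  shows "tr2 A = 0"
proof -
  have "c * tr2 A = tr2 (A ** (B ** B))" unfolding assms(2) by (simp add: tr2_def algebra_simps)
  also have "\<dots> = tr2 ((A ** B) ** B)" by (simp add: matrix_mul_assoc)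
  also have "\<dots> = tr2 (B ** (A ** B))" by (rule tr2_commute)
  also have "\<dots> = tr2 ((B ** A) ** B)" by (simp add: matrix_mul_assoc)
  also have "B ** A = - (A ** B)" using assms(1) by simp
  also have "tr2 (- (A ** B) ** B) = - tr2 (A ** (B ** B))" by (simp add: tr2_def algebra_simps)
  also have "\<dots> = - (c * tr2 A)" unfolding assms(2) by (simp add: tr2_def algebra_simps)
  finally show ?thesis using assms(3) by simp
qed

context
  fixes K :: "real set" and a b :: real and \<sigma> :: "real \<Rightarrow> real" and \<rho> :: "quat \<Rightarrow> mat2"
  assumes K: "number_field K" and ab: "a \<in> K" "b \<in> K" "a \<noteq> 0" "b \<noteq> 0"
    and \<sigma>: "field_emb K \<sigma>" and \<rho>: "alg_emb K a b \<sigma> \<rho>"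
begin

lemma K_closed: "0 \<in> K" "1 \<in> K" "x \<in> K \<Longrightarrow> y \<in> K \<Longrightarrow> x + y \<in> K" "x \<in> K \<Longrightarrow> y \<in> K \<Longrightarrow> x - y \<in> K"
  "x \<in> K \<Longrightarrow> y \<in> K \<Longrightarrow> x * y \<in> K" "-1 \<in> K"
  using K unfolding number_field_def by (blast, blast, blast, blast, blast) (metis K diff_0 number_field_def)

lemma rho: "\<rho> qone = mat 1" "x \<in> qalg K \<Longrightarrow> y \<in> qalg K \<Longrightarrow> \<rho> (qadd x y) = \<rho> x + \<rho> y"
  "x \<in> qalg K \<Longrightarrow> y \<in> qalg K \<Longrightarrow> \<rho> (qmul a b x y) = \<rho> x ** \<rho> y" "c \<in> K \<Longrightarrow> x \<in> qalg K \<Longrightarrow> \<rho> (qscal c x) = \<sigma> c *\<^sub>R \<rho> x"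
  using \<rho> unfolding alg_emb_def by blast+

text \<open>The images of i, j and k each anticommute with a matrix whose square is a non-zero
  scalar, so they are traceless. The traces in the different components are therefore conjugates of
  one number.\<close>

lemma rho_trace:
  assumes x: "(x0, x1, x2, x3) \<in> qalg K"
  shows "tr2 (\<rho> (x0, x1, x2, x3)) = 2 * \<sigma> x0"
proof -
  let ?i = "(0, 1, 0, 0) :: quat" and ?j = "(0, 0, 1, 0) :: quat" and ?k = "(0, 0, 0, 1) :: quat"
  have xs: "x0 \<in> K" "x1 \<in> K" "x2 \<in> K" "x3 \<in> K" using x by (auto simp: qalg_def)
  have q: "?i \<in> qalg K" "?j \<in> qalg K" "?k \<in> qalg K" "qone \<in> qalg K" by (auto simp: qalg_def qone_def K_closed)
  have qs: "qscal c y \<in> qalg K" if "c \<in> K" "y \<in> qalg K" for c y using that by (auto simp: qalg_def qscal_def K_closed)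
  have qa: "qadd y z \<in> qalg K" if "y \<in> qalg K" "z \<in> qalg K" for y z using that by (auto simp: qalg_def qadd_def K_closed)
  have m1: "\<sigma> (-1) = -1" by (rule field_emb_props(3)[OF K \<sigma>])
  have s0: "\<sigma> a \<noteq> 0" "\<sigma> b \<noteq> 0" using field_emb_props(2)[OF K \<sigma>] ab by blast+
  have "qmul a b ?i ?i = qscal a qone" by (simp add: qmul_def qscal_def qone_def)
  then have ii: "\<rho> ?i ** \<rho> ?i = \<sigma> a *\<^sub>R mat 1" using rho(3)[OF q(1) q(1)] rho(4)[OF ab(1) q(4)] rho(1) by simp
  have "qmul a b ?j ?j = qscal b qone" by (simp add: qmul_def qscal_def qone_def)
  then have jj: "\<rho> ?j ** \<rho> ?j = \<sigma> b *\<^sub>R mat 1" using rho(3)[OF q(2) q(2)] rho(4)[OF ab(2) q(4)] rho(1) by simp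
  have "qmul a b ?i ?j = ?k" by (simp add: qmul_def)
  then have ij: "\<rho> ?i ** \<rho> ?j = \<rho> ?k" using rho(3)[OF q(1) q(2)] by simp
  have "qmul a b ?j ?i = qscal (-1) ?k" by (simp add: qmul_def qscal_def)
  then have ji: "\<rho> ?j ** \<rho> ?i = - \<rho> ?k" using rho(3)[OF q(2) q(1)] rho(4)[OF K_closed(6) q(3)] m1 by simp
  have ti: "tr2 (\<rho> ?i) = 0" by (rule anticommuting_trace[OF _ jj s0(2)]) (simp add: ij ji)
  have tj: "tr2 (\<rho> ?j) = 0" by (rule anticommuting_trace[OF _ ii s0(1)]) (simp add: ij ji)
  have "\<rho> ?k ** \<rho> ?j = \<rho> ?i ** (\<rho> ?j ** \<rho> ?j)" by (simp add: ij[symmetric] matrix_mul_assoc)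
  moreover have "\<rho> ?j ** \<rho> ?k = - ((\<rho> ?j ** \<rho> ?i) ** - \<rho> ?j)" by (simp add: ij[symmetric] matrix_mul_assoc)
  then have "\<rho> ?j ** \<rho> ?k = - (\<rho> ?k ** \<rho> ?j)" by (simp add: ji)
  ultimately have tk: "tr2 (\<rho> ?k) = 0" by (intro anticommuting_trace[OF _ jj s0(2)]) simp
  have "(x0, x1, x2, x3) = qadd (qscal x0 qone) (qadd (qscal x1 ?i) (qadd (qscal x2 ?j) (qscal x3 ?k)))"
    by (simp add: qadd_def qscal_def qone_def)
  then have "\<rho> (x0, x1, x2, x3) = \<sigma> x0 *\<^sub>R mat 1 + (\<sigma> x1 *\<^sub>R \<rho> ?i + (\<sigma> x2 *\<^sub>R \<rho> ?j + \<sigma> x3 *\<^sub>R \<rho> ?k))"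
    using xs q by (simp add: rho qs qa)
  then have "tr2 (\<rho> (x0, x1, x2, x3)) = 2 * \<sigma> x0 + \<sigma> x1 * tr2 (\<rho> ?i) + \<sigma> x2 * tr2 (\<rho> ?j) + \<sigma> x3 * tr2 (\<rho> ?k)"
    by (simp add: tr2_def algebra_simps)
  then show ?thesis by (simp add: ti tj tk)
qed

text \<open>The trace form is nondegenerate: multiplying x by 1, i, j, k brings each coefficient, up
  to a non-zero scalar, into the position read by the trace.\<close>

lemma rho_inj:
  assumes x: "x \<in> qalg K" and z: "\<rho> x = 0" shows "x = (0, 0, 0, 0)"
proof -
  obtain x0 x1 x2 x3 where xx: "x = (x0, x1, x2, x3)" by (cases x) auto
  have xs: "x0 \<in> K" "x1 \<in> K" "x2 \<in> K" "x3 \<in> K" using x by (auto simp: xx qalg_def)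
  have z0: "fst (qmul a b x y) = 0" if y: "y \<in> qalg K" for y
  proof -
    obtain p0 p1 p2 p3 where p: "qmul a b x y = (p0, p1, p2, p3)" by (cases "qmul a b x y") auto
    have m: "qmul a b x y \<in> qalg K" using x y ab by (auto simp: qalg_def qmul_def intro!: K_closed)
    have "\<rho> (qmul a b x y) = 0" using rho(3)[OF x y] z by (simp add: mat2_eq_iff)
    then have "2 * \<sigma> p0 = 0" using rho_trace[OF m[unfolded p]] p by (simp add: tr2_def)
    then have "p0 = 0" using field_emb_props(2)[OF K \<sigma>, of p0] m[unfolded p] by (auto simp: qalg_def)
    then show ?thesis by (simp add: p)
  qed
  have "x0 = 0" using z0[of "(1,0,0,0)"] by (simp add: xx qmul_def qalg_def K_closed)
  moreover have "x1 = 0" using z0[of "(0,1,0,0)"] ab by (simp add: xx qmul_def qalg_def K_closed)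
  moreover have "x2 = 0" using z0[of "(0,0,1,0)"] ab by (simp add: xx qmul_def qalg_def K_closed)
  moreover have "x3 = 0" using z0[of "(0,0,0,1)"] ab by (simp add: xx qmul_def qalg_def K_closed)
  ultimately show ?thesis by (simp add: xx)
qed

text \<open>The point of this lemma and of \<open>rho_trace_4\<close> is that the condition on the
  right involves x alone and hence is the same for all embeddings.\<close>

lemma rho_pm1:
  assumes x: "x \<in> qalg K" shows "pm1 (\<rho> x) \<longleftrightarrow> x = (1, 0, 0, 0) \<or> x = (-1, 0, 0, 0)"
proof -
  have q: "qone \<in> qalg K" by (auto simp: qalg_def qone_def K_closed)
  have m1: "\<sigma> (-1) = -1" by (rule field_emb_props(3)[OF K \<sigma>])
  have qm: "qscal (-1) qone \<in> qalg K" by (auto simp: qalg_def qscal_def qone_def K_closed)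
  have rm: "\<rho> (qscal (-1) qone) = - mat 1" using rho(4)[OF K_closed(6) q] rho(1) m1 by simp
  have "\<rho> x = mat 1 \<longrightarrow> x = (1, 0, 0, 0)"
  proof
    assume "\<rho> x = mat 1"
    then have "\<rho> (qadd x (qscal (-1) qone)) = 0" using rho(2)[OF x qm] rm by simp
    moreover have "qadd x (qscal (-1) qone) \<in> qalg K" using x qm by (auto simp: qalg_def qadd_def K_closed)
    ultimately have "qadd x (qscal (-1) qone) = (0, 0, 0, 0)" using rho_inj by blast
    then show "x = (1, 0, 0, 0)" by (cases x) (auto simp: qadd_def qscal_def qone_def)
  qed
  moreover have "\<rho> x = - mat 1 \<longrightarrow> x = (-1, 0, 0, 0)"
  proof
    assume "\<rho> x = - mat 1"
    then have "\<rho> (qadd x qone) = 0" using rho(2)[OF x q] rho(1) by simp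
    moreover have "qadd x qone \<in> qalg K" using x by (auto simp: qalg_def qadd_def qone_def K_closed)
    ultimately have "qadd x qone = (0, 0, 0, 0)" using rho_inj by blast
    then show "x = (-1, 0, 0, 0)" by (cases x) (auto simp: qadd_def qone_def)
  qed
  moreover have "qscal (-1) qone = (-1, 0, 0, 0)" by (simp add: qscal_def qone_def)
  ultimately show ?thesis using rm rho(1) by (auto simp: pm1_def qone_def)
qed

lemma rho_trace_4:
  assumes x: "(x0, x1, x2, x3) \<in> qalg K"
  shows "(tr2 (\<rho> (x0, x1, x2, x3)))\<^sup>2 = 4 \<longleftrightarrow> x0 * x0 = 1"
proof -
  have x0: "x0 \<in> K" using x by (auto simp: qalg_def)
  have m1: "\<sigma> (-1) = -1" by (rule field_emb_props(3)[OF K \<sigma>])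
  have "\<sigma> (x0 * x0 + -1) = \<sigma> x0 * \<sigma> x0 + \<sigma> (-1)" using \<sigma> x0 K_closed unfolding field_emb_def by metis
  then have e: "\<sigma> (x0 * x0 - 1) = \<sigma> x0 * \<sigma> x0 - 1" using m1 by simp
  have "(tr2 (\<rho> (x0, x1, x2, x3)))\<^sup>2 = 4 \<longleftrightarrow> \<sigma> x0 * \<sigma> x0 - 1 = 0"
    unfolding rho_trace[OF x] by (simp add: power2_eq_square)
  also have "\<dots> \<longleftrightarrow> x0 * x0 - 1 = 0"
    unfolding e[symmetric] using field_emb_props(1,2)[OF K \<sigma>] K_closed x0 by (metis diff_self)
  finally show ?thesis by simp
qed

end

section \<open>Transfer of trivial, parabolic and hyperbolic elements between components\<close>

locale agroup = zgroup +
  assumes arith: "\<exists>\<Delta>. irr_arith r \<Delta> \<and> \<Gamma> \<subseteq> \<Delta>"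
begin

text \<open>Commensurability puts a positive power of g into \<open>Gamma_AO\<close>, where
  triviality and trace plus or minus 2 are conditions on one quaternion and not on the
  component.\<close>

lemma power_arith:
  assumes g: "g \<in> \<Gamma>"
  shows "\<exists>n>0. \<forall>j<r. \<forall>k<r. (pm1 (mpow (g j) n) \<longrightarrow> pm1 (mpow (g k) n)) \<and>
      ((tr2 (mpow (g j) n))\<^sup>2 = 4 \<longrightarrow> (tr2 (mpow (g k) n))\<^sup>2 = 4)"
proof -
  obtain \<Delta> where \<Delta>: "irr_arith r \<Delta>" "\<Gamma> \<subseteq> \<Delta>" using arith by blast
  then obtain K a b Ord and \<sigma> :: "nat \<Rightarrow> real \<Rightarrow> real" and \<rho> where K: "number_field K" and ab: "a \<in> K" "b \<in> K" "a \<noteq> 0" "b \<noteq> 0"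
    and \<sigma>: "\<forall>i<r. field_emb K (\<sigma> i)" and \<rho>: "\<forall>i<r. alg_emb K a b (\<sigma> i) (\<rho> i)" and Ord: "is_order K a b Ord"
    and com: "commensurable \<Delta> (Gamma_AO r a b Ord \<rho>)"
    unfolding irr_arith_def by (elim conjE exE)
  let ?H = "\<Delta> \<inter> Gamma_AO r a b Ord \<rho>"
  let ?p = "\<lambda>n i. mpow (g i) n"
  have fin: "finite ((\<lambda>g. gmul g ` ?H) ` \<Delta>)" using com by (simp add: commensurable_def fin_index_def)
  have p: "?p n \<in> \<Delta>" for n using pow_G[OF g] \<Delta>(2) by blast
  have "(\<lambda>n. gmul (?p n) ` ?H) ` UNIV \<subseteq> (\<lambda>g. gmul g ` ?H) ` \<Delta>" using p by blast
  \<comment> \<open>Pigeonhole: infinitely many powers of g, finitely many cosets.\<close>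
  then have "\<not> inj (\<lambda>n. gmul (?p n) ` ?H)" using fin finite_subset finite_imageD infinite_UNIV_nat by blast
  then obtain m n where mn: "m < n" "gmul (?p m) ` ?H = gmul (?p n) ` ?H" unfolding inj_def by (metis linorder_neqE_nat)
  have one: "(\<lambda>i. mat 1) \<in> ?H"
  proof
    show "(\<lambda>i. mat 1) \<in> \<Delta>" using one_G \<Delta>(2) by blast
    have "gmul (\<lambda>i. mat 1) (\<lambda>i. if i < r then \<rho> i qone else mat 1) = (\<lambda>i. mat 1)"
      using \<rho> by (auto simp: gmul_def fun_eq_iff alg_emb_def)
    moreover have "(\<lambda>i. mat 1) \<in> signs r" "qone \<in> Ord" "qnrd a b qone = 1"
      using Ord by (auto simp: signs_def is_order_def qnrd_def qone_def)
    ultimately show "(\<lambda>i. mat 1) \<in> Gamma_AO r a b Ord \<rho>"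
      unfolding Gamma_AO_def by (intro CollectI exI[of _ "\<lambda>i. mat 1"] exI[of _ qone]) auto
  qed
  have "gmul (?p n) (\<lambda>i. mat 1) \<in> gmul (?p m) ` ?H" using one mn(2) by blast
  then obtain h where h: "h \<in> Gamma_AO r a b Ord \<rho>" "gmul (?p n) (\<lambda>i. mat 1) = gmul (?p m) h" by blast
  have hn: "h i = mpow (g i) (n - m)" for i
  proof -
    have "mpow (g i) m ** h i = mpow (g i) n" using fun_cong[OF h(2), of i] by (simp add: gmul_def matrix_mul_rid)
    also have "\<dots> = mpow (g i) m ** mpow (g i) (n - m)" using mpow_add[of "g i" m "n - m"] mn(1) by simp
    finally show ?thesis using inv2_cancel_left[OF det_mpow[OF det_G[OF g]]] by metis
  qed
  obtain s x where sx: "s \<in> signs r" "x \<in> Ord" "h = gmul s (\<lambda>i. if i < r then \<rho> i x else mat 1)"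
    using h(1) unfolding Gamma_AO_def by blast
  have xq: "x \<in> qalg K" using sx(2) Ord by (auto simp: is_order_def)
  obtain x0 x1 x2 x3 where xx: "x = (x0, x1, x2, x3)" by (cases x) auto
  have hi: "h i = \<rho> i x \<or> h i = - \<rho> i x" if "i < r" for i
    using sx that by (auto simp: gmul_def signs_def matrix_mul_lid)
  have pm: "pm1 (h i) \<longleftrightarrow> x = (1, 0, 0, 0) \<or> x = (-1, 0, 0, 0)" if "i < r" for i
  proof -
    have "pm1 (h i) \<longleftrightarrow> pm1 (\<rho> i x)" using hi[OF that] by (auto simp: pm1_def minus_equation_iff)
    then show ?thesis using rho_pm1[OF K ab, of "\<sigma> i" "\<rho> i" x] \<sigma> \<rho> that xq by simp
  qed
  have tr: "(tr2 (h i))\<^sup>2 = 4 \<longleftrightarrow> x0 * x0 = 1" if "i < r" for i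
  proof -
    have "(tr2 (h i))\<^sup>2 = (tr2 (\<rho> i x))\<^sup>2" using hi[OF that] by (auto simp: tr2_def power2_eq_square algebra_simps)
    then show ?thesis using rho_trace_4[OF K ab, of "\<sigma> i" "\<rho> i" x0 x1 x2 x3] \<sigma> \<rho> that xq xx by simp
  qed
  show ?thesis using pm tr mn(1) unfolding hn by (intro exI[of _ "n - m"]) auto
qed

lemma pm1_transfer_aux:
  assumes g: "g \<in> \<Gamma>" and jk: "j < r" "k < r" and pm: "pm1 (g j)"
  shows "\<bar>tr2 (g k)\<bar> \<le> 2 \<and> (\<bar>tr2 (g k)\<bar> = 2 \<longrightarrow> pm1 (g k))"
proof -
  obtain n where n: "n > 0" "pm1 (mpow (g j) n) \<longrightarrow> pm1 (mpow (g k) n)" using power_arith[OF g] jk by blast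
  then have pk: "pm1 (mpow (g k) n)" using pm1_mpow[OF pm] by blast
  have "\<not> \<bar>tr2 (g k)\<bar> > 2" using hyperbolic_pow[OF det_G[OF g] _ n(1), of k] pm1_tr2[OF pk] by auto
  then show ?thesis using parabolic_root_of_unity[OF det_G[OF g] _ n(1) pk] by auto
qed

text \<open>By \<open>power_arith\<close> the k-component is at first only of finite order up to
  sign, so it could be elliptic. In that case some commutator with g would be hyperbolic in
  component k although it is trivial in component j.\<close>

lemma pm1_transfer:
  assumes g: "g \<in> \<Gamma>" and jk: "j < r" "k < r" and pm: "pm1 (g j)"
  shows "pm1 (g k)"
proof (rule ccontr)
  assume np: "\<not> pm1 (g k)"
  then have l: "\<bar>tr2 (g k)\<bar> < 2" using pm1_transfer_aux[OF g jk pm] by linarith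
  obtain M where M: "det M = 1" "g k ** M - M ** g k \<noteq> 0" using noncommuting[of "g k"] l g by auto
  have "(\<lambda>h. (norm (g k ** h k ** mat 1 - mat 1 ** h k ** g k))\<^sup>2) \<in> polyfun r"
    by (rule norm_diff_mat2_pf[OF jk(2)])
  then have "(\<lambda>h. (norm (g k ** h k - h k ** g k))\<^sup>2) \<in> polyfun r" by (simp add: matrix_mul_rid matrix_mul_lid)
  then obtain h where h: "h \<in> \<Gamma>" "g k ** h k \<noteq> h k ** g k"
    using zariski_pick1[OF jk(2), of "\<lambda>h. (norm (g k ** h - h ** g k))\<^sup>2" M] M by auto
  let ?c = "\<lambda>i. g i ** h i ** inv2 (g i) ** inv2 (h i)"
  have "?c \<in> \<Gamma>" using g h(1) by (intro mult_G inv_G)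
  moreover have "pm1 (?c j)" using pm h(1) by (auto simp: pm1_def matrix_mul_lid matrix_mul_rid inv2_right)
  ultimately have "\<bar>tr2 (?c k)\<bar> \<le> 2" using pm1_transfer_aux[of ?c j k] jk by blast
  moreover have "tr2 (?c k) > 2" by (rule commutator_trace_gt2) (use g h l in auto)
  ultimately show False by simp
qed

text \<open>A power of g has trace plus or minus 2 in component k. This excludes hyperbolic g there;
  if g were elliptic there, that power would have bounded powers and be trivial, and so would a
  power of the parabolic component j.\<close>

lemma parabolic_transfer:
  assumes g: "g \<in> \<Gamma>" and jk: "j < r" "k < r" and t: "\<bar>tr2 (g j)\<bar> = 2" and np: "\<not> pm1 (g j)"
  shows "\<bar>tr2 (g k)\<bar> = 2 \<and> \<not> pm1 (g k)"
proof
  show npk: "\<not> pm1 (g k)" using pm1_transfer[OF g jk(2,1)] np by blast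
  obtain n where n: "n > 0" "pm1 (mpow (g k) n) \<longrightarrow> pm1 (mpow (g j) n)"
    "(tr2 (mpow (g j) n))\<^sup>2 = 4 \<longrightarrow> (tr2 (mpow (g k) n))\<^sup>2 = 4" using power_arith[OF g] jk by blast
  obtain s N where s: "s = 1 \<or> s = (-1::real)" "tr2 N = 0" "\<And>n. mpow (g j) n = s ^ n *\<^sub>R (mat 1 + real n *\<^sub>R N)"
    by (rule parabolic_form[OF det_G[OF g] t]) (rule that)
  have sn: "s ^ n * s ^ n = 1" using s(1) by (auto simp: power_mult_distrib[symmetric])
  have "tr2 (mpow (g j) n) = s ^ n * (2 + real n * tr2 N)" unfolding s(3) by (simp add: tr2_def algebra_simps)
  then have "(tr2 (mpow (g j) n))\<^sup>2 = 4" using s(2) sn by (simp add: power2_eq_square)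
  then have "(tr2 (mpow (g k) n))\<^sup>2 = 2\<^sup>2" using n(3) by simp
  then have tk: "\<bar>tr2 (mpow (g k) n)\<bar> = 2" using power2_eq_iff by fastforce
  show "\<bar>tr2 (g k)\<bar> = 2"
  proof (rule ccontr)
    assume "\<bar>tr2 (g k)\<bar> \<noteq> 2"
    then consider "\<bar>tr2 (g k)\<bar> > 2" | "\<bar>tr2 (g k)\<bar> < 2" by linarith
    then show False
    proof cases
      case 1
      then show False using hyperbolic_pow[OF det_G[OF g] _ n(1), of k] tk by auto
    next
      case 2
      obtain C where C: "\<And>n. norm (mpow (g k) n) \<le> C" using elliptic_bounded_powers[OF det_G[OF g] 2] by blast
      have "pm1 (mpow (g k) n)"
        by (rule parabolic_bounded_powers[OF det_mpow[OF det_G[OF g]] tk, of C]) (simp add: mpow_mult[symmetric] C)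
      then have "pm1 (mpow (g j) n)" using n(2) by blast
      then show False using parabolic_root_of_unity[OF det_G[OF g] t n(1)] np by blast
    qed
  qed
qed

lemma proj_sl2_group: "sl2_group (proj k \<Gamma>)"
proof
  show "mat 1 \<in> proj k \<Gamma>" unfolding proj_def by (rule image_eqI[OF _ one_G]) simp
  show "A ** B \<in> proj k \<Gamma>" if "A \<in> proj k \<Gamma>" "B \<in> proj k \<Gamma>" for A B
    using that mult_G unfolding proj_def by (auto intro!: image_eqI[OF _ mult_G])
  show "inv2 A \<in> proj k \<Gamma>" if "A \<in> proj k \<Gamma>" for A
    using that unfolding proj_def by (auto intro!: image_eqI[OF _ inv_G])
qed (auto simp: proj_def)

text \<open>Discreteness of the target excludes elliptic elements of infinite order, and one of
  finite order would force a trivial power in component j.\<close>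

lemma hyperbolic_transfer:
  assumes g: "g \<in> \<Gamma>" and jk: "j < r" "k < r" and disc: "discrete_grp (proj k \<Gamma>)" and t: "\<bar>tr2 (g j)\<bar> > 2"
  shows "\<bar>tr2 (g k)\<bar> > 2"
proof (rule ccontr)
  interpret sl2_group "proj k \<Gamma>" by (rule proj_sl2_group)
  interpret discrete_sl2_group "proj k \<Gamma>" by unfold_locales (rule disc)
  assume "\<not> ?thesis"
  then consider "\<bar>tr2 (g k)\<bar> = 2" | "\<bar>tr2 (g k)\<bar> < 2" by linarith
  then show False
  proof cases
    case 1
    have "\<not> pm1 (g k)" using pm1_transfer[OF g jk(2,1)] pm1_tr2[of "g j"] t by auto
    then show False using parabolic_transfer[OF g jk(2,1) 1] t by auto
  next
    case 2
    obtain n where n: "n > 0" "mpow (g k) n = mat 1" using elliptic_finite_order[OF _ 2] g by (auto simp: proj_def)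
    then have "pm1 (mpow (g j) n)" using pm1_transfer[OF pow_G[OF g, of n] jk(2,1)] by (simp add: pm1_def)
    then show False using pm1_tr2 hyperbolic_pow[OF det_G[OF g] t n(1)] by fastforce
  qed
qed

end

section \<open>The upper half-plane\<close>

lemma moeb_denom:
  fixes M :: mat2
  assumes "det M = 1" "Im z > 0" shows "of_real (M$2$1) * z + of_real (M$2$2) \<noteq> 0"
proof
  assume "of_real (M$2$1) * z + of_real (M$2$2) = 0"
  then have "M$2$1 * Re z + M$2$2 = 0" "M$2$1 * Im z = 0" by (simp_all add: complex_eq_iff)
  then have "M$2$1 = 0" "M$2$2 = 0" using assms(2) by auto
  then show False using assms(1) by (simp add: det2)
qed

lemma moeb_mult:
  assumes "det A = 1" "det B = 1" "Im z > 0"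
  shows "moeb (A ** B) z = moeb A (moeb B z)"
proof -
  let ?D = "of_real (B$2$1) * z + of_real (B$2$2)"
  have D: "?D \<noteq> 0" by (rule moeb_denom[OF assms(2,3)])
  have "moeb A (moeb B z) = (of_real (A$1$1) * (of_real (B$1$1) * z + of_real (B$1$2)) + of_real (A$1$2) * ?D) /
      (of_real (A$2$1) * (of_real (B$1$1) * z + of_real (B$1$2)) + of_real (A$2$2) * ?D)"
    unfolding moeb_def using D by (simp add: divide_simps)
  then show ?thesis by (simp add: moeb_def algebra_simps)
qed

lemma moeb_one [simp]: "moeb (mat 1) z = z"
  by (simp add: moeb_def)

lemma Im_moeb:
  assumes "det M = 1" "Im z > 0"
  shows "Im (moeb M z) = Im z / (cmod (of_real (M$2$1) * z + of_real (M$2$2)))\<^sup>2"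
proof -
  let ?D = "of_real (M$2$1) * z + of_real (M$2$2)"
  have "Im (moeb M z) = (det M * Im z) / (cmod ?D)\<^sup>2"
    unfolding moeb_def Im_divide cmod_power2 det2 by (simp add: algebra_simps power2_eq_square)
  then show ?thesis using assms(1) by simp
qed

lemma Im_moeb_pos: "det M = 1 \<Longrightarrow> Im z > 0 \<Longrightarrow> Im (moeb M z) > 0"
  using moeb_denom[of M z] by (simp add: Im_moeb)

lemma moeb_inv: "det M = 1 \<Longrightarrow> Im z > 0 \<Longrightarrow> moeb (inv2 M) (moeb M z) = z"
  and moeb_inv': "det M = 1 \<Longrightarrow> Im z > 0 \<Longrightarrow> moeb M (moeb (inv2 M) z) = z"
  by (simp_all add: moeb_mult[symmetric] inv2_left inv2_right)

lemma continuous_on_moeb: "det M = 1 \<Longrightarrow> continuous_on {z. Im z > 0} (moeb M)"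
  unfolding moeb_def by (intro continuous_intros) (auto dest: moeb_denom)

text \<open>Twice the hyperbolic cosine of the distance from z to \<open>\<i>\<close>.\<close>

definition qh :: "complex \<Rightarrow> real" where "qh z = ((cmod z)\<^sup>2 + 1) / Im z"

lemma qh_moeb:
  assumes "det M = 1" shows "qh (moeb M \<i>) = (norm M)\<^sup>2"
proof -
  let ?D = "of_real (M$2$1) * \<i> + of_real (M$2$2)"
  have D: "?D \<noteq> 0" by (rule moeb_denom[OF assms]) simp
  then have d: "(cmod ?D)\<^sup>2 \<noteq> 0" by simp
  have "qh (moeb M \<i>) = ((cmod (of_real (M$1$1) * \<i> + of_real (M$1$2)))\<^sup>2 / (cmod ?D)\<^sup>2 + 1) / (1 / (cmod ?D)\<^sup>2)"
    using Im_moeb[OF assms, of \<i>] by (simp add: qh_def) (simp add: moeb_def norm_divide power_divide)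
  also have "\<dots> = (cmod (of_real (M$1$1) * \<i> + of_real (M$1$2)))\<^sup>2 + (cmod ?D)\<^sup>2"
    using d by (simp add: field_simps)
  finally show ?thesis by (simp add: norm_mat2_sq cmod_power2)
qed

lemma half_plane_matrix:
  assumes "Im z > 0" obtains M where "det M = 1" "z = moeb M \<i>"
proof
  let ?s = "sqrt (Im z)"
  have s: "?s > 0" "?s * ?s = Im z" using assms by simp_all
  show "det (mk2 ?s (Re z / ?s) 0 (1 / ?s)) = 1" using s by (simp add: det2)
  show "z = moeb (mk2 ?s (Re z / ?s) 0 (1 / ?s)) \<i>"
    using s by (simp add: moeb_def complex_eq_iff)
qed

lemma path_component_moeb:
  assumes "path_component S z w" "S \<subseteq> {z. Im z > 0}" "det M = 1"
  shows "path_component (moeb M ` S) (moeb M z) (moeb M w)"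
proof -
  obtain g where g: "path g" "path_image g \<subseteq> S" "pathstart g = z" "pathfinish g = w"
    using assms(1) unfolding path_component_def by blast
  have "path (moeb M \<circ> g)"
    by (rule path_continuous_image[OF g(1) continuous_on_subset[OF continuous_on_moeb[OF assms(3)]]]) (use g(2) assms(2) in auto)
  then show ?thesis unfolding path_component_def
    by (rule exI[of _ "moeb M \<circ> g", OF conjI]) (use g in \<open>auto simp: path_image_compose pathstart_compose pathfinish_compose\<close>)
qed

section \<open>Crossing paths\<close>

definition clamp1 :: "real \<Rightarrow> real \<Rightarrow> real" where "clamp1 c t = max (- c) (min c t)"

lemma clamp1_eq: "\<bar>clamp1 c t\<bar> < c \<Longrightarrow> clamp1 c t = t"
  by (auto simp: clamp1_def max_def min_def split: if_splits)

lemma clamp1_le: "c \<ge> 0 \<Longrightarrow> \<bar>clamp1 c t\<bar> \<le> c"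
  by (auto simp: clamp1_def max_def min_def)

text \<open>In the coordinates \<open>(ln |z|, Re z / |z|)\<close> the half-plane becomes a strip; truncating
  both paths to a rectangle makes the Fashoda theorem applicable.\<close>

lemma paths_cross:
  assumes S: "S \<subseteq> {z. Im z > 0}" and T: "T \<subseteq> {z. Im z > 0}"
    and \<rho>: "0 < \<rho>" "\<And>z. z \<in> S \<Longrightarrow> \<bar>Re z / cmod z\<bar> < \<rho>"
    and \<Lambda>: "0 < \<Lambda>" "\<And>z. z \<in> T \<Longrightarrow> \<bar>ln (cmod z)\<bar> < \<Lambda>"
    and f: "path_component S a b" "ln (cmod a) \<le> - \<Lambda>" "ln (cmod b) \<ge> \<Lambda>"
    and g: "path_component T c d" "Re c / cmod c \<le> - \<rho>" "Re d / cmod d \<ge> \<rho>"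
  shows "S \<inter> T \<noteq> {}"
proof -
  obtain p where p: "path p" "path_image p \<subseteq> S" "pathstart p = a" "pathfinish p = b"
    using f(1) unfolding path_component_def by blast
  obtain k where k: "path k" "path_image k \<subseteq> T" "pathstart k = c" "pathfinish k = d"
    using g(1) unfolding path_component_def by blast
  have pS: "p t \<in> S" and kT: "k t \<in> T" if "t \<in> {0..1}" for t
    using p(2) k(2) that by (auto simp: path_image_def)
  have nz: "z \<noteq> 0" "cmod z > 0" if "Im z > 0" for z using that by auto
  have nS: "cmod (p t) \<noteq> 0" and nT: "cmod (k t) \<noteq> 0" if "t \<in> {0..1}" for t
    using pS[OF that] kT[OF that] S T by auto
  define vec2 where "vec2 u v = (\<chi> i::2. if i = 1 then u else v)" for u v :: real
  have v2: "vec2 u v $ 1 = u" "vec2 u v $ 2 = v" for u v by (simp_all add: vec2_def)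
  define P where "P t = vec2 (clamp1 \<Lambda> (ln (cmod (p t)))) (Re (p t) / cmod (p t))" for t
  define Q where "Q t = vec2 (ln (cmod (k t))) (clamp1 \<rho> (Re (k t) / cmod (k t)))" for t
  have cv: "path (\<lambda>t. vec2 (u t) (v t))" if "continuous_on {0..1} u" "continuous_on {0..1} v" for u v
  proof -
    have "continuous_on {0..1} (\<lambda>t. if i = 1 then u t else v t)" for i :: 2
      using that by (cases "i = 1") simp_all
    then show ?thesis unfolding path_def vec2_def by (rule continuous_on_vec_lambda)
  qed
  have pc: "continuous_on {0..1} p" and kc: "continuous_on {0..1} k" using p(1) k(1) by (auto simp: path_def)
  have pP: "path P" unfolding P_def clamp1_def
    by (intro cv continuous_intros pc) (use nS in auto)
  have pQ: "path Q" unfolding Q_def clamp1_def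
    by (intro cv continuous_intros kc) (use nT in auto)
  have ctop: "clamp1 c t = c" if "t \<ge> c" "c \<ge> 0" for c t using that by (simp add: clamp1_def)
  have cbot: "clamp1 c t = - c" if "t \<le> - c" "c \<ge> 0" for c t using that by (simp add: clamp1_def)
  let ?a = "vec2 (- \<Lambda>) (- \<rho>)" and ?b = "vec2 \<Lambda> \<rho>"
  have iP: "path_image P \<subseteq> cbox ?a ?b"
  proof
    fix x assume "x \<in> path_image P"
    then obtain t where t: "t \<in> {0..1}" "x = P t" by (auto simp: path_image_def)
    show "x \<in> cbox ?a ?b"
      using clamp1_le[of \<Lambda> "ln (cmod (p t))"] \<Lambda>(1) \<rho>(2)[OF pS[OF t(1)]]
      unfolding abs_le_iff abs_less_iff by (simp add: t(2) mem_box_cart forall_2 P_def v2)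
  qed
  have iQ: "path_image Q \<subseteq> cbox ?a ?b"
  proof
    fix x assume "x \<in> path_image Q"
    then obtain t where t: "t \<in> {0..1}" "x = Q t" by (auto simp: path_image_def)
    show "x \<in> cbox ?a ?b"
      using clamp1_le[of \<rho> "Re (k t) / cmod (k t)"] \<rho>(1) \<Lambda>(2)[OF kT[OF t(1)]]
      unfolding abs_le_iff abs_less_iff by (simp add: t(2) mem_box_cart forall_2 Q_def v2)
  qed
  have ends: "pathstart P $ 1 = ?a $ 1" "pathfinish P $ 1 = ?b $ 1" "pathstart Q $ 2 = ?a $ 2" "pathfinish Q $ 2 = ?b $ 2"
    using f(2,3) g(2,3) p(3,4) k(3,4) \<Lambda>(1) \<rho>(1)
    by (simp_all add: pathstart_def pathfinish_def P_def Q_def v2 ctop cbot)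
  obtain z where z: "z \<in> path_image P" "z \<in> path_image Q"
    by (rule fashoda[OF pP pQ iP iQ ends])
  then obtain t u where t: "t \<in> {0..1}" "z = P t" and u: "u \<in> {0..1}" "z = Q u" by (auto simp: path_image_def)
  have e1: "clamp1 \<Lambda> (ln (cmod (p t))) = ln (cmod (k u))" and e2: "Re (p t) / cmod (p t) = clamp1 \<rho> (Re (k u) / cmod (k u))"
    using t(2) u(2) by (metis P_def Q_def v2)+
  \<comment> \<open>A truncated value strictly inside the rectangle is the true value; the strict
    bounds on T and S apply to one coordinate each.\<close>
  have "ln (cmod (p t)) = ln (cmod (k u))" using clamp1_eq[of \<Lambda> "ln (cmod (p t))"] \<Lambda>(2)[OF kT[OF u(1)]] e1 by simp
  then have m: "cmod (p t) = cmod (k u)" using nS[OF t(1)] nT[OF u(1)] by simp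
  have "Re (p t) / cmod (p t) = Re (k u) / cmod (k u)"
    using clamp1_eq[of \<rho> "Re (k u) / cmod (k u)"] \<rho>(2)[OF pS[OF t(1)]] e2 by simp
  then have r: "Re (p t) = Re (k u)" using m nS[OF t(1)] by simp
  have "(Im (p t))\<^sup>2 = (Im (k u))\<^sup>2" using m r by (metis add_left_cancel cmod_power2)
  moreover have "Im (p t) > 0" "Im (k u) > 0" using pS[OF t(1)] kT[OF u(1)] S T by auto
  ultimately have "Im (p t) = Im (k u)" by (simp add: power2_eq_iff_nonneg)
  then have "p t = k u" using r by (simp add: complex_eq_iff)
  then show ?thesis using pS[OF t(1)] kT[OF u(1)] by auto
qed

lemma moeb_diag2:
  assumes "x \<noteq> 0" shows "moeb (diag2 x) z = of_real (x\<^sup>2) * z"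
  using assms by (simp add: moeb_def power2_eq_square)

lemma moeb_inv_diag2:
  assumes "x \<noteq> 0" shows "moeb (inv2 (diag2 x)) z = of_real (1 / x\<^sup>2) * z"
  using assms by (simp add: moeb_def power2_eq_square)

lemma moeb_conj:
  assumes "det Q = 1" "det Z = 1" "Im u > 0"
  shows "moeb (Q ** Z ** inv2 Q) (moeb Q u) = moeb Q (moeb Z u)"
proof -
  have "moeb (Q ** Z ** inv2 Q) (moeb Q u) = moeb (Q ** Z ** inv2 Q ** Q) u"
    by (rule moeb_mult[symmetric, OF _ assms(1,3)]) (simp add: det_mul assms)
  also have "\<dots> = moeb Q (moeb Z u)" unfolding inv2_cancel_right'[OF assms(1)] by (rule moeb_mult[OF assms])
  finally show ?thesis .
qed

lemma path_component_orbit: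
  assumes det: "det X = 1" and S: "S \<subseteq> {z. Im z > 0}" and inv: "\<And>z. z \<in> S \<Longrightarrow> moeb X z \<in> S"
    and pc: "path_component S z (moeb X z)"
  shows "path_component S z (moeb (mpow X n) z)"
proof (induction n)
  case 0
  have "z \<in> S" using pc by (rule path_component_mem)
  then show ?case by (simp add: path_component_refl)
next
  case (Suc n)
  have z: "Im z > 0" using path_component_mem[OF pc] S by auto
  have "path_component (moeb X ` S) (moeb X z) (moeb X (moeb (mpow X n) z))"
    by (rule path_component_moeb[OF Suc S det])
  then have "path_component S (moeb X z) (moeb X (moeb (mpow X n) z))"
    by (rule path_component_of_subset[rotated]) (use inv in auto)
  moreover have "moeb X (moeb (mpow X n) z) = moeb (mpow X (Suc n)) z"
    using moeb_mult[OF det det_mpow[OF det] z] by simp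
  ultimately show ?case using path_component_trans[OF pc] by simp
qed

text \<open>The quotient Im z / |z| does not change under scaling, so the cone over a compact set
  stays in a sector away from the real axis.\<close>

lemma scaled_sets_slope:
  assumes c: "compact C" "C \<subseteq> {z. Im z > 0}"
  shows "\<exists>s>0. s < 1 \<and> (\<forall>z\<in>C. \<forall>t>0. Im (of_real t * z) \<ge> s * cmod (of_real t * z))"
proof (cases "C = {}")
  case True then show ?thesis by (intro exI[of _ "1/2"]) auto
next
  case False
  have nz: "cmod z \<noteq> 0" if "z \<in> C" for z using c(2) that by auto
  have "continuous_on C (\<lambda>z. Im z / cmod z)" by (intro continuous_intros) (use nz in auto)
  then obtain z0 where z0: "z0 \<in> C" "\<And>z. z \<in> C \<Longrightarrow> Im z0 / cmod z0 \<le> Im z / cmod z"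
    using continuous_attains_inf[OF c(1) False] by blast
  define s where "s = min (1/2) (Im z0 / cmod z0)"
  have s: "s > 0" "s < 1" "s \<le> Im z0 / cmod z0" using z0(1) c(2) nz by (auto simp: s_def)
  have "Im (of_real t * z) \<ge> s * cmod (of_real t * z)" if "z \<in> C" "t > 0" for z t
  proof -
    have "s \<le> Im z / cmod z" using s(3) z0(2)[OF that(1)] by simp
    then have "s * cmod z \<le> Im z" using nz[OF that(1)] by (simp add: le_divide_eq split: if_splits)
    then have "t * (s * cmod z) \<le> t * Im z" using that(2) by (intro mult_left_mono) auto
    then show ?thesis using that(2) by (simp add: norm_mult mult_ac)
  qed
  then show ?thesis using s by blast
qed

text \<open>In such a sector the terms a w and b cannot cancel. Multiplication by
  \<open>cnj w\<close> exchanges their roles and gives the second bound.\<close>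

lemma slope_denominator:
  assumes "Im w \<ge> s * cmod w" "s > 0" "s < 1"
  shows "cmod (of_real a * w + of_real b) \<ge> s * \<bar>a\<bar> * cmod w" "cmod (of_real a * w + of_real b) \<ge> s * \<bar>b\<bar>"
proof -
  have w: "Im w \<ge> 0" using assms(1,2) by (smt (verit) mult_nonneg_nonneg norm_ge_zero)
  have "\<bar>a\<bar> * (s * cmod w) \<le> \<bar>a\<bar> * Im w" using assms(1) by (intro mult_left_mono) auto
  also have "\<dots> = \<bar>Im (of_real a * w + of_real b)\<bar>" using w by (simp add: abs_mult)
  also have "\<dots> \<le> cmod (of_real a * w + of_real b)" by (rule abs_Im_le_cmod)
  finally show "cmod (of_real a * w + of_real b) \<ge> s * \<bar>a\<bar> * cmod w" by (simp add: mult_ac)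
  show "cmod (of_real a * w + of_real b) \<ge> s * \<bar>b\<bar>"
  proof (cases "w = 0")
    case True
    have "s * \<bar>b\<bar> \<le> 1 * \<bar>b\<bar>" using assms(3) by (intro mult_right_mono) auto
    then show ?thesis using True by simp
  next
    case False
    have e: "cmod (of_real a * w + of_real b) * cmod w = cmod ((of_real a * w + of_real b) * cnj w)" by (simp add: norm_mult)
    have "(s * \<bar>b\<bar>) * cmod w \<le> \<bar>b\<bar> * Im w" using mult_left_mono[OF assms(1), of "\<bar>b\<bar>"] by (simp add: mult_ac)
    also have "\<dots> = \<bar>Im ((of_real a * w + of_real b) * cnj w)\<bar>" using w by (simp add: abs_mult algebra_simps)
    also have "\<dots> \<le> cmod (of_real a * w + of_real b) * cmod w" unfolding e by (rule abs_Im_le_cmod)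
    finally show ?thesis using False by simp
  qed
qed

text \<open>The axis of \<open>diag2 x\<close> is the imaginary axis, and the sign condition says
  that the fixed points of Y lie on both sides of 0. Iterating the two given path segments produces
  a path in S from near 0 to near infinity and one in T between neighbourhoods of the two fixed
  points; they must meet.\<close>

lemma cross_diag:
  assumes x: "\<bar>x\<bar> > 1" and Y: "det Y = 1" "Y$1$2 * Y$2$1 > 0"
    and S: "S \<subseteq> {z. Im z > 0}" "\<And>z. z \<in> S \<Longrightarrow> moeb (diag2 x) z \<in> S" "\<And>z. z \<in> S \<Longrightarrow> moeb (inv2 (diag2 x)) z \<in> S"
    and z: "path_component S z (moeb (diag2 x) z)"
    and T: "T \<subseteq> {z. Im z > 0}" "\<And>z. z \<in> T \<Longrightarrow> moeb Y z \<in> T" "\<And>z. z \<in> T \<Longrightarrow> moeb (inv2 Y) z \<in> T"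
    and w: "path_component T w (moeb Y w)"
  shows "S \<inter> T \<noteq> {}"
proof -
  have x0: "x \<noteq> 0" "x\<^sup>2 > 1" using x one_less_power[of "\<bar>x\<bar>" 2] by auto
  have dx: "det (diag2 x) = 1" using x0 by (intro det_diag2)
  have trY: "\<bar>tr2 Y\<bar> > 2"
  proof -
    have "(tr2 Y)\<^sup>2 = (Y$1$1 - Y$2$2)\<^sup>2 + 4 * (Y$1$2 * Y$2$1) + 4 * det Y"
      by (simp add: tr2_def det2 power2_eq_square algebra_simps)
    moreover have "(Y$1$1 - Y$2$2)\<^sup>2 \<ge> 0" by simp
    ultimately have "(tr2 Y)\<^sup>2 > 4" using Y by linarith
    then have "\<not> (tr2 Y)\<^sup>2 \<le> 2\<^sup>2" by simp
    then show ?thesis using abs_le_square_iff[of "tr2 Y" 2] by simp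
  qed
  obtain Q y where Q: "det Q = 1" "\<bar>y\<bar> > 1" "Y = Q ** diag2 y ** inv2 Q" by (rule hyperbolic_diag[OF Y(1) trY])
  have y0: "y \<noteq> 0" "y\<^sup>2 > 1" using Q(2) one_less_power[of "\<bar>y\<bar>" 2] by auto
  define A B C D where "A = Q$1$1" "B = Q$1$2" "C = Q$2$1" "D = Q$2$2"
  note ABCD = this
  \<comment> \<open>The fixed points of Y are A/C and B/D; the sign of ABCD is that of their
    product.\<close>
  have neg: "A * B * (C * D) < 0"
  proof -
    have "Y$1$2 * Y$2$1 = - (A * B * (C * D)) * (y - 1 / y)\<^sup>2"
      unfolding Q(3) by (simp add: ABCD power2_eq_square algebra_simps)
    then have "- (A * B * (C * D)) * (y - 1 / y)\<^sup>2 > 0" using Y(2) by simp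
    moreover have "y \<noteq> 1 / y" using y0 by (auto simp: field_simps power2_eq_square)
    then have "(y - 1 / y)\<^sup>2 > 0" by simp
    ultimately have "0 < - (A * B * (C * D))" by (rule zero_less_mult_pos2)
    then show ?thesis by simp
  qed
  then have nz: "A \<noteq> 0" "B \<noteq> 0" "C \<noteq> 0" "D \<noteq> 0" by auto
  have opp: "(A / C) * (B / D) < 0"
  proof -
    have "(A / C) * (B / D) = (A * B * (C * D)) / (C * D)\<^sup>2" using nz by (simp add: power2_eq_square)
    then show ?thesis using neg nz by (simp add: divide_neg_pos)
  qed
  have dyp: "det (diag2 y) = 1" using y0 by (intro det_diag2)
  have hQ: "moeb Q u = (of_real A * u + of_real B) / (of_real C * u + of_real D)" for u by (simp add: moeb_def ABCD)
  have cone: "Im (of_real t * c) > 0" if "t > 0" "Im c > 0" for t c using that by simp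
  obtain p where p: "path p" "path_image p \<subseteq> S" "pathstart p = z" "pathfinish p = moeb (diag2 x) z"
    using z unfolding path_component_def by blast
  obtain k where k: "path k" "path_image k \<subseteq> T" "pathstart k = w" "pathfinish k = moeb Y w"
    using w unfolding path_component_def by blast
  let ?C = "path_image p" and ?C' = "moeb (inv2 Q) ` path_image k"
  have C: "compact ?C" "?C \<subseteq> {z. Im z > 0}" using p(1,2) S(1) by (auto intro: compact_path_image)
  have C': "compact ?C'" "?C' \<subseteq> {z. Im z > 0}"
  proof -
    have sub: "path_image k \<subseteq> {z. Im z > 0}" using k(2) T(1) by blast
    show "compact ?C'"
      by (rule compact_continuous_image[OF continuous_on_subset[OF continuous_on_moeb sub] compact_path_image[OF k(1)]]) (simp add: Q)
    show "?C' \<subseteq> {z. Im z > 0}" using sub Im_moeb_pos[of "inv2 Q"] Q(1) by auto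
  qed
  obtain s where s: "s > 0" "s < 1" "\<And>c t. c \<in> ?C \<Longrightarrow> t > 0 \<Longrightarrow> Im (of_real t * c) \<ge> s * cmod (of_real t * c)"
    using scaled_sets_slope[OF C] by blast
  obtain s' where s': "s' > 0" "s' < 1" "\<And>c t. c \<in> ?C' \<Longrightarrow> t > 0 \<Longrightarrow> Im (of_real t * c) \<ge> s' * cmod (of_real t * c)"
    using scaled_sets_slope[OF C'] by blast
  \<comment> \<open>S and T themselves are not controlled near the boundary. They are cut down to
    the cones along the two axes over one path segment each, which are still invariant and contain
    the iterated paths.\<close>
  define S0 where "S0 = S \<inter> {of_real t * c | t c. t > 0 \<and> c \<in> ?C}"
  define T0 where "T0 = T \<inter> {moeb Q (of_real t * c) | t c. t > 0 \<and> c \<in> ?C'}"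
  have S0: "S0 \<subseteq> {z. Im z > 0}" "T0 \<subseteq> {z. Im z > 0}" using S(1) T(1) by (auto simp: S0_def T0_def)
  have S0i: "moeb (diag2 x) u \<in> S0" "moeb (inv2 (diag2 x)) u \<in> S0" if "u \<in> S0" for u
  proof -
    obtain t c where tc: "t > 0" "c \<in> ?C" "u = of_real t * c" and u: "u \<in> S" using \<open>u \<in> S0\<close> unfolding S0_def by blast
    have "moeb (diag2 x) u = of_real (x\<^sup>2 * t) * c" "x\<^sup>2 * t > 0" using x0 tc by (simp_all add: moeb_diag2)
    then show "moeb (diag2 x) u \<in> S0" using S(2)[OF u] tc(2) unfolding S0_def by blast
    have "moeb (inv2 (diag2 x)) u = of_real (1 / x\<^sup>2 * t) * c" "1 / x\<^sup>2 * t > 0" unfolding moeb_inv_diag2[OF x0(1)] using x0 tc by simp_all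
    then show "moeb (inv2 (diag2 x)) u \<in> S0" using S(3)[OF u] tc(2) unfolding S0_def by blast
  qed
  have YQ: "moeb Y (moeb Q u) = moeb Q (of_real (y\<^sup>2) * u)" "moeb (inv2 Y) (moeb Q u) = moeb Q (of_real (1 / y\<^sup>2) * u)" if u: "Im u > 0" for u
    unfolding Q(3) conj_inv2 moeb_diag2[OF y0(1), symmetric] moeb_inv_diag2[OF y0(1), symmetric]
    by (intro moeb_conj Q(1) u, simp add: dyp)+
  have T0i: "moeb Y u \<in> T0" "moeb (inv2 Y) u \<in> T0" if "u \<in> T0" for u
  proof -
    obtain t c where tc: "t > 0" "c \<in> ?C'" "u = moeb Q (of_real t * c)" and u: "u \<in> T" using \<open>u \<in> T0\<close> unfolding T0_def by blast
    have c: "Im (of_real t * c) > 0" using C'(2) tc(1,2) by (intro cone) auto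
    have "moeb Y u = moeb Q (of_real (y\<^sup>2 * t) * c)" "y\<^sup>2 * t > 0" using y0 tc YQ(1)[OF c] by (simp_all add: mult.assoc)
    then show "moeb Y u \<in> T0" using T(2)[OF u] tc(2) unfolding T0_def by blast
    have "moeb (inv2 Y) u = moeb Q (of_real (1 / y\<^sup>2 * t) * c)" "1 / y\<^sup>2 * t > 0" using y0 tc YQ(2)[OF c] by simp_all
    then show "moeb (inv2 Y) u \<in> T0" using T(3)[OF u] tc(2) unfolding T0_def by blast
  qed
  have pS0: "path_component S0 z (moeb (diag2 x) z)"
  proof -
    have "path_image p \<subseteq> S0"
    proof
      fix u assume u: "u \<in> path_image p"
      then have "u = of_real 1 * u" by simp
      then show "u \<in> S0" using u p(2) unfolding S0_def by (intro IntI CollectI exI[of _ 1] exI[of _ u]) auto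
    qed
    then show ?thesis using p unfolding path_component_def by blast
  qed
  have kT0: "path_component T0 w (moeb Y w)"
  proof -
    have "path_image k \<subseteq> T0"
    proof
      fix u assume u: "u \<in> path_image k"
      then have "Im u > 0" using k(2) T(1) by auto
      then have "u = moeb Q (of_real 1 * moeb (inv2 Q) u)" using Q(1) by (simp add: moeb_inv')
      then show "u \<in> T0" using u k(2) unfolding T0_def by (intro IntI CollectI exI[of _ 1] exI[of _ "moeb (inv2 Q) u"]) auto
    qed
    then show ?thesis using k unfolding path_component_def by blast
  qed
  have zw: "Im z > 0" "Im w > 0" using path_component_mem(1)[OF pS0] path_component_mem(1)[OF kT0] S0 by auto
  have inv_step: "path_component V u (moeb (inv2 M) u)"
    if "det M = 1" "V \<subseteq> {z. Im z > 0}" "\<And>u. u \<in> V \<Longrightarrow> moeb (inv2 M) u \<in> V" "path_component V u (moeb M u)" for V M u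
  proof -
    have u: "Im u > 0" using path_component_mem(1)[OF that(4)] that(2) by auto
    have "path_component (moeb (inv2 M) ` V) (moeb (inv2 M) u) (moeb (inv2 M) (moeb M u))"
      by (rule path_component_moeb[OF that(4,2)]) (simp add: that(1))
    then have "path_component V (moeb (inv2 M) u) (moeb (inv2 M) (moeb M u))"
      by (rule path_component_of_subset[rotated]) (use that(3) in auto)
    then show ?thesis using moeb_inv[OF that(1) u] by (simp add: path_component_sym)
  qed
  have S_orb: "path_component S0 z (moeb (mpow (diag2 x) n) z)" "path_component S0 z (moeb (mpow (inv2 (diag2 x)) n) z)" for n
    using path_component_orbit[OF dx S0(1) S0i(1) pS0]
      path_component_orbit[OF _ S0(1) S0i(2) inv_step[OF dx S0(1) S0i(2) pS0]] dx by auto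
  have T_orb: "path_component T0 w (moeb (mpow Y n) w)" "path_component T0 w (moeb (mpow (inv2 Y) n) w)" for n
    using path_component_orbit[OF Y(1) S0(2) T0i(1) kT0]
      path_component_orbit[OF _ S0(2) T0i(2) inv_step[OF Y(1) S0(2) T0i(2) kT0]] Y(1) by auto
  \<comment> \<open>Strictly between the bound for |Re u| / |u| on S0 and 1, the limit of this
    quotient towards the real fixed points of Y.\<close>
  define \<rho> where "\<rho> = (1 + sqrt (1 - s\<^sup>2)) / 2"
  have s2: "s\<^sup>2 < 1" "s\<^sup>2 > 0" using s by (auto simp: power_less_one_iff abs_square_less_1)
  have q1: "0 < sqrt (1 - s\<^sup>2)" "sqrt (1 - s\<^sup>2) < 1" using s2 by auto
  have \<rho>: "0 < \<rho>" "\<rho> < 1" "sqrt (1 - s\<^sup>2) < \<rho>"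
  proof -
    define q where "q = sqrt (1 - s\<^sup>2)"
    have "0 < q" "q < 1" "\<rho> = (1 + q) / 2" using q1 by (simp_all only: q_def \<rho>_def)
    then show "0 < \<rho>" "\<rho> < 1" "sqrt (1 - s\<^sup>2) < \<rho>" unfolding q_def[symmetric] by simp_all
  qed
  have \<rho>S: "\<bar>Re u / cmod u\<bar> < \<rho>" if "u \<in> S0" for u
  proof -
    obtain t c where tc: "t > 0" "c \<in> ?C" "u = of_real t * c" using \<open>u \<in> S0\<close> unfolding S0_def by blast
    have i: "Im u \<ge> s * cmod u" using s(3)[OF tc(2,1)] tc(3) by simp
    have u0: "cmod u > 0" using S0(1) that by auto
    have "(s * cmod u)\<^sup>2 \<le> (Im u)\<^sup>2" using i s(1) by (intro power_mono) auto
    then have "(Re u)\<^sup>2 \<le> (1 - s\<^sup>2) * (cmod u)\<^sup>2" using cmod_power2[of u] by (simp add: power_mult_distrib algebra_simps)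
    then have "(Re u / cmod u)\<^sup>2 \<le> 1 - s\<^sup>2" using u0 by (simp add: power_divide divide_le_eq)
    then have "\<bar>Re u / cmod u\<bar> \<le> sqrt (1 - s\<^sup>2)" by (rule real_le_rsqrt[of "\<bar>_\<bar>", unfolded power2_abs])
    then show ?thesis using \<rho>(3) by linarith
  qed
  \<comment> \<open>U and U' show that T0 lies in an annulus around 0, so that ln |u| is bounded on
    it.\<close>
  define U where "U = (\<bar>A / C\<bar> + \<bar>B / D\<bar>) / s'"
  define U' where "U' = (\<bar>C / A\<bar> + \<bar>D / B\<bar>) / s'"
  have U: "U > 0" "U' > 0" using nz s'(1) by (auto simp: U_def U'_def intro!: divide_pos_pos add_pos_pos)
  have ratio: "cmod (of_real a * u + of_real b) / cmod (of_real c * u + of_real d) \<le> (\<bar>a / c\<bar> + \<bar>b / d\<bar>) / s'"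
    if "Im u \<ge> s' * cmod u" "c \<noteq> 0" "d \<noteq> 0" "u \<noteq> 0" for u a b c d
  proof -
    let ?d = "cmod (of_real c * u + of_real d)"
    have d1: "?d \<ge> s' * \<bar>c\<bar> * cmod u" "?d \<ge> s' * \<bar>d\<bar>" by (rule slope_denominator[OF that(1) s'(1,2)])+
    have p1: "s' * \<bar>c\<bar> * cmod u > 0" "s' * \<bar>d\<bar> > 0" using s'(1) that by auto
    have "cmod (of_real a * u + of_real b) / ?d \<le> (\<bar>a\<bar> * cmod u + \<bar>b\<bar>) / ?d"
      by (intro divide_right_mono order_trans[OF norm_triangle_ineq]) (simp_all add: norm_mult)
    also have "\<dots> = \<bar>a\<bar> * cmod u / ?d + \<bar>b\<bar> / ?d" by (simp add: add_divide_distrib)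
    also have "\<dots> \<le> \<bar>a\<bar> * cmod u / (s' * \<bar>c\<bar> * cmod u) + \<bar>b\<bar> / (s' * \<bar>d\<bar>)"
      by (intro add_mono divide_left_mono d1 mult_pos_pos order_less_le_trans[OF p1(1) d1(1)] p1) auto
    also have "\<dots> = (\<bar>a / c\<bar> + \<bar>b / d\<bar>) / s'" using that s'(1) by (simp add: field_simps)
    finally show ?thesis .
  qed
  have UT: "cmod u \<le> U" "1 / cmod u \<le> U'" "cmod u > 0" if "u \<in> T0" for u
  proof -
    obtain t c where tc: "t > 0" "c \<in> ?C'" "u = moeb Q (of_real t * c)" using \<open>u \<in> T0\<close> unfolding T0_def by blast
    let ?v = "of_real t * c"
    have v: "Im ?v \<ge> s' * cmod ?v" by (rule s'(3)[OF tc(2,1)])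
    have v0: "?v \<noteq> 0" using tc C'(2) by auto
    have m: "cmod u = cmod (of_real A * ?v + of_real B) / cmod (of_real C * ?v + of_real D)"
      unfolding tc(3) hQ by (simp add: norm_divide)
    show "cmod u \<le> U" unfolding m U_def by (rule ratio[OF v nz(3,4) v0])
    show "1 / cmod u \<le> U'" unfolding m U'_def using ratio[OF v nz(1,2) v0, of C D] by simp
    show "cmod u > 0" using S0(2) that by auto
  qed
  define L where "L = \<bar>ln U\<bar> + \<bar>ln U'\<bar> + 1"
  have L0: "L > 0" by (simp add: L_def)
  have LT: "\<bar>ln (cmod u)\<bar> < L" if "u \<in> T0" for u
  proof -
    have "ln (cmod u) \<le> ln U" using UT[OF that] by (intro ln_mono) auto
    moreover have "ln (1 / cmod u) \<le> ln U'" using UT[OF that] by (intro ln_mono) auto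
    then have "- ln (cmod u) \<le> ln U'" using UT(3)[OF that] by (simp add: ln_div)
    ultimately show ?thesis unfolding L_def by linarith
  qed
  have X2: "ln (x\<^sup>2) > 0" using x0 by simp
  obtain n where n: "(L + \<bar>ln (cmod z)\<bar>) / ln (x\<^sup>2) < real n" using reals_Archimedean2 by blast
  then have n': "L + \<bar>ln (cmod z)\<bar> \<le> real n * ln (x\<^sup>2)" using X2 by (simp add: divide_less_eq less_imp_le)
  have z0: "cmod z > 0" using zw by auto
  have up: "ln (cmod (moeb (mpow (diag2 x) n) z)) \<ge> L"
  proof -
    have "moeb (mpow (diag2 x) n) z = of_real ((x\<^sup>2) ^ n) * z"
      using x0 by (simp add: mpow_diag2 moeb_diag2 power_sq_swap)
    then have "ln (cmod (moeb (mpow (diag2 x) n) z)) = real n * ln (x\<^sup>2) + ln (cmod z)"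
      using x0 z0 by (simp add: norm_mult norm_power ln_mult ln_realpow)
    then show ?thesis using n' by linarith
  qed
  have down: "ln (cmod (moeb (mpow (inv2 (diag2 x)) n) z)) \<le> - L"
  proof -
    have "mpow (inv2 (diag2 x)) n = inv2 (diag2 (x ^ n))" using x0 by (simp add: mpow_inv2 mpow_diag2)
    then have "moeb (mpow (inv2 (diag2 x)) n) z = of_real (1 / (x\<^sup>2) ^ n) * z"
      using x0 by (simp add: moeb_inv_diag2 power_sq_swap)
    then have "cmod (moeb (mpow (inv2 (diag2 x)) n) z) = \<bar>1 / (x\<^sup>2) ^ n\<bar> * cmod z"
      by (simp only: norm_mult norm_of_real)
    then have "cmod (moeb (mpow (inv2 (diag2 x)) n) z) = 1 / (x\<^sup>2) ^ n * cmod z" by simp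
    moreover have "1 / (x\<^sup>2) ^ n > 0" using x0 by simp
    ultimately have "ln (cmod (moeb (mpow (inv2 (diag2 x)) n) z)) = ln (1 / (x\<^sup>2) ^ n) + ln (cmod z)"
      using z0 by (simp only: ln_mult_pos)
    also have "ln (1 / (x\<^sup>2) ^ n) = - (real n * ln (x\<^sup>2))" using x0 by (simp add: ln_div ln_realpow)
    finally show ?thesis using n' by linarith
  qed
  define w' where "w' = moeb (inv2 Q) w"
  have w': "Im w' > 0" using Im_moeb_pos[of "inv2 Q" w] zw(2) Q(1) by (simp add: w'_def)
  then have w0: "w' \<noteq> 0" by auto
  have wQ: "w = moeb Q w'" using moeb_inv'[OF Q(1) zw(2)] by (simp add: w'_def)
  have Yn: "moeb (mpow Y n) w = moeb Q (of_real ((y\<^sup>2) ^ n) * w')" "moeb (mpow (inv2 Y) n) w = moeb Q (of_real (1 / (y\<^sup>2) ^ n) * w')" for n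
  proof -
    have y: "y ^ n \<noteq> 0" using y0 by simp
    show "moeb (mpow Y n) w = moeb Q (of_real ((y\<^sup>2) ^ n) * w')"
      unfolding wQ Q(3) mpow_hyperbolic[OF Q(1) y0(1)] power_sq_swap[symmetric] moeb_diag2[OF y, symmetric]
      by (intro moeb_conj Q(1) w' det_diag2 y)
    show "moeb (mpow (inv2 Y) n) w = moeb Q (of_real (1 / (y\<^sup>2) ^ n) * w')"
      unfolding wQ mpow_inv2 unfolding Q(3) mpow_hyperbolic[OF Q(1) y0(1)] conj_inv2 power_sq_swap[symmetric] moeb_inv_diag2[OF y, symmetric]
      by (intro moeb_conj Q(1) w') (simp add: det_diag2[OF y])
  qed
  have small: "(\<lambda>n. 1 / (y\<^sup>2) ^ n) \<longlonglongrightarrow> 0"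
    using LIMSEQ_realpow_zero[of "1 / y\<^sup>2"] y0 by (simp add: power_divide divide_less_eq)
  have smallc: "(\<lambda>n. of_real (1 / (y\<^sup>2) ^ n) :: complex) \<longlonglongrightarrow> 0" using tendsto_of_real[OF small, where 'a = complex] by (simp only: of_real_0)
  have lim2: "(\<lambda>n. moeb (mpow (inv2 Y) n) w) \<longlonglongrightarrow> of_real (B / D)"
  proof -
    have "(\<lambda>n. (of_real A * (of_real (1 / (y\<^sup>2) ^ n) * w') + of_real B) / (of_real C * (of_real (1 / (y\<^sup>2) ^ n) * w') + of_real D))
      \<longlonglongrightarrow> (of_real A * (0 * w') + of_real B) / (of_real C * (0 * w') + of_real D)"
      by (intro tendsto_intros smallc) (use nz in simp)
    then show ?thesis unfolding Yn hQ by simp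
  qed
  have lim1: "(\<lambda>n. moeb (mpow Y n) w) \<longlonglongrightarrow> of_real (A / C)"
  proof -
    have "(\<lambda>n. (of_real A * w' + of_real B * of_real (1 / (y\<^sup>2) ^ n)) / (of_real C * w' + of_real D * of_real (1 / (y\<^sup>2) ^ n)))
      \<longlonglongrightarrow> (of_real A * w' + of_real B * 0) / (of_real C * w' + of_real D * 0)"
      by (intro tendsto_intros smallc) (use nz w0 in simp)
    moreover have "(of_real A * w' + of_real B * of_real (1 / (y\<^sup>2) ^ n)) / (of_real C * w' + of_real D * of_real (1 / (y\<^sup>2) ^ n))
        = moeb (mpow Y n) w" for n
    proof -
      let ?t = "of_real ((y\<^sup>2) ^ n) :: complex"
      have t: "?t \<noteq> 0" using y0 by simp
      have i: "of_real (1 / (y\<^sup>2) ^ n) = 1 / ?t" by simp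
      have "(of_real A * w' + of_real B * (1 / ?t)) / (of_real C * w' + of_real D * (1 / ?t))
         = (?t * (of_real A * w' + of_real B * (1 / ?t))) / (?t * (of_real C * w' + of_real D * (1 / ?t)))"
        by (rule mult_divide_mult_cancel_left[symmetric, OF t])
      also have "\<dots> = moeb (mpow Y n) w" unfolding Yn hQ using t by (simp add: distrib_left) (simp add: mult_ac)
      finally show ?thesis unfolding i .
    qed
    ultimately show ?thesis using nz w0 by simp
  qed
  have th: "(\<lambda>n. Re (f n) / cmod (f n)) \<longlonglongrightarrow> sgn e" if "f \<longlonglongrightarrow> of_real e" "e \<noteq> 0" for f e
  proof -
    have "(\<lambda>n. Re (f n) / cmod (f n)) \<longlonglongrightarrow> Re (of_real e) / cmod (of_real e)"
      by (intro tendsto_intros that(1)) (use that(2) in simp)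
    then show ?thesis by (simp add: real_sgn_eq)
  qed
  have pos: "\<exists>n. Re (f n) / cmod (f n) \<ge> \<rho>" if "f \<longlonglongrightarrow> of_real e" "e > 0" for f e
  proof -
    have "\<forall>\<^sub>F n in sequentially. Re (f n) / cmod (f n) > \<rho>" by (rule order_tendstoD(1)[OF th[OF that(1)]]) (use that \<rho> in auto)
    from eventually_happens[OF this] show ?thesis by (auto intro: less_imp_le)
  qed
  have negx: "\<exists>n. Re (f n) / cmod (f n) \<le> - \<rho>" if "f \<longlonglongrightarrow> of_real e" "e < 0" for f e
  proof -
    have "\<forall>\<^sub>F n in sequentially. Re (f n) / cmod (f n) < - \<rho>" by (rule order_tendstoD(2)[OF th[OF that(1)]]) (use that \<rho> in auto)
    from eventually_happens[OF this] show ?thesis by (auto intro: less_imp_le)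
  qed
  \<comment> \<open>The sign of A/C decides whether the forward or the backward iterates approach
    the positive fixed point.\<close>
  have "\<exists>c d. path_component T0 c d \<and> Re c / cmod c \<le> - \<rho> \<and> Re d / cmod d \<ge> \<rho>"
  proof (cases "A / C > 0")
    case True
    then have "B / D < 0" using opp unfolding mult_less_0_iff by (meson less_asym)
    then obtain m where m: "Re (moeb (mpow (inv2 Y) m) w) / cmod (moeb (mpow (inv2 Y) m) w) \<le> - \<rho>" using negx[OF lim2] by blast
    obtain l where l: "Re (moeb (mpow Y l) w) / cmod (moeb (mpow Y l) w) \<ge> \<rho>" using pos[OF lim1 True] by blast
    show ?thesis using m l path_component_trans[OF path_component_sym[OF T_orb(2)] T_orb(1)] by blast
  next
    case False
    then have "A / C < 0" using nz by (simp add: not_less order_le_less)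
    then have bd: "B / D > 0" using opp unfolding mult_less_0_iff by (meson less_asym)
    obtain l where l: "Re (moeb (mpow Y l) w) / cmod (moeb (mpow Y l) w) \<le> - \<rho>" using negx[OF lim1 \<open>A / C < 0\<close>] by blast
    obtain m where m: "Re (moeb (mpow (inv2 Y) m) w) / cmod (moeb (mpow (inv2 Y) m) w) \<ge> \<rho>" using pos[OF lim2 bd] by blast
    show ?thesis using m l path_component_trans[OF path_component_sym[OF T_orb(1)] T_orb(2)] by blast
  qed
  then obtain c d where cd: "path_component T0 c d" "Re c / cmod c \<le> - \<rho>" "Re d / cmod d \<ge> \<rho>" by blast
  have "S0 \<inter> T0 \<noteq> {}"
    by (rule paths_cross[OF S0 \<rho>(1) \<rho>S L0 LT path_component_trans[OF path_component_sym[OF S_orb(2)] S_orb(1)] down up cd])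
  then show ?thesis unfolding S0_def T0_def by blast
qed

text \<open>In the eigenbasis of X the commutator has trace 2 - Y12 Y21 (x - 1/x)^2. A trace below 2
  thus means that the fixed points of X separate those of Y.\<close>

lemma crossing_axes:
  assumes X: "det X = 1" "\<bar>tr2 X\<bar> > 2" and Y: "det Y = 1" and tr: "tr2 (X ** Y ** inv2 X ** inv2 Y) < 2"
    and S: "S \<subseteq> {z. Im z > 0}" "\<And>z. z \<in> S \<Longrightarrow> moeb X z \<in> S" "\<And>z. z \<in> S \<Longrightarrow> moeb (inv2 X) z \<in> S"
    and z: "path_component S z (moeb X z)"
    and T: "T \<subseteq> {z. Im z > 0}" "\<And>z. z \<in> T \<Longrightarrow> moeb Y z \<in> T" "\<And>z. z \<in> T \<Longrightarrow> moeb (inv2 Y) z \<in> T"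
    and w: "path_component T w (moeb Y w)"
  shows "S \<inter> T \<noteq> {}"
proof -
  obtain P x where P: "det P = 1" "\<bar>x\<bar> > 1" "X = P ** diag2 x ** inv2 P" by (rule hyperbolic_diag[OF X])
  have x0: "x \<noteq> 0" using P(2) by auto
  have dx: "det (diag2 x) = 1" by (rule det_diag2[OF x0])
  define Y' where "Y' = inv2 P ** Y ** P"
  have YY: "Y = P ** Y' ** inv2 P" by (simp add: Y'_def conj_unconj P)
  have dY': "det Y' = 1" by (simp add: Y'_def det_mul P Y)
  have "X ** Y ** inv2 X ** inv2 Y = P ** (diag2 x ** Y' ** inv2 (diag2 x) ** inv2 Y') ** inv2 P"
    unfolding P(3) YY conj_inv2 by (simp only: conj_mult[OF P(1)])
  then have "tr2 (X ** Y ** inv2 X ** inv2 Y) = tr2 (diag2 x ** Y' ** inv2 (diag2 x) ** inv2 Y')"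
    using tr2_conj[OF P(1)] by simp
  also have "\<dots> = 2 * det Y' - Y'$1$2 * Y'$2$1 * (x - 1 / x)\<^sup>2"
    using x0 by (simp add: tr2_def det2 power2_eq_square field_simps)
  finally have "Y'$1$2 * Y'$2$1 * (x - 1 / x)\<^sup>2 > 0" using tr dY' by simp
  then have pos: "Y'$1$2 * Y'$2$1 > 0" by (simp add: zero_less_mult_iff not_less)
  have dP: "det (inv2 P) = 1" using P by simp
  have cX: "moeb (diag2 x) (moeb (inv2 P) u) = moeb (inv2 P) (moeb X u)" "moeb (inv2 (diag2 x)) (moeb (inv2 P) u) = moeb (inv2 P) (moeb (inv2 X) u)"
    and cY: "moeb Y' (moeb (inv2 P) u) = moeb (inv2 P) (moeb Y u)" "moeb (inv2 Y') (moeb (inv2 P) u) = moeb (inv2 P) (moeb (inv2 Y) u)"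
    if "Im u > 0" for u
  proof -
    have gen: "moeb Z (moeb (inv2 P) u) = moeb (inv2 P) (moeb (P ** Z ** inv2 P) u)" if "det Z = 1" for Z
      using moeb_conj[OF P(1) that Im_moeb_pos[OF dP \<open>Im u > 0\<close>]] Im_moeb_pos[OF that Im_moeb_pos[OF dP \<open>Im u > 0\<close>]]
      by (simp add: moeb_inv moeb_inv' P(1) \<open>Im u > 0\<close>)
    show "moeb (diag2 x) (moeb (inv2 P) u) = moeb (inv2 P) (moeb X u)" unfolding P(3) by (rule gen[OF dx])
    show "moeb (inv2 (diag2 x)) (moeb (inv2 P) u) = moeb (inv2 P) (moeb (inv2 X) u)"
      unfolding P(3) conj_inv2 by (rule gen) (simp add: dx)
    show "moeb Y' (moeb (inv2 P) u) = moeb (inv2 P) (moeb Y u)" using gen[OF dY'] unfolding YY[symmetric] .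
    show "moeb (inv2 Y') (moeb (inv2 P) u) = moeb (inv2 P) (moeb (inv2 Y) u)"
      using gen[of "inv2 Y'"] dY' unfolding conj_inv2[symmetric] YY[symmetric] by simp
  qed
  have zI: "Im z > 0" and wI: "Im w > 0" using path_component_mem(1)[OF z] path_component_mem(1)[OF w] S(1) T(1) by auto
  have "moeb (inv2 P) ` S \<inter> moeb (inv2 P) ` T \<noteq> {}"
  proof (rule cross_diag[OF P(2) dY' pos])
    show "moeb (inv2 P) ` S \<subseteq> {z. Im z > 0}" "moeb (inv2 P) ` T \<subseteq> {z. Im z > 0}"
      using S(1) T(1) Im_moeb_pos[OF dP] by auto
    show "moeb (diag2 x) u \<in> moeb (inv2 P) ` S" "moeb (inv2 (diag2 x)) u \<in> moeb (inv2 P) ` S" if "u \<in> moeb (inv2 P) ` S" for u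
      using that cX S by (auto intro!: imageI)
    show "moeb Y' u \<in> moeb (inv2 P) ` T" "moeb (inv2 Y') u \<in> moeb (inv2 P) ` T" if "u \<in> moeb (inv2 P) ` T" for u
      using that cY T by (auto intro!: imageI)
    show "path_component (moeb (inv2 P) ` S) (moeb (inv2 P) z) (moeb (diag2 x) (moeb (inv2 P) z))"
      unfolding cX(1)[OF zI] by (rule path_component_moeb[OF z S(1) dP])
    show "path_component (moeb (inv2 P) ` T) (moeb (inv2 P) w) (moeb Y' (moeb (inv2 P) w))"
      unfolding cY(1)[OF wI] by (rule path_component_moeb[OF w T(1) dP])
  qed
  then obtain u v where uv: "u \<in> S" "v \<in> T" "moeb (inv2 P) u = moeb (inv2 P) v" by blast
  then have "u = v" using moeb_inv'[OF P(1)] S(1) T(1) by (metis (mono_tags) mem_Collect_eq subsetD)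
  then show ?thesis using uv by blast
qed

section \<open>Discrete groups without crossing axes\<close>

lemma fricke_identity:
  fixes A B :: mat2
  shows "tr2 (A ** B ** inv2 A ** inv2 B) = (tr2 A)\<^sup>2 * det B + (tr2 B)\<^sup>2 * det A + (tr2 (A ** B))\<^sup>2
    - tr2 A * tr2 B * tr2 (A ** B) - 2 * det A * det B"
  by (simp add: tr2_def det2 power2_eq_square algebra_simps)

lemma scale_into_interval:
  fixes X t :: real
  assumes "X > 1" "t > 0"
  shows "\<exists>n. (1 \<le> X ^ n * t \<and> X ^ n * t \<le> X) \<or> (1 \<le> t / X ^ n \<and> t / X ^ n \<le> X)"
proof (cases "t \<le> X")
  case True
  then show ?thesis using scale_up_into_interval[OF assms] by blast
next
  case False
  then have t: "0 < X / t" "X / t \<le> X" using assms by (simp_all add: divide_le_eq)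
  obtain m where m: "1 \<le> X ^ m * (X / t)" "X ^ m * (X / t) \<le> X" using scale_up_into_interval[OF assms(1) t] by blast
  have p: "X ^ m > 0" using assms(1) by simp
  have "t \<le> X ^ m * X" using m(1) assms(2) by (simp add: le_divide_eq)
  then have "t / X ^ m \<le> X" using p by (simp add: divide_le_eq mult.commute)
  moreover have "X ^ m * X \<le> t * X" using m(2) assms(2) by (simp add: divide_le_eq mult.commute)
  then have "X ^ m \<le> t" using assms(1) by simp
  then have "1 \<le> t / X ^ m" using p by simp
  ultimately show ?thesis by blast
qed

text \<open>The types that can be carried over to another discrete component. Elliptic generators do
  not arise, because finite stabilisers are listed completely with the generator
  \<open>mat 1\<close>.\<close>

definition jump_type :: "mat2 \<Rightarrow> bool" where
  "jump_type w \<longleftrightarrow> w = mat 1 \<or> (\<bar>tr2 w\<bar> = 2 \<and> \<not> pm1 w) \<or> \<bar>tr2 w\<bar> > 2"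

text \<open>An algebraic substitute for the stabiliser of a component of the complement of the orbit
  neighbourhood; the trace condition excludes crossing axes.\<close>

locale noncrossing_group = discrete_sl2_group H for H +
  assumes noncrossing: "A \<in> H \<Longrightarrow> B \<in> H \<Longrightarrow> \<bar>tr2 A\<bar> > 2 \<Longrightarrow> tr2 (A ** B ** inv2 A ** inv2 B) \<ge> 2"
begin

text \<open>Every B in H turns out to be diagonal or antidiagonal in the eigenbasis of A, so it
  preserves the axis of A. Modulo powers of A it moves along the axis by at most one period, which
  leaves finitely many elements.\<close>

lemma hyperbolic_case:
  assumes A: "A \<in> H" "\<bar>tr2 A\<bar> > 2"
  shows "\<exists>E. finite E \<and> E \<subseteq> H \<and> (\<forall>B\<in>H. \<exists>n. \<exists>e\<in>E. B = mpow A n ** e \<or> B = mpow (inv2 A) n ** e)"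
proof -
  obtain S x where S: "det S = 1" "\<bar>x\<bar> > 1" "A = S ** diag2 x ** inv2 S" by (rule hyperbolic_diag[OF det1[OF A(1)] A(2)])
  have x0: "x \<noteq> 0" using S(2) by auto
  have X: "x\<^sup>2 > 1" using one_less_power[OF S(2), of 2] by simp
  define c where "c B = inv2 S ** B ** S" for B
  have cS: "S ** c B ** inv2 S = B" for B by (simp add: c_def conj_unconj S)
  have cm: "c (B ** C) = c B ** c C" for B C
  proof -
    have "S ** (c B ** c C) ** inv2 S = S ** c (B ** C) ** inv2 S" using conj_mult[OF S(1), of "c B" "c C"] cS by simp
    then show ?thesis by (metis unconj S(1))
  qed
  have ci: "c (inv2 B) = inv2 (c B)" for B by (simp add: c_def inv2_mult matrix_mul_assoc)
  have ct: "tr2 (c B) = tr2 B" for B using tr2_conj[OF S(1), of "c B"] cS by simp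
  have cd: "det (c B) = 1" if "B \<in> H" for B using det1[OF that] by (simp add: c_def det_mul S)
  have cA: "c (mpow A n) = diag2 (x ^ n)" for n
    unfolding S(3) mpow_hyperbolic[OF S(1) x0] by (simp add: c_def unconj S)
  have cA': "c (mpow (inv2 A) n) = inv2 (diag2 (x ^ n))" for n using cA[of n] by (simp add: mpow_inv2 ci)
  have An: "mpow A n \<in> H" "mpow (inv2 A) n \<in> H" for n using A(1) by (auto intro: mpow_mem inv)
  have nle: "norm B \<le> norm S * norm S * norm (c B)" for B using norm_conj_le[of S "c B" S] by (simp add: cS)
  have cfin: "finite {B \<in> H. norm (c B) \<le> R}" for R
  proof (rule finite_subset[OF _ finite_bounded[of "norm S * norm S * R"]], rule subsetI)
    fix B assume "B \<in> {B \<in> H. norm (c B) \<le> R}"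
    then have "B \<in> H" "norm S * norm S * norm (c B) \<le> norm S * norm S * R" by (auto intro: mult_left_mono)
    then show "B \<in> {A \<in> H. norm A \<le> norm S * norm S * R}" using nle[of B] by simp
  qed
  \<comment> \<open>The commutator of A and B has trace 2 - (c B)12 (c B)21 (x - 1/x)^2, so
    non-crossing determines the sign.\<close>
  have off: "(c B)$1$2 * (c B)$2$1 \<le> 0" if B: "B \<in> H" for B
  proof -
    have "2 \<le> tr2 (c (A ** B ** inv2 A ** inv2 B))" using noncrossing[OF A(1) B A(2)] by (simp only: ct)
    also have "c (A ** B ** inv2 A ** inv2 B) = diag2 x ** c B ** inv2 (diag2 x) ** inv2 (c B)"
      using cA[of 1] by (simp add: cm ci)
    also have "tr2 \<dots> = 2 * det (c B) - (c B)$1$2 * (c B)$2$1 * (x - 1 / x)\<^sup>2"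
      using x0 by (simp add: tr2_def det2 power2_eq_square field_simps)
    finally have "(c B)$1$2 * (c B)$2$1 * (x - 1 / x)\<^sup>2 \<le> 0" using cd[OF B] by simp
    moreover have "x \<noteq> 1 / x"
    proof
      assume "x = 1 / x"
      then have "x * x = 1" using x0 by (metis nonzero_divide_eq_eq mult_eq_0_iff)
      then show False using X by (simp add: power2_eq_square)
    qed
    then have "(x - 1 / x)\<^sup>2 > 0" by simp
    ultimately show ?thesis by (simp only: mult_le_0_iff) linarith
  qed
  \<comment> \<open>If exactly one off-diagonal entry vanishes, conjugation by powers of A shrinks
    the other and yields infinitely many elements of bounded norm.\<close>
  have nd: "q = 0 \<and> u = 0"
    if F: "\<And>n. F n \<in> H" "\<And>n. c (F n) = mk2 p (q / (x\<^sup>2) ^ n) (u / (x\<^sup>2) ^ n) v" for F p q u v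
  proof (rule ccontr)
    assume qu: "\<not> (q = 0 \<and> u = 0)"
    have "norm (c (F n)) \<le> \<bar>p\<bar> + \<bar>q\<bar> + \<bar>u\<bar> + \<bar>v\<bar>" for n
    proof -
      have "(x\<^sup>2) ^ n \<ge> 1" using X by (simp add: one_le_power)
      then have "\<bar>e\<bar> / (x\<^sup>2) ^ n \<le> \<bar>e\<bar> / 1" for e :: real by (intro divide_left_mono) auto
      from this[of q] this[of u] show ?thesis using norm_mat2_le_sum[of "c (F n)"] unfolding F(2) by simp
    qed
    then have "range F \<subseteq> {M \<in> H. norm (c M) \<le> \<bar>p\<bar> + \<bar>q\<bar> + \<bar>u\<bar> + \<bar>v\<bar>}" using F(1) by auto
    then have "finite (range F)" using cfin finite_subset by blast
    moreover have "inj F"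
    proof (rule injI)
      fix m n assume "F m = F n"
      then have "c (F m) $1$2 = c (F n) $1$2" "c (F m) $2$1 = c (F n) $2$1" by (simp_all only:)
      then have "(x\<^sup>2) ^ m = (x\<^sup>2) ^ n" unfolding F(2) using qu x0 by (auto simp: frac_eq_eq)
      then show "m = n" using X by (rule power_inject_exp[THEN iffD1, rotated])
    qed
    ultimately show False using finite_imageD infinite_UNIV_nat by blast
  qed
  have nondisc: "(c B)$1$2 = 0" if B: "B \<in> H" "(c B)$2$1 = 0" for B
  proof (rule nd[where F = "\<lambda>n. mpow (inv2 A) n ** B ** mpow A n" and u = 0, THEN conjunct1])
    show "mpow (inv2 A) n ** B ** mpow A n \<in> H" for n by (intro mult An B)
  qed (use x0 B(2) in \<open>simp add: cm cA cA' mat2_eq_iff power2_eq_square power_mult_distrib\<close>)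
  have nondisc': "(c B)$2$1 = 0" if B: "B \<in> H" "(c B)$1$2 = 0" for B
  proof (rule nd[where F = "\<lambda>n. mpow A n ** B ** mpow (inv2 A) n" and q = 0, THEN conjunct2])
    show "mpow A n ** B ** mpow (inv2 A) n \<in> H" for n by (intro mult An B)
  qed (use x0 B(2) in \<open>simp add: cm cA cA' mat2_eq_iff power2_eq_square power_mult_distrib\<close>)
  text \<open>If both off-diagonal entries were non-zero with negative product, the axes of
    \<open>A^n B\<close> and \<open>B A^n\<close> would cross for large \<open>n\<close>.\<close>
  have noneg: "(c B)$1$1 = 0" if B: "B \<in> H" and neg: "(c B)$1$2 * (c B)$2$1 < 0" for B
  proof (rule ccontr)
    assume p0: "(c B)$1$1 \<noteq> 0"
    define p q u v where "p = (c B)$1$1" "q = (c B)$1$2" "u = (c B)$2$1" "v = (c B)$2$2"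
    note pq = this
    \<comment> \<open>Replacing B by A^k B makes \<open>Z\<close> positive while the product q u of
      the off-diagonal entries stays the same.\<close>
    obtain k where k: "- (q * u) / p\<^sup>2 < (x\<^sup>2) ^ k" using real_arch_pow[OF X] by blast
    define p' where "p' = x ^ k * p"
    define B' where "B' = mpow A k ** B"
    have B': "B' \<in> H" unfolding B'_def using An B by (intro mult)
    have cB': "c B' = mk2 p' (x ^ k * q) (u / x ^ k) (v / x ^ k)"
      using x0 by (simp add: B'_def cm cA mat2_eq_iff p'_def pq)
    have e: "p'\<^sup>2 + q * u > 0"
    proof -
      have "- (q * u) < (x\<^sup>2) ^ k * p\<^sup>2" using k p0 by (simp only: pq[symmetric] divide_less_eq zero_less_power2 if_True not_False_eq_True)
      then show ?thesis by (simp add: p'_def power_mult_distrib power_sq_swap)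
    qed
    define v' where "v' = v / x ^ k"
    define Z where "Z = p'\<^sup>2 + q * u"
    have p'0: "p' \<noteq> 0" using p0 x0 by (simp add: p'_def pq)
    let ?M = "\<lambda>n. mpow A n ** B'" and ?N = "\<lambda>n. B' ** mpow A n"
    have MH: "?M n \<in> H" "?N n \<in> H" for n using An B' by (auto intro: mult)
    have trM: "tr2 (?M n) = x ^ n * p' + v' / x ^ n" "tr2 (?N n) = x ^ n * p' + v' / x ^ n" for n
      using x0 by (subst ct[symmetric], simp add: cm cA cB' tr2_def v'_def)+
    have trMN: "tr2 (?M n ** ?N n) = (x ^ n)\<^sup>2 * Z + (v'\<^sup>2 + q * u) / (x ^ n)\<^sup>2" for n
    proof -
      have "tr2 (?M n ** ?N n) = tr2 (diag2 (x ^ n) ** c B' ** (c B' ** diag2 (x ^ n)))"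
        by (subst ct[symmetric]) (simp only: cm cA)
      then show ?thesis using x0 unfolding cB'
        by (simp add: tr2_def Z_def v'_def power2_eq_square field_simps)
    qed
    define t where "t n = 1 / x ^ n" for n
    have t0: "t n \<noteq> 0" "x ^ n = 1 / t n" for n using x0 by (simp_all add: t_def)
    have tl: "t \<longlonglongrightarrow> 0"
    proof -
      have "\<bar>1 / x\<bar> < 1" using S(2) by simp
      then show ?thesis unfolding t_def[abs_def] using LIMSEQ_realpow_zero[of "1/x"] LIMSEQ_power_zero[of "1 / x"] by (simp add: power_divide)
    qed
    have h1: "(\<lambda>n. t n * tr2 (?M n)) \<longlonglongrightarrow> p'"
    proof -
      have "t n * tr2 (?M n) = p' + v' * (t n)\<^sup>2" for n
        unfolding trM using x0 by (simp add: t_def power2_eq_square field_simps)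
      moreover have "(\<lambda>n. p' + v' * (t n)\<^sup>2) \<longlonglongrightarrow> p' + v' * 0\<^sup>2" by (intro tendsto_intros tl)
      ultimately show ?thesis by simp
    qed
    have h2: "(\<lambda>n. (t n)\<^sup>2 * tr2 (?M n ** ?N n)) \<longlonglongrightarrow> Z"
    proof -
      have "(t n)\<^sup>2 * tr2 (?M n ** ?N n) = Z + (v'\<^sup>2 + q * u) * (t n)^4" for n
        unfolding trMN using x0 by (simp add: t_def power2_eq_square power4_eq_xxxx field_simps)
      moreover have "(\<lambda>n. Z + (v'\<^sup>2 + q * u) * (t n)^4) \<longlonglongrightarrow> Z + (v'\<^sup>2 + q * u) * 0^4" by (intro tendsto_intros tl)
      ultimately show ?thesis by simp
    qed
    have comm: "tr2 (?M n ** ?N n ** inv2 (?M n) ** inv2 (?N n)) = 2 * (tr2 (?M n))\<^sup>2 + (tr2 (?M n ** ?N n))\<^sup>2 - (tr2 (?M n))\<^sup>2 * tr2 (?M n ** ?N n) - 2" for n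
      unfolding fricke_identity using det1[OF MH(1)] det1[OF MH(2)] trM by (simp add: power2_eq_square)
    have h3: "(\<lambda>n. (t n)^4 * tr2 (?M n ** ?N n ** inv2 (?M n) ** inv2 (?N n))) \<longlonglongrightarrow> Z\<^sup>2 - p'\<^sup>2 * Z"
    proof -
      have "(t n)^4 * tr2 (?M n ** ?N n ** inv2 (?M n) ** inv2 (?N n))
        = 2 * (t n * tr2 (?M n))\<^sup>2 * (t n)\<^sup>2 + ((t n)\<^sup>2 * tr2 (?M n ** ?N n))\<^sup>2 - (t n * tr2 (?M n))\<^sup>2 * ((t n)\<^sup>2 * tr2 (?M n ** ?N n)) - 2 * (t n)^4" for n
        unfolding comm by (simp add: power2_eq_square power4_eq_xxxx algebra_simps)
      moreover have "(\<lambda>n. 2 * (t n * tr2 (?M n))\<^sup>2 * (t n)\<^sup>2 + ((t n)\<^sup>2 * tr2 (?M n ** ?N n))\<^sup>2 - (t n * tr2 (?M n))\<^sup>2 * ((t n)\<^sup>2 * tr2 (?M n ** ?N n)) - 2 * (t n)^4)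
        \<longlonglongrightarrow> 2 * p'\<^sup>2 * 0\<^sup>2 + Z\<^sup>2 - p'\<^sup>2 * Z - 2 * 0^4" by (intro tendsto_intros h1 h2 tl)
      ultimately show ?thesis by simp
    qed
    \<comment> \<open>The leading coefficient of the commutator trace of A^n B' and B' A^n; its
      negative sign contradicts the bound 2.\<close>
    have "Z\<^sup>2 - p'\<^sup>2 * Z = Z * (q * u)" by (simp add: Z_def power2_eq_square algebra_simps)
    also have "\<dots> < 0" using e neg by (simp add: Z_def pq mult_less_0_iff)
    finally have "\<forall>\<^sub>F n in sequentially. (t n)^4 * tr2 (?M n ** ?N n ** inv2 (?M n) ** inv2 (?N n)) < 0"
      using order_tendstoD(2)[OF h3] by blast
    moreover have "\<forall>\<^sub>F n in sequentially. \<bar>t n * tr2 (?M n)\<bar> > \<bar>p'\<bar> / 2"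
      by (rule order_tendstoD(1)[OF tendsto_rabs[OF h1]]) (use p'0 in simp)
    moreover have "\<forall>\<^sub>F n in sequentially. \<bar>t n\<bar> < \<bar>p'\<bar> / 4"
      by (rule order_tendstoD(2)[OF tendsto_rabs[OF tl]]) (use p'0 in simp)
    ultimately have "\<forall>\<^sub>F n in sequentially. False"
    proof eventually_elim
      case (elim n)
      have "\<bar>t n\<bar> * \<bar>tr2 (?M n)\<bar> > \<bar>t n\<bar> * 2" using elim(2,3) by (simp add: abs_mult)
      then have "\<bar>tr2 (?M n)\<bar> > 2" using t0(1)[of n] by (simp add: mult_less_cancel_left)
      then have "tr2 (?M n ** ?N n ** inv2 (?M n) ** inv2 (?N n)) \<ge> 2" by (rule noncrossing[OF MH])
      moreover have "(t n)^4 \<ge> 0" by simp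
      ultimately have "(t n)^4 * tr2 (?M n ** ?N n ** inv2 (?M n) ** inv2 (?N n)) \<ge> 0" by (intro mult_nonneg_nonneg) auto
      then show False using elim(1) by simp
    qed
    then show False by simp
  qed
  have shape: "((c B)$1$2 = 0 \<and> (c B)$2$1 = 0) \<or> ((c B)$1$1 = 0 \<and> (c B)$2$2 = 0)" if B: "B \<in> H" for B
  proof (cases "(c B)$1$2 * (c B)$2$1 = 0")
    case True
    then show ?thesis using nondisc[OF B] nondisc'[OF B] by auto
  next
    case False
    then have neg: "(c B)$1$2 * (c B)$2$1 < 0" using off[OF B] by linarith
    have "(c B)$1$1 = 0" by (rule noneg[OF B neg])
    moreover have "(c (inv2 B))$1$1 = 0" by (rule noneg[OF inv[OF B]]) (use neg in \<open>simp add: ci\<close>)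
    ultimately show ?thesis by (simp add: ci)
  qed
  \<comment> \<open>Large enough for the representatives whose parameter s has been brought into
    [1, |x|] by a power of A.\<close>
  define E where "E = {B \<in> H. norm (c B) \<le> \<bar>x\<bar> + 1}"
  have "\<exists>n. \<exists>e\<in>E. B = mpow A n ** e \<or> B = mpow (inv2 A) n ** e" if B: "B \<in> H" for B
  proof -
    define s where "s = (if (c B)$1$2 = 0 then (c B)$1$1 else (c B)$1$2)"
    have sc: "(c B = mk2 s 0 0 (1 / s) \<or> c B = mk2 0 s (- 1 / s) 0) \<and> s \<noteq> 0"
    proof (cases "(c B)$1$2 = 0")
      case True
      then have z: "(c B)$1$1 * (c B)$2$2 = 1" "(c B)$2$1 = 0" using cd[OF B] nondisc'[OF B] by (simp_all add: det2)
      then have "(c B)$1$1 \<noteq> 0" by auto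
      moreover from this have "(c B)$2$2 = 1 / (c B)$1$1" using z(1) by (simp add: field_simps)
      ultimately show ?thesis using True z(2) by (simp add: s_def mat2_eq_iff)
    next
      case False
      then have p: "(c B)$1$1 = 0" "(c B)$2$2 = 0" using shape[OF B] by auto
      then have "(c B)$1$2 * (c B)$2$1 = -1" using cd[OF B] by (simp add: det2)
      then have "(c B)$2$1 = - 1 / (c B)$1$2" using False by (simp add: field_simps)
      then show ?thesis using False p by (simp add: s_def mat2_eq_iff)
    qed
    then have s0: "\<bar>s\<bar> > 0" by simp
    have bd: "norm (c C) \<le> \<bar>x\<bar> + 1"
      if "c C = mk2 s' 0 0 (1 / s') \<or> c C = mk2 0 s' (- 1 / s') 0" "1 \<le> \<bar>s'\<bar>" "\<bar>s'\<bar> \<le> \<bar>x\<bar>" for C s'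
    proof -
      have i: "1 / \<bar>s'\<bar> \<le> 1" using that(2) by simp
      have "norm (c C) \<le> \<bar>s'\<bar> + 1 / \<bar>s'\<bar>" using that(1) norm_mat2_le_sum[of "c C"] by auto
      then show ?thesis using i that(3) by linarith
    qed
    have AB: "c (mpow A n ** B) = mk2 (x ^ n * s) 0 0 (1 / (x ^ n * s)) \<or> c (mpow A n ** B) = mk2 0 (x ^ n * s) (- 1 / (x ^ n * s)) 0"
      and AB': "c (mpow (inv2 A) n ** B) = mk2 (s / x ^ n) 0 0 (1 / (s / x ^ n)) \<or> c (mpow (inv2 A) n ** B) = mk2 0 (s / x ^ n) (- 1 / (s / x ^ n)) 0" for n
      using sc x0 by (auto simp: cm cA cA' mat2_eq_iff)
    obtain n where "(1 \<le> \<bar>x\<bar> ^ n * \<bar>s\<bar> \<and> \<bar>x\<bar> ^ n * \<bar>s\<bar> \<le> \<bar>x\<bar>) \<or> (1 \<le> \<bar>s\<bar> / \<bar>x\<bar> ^ n \<and> \<bar>s\<bar> / \<bar>x\<bar> ^ n \<le> \<bar>x\<bar>)"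
      using scale_into_interval[OF S(2) s0] by blast
    then show ?thesis
    proof
      assume "1 \<le> \<bar>x\<bar> ^ n * \<bar>s\<bar> \<and> \<bar>x\<bar> ^ n * \<bar>s\<bar> \<le> \<bar>x\<bar>"
      then have "mpow A n ** B \<in> E" unfolding E_def using mult[OF An(1)[of n] B] bd[OF AB[of n]] by (simp add: abs_mult power_abs)
      moreover have "B = mpow (inv2 A) n ** (mpow A n ** B)"
        using inv2_cancel_left[OF det1[OF An(1)[of n]], of B] by (simp add: mpow_inv2)
      ultimately show ?thesis by blast
    next
      assume "1 \<le> \<bar>s\<bar> / \<bar>x\<bar> ^ n \<and> \<bar>s\<bar> / \<bar>x\<bar> ^ n \<le> \<bar>x\<bar>"
      then have "mpow (inv2 A) n ** B \<in> E" unfolding E_def using mult[OF An(2)[of n] B] bd[OF AB'[of n]] by (simp add: power_abs)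
      moreover have "B = mpow A n ** (mpow (inv2 A) n ** B)"
        using inv2_cancel_left'[OF det1[OF An(1)[of n]], of B] by (simp add: mpow_inv2)
      ultimately show ?thesis by blast
    qed
  qed
  moreover have "finite E" unfolding E_def by (rule cfin)
  ultimately show ?thesis by (intro exI[of _ E]) (auto simp: E_def)
qed

text \<open>An element not commuting with A would give a hyperbolic commutator. So H lies in the
  centraliser of A, a group of rotations u + v A whose coefficients are bounded by a definite
  form.\<close>

lemma elliptic_case:
  assumes A: "A \<in> H" "\<bar>tr2 A\<bar> < 2" and nh: "\<And>B. B \<in> H \<Longrightarrow> \<bar>tr2 B\<bar> \<le> 2"
  shows "finite H"
proof -
  define a b c e where "a = A$1$1" "b = A$1$2" "c = A$2$1" "e = A$2$2"
  note abce = this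
  have dt: "a * e - b * c = 1" using det1[OF A(1)] by (simp add: abce det2)
  define \<tau> where "\<tau> = a + e"
  have \<tau>: "\<tau>\<^sup>2 < 4"
  proof -
    have "(tr2 A)\<^sup>2 < 2\<^sup>2" using A(2) by (metis abs_numeral power2_abs power_strict_mono abs_ge_zero pos2)
    then show ?thesis by (simp add: \<tau>_def abce tr2_def)
  qed
  have "(a - e)\<^sup>2 + 4 * (b * c) < 0"
  proof -
    have "(a - e)\<^sup>2 + 4 * (b * c) = \<tau>\<^sup>2 - 4 * (a * e - b * c)" by (simp add: \<tau>_def power2_eq_square algebra_simps)
    then show ?thesis using \<tau> dt by simp
  qed
  moreover have "(a - e)\<^sup>2 \<ge> 0" by simp
  ultimately have "b * c < 0" by linarith
  then have b0: "b \<noteq> 0" by auto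
  have d4: "4 - \<tau>\<^sup>2 > 0" using \<tau> by linarith
  define K where "K = sqrt (4 / (4 - \<tau>\<^sup>2))"
  have bdd: "norm B \<le> 2 * K + K * norm A" if B: "B \<in> H" for B
  proof -
    have comm: "A ** B = B ** A"
    proof (rule ccontr)
      assume "A ** B \<noteq> B ** A"
      then have "tr2 (A ** B ** inv2 A ** inv2 B) > 2" by (rule commutator_trace_gt2[OF det1[OF A(1)] det1[OF B] A(2)])
      moreover have "\<bar>tr2 (A ** B ** inv2 A ** inv2 B)\<bar> \<le> 2" by (rule nh[OF mult[OF mult[OF mult[OF A(1) B] inv[OF A(1)]] inv[OF B]]])
      ultimately show False by simp
    qed
    define v where "v = B$1$2 / b"
    define u where "u = B$1$1 - v * a"
    have c1: "b * B$2$1 = B$1$2 * c" "a * B$1$2 + b * B$2$2 = B$1$1 * b + B$1$2 * e"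
    proof -
      have "(A ** B)$1$1 = (B ** A)$1$1" "(A ** B)$1$2 = (B ** A)$1$2" unfolding comm by (rule refl)+
      then show "b * B$2$1 = B$1$2 * c" "a * B$1$2 + b * B$2$2 = B$1$1 * b + B$1$2 * e"
        unfolding mat2_mult_nth abce by (simp_all add: mult.commute)
    qed
    have Bf: "B = u *\<^sub>R mat 1 + v *\<^sub>R A"
    proof -
      have "B$2$1 = v * c" using c1(1) b0 by (simp add: v_def field_simps)
      moreover have "B$2$2 = u + v * e" using c1(2) b0 by (simp add: u_def v_def field_simps)
      moreover have "B$1$2 = v * b" using b0 by (simp add: v_def)
      ultimately show ?thesis by (simp add: mat2_eq_iff u_def abce)
    qed
    have "det B = u\<^sup>2 + u * v * \<tau> + v\<^sup>2 * (a * e - b * c)"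
      by (simp add: Bf det2 abce[symmetric] \<tau>_def power2_eq_square algebra_simps)
    then have q: "u\<^sup>2 + u * v * \<tau> + v\<^sup>2 = 1" using det1[OF B] dt by simp
    have "v\<^sup>2 * (4 - \<tau>\<^sup>2) = 4 * (u\<^sup>2 + u * v * \<tau> + v\<^sup>2) - (2 * u + v * \<tau>)\<^sup>2"
      "u\<^sup>2 * (4 - \<tau>\<^sup>2) = 4 * (u\<^sup>2 + u * v * \<tau> + v\<^sup>2) - (2 * v + u * \<tau>)\<^sup>2"
      by (simp_all add: power2_eq_square algebra_simps)
    moreover have "(2 * u + v * \<tau>)\<^sup>2 \<ge> 0" "(2 * v + u * \<tau>)\<^sup>2 \<ge> 0" by (rule zero_le_power2)+
    ultimately have "v\<^sup>2 * (4 - \<tau>\<^sup>2) \<le> 4" "u\<^sup>2 * (4 - \<tau>\<^sup>2) \<le> 4" unfolding q by linarith+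
    then have "v\<^sup>2 \<le> 4 / (4 - \<tau>\<^sup>2)" "u\<^sup>2 \<le> 4 / (4 - \<tau>\<^sup>2)" by (simp_all only: pos_le_divide_eq[OF d4])
    then have "sqrt (v\<^sup>2) \<le> K" "sqrt (u\<^sup>2) \<le> K" unfolding K_def by (auto intro: real_sqrt_le_mono simp only:)
    then have uv: "\<bar>v\<bar> \<le> K" "\<bar>u\<bar> \<le> K" unfolding real_sqrt_abs .
    have n1: "norm (mat 1 :: mat2) \<le> 2" by (rule pm1_norm) (simp add: pm1_def)
    have 1: "norm B \<le> norm (u *\<^sub>R (mat 1 :: mat2)) + norm (v *\<^sub>R A)"
      using norm_triangle_ineq[of "u *\<^sub>R mat 1" "v *\<^sub>R A"] Bf by metis
    have 2: "norm (u *\<^sub>R (mat 1 :: mat2)) \<le> K * 2"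
      unfolding norm_scaleR by (rule mult_mono[OF uv(2) n1 order_trans[OF abs_ge_zero uv(2)] norm_ge_zero])
    have 3: "norm (v *\<^sub>R A) \<le> K * norm A"
      unfolding norm_scaleR by (rule mult_right_mono[OF uv(1) norm_ge_zero])
    show ?thesis using order_trans[OF 1 add_mono[OF 2 3]] by (metis mult.commute)
  qed
  have "H \<subseteq> {M \<in> H. norm M \<le> 2 * K + K * norm A}"
  proof (rule subsetI, rule CollectI, rule conjI, assumption)
    fix B assume "B \<in> H"
    then show "norm B \<le> 2 * K + K * norm A" by (rule bdd)
  qed
  then show ?thesis by (rule finite_subset[OF _ finite_bounded])
qed

text \<open>On traceless matrices - det is a form of signature (2,1), polar to the trace form; two
  orthogonal isotropic vectors are proportional.\<close>

lemma nilpotent_proportional: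
  fixes N N' :: mat2
  assumes "tr2 N = 0" "det N = 0" "tr2 N' = 0" "det N' = 0" "tr2 (N ** N') = 0" "N \<noteq> 0"
  shows "\<exists>k. N' = k *\<^sub>R N"
proof -
  define p q r where "p = N$1$1" "q = N$1$2" "r = N$2$1"
  note N = this
  define p' q' r' where "p' = N'$1$1" "q' = N'$1$2" "r' = N'$2$1"
  note N' = this
  have d: "N$2$2 = - p" "N'$2$2 = - p'" using assms(1,3) by (simp_all add: tr2_def N N')
  have n: "p * p + q * r = 0" "p' * p' + q' * r' = 0" using assms(2,4) by (simp_all add: det2 d N[symmetric] N'[symmetric])
  have t: "2 * (p * p') + q * r' + r * q' = 0" using assms(5) by (simp add: tr2_def d N[symmetric] N'[symmetric] algebra_simps)
  show ?thesis
  proof (cases "q = 0")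
    case True
    then have p: "p = 0" using n(1) by simp
    have r: "r \<noteq> 0" using assms(6) True p by (auto simp: mat2_eq_iff d N[symmetric])
    have "q' = 0" using t True p r by simp
    moreover have "p' = 0" using n(2) \<open>q' = 0\<close> by simp
    ultimately show ?thesis using r True p by (intro exI[of _ "r' / r"]) (simp add: mat2_eq_iff d N[symmetric] N'[symmetric])
  next
    case False
    have "(q * p' - p * q')\<^sup>2 = - (q * q') * (2 * (p * p') + q * r' + r * q') + q\<^sup>2 * (p' * p' + q' * r') + q'\<^sup>2 * (p * p + q * r)"
      by (simp add: power2_eq_square algebra_simps)
    then have "q * p' = p * q'" unfolding n t by simp
    then have p': "p' = q' / q * p" using False by (simp add: field_simps)
    have r: "r = - (p * p) / q" using n(1) False by (simp add: field_simps)
    have "q * q * r' = q' * q * r"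
    proof -
      have "q * (2 * (p * p') + q * r' + r * q') = 0" using t by simp
      then have "q * q * r' = - (2 * p * (q * p')) - q * r * q'" by (simp add: algebra_simps)
      also have "\<dots> = - (2 * (p * p) * q') - q * r * q'" unfolding \<open>q * p' = p * q'\<close> by simp
      also have "p * p = - (q * r)" using n(1) by simp
      finally show ?thesis by simp
    qed
    then have "r' = q' / q * r" using False by (simp add: field_simps)
    then show ?thesis using p' False by (intro exI[of _ "q' / q"]) (simp add: mat2_eq_iff d N[symmetric] N'[symmetric])
  qed
qed

text \<open>With t the trace of N N', the traces of A B and of A times the inverse of B give |2 + t|
  = |2 - t| = 2, hence t = 0. All nilpotent parts are then multiples of N, and H is a discrete group
  of translations up to sign.\<close>

lemma parabolic_case:
  assumes A: "A \<in> H" "\<not> pm1 A" and par: "\<And>B. B \<in> H \<Longrightarrow> \<bar>tr2 B\<bar> = 2"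
  shows "\<exists>E. finite E \<and> E \<subseteq> H \<and> (\<forall>B\<in>H. \<exists>n. \<exists>e\<in>E. B = mpow A n ** e \<or> B = mpow (inv2 A) n ** e)"
proof -
  obtain s N where s: "s = 1 \<or> s = (-1::real)" "N ** N = 0" "tr2 N = 0" "det N = 0" "A = s *\<^sub>R (mat 1 + N)"
    "\<And>n. mpow A n = s ^ n *\<^sub>R (mat 1 + real n *\<^sub>R N)"
    by (rule parabolic_form[OF det1[OF A(1)] par[OF A(1)]]) (rule that)
  have N0: "N \<noteq> 0" using A(2) s(1,5) by (auto simp: pm1_def)
  have iA: "mpow (inv2 A) n = s ^ n *\<^sub>R (mat 1 - real n *\<^sub>R N)" for n
  proof -
    have "N$2$2 = - N$1$1" using s(3) by (simp add: tr2_def)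
    then show ?thesis unfolding mpow_inv2 s(6) by (simp add: mat2_eq_iff)
  qed
  define E where "E = {B \<in> H. norm B \<le> 2 + norm N}"
  have "\<exists>n. \<exists>e\<in>E. B = mpow A n ** e \<or> B = mpow (inv2 A) n ** e" if B: "B \<in> H" for B
  proof -
    obtain s' N' where s': "s' = 1 \<or> s' = (-1::real)" "tr2 N' = 0" "det N' = 0" "B = s' *\<^sub>R (mat 1 + N')"
      by (rule parabolic_form[OF det1[OF B] par[OF B]]) (rule that)
    have t1: "tr2 (A ** B) = s * s' * (2 + tr2 (N ** N'))"
    proof -
      have "tr2 (A ** B) = s * s' * (2 + tr2 N + tr2 N' + tr2 (N ** N'))"
        unfolding s(5) s'(4) by (simp add: tr2_def algebra_simps)
      then show ?thesis by (simp add: s s')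
    qed
    have iB: "inv2 B = s' *\<^sub>R (mat 1 - N')" unfolding s'(4) using s'(2) by (simp add: mat2_eq_iff tr2_def)
    have t2: "tr2 (A ** inv2 B) = s * s' * (2 - tr2 (N ** N'))"
    proof -
      have "tr2 (A ** inv2 B) = s * s' * (2 + tr2 N - tr2 N' - tr2 (N ** N'))"
        unfolding s(5) iB by (simp add: tr2_def algebra_simps)
      then show ?thesis by (simp add: s s')
    qed
    have "\<bar>2 + tr2 (N ** N')\<bar> = 2" "\<bar>2 - tr2 (N ** N')\<bar> = 2"
      using par[OF mult[OF A(1) B]] par[OF mult[OF A(1) inv[OF B]]] s(1) s'(1) unfolding t1 t2 by (auto simp: abs_mult)
    then have "tr2 (N ** N') = 0" by linarith
    then obtain k where k: "N' = k *\<^sub>R N" using nilpotent_proportional[OF s(3,4) s'(2,3) _ N0] by blast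
    have prod: "(mat 1 + u *\<^sub>R N) ** (mat 1 + k *\<^sub>R N) = mat 1 + (u + k) *\<^sub>R N" for u
    proof -
      have "(mat 1 + u *\<^sub>R N) ** (mat 1 + k *\<^sub>R N) = mat 1 + (u + k) *\<^sub>R N + (u * k) *\<^sub>R (N ** N)"
        by (simp add: mat2_eq_iff algebra_simps)
      then show ?thesis by (simp add: s(2))
    qed
    have scal: "(c *\<^sub>R M) ** (d *\<^sub>R M') = (c * d) *\<^sub>R (M ** M')" for c d and M M' :: mat2 by (simp add: mat2_eq_iff algebra_simps)
    have AB: "mpow A n ** B = (s ^ n * s') *\<^sub>R (mat 1 + (real n + k) *\<^sub>R N)" for n
      unfolding s(6) s'(4) k scal prod ..
    have AB': "mpow (inv2 A) n ** B = (s ^ n * s') *\<^sub>R (mat 1 + (- real n + k) *\<^sub>R N)" for n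
      using prod[of "- real n"] unfolding iA s'(4) k scal by simp
    have bd: "norm ((s ^ n * s') *\<^sub>R (mat 1 + u *\<^sub>R N)) \<le> 2 + norm N" if "\<bar>u\<bar> \<le> 1" for u n
    proof -
      have "\<bar>s ^ n * s'\<bar> = 1" using s(1) s'(1) by (auto simp: abs_mult power_abs)
      then have "norm ((s ^ n * s') *\<^sub>R (mat 1 + u *\<^sub>R N)) = norm (mat 1 + u *\<^sub>R N)" by simp
      also have "\<dots> \<le> norm (mat 1 :: mat2) + \<bar>u\<bar> * norm N" using norm_triangle_ineq[of "mat 1" "u *\<^sub>R N"] by simp
      also have "\<dots> \<le> 2 + 1 * norm N" using that pm1_norm[of "mat 1"] by (intro add_mono mult_right_mono) (auto simp: pm1_def)
      finally show ?thesis by simp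
    qed
    have An: "mpow A n \<in> H" "mpow (inv2 A) n \<in> H" for n using A(1) by (auto intro: mpow_mem inv)
    show ?thesis
    proof (cases "k \<le> 0")
      case True
      define n where "n = nat \<lfloor>- k\<rfloor>"
      have "real n = of_int \<lfloor>- k\<rfloor>" using True by (simp add: n_def)
      then have "\<bar>real n + k\<bar> \<le> 1" using floor_correct[of "- k"] by (simp add: abs_le_iff) linarith
      then have "mpow A n ** B \<in> E" unfolding E_def using bd[of "real n + k" n] mult[OF An(1)[of n] B] unfolding AB[of n] by simp
      moreover have "B = mpow (inv2 A) n ** (mpow A n ** B)"
        using inv2_cancel_left[OF det1[OF An(1)[of n]], of B] by (simp add: mpow_inv2)
      ultimately show ?thesis by blast
    next
      case False
      define n where "n = nat \<lfloor>k\<rfloor>"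
      have "real n = of_int \<lfloor>k\<rfloor>" using False by (simp add: n_def)
      then have "\<bar>- real n + k\<bar> \<le> 1" using floor_correct[of "k"] by (simp add: abs_le_iff) linarith
      then have "mpow (inv2 A) n ** B \<in> E" unfolding E_def using bd[of "- real n + k" n] mult[OF An(2)[of n] B] unfolding AB'[of n] by simp
      moreover have "B = mpow A n ** (mpow (inv2 A) n ** B)"
        using inv2_cancel_left'[OF det1[OF An(1)[of n]], of B] by (simp add: mpow_inv2)
      ultimately show ?thesis by blast
    qed
  qed
  moreover have "finite E" unfolding E_def by (rule finite_bounded)
  ultimately show ?thesis by (intro exI[of _ E]) (auto simp: E_def)
qed

lemma virtually_cyclic:
  "\<exists>w E. w \<in> H \<and> jump_type w \<and> finite E \<and> E \<subseteq> H \<and> (\<forall>B\<in>H. \<exists>n. \<exists>e\<in>E. B = mpow w n ** e \<or> B = mpow (inv2 w) n ** e)"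
proof -
  \<comment> \<open>For a finite group the whole group serves as E, with trivial generator.\<close>
  have fin: ?thesis if "finite H"
  proof (intro exI conjI)
    show "\<forall>B\<in>H. \<exists>n. \<exists>e\<in>H. B = mpow (mat 1) n ** e \<or> B = mpow (inv2 (mat 1)) n ** e"
    proof
      fix B assume "B \<in> H"
      have "mpow (mat 1) 0 ** B = B" by (simp only: mpow.simps matrix_mul_lid)
      then show "\<exists>n. \<exists>e\<in>H. B = mpow (mat 1) n ** e \<or> B = mpow (inv2 (mat 1)) n ** e"
        using \<open>B \<in> H\<close> by (intro exI[of _ 0] bexI[of _ B] disjI1) (rule sym)
    qed
    show "mat 1 \<in> H" "finite H" "H \<subseteq> H" using that one by simp_all
    show "jump_type (mat 1)" by (simp add: jump_type_def)
  qed
  show ?thesis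
  proof (cases "\<exists>A\<in>H. \<bar>tr2 A\<bar> > 2")
    case True
    then obtain A where A: "A \<in> H" "\<bar>tr2 A\<bar> > 2" by blast
    have "jump_type A" using A(2) by (simp add: jump_type_def)
    obtain E where E: "finite E" "E \<subseteq> H" "\<forall>B\<in>H. \<exists>n. \<exists>e\<in>E. B = mpow A n ** e \<or> B = mpow (inv2 A) n ** e"
      using hyperbolic_case[OF A] by (elim exE conjE) (rule that)
    then show ?thesis using A(1) \<open>jump_type A\<close> by (intro exI[of _ A] exI[of _ E] conjI)
  next
    case False
    then have le: "\<bar>tr2 B\<bar> \<le> 2" if "B \<in> H" for B using that by (meson not_le)
    show ?thesis
    proof (cases "\<exists>A\<in>H. \<bar>tr2 A\<bar> < 2")
      case True
      then obtain A where A: "A \<in> H" "\<bar>tr2 A\<bar> < 2" by blast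
      show ?thesis by (rule fin[OF elliptic_case[OF A le]])
    next
      case False
      then have p: "\<bar>tr2 B\<bar> = 2" if "B \<in> H" for B using that le[OF that] by force
      show ?thesis
      proof (cases "\<forall>A\<in>H. pm1 A")
        case True
        then have "H \<subseteq> {mat 1, - mat 1}" by (auto simp: pm1_def)
        then have "finite H" by (rule finite_subset) simp
        then show ?thesis by (rule fin)
      next
        case False
        then obtain A where A: "A \<in> H" "\<not> pm1 A" by blast
        have "jump_type A" using p[OF A(1)] A(2) by (simp add: jump_type_def)
        obtain E where E: "finite E" "E \<subseteq> H" "\<forall>B\<in>H. \<exists>n. \<exists>e\<in>E. B = mpow A n ** e \<or> B = mpow (inv2 A) n ** e"
          using parabolic_case[OF A] p by metis
        then show ?thesis using A(1) \<open>jump_type A\<close> by (intro exI[of _ A] exI[of _ E] conjI)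
      qed
    qed
  qed
qed

end

section \<open>Excursions away from a connected orbit\<close>

text \<open>A union of hyperbolic balls of one radius around the orbit of \<open>\<i>\<close>:
  \<open>qh (moeb (inv2 v) z)\<close> measures the distance from z to
  \<open>moeb v \<i>\<close>.\<close>

definition orbit_nbhd :: "mat2 set \<Rightarrow> real \<Rightarrow> complex set" where
  "orbit_nbhd G R = {z. Im z > 0 \<and> (\<exists>v\<in>G. qh (moeb (inv2 v) z) \<le> R)}"

definition orbit_far :: "mat2 set \<Rightarrow> real \<Rightarrow> complex set" where
  "orbit_far G R = {z. Im z > 0 \<and> (\<forall>v\<in>G. qh (moeb (inv2 v) z) > R)}"

lemma orbit_sets_upper: "orbit_nbhd G R \<subseteq> {z. Im z > 0}" "orbit_far G R \<subseteq> {z. Im z > 0}"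
  by (auto simp: orbit_nbhd_def orbit_far_def)

lemma orbit_sets_disjoint: "orbit_far G R \<inter> orbit_nbhd G R = {}"
  by (force simp: orbit_nbhd_def orbit_far_def)

lemma jump_type_inv2: "det w = 1 \<Longrightarrow> jump_type w \<Longrightarrow> jump_type (inv2 w)"
proof -
  assume d: "det w = 1" and w: "jump_type w"
  have "tr2 (inv2 w) = tr2 w" by (simp add: tr2_def)
  moreover have "pm1 (inv2 w) \<longleftrightarrow> pm1 w" by (auto simp: pm1_def mat2_eq_iff)
  moreover have "inv2 (mat 1) = mat 1" by (simp add: mat2_eq_iff)
  ultimately show ?thesis using w by (auto simp: jump_type_def)
qed

lemma continuous_on_qh_moeb:
  assumes "det M = 1" shows "continuous_on {z. Im z > 0} (\<lambda>z. qh (moeb M z))"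
  unfolding qh_def
  by (intro continuous_intros continuous_on_moeb[OF assms]) (use Im_moeb_pos[OF assms] in force)

lemma compact_qh_ball: "compact {z. Im z > 0 \<and> qh z \<le> R}"
proof -
  have eq: "{z. Im z > 0 \<and> qh z \<le> R} = {z. (cmod z)\<^sup>2 + 1 \<le> R * Im z} \<inter> {z. Im z \<ge> 0}"
  proof (rule set_eqI)
    fix z
    show "z \<in> {z. Im z > 0 \<and> qh z \<le> R} \<longleftrightarrow> z \<in> {z. (cmod z)\<^sup>2 + 1 \<le> R * Im z} \<inter> {z. Im z \<ge> 0}"
    proof (cases "Im z > 0")
      case True
      then show ?thesis by (simp add: qh_def pos_divide_le_eq)
    next
      case False
      have "\<not> ((cmod z)\<^sup>2 + 1 \<le> R * 0)" using zero_le_power2[of "cmod z"] by linarith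
      then show ?thesis using False by (cases "Im z = 0") auto
    qed
  qed
  have "closed {z. (cmod z)\<^sup>2 + 1 \<le> R * Im z}" "closed {z. Im z \<ge> 0}"
    by (intro closed_Collect_le continuous_intros)+
  then have "closed {z. Im z > 0 \<and> qh z \<le> R}" unfolding eq by (rule closed_Int)
  moreover have "bounded {z. Im z > 0 \<and> qh z \<le> R}"
  proof (rule boundedI[where B = "\<bar>R\<bar>"])
    fix z assume "z \<in> {z. Im z > 0 \<and> qh z \<le> R}"
    then have a: "Im z > 0" "qh z \<le> R" by simp_all
    then have "(cmod z)\<^sup>2 + 1 \<le> R * Im z" "Im z > 0" by (simp_all add: qh_def pos_divide_le_eq)
    moreover have "R * Im z \<le> \<bar>R\<bar> * cmod z"
      using \<open>Im z > 0\<close> abs_Im_le_cmod[of z] by (intro mult_mono) auto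
    ultimately have "cmod z * cmod z \<le> \<bar>R\<bar> * cmod z" by (simp add: power2_eq_square)
    moreover have "cmod z > 0" using \<open>Im z > 0\<close> by auto
    ultimately show "cmod z \<le> \<bar>R\<bar>" by simp
  qed
  ultimately show ?thesis by (simp add: compact_eq_bounded_closed)
qed

context sl2_group
begin

lemma shift:
  assumes "g \<in> G" "v \<in> G" "Im z > 0"
  shows "moeb (inv2 v) (moeb g z) = moeb (inv2 (inv2 g ** v)) z"
  using assms det1 by (simp add: inv2_mult inv2_inv2 moeb_mult det_inv2)

lemma far_invariant:
  assumes "g \<in> G" "z \<in> orbit_far G R" shows "moeb g z \<in> orbit_far G R"
proof -
  have z: "Im z > 0" "\<And>v. v \<in> G \<Longrightarrow> qh (moeb (inv2 v) z) > R" using assms(2) by (auto simp: orbit_far_def)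
  have "qh (moeb (inv2 v) (moeb g z)) > R" if "v \<in> G" for v
    unfolding shift[OF assms(1) that z(1)] by (intro z(2) mult inv assms(1) that)
  then show ?thesis using Im_moeb_pos[OF det1[OF assms(1)] z(1)] by (simp add: orbit_far_def)
qed

lemma nbhd_invariant:
  assumes "g \<in> G" "z \<in> orbit_nbhd G R" shows "moeb g z \<in> orbit_nbhd G R"
proof -
  obtain v where z: "Im z > 0" "v \<in> G" "qh (moeb (inv2 v) z) \<le> R" using assms(2) by (auto simp: orbit_nbhd_def)
  have gv: "g ** v \<in> G" by (intro mult assms(1) z(2))
  have "inv2 g ** (g ** v) = v" by (rule inv2_cancel_left[OF det1[OF assms(1)]])
  then have "qh (moeb (inv2 (g ** v)) (moeb g z)) \<le> R" unfolding shift[OF assms(1) gv z(1)] using z(3) by simp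
  then show ?thesis using Im_moeb_pos[OF det1[OF assms(1)] z(1)] gv by (auto simp: orbit_nbhd_def)
qed

end

text \<open>The geometric form of finite generation. Paths in the neighbourhood act as barriers for
  paths in the set \<open>W\<close> of far points.\<close>

locale connected_orbit = discrete_sl2_group G for G +
  fixes R1 :: real
  assumes conn: "g \<in> G \<Longrightarrow> path_component (orbit_nbhd G R1) \<i> (moeb g \<i>)"
begin

abbreviation "W \<equiv> orbit_far G R1"

lemma far_path_moeb:
  assumes "g \<in> G" "path_component W z z'" shows "path_component W (moeb g z) (moeb g z')"
proof -
  have "moeb g ` W \<subseteq> W" using far_invariant[OF assms(1)] by blast
  then show ?thesis
    using path_component_moeb[OF assms(2) orbit_sets_upper(2) det1[OF assms(1)]] path_component_of_subset by blast
qed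

text \<open>Near a given point only finitely many orbit points impose a condition.\<close>

lemma open_far: "open W"
proof -
  have "\<exists>T. open T \<and> z \<in> T \<and> T \<subseteq> W" if z: "z \<in> W" for z
  proof -
    have Iz: "Im z > 0" and zf: "\<And>v. v \<in> G \<Longrightarrow> qh (moeb (inv2 v) z) > R1" using z by (auto simp: orbit_far_def)
    define Q where "Q = qh z + 1"
    \<comment> \<open>For \<open>y = moeb M \<i>\<close> with \<open>qh y < Q\<close> only these v
      can be within R1, since norm v is at most \<open>norm (inv2 v ** M) * norm M\<close>.\<close>
    define V where "V = {v \<in> G. norm v \<le> sqrt (\<bar>R1\<bar> * \<bar>Q\<bar>)}"
    have fV: "finite V" unfolding V_def by (rule finite_bounded)
    let ?U = "{z. Im z > 0}"
    have oU: "open ?U" by (intro open_Collect_less continuous_intros)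
    define T where "T v = ?U \<inter> (\<lambda>z. qh (moeb (inv2 v) z)) -` {R1<..}" for v
    have oT: "open (T v)" if "v \<in> G" for v
      unfolding T_def using det1[OF that] by (intro continuous_open_preimage continuous_on_qh_moeb oU) (simp_all add: det_inv2)
    have oQ: "open (?U \<inter> qh -` {..<Q})"
      using continuous_on_qh_moeb[of "mat 1"] by (intro continuous_open_preimage oU) simp_all
    let ?T = "(?U \<inter> qh -` {..<Q}) \<inter> (\<Inter>v\<in>V. T v)"
    have "open ?T" using fV oT by (intro open_Int oQ open_INT) (auto simp: V_def)
    moreover have "z \<in> ?T" using Iz zf by (auto simp: Q_def T_def V_def)
    moreover have "?T \<subseteq> W"
    proof
      fix y assume y: "y \<in> ?T"
      have Iy: "Im y > 0" and qy: "qh y < Q" using y by auto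
      have Ty: "qh (moeb (inv2 v) y) > R1" if "v \<in> V" for v
      proof -
        have "y \<in> T v" using y that by blast
        then show ?thesis by (simp add: T_def)
      qed
      obtain M where M: "det M = 1" "y = moeb M \<i>" using half_plane_matrix[OF Iy] .
      have "qh (moeb (inv2 v) y) > R1" if v: "v \<in> G" for v
      proof (rule ccontr)
        assume "\<not> ?thesis"
        then have le: "qh (moeb (inv2 v) y) \<le> R1" by simp
        have dv: "det (inv2 v) = 1" using det1[OF v] by (simp add: det_inv2)
        have "qh (moeb (inv2 v) y) = (norm (inv2 v ** M))\<^sup>2"
          unfolding M(2) by (subst moeb_mult[OF dv M(1), symmetric]) (simp_all add: qh_moeb[OF det_mult1[OF dv M(1)]])
        then have a: "(norm (inv2 v ** M))\<^sup>2 \<le> R1" using le by simp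
        have b: "(norm M)\<^sup>2 < Q" using qy unfolding M(2) qh_moeb[OF M(1)] .
        have "norm v \<le> norm (inv2 v ** M) * norm M"
          using norm_mult2_ge[OF M(1), of "inv2 v"] by (simp add: norm_inv2)
        then have "(norm v)\<^sup>2 \<le> (norm (inv2 v ** M) * norm M)\<^sup>2" by (intro power_mono) auto
        also have "\<dots> \<le> \<bar>R1\<bar> * \<bar>Q\<bar>" unfolding power_mult_distrib using a b by (intro mult_mono) auto
        finally have "norm v \<le> sqrt (\<bar>R1\<bar> * \<bar>Q\<bar>)" by (rule real_le_rsqrt)
        then have "v \<in> V" using v by (simp add: V_def)
        then show False using Ty le by fastforce
      qed
      then show "y \<in> W" using Iy by (simp add: orbit_far_def)
    qed
    ultimately show ?thesis by blast
  qed
  then show ?thesis by (subst open_subopen) blast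
qed

text \<open>The two elements play different roles: A has a path from z to its image in
  \<open>W\<close>, while B has a path from \<open>\<i>\<close> to its image in the disjoint
  neighbourhood. Crossing axes would make the two sets meet.\<close>

lemma stabilizer_noncrossing:
  assumes z: "z \<in> W"
  shows "noncrossing_group {h \<in> G. path_component W z (moeb h z)}" (is "noncrossing_group ?H")
proof
  have Iz: "Im z > 0" using z by (simp add: orbit_far_def)
  show "det A = 1" if "A \<in> ?H" for A using that det1 by simp
  show "mat 1 \<in> ?H" using one z by (simp add: path_component_refl_eq)
  show "A ** B \<in> ?H" if A: "A \<in> ?H" and B: "B \<in> ?H" for A B
  proof -
    have g: "A \<in> G" "B \<in> G" and pa: "path_component W z (moeb A z)" and pb: "path_component W z (moeb B z)" using A B by auto
    have "path_component W (moeb A z) (moeb (A ** B) z)"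
      unfolding moeb_mult[OF det1[OF g(1)] det1[OF g(2)] Iz] by (rule far_path_moeb[OF g(1) pb])
    then show ?thesis using mult[OF g] path_component_trans[OF pa] by simp
  qed
  show "inv2 A \<in> ?H" if A: "A \<in> ?H" for A
  proof -
    have g: "A \<in> G" and pa: "path_component W z (moeb A z)" using A by auto
    have "path_component W (moeb (inv2 A) z) z"
      using far_path_moeb[OF inv[OF g] pa] unfolding moeb_inv[OF det1[OF g] Iz] .
    then show ?thesis using inv[OF g] path_component_sym by simp
  qed
  obtain e where "e > 0" "\<forall>M\<in>G. dist M (mat 1) < e \<longrightarrow> M = mat 1" using disc unfolding discrete_grp_def by blast
  then show "discrete_grp ?H" unfolding discrete_grp_def by (intro exI[of _ e]) simp
  show "tr2 (A ** B ** inv2 A ** inv2 B) \<ge> 2" if A: "A \<in> ?H" and B: "B \<in> ?H" and t: "\<bar>tr2 A\<bar> > 2" for A B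
  proof (rule ccontr)
    assume n: "\<not> ?thesis"
    have g: "A \<in> G" "B \<in> G" and pa: "path_component W z (moeb A z)" using A B by auto
    have "W \<inter> orbit_nbhd G R1 \<noteq> {}"
      by (rule crossing_axes[OF det1[OF g(1)] t det1[OF g(2)] _ orbit_sets_upper(2) far_invariant[OF g(1)] far_invariant[OF inv[OF g(1)]]
            pa orbit_sets_upper(1) nbhd_invariant[OF g(2)] nbhd_invariant[OF inv[OF g(2)]] conn[OF g(2)]]) (use n in simp)
    then show False using orbit_sets_disjoint by blast
  qed
qed

text \<open>The points in question form a compact set; as R is larger than R1, it lies inside the
  open set \<open>W\<close> and is covered by finitely many path components.\<close>

lemma finite_components:
  assumes R: "R > R1"
  shows "\<exists>Z. finite Z \<and> Z \<subseteq> W \<and>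
    (\<forall>y. Im y > 0 \<longrightarrow> qh y \<le> R' \<longrightarrow> (\<forall>v\<in>G. qh (moeb (inv2 v) y) \<ge> R) \<longrightarrow> (\<exists>z\<in>Z. path_component W z y))"
proof -
  let ?K0 = "{z. Im z > 0 \<and> qh z \<le> R'}"
  define K where "K = ?K0 \<inter> (\<Inter>v\<in>G. ?K0 \<inter> (\<lambda>z. qh (moeb (inv2 v) z)) -` {R..})"
  have c0: "compact ?K0" by (rule compact_qh_ball)
  have cl: "closed (?K0 \<inter> (\<lambda>z. qh (moeb (inv2 v) z)) -` {R..})" if "v \<in> G" for v
  proof (rule continuous_closed_preimage[OF _ compact_imp_closed[OF c0] closed_atLeast])
    show "continuous_on ?K0 (\<lambda>z. qh (moeb (inv2 v) z))"
      using det1[OF that] by (intro continuous_on_subset[OF continuous_on_qh_moeb]) (auto simp: det_inv2)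
  qed
  have cK: "compact K" unfolding K_def by (intro compact_Int_closed c0 closed_INT ballI cl)
  have KW: "K \<subseteq> W" 
  proof
    fix y assume y: "y \<in> K"
    have "qh (moeb (inv2 v) y) > R1" if "v \<in> G" for v
    proof -
      have "y \<in> (\<lambda>z. qh (moeb (inv2 v) z)) -` {R..}" using y that unfolding K_def by blast
      then show ?thesis using R by simp
    qed
    moreover have "Im y > 0" using y by (simp add: K_def)
    ultimately show "y \<in> W" by (simp add: orbit_far_def)
  qed
  have "\<exists>D\<subseteq>K. finite D \<and> K \<subseteq> (\<Union>z\<in>D. path_component_set W z)"
  proof (rule compactE_image[OF cK])
    show "open (path_component_set W z)" for z by (intro open_path_component open_far)
    show "K \<subseteq> (\<Union>z\<in>K. path_component_set W z)" 
    proof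
      fix y assume "y \<in> K"
      then have "y \<in> path_component_set W y" using KW by (simp add: path_component_refl_eq subset_iff)
      then show "y \<in> (\<Union>z\<in>K. path_component_set W z)" using \<open>y \<in> K\<close> by blast
    qed
  qed blast
  then obtain Z where Z: "Z \<subseteq> K" "finite Z" "K \<subseteq> (\<Union>z\<in>Z. path_component_set W z)" by blast
  have "\<exists>z\<in>Z. path_component W z y" if "Im y > 0" "qh y \<le> R'" "\<forall>v\<in>G. qh (moeb (inv2 v) y) \<ge> R" for y
  proof -
    have "y \<in> K" using that by (simp add: K_def)
    then show ?thesis using Z(3) by auto
  qed
  then show ?thesis using Z KW by (intro exI[of _ Z]) auto
qed

text \<open>Moved back by v and v', both ends of an excursion fall into one ball and hence into
  finitely many components. The quotient of v and v' takes one of these components to another, so it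
  is a fixed element up to the stabiliser of a component, which is virtually cyclic.\<close>

lemma excursions:
  assumes R: "R > R1"
  shows "\<exists>L. finite L \<and> L \<subseteq> G \<times> G \<and> (\<forall>(w, e)\<in>L. jump_type w) \<and>
    (\<forall>v\<in>G. \<forall>v'\<in>G. \<forall>M M'. det M = 1 \<longrightarrow> det M' = 1 \<longrightarrow> (norm (inv2 v ** M))\<^sup>2 \<le> R' \<longrightarrow> (norm (inv2 v' ** M'))\<^sup>2 \<le> R' \<longrightarrow>
      (\<forall>g\<in>G. (norm (inv2 g ** M))\<^sup>2 \<ge> R) \<longrightarrow> (\<forall>g\<in>G. (norm (inv2 g ** M'))\<^sup>2 \<ge> R) \<longrightarrow>
      path_component W (moeb M \<i>) (moeb M' \<i>) \<longrightarrow> (\<exists>(w, e)\<in>L. \<exists>n. inv2 v ** v' = mpow w n ** e))"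
proof -
  obtain Z where Z: "finite Z" "Z \<subseteq> W"
    and Z3: "\<forall>y. Im y > 0 \<longrightarrow> qh y \<le> R' \<longrightarrow> (\<forall>v\<in>G. qh (moeb (inv2 v) y) \<ge> R) \<longrightarrow> (\<exists>z\<in>Z. path_component W z y)"
    using finite_components[OF R, of R'] by (elim exE conjE) (rule that)
  let ?H = "\<lambda>z. {h \<in> G. path_component W z (moeb h z)}"
  let ?P = "\<lambda>z w E. w \<in> ?H z \<and> jump_type w \<and> finite E \<and> E \<subseteq> ?H z \<and> (\<forall>B\<in>?H z. \<exists>n. \<exists>e\<in>E. B = mpow w n ** e \<or> B = mpow (inv2 w) n ** e)"
  have "\<forall>z\<in>Z. \<exists>w E. ?P z w E"
  proof
    fix z assume "z \<in> Z"
    then have "z \<in> W" using Z(2) by (rule subsetD[rotated])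
    then show "\<exists>w E. ?P z w E"
      by (rule noncrossing_group.virtually_cyclic[OF stabilizer_noncrossing])
  qed
  then obtain w where "\<forall>z\<in>Z. \<exists>E. ?P z (w z) E"
    by (drule_tac bchoice) (elim exE, rule that)
  then obtain E where "\<forall>z\<in>Z. ?P z (w z) (E z)"
    by (drule_tac bchoice) (elim exE, rule that)
  then have w: "\<And>z. z \<in> Z \<Longrightarrow> w z \<in> ?H z" "\<And>z. z \<in> Z \<Longrightarrow> jump_type (w z)" and E: "\<And>z. z \<in> Z \<Longrightarrow> finite (E z)" "\<And>z. z \<in> Z \<Longrightarrow> E z \<subseteq> ?H z"
    and WE: "\<And>z B. z \<in> Z \<Longrightarrow> B \<in> ?H z \<Longrightarrow> \<exists>n. \<exists>e\<in>E z. B = mpow (w z) n ** e \<or> B = mpow (inv2 (w z)) n ** e"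
    by simp_all
  \<comment> \<open>One element for each pair of representatives with equivalent components; any
    other one differs from it by an element of the stabiliser of the first component.\<close>
  define u0 where "u0 z z' = (SOME u. u \<in> G \<and> path_component W z (moeb u z'))" for z z'
  define P where "P = {(z, z'). z \<in> Z \<and> z' \<in> Z \<and> (\<exists>u. u \<in> G \<and> path_component W z (moeb u z'))}"
  have fP: "finite P" by (rule finite_subset[of _ "Z \<times> Z"]) (auto simp: P_def Z(1))
  have u0: "u0 z z' \<in> G" "path_component W z (moeb (u0 z z') z')" if "(z, z') \<in> P" for z z'
    using that someI_ex[of "\<lambda>u. u \<in> G \<and> path_component W z (moeb u z')"] unfolding u0_def P_def by auto
  define L where "L = (\<Union>(z, z')\<in>P. \<Union>e\<in>E z. {(w z, e ** u0 z z'), (inv2 (w z), e ** u0 z z')})"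
  have "finite L" unfolding L_def using fP E(1) by (intro finite_UN_I) (auto simp: P_def)
  moreover have "L \<subseteq> G \<times> G"
  proof
    fix x assume "x \<in> L"
    then obtain z z' e where x: "(z, z') \<in> P" "e \<in> E z" "x = (w z, e ** u0 z z') \<or> x = (inv2 (w z), e ** u0 z z')"
      unfolding L_def by auto
    have "z \<in> Z" using x(1) by (simp add: P_def)
    then have "w z \<in> G" "e \<in> G" using w(1) E(2) x(2) by auto
    then have "w z \<in> G" "inv2 (w z) \<in> G" "e ** u0 z z' \<in> G" using u0(1)[OF x(1)] by (auto intro: mult inv)
    then show "x \<in> G \<times> G" using x(3) by auto
  qed
  moreover have jt: "jump_type a" if "(a, b) \<in> L" for a b
  proof -
    obtain z z' where x: "(z, z') \<in> P" "a = w z \<or> a = inv2 (w z)" using \<open>(a, b) \<in> L\<close> unfolding L_def by auto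
    have z: "z \<in> Z" using x(1) by (simp add: P_def)
    have "det (w z) = 1" using w(1)[OF z] det1 by simp
    then show ?thesis using x(2) w(2)[OF z] jump_type_inv2 by auto
  qed
  moreover have main: "\<exists>(w, e)\<in>L. \<exists>n. inv2 v ** v' = mpow w n ** e"
    if v: "v \<in> G" "v' \<in> G" and M: "det M = 1" "det M' = 1" and n: "(norm (inv2 v ** M))\<^sup>2 \<le> R'" "(norm (inv2 v' ** M'))\<^sup>2 \<le> R'"
      and far: "\<forall>g\<in>G. (norm (inv2 g ** M))\<^sup>2 \<ge> R" "\<forall>g\<in>G. (norm (inv2 g ** M'))\<^sup>2 \<ge> R"
      and pc: "path_component W (moeb M \<i>) (moeb M' \<i>)" for v v' M M'
  proof -
    have near: "\<exists>z\<in>Z. path_component W z (moeb (inv2 v) (moeb M \<i>))"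
      if v: "v \<in> G" and M: "det M = 1" and n: "(norm (inv2 v ** M))\<^sup>2 \<le> R'" and far: "\<forall>g\<in>G. (norm (inv2 g ** M))\<^sup>2 \<ge> R" for v M
    proof -
      have dv: "det (inv2 v) = 1" using det1[OF v] by (simp add: det_inv2)
      have e: "moeb (inv2 v) (moeb M \<i>) = moeb (inv2 v ** M) \<i>" by (rule moeb_mult[OF dv M, symmetric]) simp
      have dM: "det (inv2 v ** M) = 1" by (rule det_mult1[OF dv M])
      have "R \<le> qh (moeb (inv2 g) (moeb (inv2 v ** M) \<i>))" if g: "g \<in> G" for g
      proof -
        have dg: "det (inv2 g) = 1" using det1[OF g] by (simp add: det_inv2)
        have "moeb (inv2 g) (moeb (inv2 v ** M) \<i>) = moeb (inv2 g ** (inv2 v ** M)) \<i>" by (rule moeb_mult[OF dg dM, symmetric]) simp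
        also have "inv2 g ** (inv2 v ** M) = inv2 (v ** g) ** M" by (simp add: inv2_mult matrix_mul_assoc)
        finally have "qh (moeb (inv2 g) (moeb (inv2 v ** M) \<i>)) = (norm (inv2 (v ** g) ** M))\<^sup>2"
          using det1[OF mult[OF v g]] M by (simp add: qh_moeb det_mult1 det_inv2)
        then show ?thesis using far mult[OF v g] by simp
      qed
      moreover have "Im (moeb (inv2 v ** M) \<i>) > 0" by (rule Im_moeb_pos[OF dM]) simp
      moreover have "qh (moeb (inv2 v ** M) \<i>) \<le> R'" using n by (simp add: qh_moeb[OF dM])
      ultimately show ?thesis unfolding e using Z3 by simp
    qed
    obtain z z' where z: "z \<in> Z" "path_component W z (moeb (inv2 v) (moeb M \<i>))" "z' \<in> Z" "path_component W z' (moeb (inv2 v') (moeb M' \<i>))"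
      using near[OF v(1) M(1) n(1) far(1)] near[OF v(2) M(2) n(2) far(2)] by blast
    define u where "u = inv2 v ** v'"
    have uG: "u \<in> G" unfolding u_def by (intro mult inv v)
    have Iz: "Im z > 0" "Im z' > 0" using z(1,3) Z(2) by (auto simp: orbit_far_def)
    have IM: "Im (moeb M' \<i>) > 0" by (rule Im_moeb_pos[OF M(2)]) simp
    have dv': "det (inv2 v') = 1" using det1[OF v(2)] by (simp add: det_inv2)
    have "moeb u (moeb (inv2 v') (moeb M' \<i>)) = moeb (u ** inv2 v') (moeb M' \<i>)"
      by (rule moeb_mult[OF det1[OF uG] dv' IM, symmetric])
    also have "u ** inv2 v' = inv2 v" unfolding u_def by (rule inv2_cancel_right[OF det1[OF v(2)]])
    finally have p1: "path_component W (moeb u z') (moeb (inv2 v) (moeb M' \<i>))" using far_path_moeb[OF uG z(4)] by simp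
    have p2: "path_component W (moeb (inv2 v) (moeb M \<i>)) (moeb (inv2 v) (moeb M' \<i>))" by (rule far_path_moeb[OF inv[OF v(1)] pc])
    have pu: "path_component W z (moeb u z')"
      by (rule path_component_trans[OF path_component_trans[OF z(2) p2] path_component_sym[OF p1]])
    then have zz: "(z, z') \<in> P" using z(1,3) uG by (auto simp: P_def)
    let ?u0 = "u0 z z'"
    note u0z = u0[OF zz]
    define h where "h = u ** inv2 ?u0"
    have hG: "h \<in> G" unfolding h_def by (intro mult inv uG u0z)
    have "path_component W (moeb h z) (moeb h (moeb ?u0 z'))" by (rule far_path_moeb[OF hG u0z(2)])
    moreover have "moeb h (moeb ?u0 z') = moeb (h ** ?u0) z'" by (rule moeb_mult[OF det1[OF hG] det1[OF u0z(1)] Iz(2), symmetric])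
    moreover have hu: "h ** ?u0 = u" unfolding h_def by (rule inv2_cancel_right'[OF det1[OF u0z(1)]])
    ultimately have "path_component W (moeb h z) (moeb u z')" by simp
    then have "path_component W z (moeb h z)" using path_component_trans[OF pu path_component_sym] by blast
    then have "h \<in> ?H z" using hG by simp
    then obtain n e where ne: "e \<in> E z" "h = mpow (w z) n ** e \<or> h = mpow (inv2 (w z)) n ** e" using WE[OF z(1)] by blast
    have l: "(w z, e ** ?u0) \<in> L" "(inv2 (w z), e ** ?u0) \<in> L" unfolding L_def using zz ne(1) by auto
    have "u = mpow (w z) n ** (e ** ?u0) \<or> u = mpow (inv2 (w z)) n ** (e ** ?u0)"
      using ne(2) unfolding hu[symmetric] matrix_mul_assoc by (elim disjE) (simp_all only: simp_thms)
    then show ?thesis unfolding u_def[symmetric]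
    proof
      assume "u = mpow (w z) n ** (e ** ?u0)"
      then show "\<exists>(w, e)\<in>L. \<exists>n. u = mpow w n ** e" by (intro bexI[OF _ l(1)]) auto
    next
      assume "u = mpow (inv2 (w z)) n ** (e ** ?u0)"
      then show "\<exists>(w, e)\<in>L. \<exists>n. u = mpow w n ** e" by (intro bexI[OF _ l(2)]) auto
    qed
  qed
  ultimately show ?thesis
  proof (intro exI[of _ L] conjI ballI allI impI)
    show "case x of (w, e) \<Rightarrow> jump_type w" if "x \<in> L" for x
      using jt[of "fst x" "snd x"] that by (simp add: case_prod_beta)
  qed (assumption | erule (10) main)+
qed

end

text \<open>Right multiplication by \<open>dg t\<close> is the geodesic flow:
  \<open>moeb (M ** dg t) \<i>\<close> runs along a geodesic at unit speed.\<close>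

definition dg :: "real \<Rightarrow> mat2" where "dg t = diag2 (exp (t / 2))"

lemma det_dg [simp]: "det (dg t) = 1"
  by (simp add: dg_def det_diag2)

lemma dg_add: "dg s ** dg t = dg (s + t)"
  by (simp add: dg_def mat2_eq_iff add_divide_distrib exp_add)

lemma dg_0 [simp]: "dg 0 = mat 1"
  by (simp add: dg_def mat2_eq_iff)

lemma norm_mult_dg: fixes M :: mat2 shows "(norm (M ** dg t))\<^sup>2 = exp t * ((M$1$1)\<^sup>2 + (M$2$1)\<^sup>2) + exp (- t) * ((M$1$2)\<^sup>2 + (M$2$2)\<^sup>2)"
proof -
  have "(exp (t / 2))\<^sup>2 = exp t" by (simp add: power2_eq_square exp_add[symmetric])
  moreover have "exp (- t) = 1 / exp t" by (simp add: exp_minus divide_inverse)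
  ultimately show ?thesis unfolding norm_mat2_sq dg_def by (simp add: power_mult_distrib power_divide add_divide_distrib distrib_left)
qed

lemma norm_dg_le: "norm (dg t) \<le> 2 * exp (\<bar>t\<bar> / 2)"
proof (rule power2_le_imp_le)
  have "(norm (dg t))\<^sup>2 = exp t + exp (- t)" using norm_mult_dg[of "mat 1" t] by (simp add: matrix_mul_lid)
  also have "\<dots> \<le> exp \<bar>t\<bar> + exp \<bar>t\<bar>" by (intro add_mono) auto
  also have "\<dots> \<le> 4 * exp \<bar>t\<bar>" by simp
  also have "exp \<bar>t\<bar> = (exp (\<bar>t\<bar> / 2))\<^sup>2" by (simp add: power2_eq_square exp_add[symmetric])
  finally show "(norm (dg t))\<^sup>2 \<le> (2 * exp (\<bar>t\<bar> / 2))\<^sup>2" by (simp add: power_mult_distrib)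
qed simp

lemma norm_dg_ge: "exp (t / 2) \<le> norm (dg t)"
proof (rule power2_le_imp_le)
  have "(exp (t / 2))\<^sup>2 = exp t" by (simp add: power2_eq_square exp_add[symmetric])
  then show "(exp (t / 2))\<^sup>2 \<le> (norm (dg t))\<^sup>2" using norm_mult_dg[of "mat 1" t] by (simp add: matrix_mul_lid)
qed simp

lemma norm_dg_le4: "\<bar>t\<bar> \<le> 1 \<Longrightarrow> norm (dg t) \<le> 4"
proof -
  assume "\<bar>t\<bar> \<le> 1"
  then have "exp (\<bar>t\<bar> / 2) \<le> exp (1 / 2 :: real)" by simp
  also have "\<dots> \<le> 2" using exp_half_le2 by simp
  finally show ?thesis using norm_dg_le[of t] by linarith
qed

lemma norm_mult_dg_near:
  fixes M :: mat2
  assumes "\<bar>s - t\<bar> \<le> 1"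
  shows "norm (M ** dg s) \<le> 4 * norm (M ** dg t)"
proof -
  have "M ** dg s = (M ** dg t) ** dg (s - t)" by (simp add: matrix_mul_assoc[symmetric] dg_add)
  then have "norm (M ** dg s) \<le> norm (M ** dg t) * norm (dg (s - t))" using norm_mult2 by metis
  also have "\<dots> \<le> norm (M ** dg t) * 4" by (intro mult_left_mono norm_dg_le4 assms) simp
  finally show ?thesis by simp
qed

lemma norm_step_le:
  assumes M: "det M = 1"
  shows "norm (inv2 v ** v') \<le> norm (inv2 v ** M ** dg s) * norm (dg (t - s)) * norm (inv2 v' ** M ** dg t)"
proof -
  have d: "det (M ** dg t) = 1" by (simp add: det_mult1 M)
  have "(inv2 v ** M ** dg s) ** dg (t - s) = inv2 v ** (M ** dg t)" by (simp add: matrix_mul_assoc[symmetric] dg_add)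
  moreover have "inv2 (inv2 v' ** M ** dg t) = inv2 (M ** dg t) ** v'"
    by (simp add: inv2_mult inv2_inv2 matrix_mul_assoc)
  ultimately have "(inv2 v ** M ** dg s) ** dg (t - s) ** inv2 (inv2 v' ** M ** dg t) = inv2 v ** ((M ** dg t) ** (inv2 (M ** dg t) ** v'))"
    by (simp add: matrix_mul_assoc)
  then have e: "inv2 v ** v' = (inv2 v ** M ** dg s) ** dg (t - s) ** inv2 (inv2 v' ** M ** dg t)"
    unfolding inv2_cancel_left'[OF d] by (rule sym)
  have "norm (inv2 v ** v') \<le> norm ((inv2 v ** M ** dg s) ** dg (t - s)) * norm (inv2 (inv2 v' ** M ** dg t))"
    unfolding e by (rule norm_mult2)
  also have "\<dots> \<le> (norm (inv2 v ** M ** dg s) * norm (dg (t - s))) * norm (inv2 v' ** M ** dg t)"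
    by (intro mult_mono norm_mult2) simp_all
  finally show ?thesis .
qed

text \<open>P is the rotation towards \<open>orb M\<close>, and s is the distance from the base
  point. The remaining factor K fixes 0, so its \<open>be\<close> vanishes and it is a rotation
  too.\<close>

lemma polar_decomposition:
  assumes d: "det M = 1"
  obtains P K s where "s \<ge> 0" "det P = 1" "det K = 1" "norm P \<le> 2" "norm K \<le> 2" "M = P ** dg s ** K"
proof -
  define t where "t = cmod (orb M)"
  have t: "0 \<le> t" "t < 1" using cmod_orb_less1[OF d] by (simp_all add: t_def)
  obtain a where a: "orb M = of_real t * cis a" using rcis_cmod_Arg[of "orb M"] unfolding t_def rcis_def by metis
  define y where "y = (1 + t) / (1 - t)"
  have y: "y \<ge> 1" using t by (simp add: y_def)
  define s where "s = ln y"
  have s: "s \<ge> 0" "exp s = y" using y by (simp_all add: s_def)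
  define P where "P = rot2 (a / 2)"
  have e2: "(exp (s / 2))\<^sup>2 = y" using s(2) by (simp add: power2_eq_square exp_add[symmetric])
  have yt: "(y - 1) / (y + 1) = t"
  proof -
    have "y * (1 - t) = 1 + t" using t by (simp add: y_def)
    then have "y - 1 = t * (y + 1)" by (simp add: algebra_simps)
    then show ?thesis using y by simp
  qed
  have "orb (P ** dg s) = cis a * of_real t"
    unfolding P_def dg_def by (subst orb_rot2_diag2) (simp_all only: exp_gt_zero e2 yt, simp)
  then have oe: "orb (P ** dg s) = orb M" using a by (simp add: mult.commute)
  define Q where "Q = P ** dg s"
  have dQ: "det Q = 1" unfolding Q_def by (rule det_mult1) (simp_all add: P_def)
  define K where "K = inv2 Q ** M"
  have dK: "det K = 1" unfolding K_def using dQ d by (simp add: det_mult1 det_inv2)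
  have "cmod (be K) / (cmod (al Q) * cmod (al M)) = 0"
    using orb_diff[OF dQ d] oe unfolding K_def Q_def by simp
  then have "be K = 0" using al_nz[OF dQ] al_nz[OF d] by simp
  then have "(cmod (al K))\<^sup>2 = 1" using cmod_al_be[OF dK] by simp
  then have "cmod (al K) = 1" by (simp add: power2_eq_1_iff) (smt (verit) norm_ge_zero)
  then have nK: "norm K \<le> 2" using norm_le_al[OF dK] by simp
  have "(norm P)\<^sup>2 = 2 * ((sin (a / 2))\<^sup>2 + (cos (a / 2))\<^sup>2)" by (simp add: norm_mat2_sq P_def rot2_def)
  then have "(norm P)\<^sup>2 \<le> 2\<^sup>2" by simp
  then have nP: "norm P \<le> 2" by (rule power2_le_imp_le) simp
  have "M = P ** dg s ** K" unfolding K_def Q_def[symmetric] by (rule inv2_cancel_left'[OF dQ, symmetric])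
  then show thesis using that[of s P K] s(1) dK nK nP by (simp add: P_def)
qed

lemma path_dg:
  assumes d: "det M = 1" and ab: "a \<le> b" and S: "\<And>u. a \<le> u \<Longrightarrow> u \<le> b \<Longrightarrow> moeb (M ** dg u) \<i> \<in> S"
  shows "path_component S (moeb (M ** dg a) \<i>) (moeb (M ** dg b) \<i>)"
proof -
  let ?f = "\<lambda>u. moeb (M ** dg u) \<i>"
  have cont: "continuous_on {a..b} ?f"
  proof -
    have nz: "\<And>u. complex_of_real ((M ** dg u)$2$1) * \<i> + of_real ((M ** dg u)$2$2) \<noteq> 0"
      by (rule moeb_denom) (simp_all add: det_mult1 d)
    show ?thesis unfolding moeb_def using nz unfolding mat2_mult_nth dg_def diag2_nth
      by (intro continuous_intros) auto
  qed
  have "path_connected (?f ` {a..b})" by (rule path_connected_continuous_image[OF cont]) simp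
  moreover have "?f a \<in> ?f ` {a..b}" "?f b \<in> ?f ` {a..b}" using ab by auto
  ultimately have "path_component (?f ` {a..b}) (?f a) (?f b)" unfolding path_connected_component by blast
  then show ?thesis by (rule path_component_of_subset[rotated]) (use S in auto)
qed

context connected_orbit
begin

text \<open>Integer times only, so that close times can be counted; moving by at most one unit
  changes norms by a factor of at most 4.\<close>

definition consecutive :: "real \<Rightarrow> mat2 \<Rightarrow> nat \<Rightarrow> nat \<Rightarrow> bool" where
  "consecutive R M t t' \<longleftrightarrow> t < t' \<and> (\<forall>s. t < s \<longrightarrow> s < t' \<longrightarrow> (\<forall>g\<in>G. norm (inv2 g ** M ** dg (real s)) > R))"

text \<open>Adjacent times give a bounded quotient. Otherwise the geodesic stays in \<open>W\<close>
  from t + 1 to t' - 1, an excursion. The 4 in the bound on R pays for rounding real times to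
  integers, and the square of |R1| + 2 exceeds R1 + 1.\<close>

lemma consecutive_jumps:
  assumes R: "R \<ge> 4 * (\<bar>R1\<bar> + 2)"
  shows "\<exists>L. finite L \<and> L \<subseteq> G \<times> G \<and> (\<forall>(w, e)\<in>L. jump_type w) \<and>
    (\<forall>M t t'. \<forall>v\<in>G. \<forall>v'\<in>G. det M = 1 \<longrightarrow> consecutive R M t t' \<longrightarrow> norm (inv2 v ** M ** dg (real t)) \<le> R \<longrightarrow>
      norm (inv2 v' ** M ** dg (real t')) \<le> R \<longrightarrow> (\<exists>(w, e)\<in>L. \<exists>n. inv2 v ** v' = mpow w n ** e))"
proof -
  define R' where "R' = (4 * R)\<^sup>2"
  obtain L where L: "finite L" "L \<subseteq> G \<times> G" "\<forall>(w, e)\<in>L. jump_type w"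
    and exc: "\<forall>v\<in>G. \<forall>v'\<in>G. \<forall>M M'. det M = 1 \<longrightarrow> det M' = 1 \<longrightarrow> (norm (inv2 v ** M))\<^sup>2 \<le> R' \<longrightarrow> (norm (inv2 v' ** M'))\<^sup>2 \<le> R' \<longrightarrow>
      (\<forall>g\<in>G. (norm (inv2 g ** M))\<^sup>2 \<ge> R1 + 1) \<longrightarrow> (\<forall>g\<in>G. (norm (inv2 g ** M'))\<^sup>2 \<ge> R1 + 1) \<longrightarrow>
      path_component W (moeb M \<i>) (moeb M' \<i>) \<longrightarrow> (\<exists>(w, e)\<in>L. \<exists>n. inv2 v ** v' = mpow w n ** e)"
    using excursions[OF less_add_one, of R'] by (elim exE conjE) (rule that)
  define E where "E = {g \<in> G. norm g \<le> 4 * R * R}"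
  \<comment> \<open>The bounded quotients are added with the trivial generator.\<close>
  define L' where "L' = L \<union> {mat 1} \<times> E"
  have "finite E" unfolding E_def by (rule finite_bounded)
  then have "finite L'" using L(1) by (simp add: L'_def)
  moreover have "L' \<subseteq> G \<times> G" using L(2) one by (auto simp: L'_def E_def)
  moreover have "\<forall>(w, e)\<in>L'. jump_type w" using L(3) by (auto simp: L'_def jump_type_def)
  moreover have "\<exists>(w, e)\<in>L'. \<exists>n. inv2 v ** v' = mpow w n ** e"
    if v: "v \<in> G" "v' \<in> G" and M: "det M = 1" and c: "consecutive R M t t'"
      and n: "norm (inv2 v ** M ** dg (real t)) \<le> R" "norm (inv2 v' ** M ** dg (real t')) \<le> R" for M t t' v v'
  proof (cases "t' = t + 1")
    case True
    have "norm (inv2 v ** v') \<le> (norm (inv2 v ** M ** dg (real t)) * norm (dg 1)) * norm (inv2 v' ** M ** dg (real t'))"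
      using norm_step_le[OF M, of v v' "real t" "real t'"] True by simp
    also have "\<dots> \<le> (R * 4) * R" using n R by (intro mult_mono norm_dg_le4) auto
    finally have "inv2 v ** v' \<in> E" using v by (auto simp: E_def intro!: mult inv)
    then have "(mat 1, inv2 v ** v') \<in> L'" by (simp add: L'_def)
    then show ?thesis by (rule bexI[rotated]) (auto simp: matrix_mul_lid intro!: exI[of _ 0])
  next
    case False
    have tt: "t + 1 \<le> t' - 1" "t < t'" using c False by (auto simp: consecutive_def)
    \<comment> \<open>Rounding u down gives an integer time strictly between t and t'.\<close>
    have far: "norm (inv2 g ** (M ** dg u)) \<ge> \<bar>R1\<bar> + 2" if g: "g \<in> G" and u: "real (t + 1) \<le> u" "u \<le> real (t' - 1)" for g u
    proof -
      define s where "s = nat \<lfloor>u\<rfloor>"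
      have u0: "u \<ge> 0" using u(1) by linarith
      have s: "real s \<le> u" "u < real s + 1" using u0 by (simp_all add: s_def)
      have "t < s" "s < t'" using s u tt by linarith+
      then have "R < norm (inv2 g ** M ** dg (real s))" using c g by (auto simp: consecutive_def)
      also have "\<dots> \<le> 4 * norm (inv2 g ** M ** dg u)" by (rule norm_mult_dg_near) (use s in linarith)
      finally show ?thesis using R by (simp add: matrix_mul_assoc)
    qed
    have sq: "R1 + 1 \<le> x\<^sup>2 \<and> R1 < x\<^sup>2" if "x \<ge> \<bar>R1\<bar> + 2" for x :: real
    proof -
      have "x * 1 \<le> x * x" using that by (intro mult_left_mono) auto
      then show ?thesis using that unfolding power2_eq_square by linarith
    qed
    define M1 M2 where "M1 = M ** dg (real (t + 1))" "M2 = M ** dg (real (t' - 1))"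
    note M12 = this
    have dM: "det M1 = 1" "det M2 = 1" by (simp_all add: M12 det_mult1 M)
    have inW: "moeb (M ** dg u) \<i> \<in> W" if u: "real (t + 1) \<le> u" "u \<le> real (t' - 1)" for u
    proof -
      have dMu: "det (M ** dg u) = 1" by (simp add: det_mult1 M)
      have "qh (moeb (inv2 g) (moeb (M ** dg u) \<i>)) > R1" if g: "g \<in> G" for g
      proof -
        have dg: "det (inv2 g) = 1" using det1[OF g] by (simp add: det_inv2)
        have "moeb (inv2 g) (moeb (M ** dg u) \<i>) = moeb (inv2 g ** (M ** dg u)) \<i>" by (rule moeb_mult[OF dg dMu, symmetric]) simp
        then have "qh (moeb (inv2 g) (moeb (M ** dg u) \<i>)) = (norm (inv2 g ** (M ** dg u)))\<^sup>2"
          by (simp add: qh_moeb[OF det_mult1[OF dg dMu]])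
        then show ?thesis using sq[OF far[OF g u]] by simp
      qed
      moreover have "Im (moeb (M ** dg u) \<i>) > 0" by (rule Im_moeb_pos[OF dMu]) simp
      ultimately show ?thesis by (simp add: orbit_far_def)
    qed
    have pc: "path_component W (moeb M1 \<i>) (moeb M2 \<i>)"
      unfolding M12 by (rule path_dg[OF M _ inW]) (use tt in auto)
    have n1: "(norm (inv2 v ** M1))\<^sup>2 \<le> R'"
    proof -
      have "norm (inv2 v ** M ** dg (real (t + 1))) \<le> 4 * norm (inv2 v ** M ** dg (real t))" by (rule norm_mult_dg_near) simp
      then have "norm (inv2 v ** M1) \<le> 4 * R" using n(1) by (simp add: M12 matrix_mul_assoc)
      then show ?thesis unfolding R'_def by (intro power_mono) auto
    qed
    have n2: "(norm (inv2 v' ** M2))\<^sup>2 \<le> R'"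
    proof -
      have "norm (inv2 v' ** M ** dg (real (t' - 1))) \<le> 4 * norm (inv2 v' ** M ** dg (real t'))" by (rule norm_mult_dg_near) (use tt in simp)
      then have "norm (inv2 v' ** M2) \<le> 4 * R" using n(2) by (simp add: M12 matrix_mul_assoc)
      then show ?thesis unfolding R'_def by (intro power_mono) auto
    qed
    have f1: "\<forall>g\<in>G. (norm (inv2 g ** M1))\<^sup>2 \<ge> R1 + 1" using sq[OF far] tt unfolding M12 by simp
    have f2: "\<forall>g\<in>G. (norm (inv2 g ** M2))\<^sup>2 \<ge> R1 + 1" using sq[OF far] tt unfolding M12 by simp
    have "\<exists>(w, e)\<in>L. \<exists>n. inv2 v ** v' = mpow w n ** e"
      using exc[rule_format, OF v dM n1 n2 _ _ pc] f1 f2 by blast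
    then show ?thesis unfolding L'_def by blast
  qed
  ultimately show ?thesis
  proof (intro exI[of _ L'] conjI allI ballI impI)
    assume main: "\<And>v v' M t t'. v \<in> G \<Longrightarrow> v' \<in> G \<Longrightarrow> det M = 1 \<Longrightarrow> consecutive R M t t' \<Longrightarrow> norm (inv2 v ** M ** dg (real t)) \<le> R \<Longrightarrow>
      norm (inv2 v' ** M ** dg (real t')) \<le> R \<Longrightarrow> \<exists>(w, e)\<in>L'. \<exists>n. inv2 v ** v' = mpow w n ** e"
    fix M t t' v v'
    assume "v \<in> G" "v' \<in> G" "det M = 1" "consecutive R M t t'" "norm (inv2 v ** M ** dg (real t)) \<le> R" "norm (inv2 v' ** M ** dg (real t')) \<le> R"
    then show "\<exists>(w, e)\<in>L'. \<exists>n. inv2 v ** v' = mpow w n ** e" by (rule main)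
  qed simp_all
qed

end

text \<open>Those g for which \<open>\<i>\<close> and its image are connected inside the
  neighbourhood form a subgroup, and the radius is large enough for it to contain the finitely many
  generators.\<close>

lemma (in zgroup) fin_gen_connected_orbit:
  assumes fg: "fin_gen r \<Gamma>" and k: "k < r" and disc: "discrete_grp (proj k \<Gamma>)" and grp: "sl2_group (proj k \<Gamma>)"
  shows "\<exists>R1. connected_orbit (proj k \<Gamma>) R1"
proof -
  interpret sl2_group "proj k \<Gamma>" by (rule grp)
  obtain S where S: "finite S" "S \<subseteq> \<Gamma>" "\<Gamma> = \<Inter>{H. psub r H \<and> S \<subseteq> H}" using fg unfolding fin_gen_def by blast
  have "\<exists>R. \<forall>z\<in>closed_segment \<i> (moeb (s k) \<i>). Im z > 0 \<and> qh z \<le> R" if s: "s \<in> S" for s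
  proof -
    have sG: "det (s k) = 1" using s S(2) by auto
    have "convex {z. Im z > 0}" using convex_halfspace_Im_gt[of 0] by simp
    then have sub: "closed_segment \<i> (moeb (s k) \<i>) \<subseteq> {z. Im z > 0}"
      by (intro closed_segment_subset) (simp_all add: Im_moeb_pos[OF sG])
    have "continuous_on (closed_segment \<i> (moeb (s k) \<i>)) qh"
      using continuous_on_subset[OF continuous_on_qh_moeb[of "mat 1"] sub] by simp
    then have "bounded (qh ` closed_segment \<i> (moeb (s k) \<i>))"
      by (intro compact_imp_bounded compact_continuous_image compact_segment)
    then obtain R where "\<forall>x\<in>qh ` closed_segment \<i> (moeb (s k) \<i>). norm x \<le> R" unfolding bounded_iff by blast
    then have "\<forall>z\<in>closed_segment \<i> (moeb (s k) \<i>). Im z > 0 \<and> qh z \<le> R" using sub by fastforce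
    then show ?thesis by blast
  qed
  then have "\<forall>s\<in>S. \<exists>R. \<forall>z\<in>closed_segment \<i> (moeb (s k) \<i>). Im z > 0 \<and> qh z \<le> R" by blast
  then obtain Rf where Rf: "\<forall>s\<in>S. \<forall>z\<in>closed_segment \<i> (moeb (s k) \<i>). Im z > 0 \<and> qh z \<le> Rf s"
    by (drule_tac bchoice) (elim exE, rule that)
  \<comment> \<open>The 2 is \<open>qh \<i>\<close>; the sum dominates the radii needed by the
    segments from \<open>\<i>\<close> to its images under generators.\<close>
  define R1 where "R1 = 2 + (\<Sum>s\<in>S. \<bar>Rf s\<bar>)"
  have Rf1: "Rf s \<le> R1" if "s \<in> S" for s
    using member_le_sum[OF that, of "\<lambda>s. \<bar>Rf s\<bar>"] S(1) by (simp add: R1_def)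
  let ?T = "orbit_nbhd (proj k \<Gamma>) R1"
  have ball: "z \<in> ?T" if "Im z > 0" "qh z \<le> R1" for z
    unfolding orbit_nbhd_def using that one by (auto intro!: bexI[of _ "mat 1"] simp: inv2_nth mat2_eq_iff)
  have iT: "\<i> \<in> ?T"
  proof (rule ball)
    have "0 \<le> (\<Sum>s\<in>S. \<bar>Rf s\<bar>)" by (intro sum_nonneg) simp
    then show "qh \<i> \<le> R1" by (simp add: qh_def R1_def)
  qed simp
  define H where "H = {g \<in> \<Gamma>. path_component ?T \<i> (moeb (g k) \<i>)}"
  have gp: "path_component ?T (moeb A z) (moeb A z')" if A: "A \<in> proj k \<Gamma>" and p: "path_component ?T z z'" for A z z'
  proof -
    have "moeb A ` ?T \<subseteq> ?T" using nbhd_invariant[OF A] by blast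
    then show ?thesis using path_component_moeb[OF p orbit_sets_upper(1) det1[OF A]] path_component_of_subset by blast
  qed
  have pk: "g k \<in> proj k \<Gamma>" if "g \<in> \<Gamma>" for g using that by (auto simp: proj_def)
  have i0: "Im \<i> > 0" by simp
  have "psub r H" unfolding psub_def
  proof (intro conjI ballI subsetI)
    show "g \<in> Gr r" if "g \<in> H" for g using that psub by (auto simp: H_def psub_def)
    show "s \<in> H" if s: "s \<in> signs r" for s
    proof -
      have "s k = mat 1 \<or> s k = - mat 1" using s k by (auto simp: signs_def)
      then have "moeb (s k) \<i> = \<i>" by (auto simp: moeb_def)
      then show ?thesis using signs_G[OF s] iT by (simp add: H_def path_component_refl_eq)
    qed
    show "gmul g h \<in> H" if g: "g \<in> H" and h: "h \<in> H" for g h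
    proof -
      have gh: "g \<in> \<Gamma>" "h \<in> \<Gamma>" and pg: "path_component ?T \<i> (moeb (g k) \<i>)" and ph: "path_component ?T \<i> (moeb (h k) \<i>)" using g h by (auto simp: H_def)
      have "path_component ?T (moeb (g k) \<i>) (moeb (g k ** h k) \<i>)"
        unfolding moeb_mult[OF det_G[OF gh(1)] det_G[OF gh(2)] i0] by (rule gp[OF pk[OF gh(1)] ph])
      then have "path_component ?T \<i> (moeb (g k ** h k) \<i>)" by (rule path_component_trans[OF pg])
      then show ?thesis using mult_G[OF gh] by (simp add: H_def gmul_def)
    qed
    show "ginv g \<in> H" if g: "g \<in> H" for g
    proof -
      have gG: "g \<in> \<Gamma>" and pg: "path_component ?T \<i> (moeb (g k) \<i>)" using g by (auto simp: H_def)
      have "path_component ?T (moeb (inv2 (g k)) \<i>) \<i>"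
        using gp[OF inv[OF pk[OF gG]] pg] unfolding moeb_inv[OF det_G[OF gG] i0] .
      then have "path_component ?T \<i> (moeb (inv2 (g k)) \<i>)" by (rule path_component_sym)
      moreover have "ginv g = (\<lambda>i. inv2 (g i))" by (simp add: ginv_def fun_eq_iff matrix_inv_eq_inv2 gG)
      ultimately show ?thesis using inv_G[OF gG] by (simp add: H_def)
    qed
  qed
  moreover have "S \<subseteq> H"
  proof
    fix s assume s: "s \<in> S"
    have "closed_segment \<i> (moeb (s k) \<i>) \<subseteq> ?T"
    proof
      fix z assume "z \<in> closed_segment \<i> (moeb (s k) \<i>)"
      then have "Im z > 0" "qh z \<le> Rf s" using Rf s by auto
      then show "z \<in> ?T" using Rf1[OF s] by (intro ball) auto
    qed
    then have "path_component ?T \<i> (moeb (s k) \<i>)" by (rule path_component_linepath)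
    then show "s \<in> H" using s S(2) by (auto simp: H_def)
  qed
  ultimately have "\<Gamma> \<subseteq> H" using S(3) by blast
  then have "path_component ?T \<i> (moeb M \<i>)" if "M \<in> proj k \<Gamma>" for M using that by (auto simp: H_def proj_def)
  then have "connected_orbit (proj k \<Gamma>) R1" by unfold_locales (use disc in auto)
  then show ?thesis by blast
qed

section \<open>Comparison of two discrete projections\<close>

lemma nilpotent_norm:
  fixes N :: mat2
  assumes "tr2 N = 0" "det N = 0"
  shows "norm N = \<bar>N$1$2 - N$2$1\<bar>"
proof -
  have d: "N$2$2 = - N$1$1" using assms(1) by (simp add: tr2_def)
  have q: "N$1$1 * N$1$1 = - (N$1$2 * N$2$1)" using assms(2) by (simp add: det2 d)
  have "(norm N)\<^sup>2 = 2 * (N$1$1 * N$1$1) + (N$1$2)\<^sup>2 + (N$2$1)\<^sup>2" unfolding norm_mat2_sq by (simp add: d power2_eq_square)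
  also have "\<dots> = (N$1$2 - N$2$1)\<^sup>2" unfolding q by (simp add: power2_eq_square algebra_simps)
  finally show ?thesis using real_sqrt_unique[OF _ norm_ge_zero, of N] by simp
qed

text \<open>Up to sign N is the product of a vector w and its transpose, followed by a quarter turn.
  The norms of N, v N and v N v^-1 are then |w|^2, |v w| |w| and |v w|^2.\<close>

lemma nilpotent_conj_norm:
  fixes N v :: mat2
  assumes "tr2 N = 0" "det N = 0" "det v = 1"
  shows "(norm (v ** N))\<^sup>2 = norm (v ** N ** inv2 v) * norm N"
proof -
  define p q s where "p = N$1$1" "q = N$1$2" "s = N$2$1"
  note N = this
  have d: "N$2$2 = - p" using assms(1) by (simp add: tr2_def N)
  have e: "p * p = - (q * s)" using assms(2) by (simp add: det2 d N[symmetric])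
  define a b c f where "a = v$1$1" "b = v$1$2" "c = v$2$1" "f = v$2$2"
  note v = this
  let ?W = "v ** N ** inv2 v"
  have nW: "norm ?W = \<bar>?W$1$2 - ?W$2$1\<bar>"
  proof (rule nilpotent_norm)
    show "tr2 ?W = 0" using tr2_conj[OF assms(3), of N] assms(1) by simp
    show "det ?W = 0" by (simp add: det_mul assms)
  qed
  have W: "?W$1$2 - ?W$2$1 = (a * a + c * c) * q - 2 * (a * b + c * f) * p - (b * b + f * f) * s"
    by (simp add: N[symmetric] v[symmetric] d algebra_simps)
  have "(norm (v ** N))\<^sup>2 = (a * a + c * c) * (p * p + q * q) + (b * b + f * f) * (s * s + p * p) + 2 * (a * b + c * f) * p * (s - q)"
    unfolding norm_mat2_sq by (simp add: N[symmetric] v[symmetric] d power2_eq_square algebra_simps)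
  also have "\<dots> = (q - s) * ((a * a + c * c) * q - 2 * (a * b + c * f) * p - (b * b + f * f) * s)"
    unfolding e by (simp add: algebra_simps)
  finally have "(norm (v ** N))\<^sup>2 = (q - s) * (?W$1$2 - ?W$2$1)" unfolding W .
  then have "\<bar>(norm (v ** N))\<^sup>2\<bar> = \<bar>(q - s) * (?W$1$2 - ?W$2$1)\<bar>" by (rule arg_cong)
  then show ?thesis unfolding abs_power2 abs_mult nW nilpotent_norm[OF assms(1,2)] N by (simp only: mult.commute)
qed

text \<open>Orbit points cannot enter deep into the horoball of A: conjugates of A^2 stay away from
  the identity, which bounds \<open>norm (v ** N)\<close> below. So n is at most a multiple of norm
  v + norm (v A^n).\<close>

lemma (in discrete_sl2_group) parabolic_growth:
  assumes A: "A \<in> G" "\<bar>tr2 A\<bar> = 2" "\<not> pm1 A"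
  shows "\<exists>C>0. \<forall>v\<in>G. \<forall>n. norm (mpow A n) \<le> C * (norm v + norm (v ** mpow A n))"
proof -
  obtain s N where s: "s = 1 \<or> s = (-1::real)" "N ** N = 0" "tr2 N = 0" "det N = 0" "A = s *\<^sub>R (mat 1 + N)"
    "\<And>n. mpow A n = s ^ n *\<^sub>R (mat 1 + real n *\<^sub>R N)"
    by (rule parabolic_form[OF det1[OF A(1)] A(2)]) (rule that)
  have N0: "N \<noteq> 0" using A(3) s(1,5) by (auto simp: pm1_def)
  obtain e where e: "e > 0" "\<And>M. M \<in> G \<Longrightarrow> dist M (mat 1) < e \<Longrightarrow> M = mat 1" using disc unfolding discrete_grp_def by blast
  define c where "c = sqrt (e / 2 * norm N)"
  have c0: "c > 0" using e(1) N0 by (simp add: c_def)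
  have low: "norm (v ** N) \<ge> c" if v: "v \<in> G" for v
  proof -
    \<comment> \<open>Squaring removes the sign s.\<close>
    have A2: "mpow A 2 = mat 1 + 2 *\<^sub>R N" using s(1) by (auto simp: s(6))
    let ?B = "v ** mpow A 2 ** inv2 v"
    have BG: "?B \<in> G" using v A(1) by (intro mult inv mpow_mem)
    have B: "?B = mat 1 + 2 *\<^sub>R (v ** N ** inv2 v)"
    proof -
      have "?B = v ** inv2 v + 2 *\<^sub>R (v ** N ** inv2 v)" unfolding A2 by (simp add: mat2_eq_iff algebra_simps)
      then show ?thesis using inv2_right[OF det1[OF v]] by simp
    qed
    have "v ** N ** inv2 v \<noteq> 0"
    proof
      assume z: "v ** N ** inv2 v = 0"
      have "N = inv2 v ** (v ** N ** inv2 v) ** v"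
        by (metis inv2_cancel_left inv2_cancel_right' det1[OF v] matrix_mul_assoc)
      also have "\<dots> = 0" unfolding z by (simp add: mat2_eq_iff)
      finally show False using N0 by simp
    qed
    then have "?B \<noteq> mat 1" unfolding B by simp
    then have "dist ?B (mat 1) \<ge> e" using e(2)[OF BG] by fastforce
    then have "e / 2 \<le> norm (v ** N ** inv2 v)" unfolding B by (simp add: dist_norm)
    then have "e / 2 * norm N \<le> norm (v ** N ** inv2 v) * norm N" by (intro mult_right_mono) auto
    then have "e / 2 * norm N \<le> (norm (v ** N))\<^sup>2" unfolding nilpotent_conj_norm[OF s(3,4) det1[OF v]] .
    then have "c \<le> sqrt ((norm (v ** N))\<^sup>2)" unfolding c_def by (rule real_sqrt_le_mono)
    then show ?thesis by simp
  qed
  have "norm (mpow A n) \<le> (2 + norm N / c) * (norm v + norm (v ** mpow A n))" if v: "v \<in> G" for v n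
  proof -
    have sn: "\<bar>s ^ n\<bar> = 1" using s(1) by (auto simp: power_abs)
    have "v ** mpow A n = s ^ n *\<^sub>R (v + real n *\<^sub>R (v ** N))" unfolding s(6) by (simp add: mat2_eq_iff algebra_simps)
    then have eq: "norm (v ** mpow A n) = norm (v + real n *\<^sub>R (v ** N))" using sn by simp
    have "real n * c \<le> real n * norm (v ** N)" using low[OF v] by (intro mult_left_mono) auto
    also have "\<dots> = norm ((v + real n *\<^sub>R (v ** N)) - v)" by simp
    also have "\<dots> \<le> norm (v ** mpow A n) + norm v" unfolding eq by (rule norm_triangle_ineq4)
    finally have nc: "real n * c \<le> norm v + norm (v ** mpow A n)" by simp
    have "real n * norm N = (real n * c) * (norm N / c)" using c0 by simp
    also have "\<dots> \<le> (norm v + norm (v ** mpow A n)) * (norm N / c)" using nc c0 by (intro mult_right_mono) auto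
    finally have 1: "real n * norm N \<le> norm N / c * (norm v + norm (v ** mpow A n))" by (simp add: mult.commute)
    have n1: "norm (mat 1 :: mat2) \<le> 2" by (rule pm1_norm) (simp add: pm1_def)
    have "norm (mpow A n) = norm (mat 1 + real n *\<^sub>R N)" unfolding s(6) using sn by simp
    also have "\<dots> \<le> norm (mat 1 :: mat2) + real n * norm N" using norm_triangle_ineq[of "mat 1" "real n *\<^sub>R N"] by simp
    finally have 2: "norm (mpow A n) \<le> 2 + real n * norm N" using n1 by linarith
    have "1 \<le> norm v" by (rule norm_ge1[OF det1[OF v]])
    moreover have "norm v \<le> norm v + norm (v ** mpow A n)" by simp
    ultimately have "1 \<le> norm v + norm (v ** mpow A n)" by (rule order_trans)
    then have 3: "2 \<le> 2 * (norm v + norm (v ** mpow A n))" by simp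
    show ?thesis using 1 2 3 unfolding distrib_right by linarith
  qed
  moreover have "2 + norm N / c > 0" using c0 by (simp add: add_pos_nonneg)
  ultimately show ?thesis by blast
qed

lemma norm_mpow_hyperbolic_le:
  assumes "det S = 1" "\<bar>x\<bar> > 1"
  shows "norm (mpow (S ** diag2 x ** inv2 S) n) \<le> 2 * (norm S)\<^sup>2 * \<bar>x\<bar> ^ n"
proof -
  have x0: "x \<noteq> 0" using assms(2) by auto
  have y: "\<bar>x\<bar> ^ n \<ge> 1" using assms(2) by (simp add: one_le_power)
  have "1 / \<bar>x\<bar> ^ n \<le> 1" using le_imp_inverse_le[OF y] by (simp only: inverse_eq_divide div_by_1)
  then have "norm (diag2 (x ^ n)) \<le> 2 * \<bar>x\<bar> ^ n" using norm_mat2_le_sum[of "diag2 (x ^ n)"] y by (simp add: power_abs)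
  then have "norm S * norm S * norm (diag2 (x ^ n)) \<le> norm S * norm S * (2 * \<bar>x\<bar> ^ n)" by (rule mult_left_mono) simp
  moreover have "norm (mpow (S ** diag2 x ** inv2 S) n) \<le> norm S * norm S * norm (diag2 (x ^ n))"
    unfolding mpow_hyperbolic[OF assms(1) x0] by (rule norm_conj_le)
  ultimately show ?thesis by (simp add: power2_eq_square mult_ac)
qed

lemma column_pos:
  fixes M :: mat2
  assumes "det M = 1"
  shows "(M$1$1)\<^sup>2 + (M$2$1)\<^sup>2 > 0" "(M$1$2)\<^sup>2 + (M$2$2)\<^sup>2 > 0"
proof -
  have "M$1$1 * M$2$2 - M$1$2 * M$2$1 = 1" using assms by (simp add: det2)
  then have "\<not> (M$1$1 = 0 \<and> M$2$1 = 0)" "\<not> (M$1$2 = 0 \<and> M$2$2 = 0)" by auto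
  then show "(M$1$1)\<^sup>2 + (M$2$1)\<^sup>2 > 0" "(M$1$2)\<^sup>2 + (M$2$2)\<^sup>2 > 0" by (auto simp: sum_power2_gt_zero_iff)
qed

lemma hyperbolic_norm_split:
  assumes "det A = 1" "\<bar>tr2 A\<bar> > 2"
  shows "\<exists>C>0. \<forall>i n. i \<le> n \<longrightarrow> norm (mpow A i) * norm (mpow A (n - i)) \<le> C * norm (mpow A n)"
proof -
  obtain S x where S: "det S = 1" "\<bar>x\<bar> > 1" "A = S ** diag2 x ** inv2 S" by (rule hyperbolic_diag[OF assms])
  have x0: "x \<noteq> 0" using S(2) by auto
  define \<sigma> where "\<sigma> = norm S * norm S"
  have "norm S > 0" using norm_ge1[OF S(1)] by linarith
  then have \<sigma>: "\<sigma> > 0" by (simp add: \<sigma>_def)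
  have up: "norm (mpow A n) \<le> 2 * \<sigma> * \<bar>x\<bar> ^ n" for n
    using norm_mpow_hyperbolic_le[OF S(1,2), of n] by (simp add: S(3) \<sigma>_def power2_eq_square)
  have dn: "\<bar>x\<bar> ^ n \<le> norm (diag2 (x ^ n))" for n
    using norm_entry[of "diag2 (x ^ n)" 1 1] by (simp add: power_abs)
  have low: "\<bar>x\<bar> ^ n \<le> \<sigma> * norm (mpow A n)" for n
  proof -
    have "norm (diag2 (x ^ n)) \<le> \<sigma> * norm (mpow A n)" unfolding S(3) mpow_hyperbolic[OF S(1) x0] \<sigma>_def by (rule norm_conj_ge[OF S(1) S(1)])
    then show ?thesis using dn[of n] by linarith
  qed
  have "norm (mpow A i) * norm (mpow A (n - i)) \<le> (4 * \<sigma> * \<sigma> * \<sigma>) * norm (mpow A n)" if "i \<le> n" for i n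
  proof -
    have "norm (mpow A i) * norm (mpow A (n - i)) \<le> (2 * \<sigma> * \<bar>x\<bar> ^ i) * (2 * \<sigma> * \<bar>x\<bar> ^ (n - i))"
      using \<sigma> by (intro mult_mono up) auto
    also have "\<dots> = 4 * \<sigma> * \<sigma> * (\<bar>x\<bar> ^ (i + (n - i)))" by (simp add: power_add)
    also have "\<dots> \<le> 4 * \<sigma> * \<sigma> * (\<sigma> * norm (mpow A n))" using low[of n] \<sigma> that by (intro mult_left_mono) auto
    finally show ?thesis by (simp add: mult_ac)
  qed
  moreover have "4 * \<sigma> * \<sigma> * \<sigma> > 0" using \<sigma> by simp
  ultimately show ?thesis by blast
qed

text \<open>The index \<open>i\<close> is that of the orbit point nearest to the origin.\<close>

lemma hyperbolic_nearest:
  assumes "det A = 1" "\<bar>tr2 A\<bar> > 2"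
  shows "\<exists>C>0. \<forall>v n. det v = 1 \<longrightarrow> (\<exists>i\<le>n. (norm (v ** mpow A i))\<^sup>2 * norm (mpow A n) \<le> C * (norm v * norm (v ** mpow A n)))"
proof -
  obtain S x where S: "det S = 1" "\<bar>x\<bar> > 1" "A = S ** diag2 x ** inv2 S" by (rule hyperbolic_diag[OF assms])
  have x0: "x \<noteq> 0" using S(2) by auto
  define y where "y = \<bar>x\<bar>"
  have y: "y > 1" using S(2) by (simp add: y_def)
  have yn: "y ^ n \<ge> 1" "y ^ n > 0" for n using y by (simp_all add: one_le_power)
  define \<sigma> where "\<sigma> = norm S"
  have \<sigma>: "\<sigma> \<ge> 1" using norm_ge1[OF S(1)] by (simp add: \<sigma>_def)
  define C where "C = 8 * \<sigma> ^ 6 * y\<^sup>2"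
  have "\<exists>i\<le>n. (norm (v ** mpow A i))\<^sup>2 * norm (mpow A n) \<le> C * (norm v * norm (v ** mpow A n))" if v: "det v = 1" for v n
  proof -
    define M where "M = v ** S"
    have dM: "det M = 1" unfolding M_def by (rule det_mult1[OF v S(1)])
    define X Z where "X = sqrt ((M$1$1)\<^sup>2 + (M$2$1)\<^sup>2)" "Z = sqrt ((M$1$2)\<^sup>2 + (M$2$2)\<^sup>2)"
    note XZ = this
    have XZ0: "X > 0" "Z > 0" using column_pos[OF dM] by (simp_all add: XZ)
    define b where "b i = norm (M ** diag2 (x ^ i))" for i
    have bsq: "(b i)\<^sup>2 = (y ^ i * X)\<^sup>2 + (Z / y ^ i)\<^sup>2" for i
    proof -
      have "y ^ i = \<bar>x ^ i\<bar>" by (simp add: y_def power_abs)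
      then show ?thesis by (simp add: b_def norm_mat2_sq XZ power_mult_distrib power_divide add_divide_distrib distrib_left mult.commute)
    qed
    have b0: "b i \<ge> 0" for i by (simp add: b_def)
    have blow: "y ^ i * X \<le> b i" "Z / y ^ i \<le> b i" for i
    proof -
      have "(y ^ i * X)\<^sup>2 \<le> (b i)\<^sup>2" "(Z / y ^ i)\<^sup>2 \<le> (b i)\<^sup>2" unfolding bsq by simp_all
      note sq = this
      show "y ^ i * X \<le> b i" by (rule power2_le_imp_le[OF sq(1) b0])
      show "Z / y ^ i \<le> b i" by (rule power2_le_imp_le[OF sq(2) b0])
    qed
    have bup: "b i \<le> y ^ i * X + Z / y ^ i" for i
    proof (rule power2_le_imp_le)
      show "(b i)\<^sup>2 \<le> (y ^ i * X + Z / y ^ i)\<^sup>2" unfolding bsq using XZ0 yn(2)[of i] by (simp add: power2_sum)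
    qed (use XZ0 yn(2)[of i] in simp)
    \<comment> \<open>\<open>b i\<close> is comparable with the larger of y^i X and Z / y^i. Where
      these balance, its square is about X Z, while b 0 is at least Z and b n at least y^n
      X.\<close>
    have key: "\<exists>i\<le>n. (b i)\<^sup>2 * y ^ n \<le> 4 * y\<^sup>2 * (b 0 * b n)"
    proof -
      obtain m0 where "Z / X < (y\<^sup>2) ^ m0" using real_arch_pow[of "y\<^sup>2" "Z / X"] y by (auto simp: one_less_power)
      then have "Z \<le> (y ^ m0 * y ^ m0) * X" using XZ0 by (simp add: divide_less_eq power2_eq_square power_mult_distrib less_imp_le)
      then have ex: "Z / y ^ m0 \<le> y ^ m0 * X" using yn(2)[of m0] by (simp add: divide_le_eq mult_ac)
      \<comment> \<open>The first index at which the growing term dominates; if it is 0 or beyond n,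
        the nearest point is an end point.\<close>
      define m where "m = (LEAST m. Z / y ^ m \<le> y ^ m * X)"
      have m1: "Z / y ^ m \<le> y ^ m * X" unfolding m_def by (rule LeastI[where P = "\<lambda>m. Z / y ^ m \<le> y ^ m * X", OF ex])
      have m2: "y ^ l * X < Z / y ^ l" if "l < m" for l
        using not_less_Least[OF that[unfolded m_def]] by simp
      have y2: "1 \<le> y\<^sup>2" using y by (simp add: one_le_power)
      show ?thesis
      proof (cases "m \<le> n")
        case False
        have lt: "y ^ n * X < Z / y ^ n" by (rule m2) (use False in simp)
        have "b n \<le> 2 * (Z / y ^ n)" using bup[of n] lt by linarith
        then have "(b n)\<^sup>2 * y ^ n \<le> (2 * (Z / y ^ n) * b n) * y ^ n"
          unfolding power2_eq_square using b0[of n] yn(2)[of n] by (intro mult_right_mono) auto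
        also have "\<dots> = 2 * Z * b n" using y by simp
        also have "\<dots> \<le> 2 * b 0 * b n" using blow(2)[of 0] b0[of n] by (intro mult_right_mono) auto
        also have "\<dots> \<le> (4 * y\<^sup>2) * (b 0 * b n)" using y2 b0 unfolding mult.assoc[symmetric]
          by (intro mult_right_mono) auto
        finally show ?thesis by blast
      next
        case True
        show ?thesis
        proof (cases m)
          case 0
          then have "b 0 \<le> 2 * X" using bup[of 0] m1 by simp
          then have "(b 0)\<^sup>2 * y ^ n \<le> (2 * X * b 0) * y ^ n"
            unfolding power2_eq_square using b0[of 0] yn(2)[of n] by (intro mult_right_mono) auto
          also have "\<dots> = 2 * b 0 * (y ^ n * X)" by simp
          also have "\<dots> \<le> 2 * b 0 * b n" using blow(1)[of n] b0[of 0] by (intro mult_left_mono) auto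
          also have "\<dots> \<le> (4 * y\<^sup>2) * (b 0 * b n)" using y2 b0 unfolding mult.assoc[symmetric]
            by (intro mult_right_mono) auto
          finally show ?thesis by blast
        next
          case (Suc l)
          define p where "p = y ^ l * X"
          have p0: "p > 0" using XZ0 yn(2)[of l] by (simp add: p_def)
          have pl: "p < Z / y ^ l" unfolding p_def by (rule m2) (simp add: Suc)
          have ppXZ: "p * p \<le> X * Z"
          proof -
            have "p * p \<le> p * (Z / y ^ l)" using p0 pl by (intro mult_left_mono) auto
            also have "\<dots> = X * Z" using y by (simp add: p_def)
            finally show ?thesis .
          qed
          have "b m \<le> 2 * (y * p)" using bup[of m] m1 unfolding Suc p_def by simp
          then have "(b m)\<^sup>2 \<le> (2 * (y * p))\<^sup>2" using b0 by (intro power_mono) auto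
          also have "\<dots> = 4 * y\<^sup>2 * (p * p)" by (simp add: power2_eq_square)
          also have "\<dots> \<le> 4 * y\<^sup>2 * (X * Z)" using ppXZ by (intro mult_left_mono) auto
          finally have "(b m)\<^sup>2 * y ^ n \<le> 4 * y\<^sup>2 * (X * Z) * y ^ n" using yn(2)[of n] by (intro mult_right_mono) auto
          also have "\<dots> = 4 * y\<^sup>2 * (Z * (y ^ n * X))" by simp
          also have "\<dots> \<le> 4 * y\<^sup>2 * (b 0 * b n)" using blow(1)[of n] blow(2)[of 0] XZ0 yn(2)[of n] b0
            by (intro mult_left_mono mult_mono) auto
          finally show ?thesis using True by blast
        qed
      qed
    qed
    then obtain i where i: "i \<le> n" "(b i)\<^sup>2 * y ^ n \<le> 4 * y\<^sup>2 * (b 0 * b n)" by blast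
    have vA: "v ** mpow A l = M ** diag2 (x ^ l) ** inv2 S" for l
      unfolding S(3) mpow_hyperbolic[OF S(1) x0] M_def by (simp add: matrix_mul_assoc)
    have nvA: "norm (v ** mpow A l) \<le> b l * \<sigma>" for l
      unfolding vA b_def \<sigma>_def using norm_mult2[of "M ** diag2 (x ^ l)" "inv2 S"] by simp
    have bl: "b l \<le> norm (v ** mpow A l) * \<sigma>" for l
      unfolding vA b_def \<sigma>_def using norm_mult2_ge[of "inv2 S" "M ** diag2 (x ^ l)"] S(1) by (simp add: det_inv2)
    have nA: "norm (mpow A n) \<le> 2 * \<sigma>\<^sup>2 * y ^ n"
      using norm_mpow_hyperbolic_le[OF S(1,2), of n] by (simp add: S(3) \<sigma>_def y_def)
    have "(norm (v ** mpow A i))\<^sup>2 * norm (mpow A n) \<le> (b i * \<sigma>)\<^sup>2 * (2 * \<sigma>\<^sup>2 * y ^ n)"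
      using nvA[of i] nA by (intro mult_mono power_mono) auto
    also have "\<dots> = 2 * \<sigma>^4 * ((b i)\<^sup>2 * y ^ n)" by (simp add: power2_eq_square power4_eq_xxxx)
    also have "\<dots> \<le> 2 * \<sigma>^4 * (4 * y\<^sup>2 * (b 0 * b n))" using i(2) by (intro mult_left_mono) auto
    also have "\<dots> \<le> 2 * \<sigma>^4 * (4 * y\<^sup>2 * ((norm (v ** mpow A 0) * \<sigma>) * (norm (v ** mpow A n) * \<sigma>)))"
    proof -
      have "0 \<le> norm (v ** mpow A 0) * \<sigma>" using \<sigma> by simp
      then have "b 0 * b n \<le> (norm (v ** mpow A 0) * \<sigma>) * (norm (v ** mpow A n) * \<sigma>)" by (rule mult_mono[OF bl bl _ b0])
      then show ?thesis by (intro mult_left_mono) auto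
    qed
    also have "\<dots> = C * (norm v * norm (v ** mpow A n))"
      by (simp add: C_def matrix_mul_rid eval_nat_numeral)
    finally show ?thesis using i(1) by blast
  qed
  moreover have "C > 0" using \<sigma> y by (simp add: C_def)
  ultimately show ?thesis by blast
qed

section \<open>Jumps seen in two components\<close>

context agroup
begin

text \<open>Corresponding types grow alike: bounded, linearly, or exponentially in component k with
  at most exponential growth in component j.\<close>

lemma jump_lower:
  assumes om: "om \<in> \<Gamma>" "jump_type (om k)" and jk: "j < r" "k < r"
  shows "\<exists>C p. C \<ge> 0 \<and> (\<forall>n. norm (mpow (om j) n) \<le> C * norm (mpow (om k) n) ^ p)"
proof -
  have g: "om k \<in> proj k \<Gamma>" using om(1) by (auto simp: proj_def)
  consider (one) "om k = mat 1" | (par) "\<bar>tr2 (om k)\<bar> = 2" "\<not> pm1 (om k)" | (hyp) "\<bar>tr2 (om k)\<bar> > 2"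
    using om(2) unfolding jump_type_def by blast
  then show ?thesis
  proof cases
    case one
    have "pm1 (om j)" by (rule pm1_transfer[OF om(1) jk(2,1)]) (simp add: one pm1_def)
    then have "norm (mpow (om j) n) \<le> 2 * norm (mpow (om k) n) ^ 0" for n
      using pm1_norm[OF pm1_mpow] by simp
    then show ?thesis by (intro exI[of _ 2] exI[of _ 0]) simp
  next
    case par
    have pj: "\<bar>tr2 (om j)\<bar> = 2" using parabolic_transfer[OF om(1) jk(2,1) par] by simp
    obtain s N where s: "s = 1 \<or> s = (-1::real)" "om k = s *\<^sub>R (mat 1 + N)" "\<And>n. mpow (om k) n = s ^ n *\<^sub>R (mat 1 + real n *\<^sub>R N)"
      by (rule parabolic_form[OF det_G[OF om(1)] par(1)]) (rule that)
    obtain s' N' where s': "s' = 1 \<or> s' = (-1::real)" "\<And>n. mpow (om j) n = s' ^ n *\<^sub>R (mat 1 + real n *\<^sub>R N')"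
      by (rule parabolic_form[OF det_G[OF om(1)] pj]) (rule that)
    have N0: "norm N > 0" using par(2) s(1,2) by (auto simp: pm1_def)
    have n1: "norm (mat 1 :: mat2) \<le> 2" by (rule pm1_norm) (simp add: pm1_def)
    have "norm (mpow (om j) n) \<le> (2 + 3 * norm N' / norm N) * norm (mpow (om k) n) ^ 1" for n
    proof -
      define x where "x = norm (mpow (om k) n)"
      have x1: "x \<ge> 1" unfolding x_def by (rule norm_ge1) (simp add: det_mpow om)
      have "\<bar>s ^ n\<bar> = 1" "\<bar>s' ^ n\<bar> = 1" using s(1) s'(1) by (auto simp: power_abs)
      then have e: "x = norm (mat 1 + real n *\<^sub>R N)" "norm (mpow (om j) n) = norm (mat 1 + real n *\<^sub>R N')"
        by (simp_all add: x_def s(3) s'(2))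
      have "real n * norm N = norm ((mat 1 + real n *\<^sub>R N) - mat 1)" by simp
      also have "\<dots> \<le> x + norm (mat 1 :: mat2)" unfolding e(1) by (rule norm_triangle_ineq4)
      also have "\<dots> \<le> 3 * x" using n1 x1 by linarith
      finally have "real n \<le> 3 * x / norm N" using N0 by (simp add: le_divide_eq)
      then have "real n * norm N' \<le> 3 * x / norm N * norm N'" by (intro mult_right_mono) auto
      moreover have "norm (mpow (om j) n) \<le> norm (mat 1 :: mat2) + real n * norm N'"
        unfolding e(2) using norm_triangle_ineq[of "mat 1" "real n *\<^sub>R N'"] by simp
      ultimately have "norm (mpow (om j) n) \<le> 2 * x + 3 * x / norm N * norm N'" using n1 x1 by linarith
      then show ?thesis by (simp add: x_def[symmetric] algebra_simps)
    qed
    moreover have "2 + 3 * norm N' / norm N \<ge> 0" by simp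
    ultimately show ?thesis by blast
  next
    case hyp
    obtain c x where c: "c > 0" "x > 1" "\<And>n. c * x ^ n \<le> norm (mpow (om k) n)" 
      by (rule norm_mpow_hyperbolic[OF det_G[OF om(1)] hyp]) (rule that)
    \<comment> \<open>The power p turns the growth rate x of component k into one that dominates
      component j.\<close>
    obtain p where p: "norm (om j) < x ^ p" using real_arch_pow[OF c(2)] by blast
    have "norm (mpow (om j) n) \<le> 2 / c ^ p * norm (mpow (om k) n) ^ p" for n
    proof -
      have "norm (mpow (om j) n) \<le> 2 * norm (om j) ^ n" by (rule norm_mpow_le) (simp add: om)
      also have "norm (om j) ^ n \<le> (x ^ p) ^ n" using p by (intro power_mono) auto
      also have "(x ^ p) ^ n = (x ^ n) ^ p" by (simp add: power_mult[symmetric] mult.commute)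
      also have "(x ^ n) ^ p \<le> (norm (mpow (om k) n) / c) ^ p"
        using c(1,2) c(3)[of n] by (intro power_mono) (auto simp: le_divide_eq mult.commute)
      finally show ?thesis by (simp add: power_divide)
    qed
    moreover have "2 / c ^ p \<ge> 0" using c(1) by simp
    ultimately show ?thesis by blast
  qed
qed

text \<open>For the jump om^n and \<open>v\<close> moved by om^i: \<open>vis\<close> of the jump is
  at most C / norm at this point in component k, and at least 1 / (C norm^2) at the same point in
  component j. One index i serves both, so the norms at this point can be compared between
  components.\<close>

lemma jump_nearest:
  assumes om: "om \<in> \<Gamma>" "jump_type (om j)" and jk: "j < r" "k < r" and disc: "discrete_grp (proj k \<Gamma>)"
  shows "\<exists>C>0. \<forall>v\<in>\<Gamma>. \<forall>n. \<exists>i\<le>n.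
    norm (v k ** mpow (om k) i) * norm (mpow (om k) n) \<le> C * (norm (v k) * norm (v k ** mpow (om k) n)) \<and>
    norm (v j) * norm (v j ** mpow (om j) n) \<le> C * ((norm (v j ** mpow (om j) i))\<^sup>2 * norm (mpow (om j) n))"
proof -
  interpret sl2_group "proj k \<Gamma>" by (rule proj_sl2_group)
  interpret discrete_sl2_group "proj k \<Gamma>" by unfold_locales (rule disc)
  \<comment> \<open>At an end point of the jump the second bound holds with constant 1 for every
    type; only hyperbolic jumps need an interior index.\<close>
  have ends: "norm (v j) * norm (v j ** mpow (om j) n) \<le> (norm (v j ** mpow (om j) i))\<^sup>2 * norm (mpow (om j) n)"
    if v: "v \<in> \<Gamma>" and i: "i = 0 \<or> i = n" for v i n
    using i
  proof
    assume "i = 0"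
    have "norm (v j ** mpow (om j) n) \<le> norm (v j) * norm (mpow (om j) n)" by (rule norm_mult2)
    then have "norm (v j) * norm (v j ** mpow (om j) n) \<le> norm (v j) * (norm (v j) * norm (mpow (om j) n))" by (intro mult_left_mono) auto
    then show ?thesis using \<open>i = 0\<close> by (simp add: matrix_mul_rid power2_eq_square mult_ac)
  next
    assume "i = n"
    have "norm (v j) \<le> norm (v j ** mpow (om j) n) * norm (mpow (om j) n)"
      by (rule norm_mult2_ge) (simp add: det_mpow om)
    then have "norm (v j) * norm (v j ** mpow (om j) n) \<le> (norm (v j ** mpow (om j) n) * norm (mpow (om j) n)) * norm (v j ** mpow (om j) n)"
      by (intro mult_right_mono) auto
    then show ?thesis using \<open>i = n\<close> by (simp add: power2_eq_square mult_ac)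
  qed
  let ?P = "\<lambda>C v n. \<exists>i\<le>n. norm (v k ** mpow (om k) i) * norm (mpow (om k) n) \<le> C * (norm (v k) * norm (v k ** mpow (om k) n)) \<and>
       norm (v j) * norm (v j ** mpow (om j) n) \<le> C * ((norm (v j ** mpow (om j) i))\<^sup>2 * norm (mpow (om j) n))"
  consider (one) "om j = mat 1" | (par) "\<bar>tr2 (om j)\<bar> = 2" "\<not> pm1 (om j)" | (hyp) "\<bar>tr2 (om j)\<bar> > 2"
    using om(2) unfolding jump_type_def by blast
  then show ?thesis
  proof cases
    case one
    have pm: "pm1 (om k)" by (rule pm1_transfer[OF om(1) jk]) (simp add: one pm1_def)
    have A: "norm (v k ** mpow (om k) 0) * norm (mpow (om k) n) \<le> 2 * (norm (v k) * norm (v k ** mpow (om k) n))" if v: "v \<in> \<Gamma>" for v n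
    proof -
      have "norm (mpow (om k) n) \<le> 2" by (rule pm1_norm[OF pm1_mpow[OF pm]])
      moreover have "1 \<le> norm (v k ** mpow (om k) n)" by (rule norm_ge1) (simp add: det_mult1 det_mpow v om)
      ultimately have "norm (mpow (om k) n) \<le> 2 * norm (v k ** mpow (om k) n)" by linarith
      then have "norm (v k) * norm (mpow (om k) n) \<le> norm (v k) * (2 * norm (v k ** mpow (om k) n))" by (intro mult_left_mono) auto
      then show ?thesis by (simp add: matrix_mul_rid mult_ac)
    qed
    have B: "norm (v j) * norm (v j ** mpow (om j) n) \<le> 2 * ((norm (v j ** mpow (om j) 0))\<^sup>2 * norm (mpow (om j) n))" if v: "v \<in> \<Gamma>" for v n
      by (rule order_trans[OF ends[OF v, of 0 n]]) simp_all
    have "?P 2 v n"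
      if v: "v \<in> \<Gamma>" for v n
      by (rule exI[of _ 0]) (intro conjI A[OF v] B[OF v], simp)
    moreover have "(0::real) < 2" by simp
    ultimately show ?thesis by blast
  next
    case par
    have pk: "\<bar>tr2 (om k)\<bar> = 2" "\<not> pm1 (om k)" using parabolic_transfer[OF om(1) jk par] by simp_all
    have Wk: "om k \<in> proj k \<Gamma>" using om(1) by (auto simp: proj_def)
    obtain C where C: "C > 0" "\<forall>v\<in>proj k \<Gamma>. \<forall>n. norm (mpow (om k) n) \<le> C * (norm v + norm (v ** mpow (om k) n))"
      using parabolic_growth[OF Wk pk] by blast
    have "?P (2 * C + 1) v n"
      if v: "v \<in> \<Gamma>" for v n
    proof -
      define a b w where "a = norm (v k)" "b = norm (v k ** mpow (om k) n)" "w = norm (mpow (om k) n)"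
      note abw = this
      have ab0: "a \<ge> 0" "b \<ge> 0" by (simp_all add: abw)
      have "v k \<in> proj k \<Gamma>" using v by (auto simp: proj_def)
      then have w: "w \<le> C * (a + b)" using C(2) by (simp add: abw)
      have up: "x \<le> (2 * C + 1) * x" if "x \<ge> 0" for x
        using that C(1) by (simp add: algebra_simps)
      have e: "norm (v j) * norm (v j ** mpow (om j) n) \<le> (2 * C + 1) * ((norm (v j ** mpow (om j) i))\<^sup>2 * norm (mpow (om j) n))"
        if "i = 0 \<or> i = n" for i
        by (rule order_trans[OF ends[OF v that] up]) simp
      have wle: "w \<le> (2 * C + 1) * m" if "a \<le> m" "b \<le> m" for m
      proof -
        have "C * (a + b) \<le> C * (2 * m)" using that C(1) by (intro mult_left_mono) auto
        moreover have "0 \<le> m" using that ab0 by linarith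
        ultimately show ?thesis using w by (simp add: algebra_simps)
      qed
      show ?thesis
      proof (cases "a \<le> b")
        case True
        have "a * w \<le> a * ((2 * C + 1) * b)" using wle[of b] True ab0 by (intro mult_left_mono) auto
        then have "norm (v k ** mpow (om k) 0) * norm (mpow (om k) n) \<le> (2 * C + 1) * (norm (v k) * norm (v k ** mpow (om k) n))"
          by (simp add: abw[symmetric] matrix_mul_rid mult_ac)
        then show ?thesis using e[of 0] by blast
      next
        case False
        have "b * w \<le> b * ((2 * C + 1) * a)" using wle[of a] False ab0 by (intro mult_left_mono) auto
        then have "norm (v k ** mpow (om k) n) * norm (mpow (om k) n) \<le> (2 * C + 1) * (norm (v k) * norm (v k ** mpow (om k) n))"
          by (simp add: abw[symmetric] mult_ac)
        then show ?thesis using e[of n] by blast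
      qed
    qed
    moreover have "2 * C + 1 > 0" using C(1) by simp
    ultimately show ?thesis by blast
  next
    case hyp
    have hk: "\<bar>tr2 (om k)\<bar> > 2" by (rule hyperbolic_transfer[OF om(1) jk disc hyp])
    obtain C1 where C1: "C1 > 0" "\<forall>i n. i \<le> n \<longrightarrow> norm (mpow (om j) i) * norm (mpow (om j) (n - i)) \<le> C1 * norm (mpow (om j) n)"
      using hyperbolic_norm_split[OF det_G[OF om(1)] hyp] by blast
    obtain C2 where C2: "C2 > 0" "\<forall>v n. det v = 1 \<longrightarrow> (\<exists>i\<le>n. (norm (v ** mpow (om k) i))\<^sup>2 * norm (mpow (om k) n) \<le> C2 * (norm v * norm (v ** mpow (om k) n)))"
      using hyperbolic_nearest[OF det_G[OF om(1)] hk] by blast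
    have "?P (C1 + C2) v n"
      if v: "v \<in> \<Gamma>" for v n
    proof -
      obtain i where i: "i \<le> n" "(norm (v k ** mpow (om k) i))\<^sup>2 * norm (mpow (om k) n) \<le> C2 * (norm (v k) * norm (v k ** mpow (om k) n))"
        using C2(2) det_G[OF v] by blast
      define a where "a = norm (v k ** mpow (om k) i)"
      have "a \<ge> 1" unfolding a_def by (rule norm_ge1) (simp add: det_mult1 det_mpow v om)
      then have "a * 1 \<le> a * a" by (intro mult_left_mono) auto
      then have "a * norm (mpow (om k) n) \<le> a\<^sup>2 * norm (mpow (om k) n)" unfolding power2_eq_square by (intro mult_right_mono) auto
      also have "\<dots> \<le> C2 * (norm (v k) * norm (v k ** mpow (om k) n))" using i(2) by (simp add: a_def)
      also have "\<dots> \<le> (C1 + C2) * (norm (v k) * norm (v k ** mpow (om k) n))" using C1(1) by (intro mult_right_mono) auto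
      finally have A: "norm (v k ** mpow (om k) i) * norm (mpow (om k) n) \<le> (C1 + C2) * (norm (v k) * norm (v k ** mpow (om k) n))" unfolding a_def .
      define b where "b = norm (v j ** mpow (om j) i)"
      have b0: "norm (v j) \<le> b * norm (mpow (om j) i)"
        unfolding b_def by (rule norm_mult2_ge) (simp add: det_mpow om)
      have "v j ** mpow (om j) n = (v j ** mpow (om j) i) ** mpow (om j) (n - i)"
        using i(1) by (simp add: matrix_mul_assoc[symmetric] mpow_add[symmetric])
      then have bn: "norm (v j ** mpow (om j) n) \<le> b * norm (mpow (om j) (n - i))"
        unfolding b_def using norm_mult2 by metis
      have "norm (v j) * norm (v j ** mpow (om j) n) \<le> (b * norm (mpow (om j) i)) * (b * norm (mpow (om j) (n - i)))"
        by (rule mult_mono[OF b0 bn]) (simp_all add: b_def)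
      also have "\<dots> = b\<^sup>2 * (norm (mpow (om j) i) * norm (mpow (om j) (n - i)))" by (simp add: power2_eq_square)
      also have "\<dots> \<le> b\<^sup>2 * (C1 * norm (mpow (om j) n))" using C1(2) i(1) by (intro mult_left_mono) auto
      also have "\<dots> = C1 * (b\<^sup>2 * norm (mpow (om j) n))" by simp
      also have "\<dots> \<le> (C1 + C2) * (b\<^sup>2 * norm (mpow (om j) n))" using C2(1) by (intro mult_right_mono) auto
      finally have "norm (v j) * norm (v j ** mpow (om j) n) \<le> (C1 + C2) * ((norm (v j ** mpow (om j) i))\<^sup>2 * norm (mpow (om j) n))" unfolding b_def .
      then show ?thesis using A i(1) by blast
    qed
    moreover have "C1 + C2 > 0" using C1(1) C2(1) by simp
    ultimately show ?thesis by blast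
  qed
qed

text \<open>Up to sign an element of \<open>\<Gamma>\<close> is determined by any single component,
  by \<open>pm1_transfer\<close>.\<close>

lemma jump_lift:
  assumes u: "u \<in> \<Gamma>" and g: "g \<in> \<Gamma>" and eq: "u k = g k" and jk: "j < r" "k < r"
  shows "\<exists>s::real. \<bar>s\<bar> = 1 \<and> u j = s *\<^sub>R g j"
proof -
  let ?h = "\<lambda>i. u i ** inv2 (g i)"
  have "?h \<in> \<Gamma>" by (rule mult_G[OF u inv_G[OF g]])
  moreover have "pm1 (?h k)" using inv2_right[OF det_G[OF g]] by (simp add: eq pm1_def)
  ultimately have "pm1 (?h j)" using pm1_transfer[of ?h k j] jk by simp
  then obtain s where s: "\<bar>s\<bar> = 1" "u j ** inv2 (g j) = s *\<^sub>R mat 1"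
    by (auto simp: pm1_def intro: that[of 1] that[of "-1"])
  have "u j = (u j ** inv2 (g j)) ** g j" by (rule inv2_cancel_right'[OF det_G[OF g], symmetric])
  also have "\<dots> = s *\<^sub>R g j" unfolding s(2) by (simp add: mat2_eq_iff)
  finally show ?thesis using s(1) by blast
qed

text \<open>Here v is an element of \<open>\<Gamma>\<close> and not of its projection, so that its
  other components remain available.\<close>

definition close :: "nat \<Rightarrow> real \<Rightarrow> mat2 \<Rightarrow> nat \<Rightarrow> (nat \<Rightarrow> mat2) \<Rightarrow> bool" where
  "close k R M t v \<longleftrightarrow> v \<in> \<Gamma> \<and> norm (inv2 (v k) ** M ** dg (real t)) \<le> R"

definition consec :: "nat \<Rightarrow> real \<Rightarrow> mat2 \<Rightarrow> nat \<Rightarrow> nat \<Rightarrow> bool" where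
  "consec k R M t t' \<longleftrightarrow> t < t' \<and> (\<forall>s v. t < s \<longrightarrow> s < t' \<longrightarrow> \<not> close k R M s v)"

end

text \<open>The bound 12 makes both ends of the geodesic in \<open>geodesic\<close> close: they need
  only 2 and 8.\<close>

locale chain_group = agroup +
  fixes k R L
  assumes k: "k < r" and disc: "discrete_grp (proj k \<Gamma>)" and R: "R \<ge> 12"
    and L: "finite L" "L \<subseteq> \<Gamma> \<times> \<Gamma>" "\<forall>(om, \<epsilon>)\<in>L. jump_type (om k)"
    and jump: "det M = 1 \<Longrightarrow> consec k R M t t' \<Longrightarrow> close k R M t v \<Longrightarrow> close k R M t' v' \<Longrightarrow>
      \<exists>(om, \<epsilon>)\<in>L. \<exists>n. inv2 (v k) ** v' k = mpow (om k) n ** \<epsilon> k"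

lemma (in agroup) ex_chain_group:
  assumes fg: "fin_gen r \<Gamma>" and k: "k < r" and disc: "discrete_grp (proj k \<Gamma>)"
  shows "\<exists>R L. chain_group r \<Gamma> k R L"
proof -
  obtain R1 where "connected_orbit (proj k \<Gamma>) R1" using fin_gen_connected_orbit[OF fg k disc proj_sl2_group] by blast
  then interpret connected_orbit "proj k \<Gamma>" R1 .
  define R where "R = 4 * (\<bar>R1\<bar> + 2) + 12"
  have R4: "R \<ge> 4 * (\<bar>R1\<bar> + 2)" by (simp add: R_def)
  obtain L0 where L0: "finite L0" "L0 \<subseteq> proj k \<Gamma> \<times> proj k \<Gamma>" "\<forall>(w, e)\<in>L0. jump_type w"
    and J: "\<forall>M t t'. \<forall>v\<in>proj k \<Gamma>. \<forall>v'\<in>proj k \<Gamma>. det M = 1 \<longrightarrow> consecutive R M t t' \<longrightarrow> norm (inv2 v ** M ** dg (real t)) \<le> R \<longrightarrow>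
      norm (inv2 v' ** M ** dg (real t')) \<le> R \<longrightarrow> (\<exists>(w, e)\<in>L0. \<exists>n. inv2 v ** v' = mpow w n ** e)"
    using consecutive_jumps[OF R4] by (elim exE conjE) (rule that)
  define lift where "lift M = (SOME g. g \<in> \<Gamma> \<and> g k = M)" for M
  have lift: "lift M \<in> \<Gamma>" "lift M k = M" if "M \<in> proj k \<Gamma>" for M
    using that someI_ex[of "\<lambda>g. g \<in> \<Gamma> \<and> g k = M"] unfolding lift_def by (auto simp: proj_def)
  define L where "L = (\<lambda>(w, e). (lift w, lift e)) ` L0"
  have "chain_group r \<Gamma> k R L"
  proof (unfold_locales)
    show "k < r" "discrete_grp (proj k \<Gamma>)" by (fact k disc)+
    show "R \<ge> 12" by (simp add: R_def)
    show "finite L" unfolding L_def using L0(1) by (rule finite_imageI)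
    show "L \<subseteq> \<Gamma> \<times> \<Gamma>" unfolding L_def using L0(2) lift(1) by auto
    show "\<forall>(om, \<epsilon>)\<in>L. jump_type (om k)"
    proof
      fix x assume "x \<in> L"
      then obtain w e where we: "(w, e) \<in> L0" "x = (lift w, lift e)" unfolding L_def by auto
      then have "w \<in> proj k \<Gamma>" "jump_type w" using L0 by auto
      then show "case x of (om, \<epsilon>) \<Rightarrow> jump_type (om k)" using we(2) lift(2) by simp
    qed
    show "\<exists>(om, \<epsilon>)\<in>L. \<exists>n. inv2 (v k) ** v' k = mpow (om k) n ** \<epsilon> k"
      if M: "det M = 1" and c: "consec k R M t t'" and v: "close k R M t v" and v': "close k R M t' v'" for M t t' v v'
    proof -
      have "consecutive R M t t'"
        unfolding consecutive_def
      proof (intro conjI allI impI ballI)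
        show "t < t'" using c by (simp add: consec_def)
        fix s g assume s: "t < s" "s < t'" "g \<in> proj k \<Gamma>"
        have "\<not> close k R M s (lift g)" using c s unfolding consec_def by blast
        then show "R < norm (inv2 g ** M ** dg (real s))" using lift[OF s(3)] by (simp add: close_def)
      qed
      moreover have "v k \<in> proj k \<Gamma>" "v' k \<in> proj k \<Gamma>" using v v' by (auto simp: close_def proj_def)
      moreover have "norm (inv2 (v k) ** M ** dg (real t)) \<le> R" "norm (inv2 (v' k) ** M ** dg (real t')) \<le> R" using v v' by (auto simp: close_def)
      ultimately have "\<exists>(w, e)\<in>L0. \<exists>n. inv2 (v k) ** v' k = mpow w n ** e" using J M by simp
      then obtain w e n where we: "(w, e) \<in> L0" "inv2 (v k) ** v' k = mpow w n ** e" by blast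
      have "w \<in> proj k \<Gamma>" "e \<in> proj k \<Gamma>" using we(1) L0(2) by auto
      then have "inv2 (v k) ** v' k = mpow (lift w k) n ** lift e k" using we(2) lift(2) by simp
      moreover have "(lift w, lift e) \<in> L" unfolding L_def using we(1) by force
      ultimately show ?thesis by blast
    qed
  qed
  then show ?thesis by blast
qed

text \<open>Since b is at least 1, constants and exponents may be replaced by their sums.\<close>

lemma finite_uniform_bound:
  assumes "finite A" "\<And>x. x \<in> A \<Longrightarrow> \<exists>C p. C \<ge> (0::real) \<and> (\<forall>a b. Q x a b \<longrightarrow> b \<ge> (1::real) \<and> a \<le> C * b ^ p)"
  shows "\<exists>C p. C \<ge> 0 \<and> (\<forall>x\<in>A. \<forall>a b. Q x a b \<longrightarrow> a \<le> C * b ^ p)"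
proof -
  have "\<forall>x\<in>A. \<exists>C p. C \<ge> 0 \<and> (\<forall>a b. Q x a b \<longrightarrow> b \<ge> 1 \<and> a \<le> C * b ^ p)" using assms(2) by (intro ballI)
  then obtain C where "\<forall>x\<in>A. \<exists>p. C x \<ge> 0 \<and> (\<forall>a b. Q x a b \<longrightarrow> b \<ge> 1 \<and> a \<le> C x * b ^ p)"
    by (drule_tac bchoice) (elim exE, rule that)
  then obtain p where Cp: "\<forall>x\<in>A. C x \<ge> 0 \<and> (\<forall>a b. Q x a b \<longrightarrow> b \<ge> 1 \<and> a \<le> C x * b ^ p x)"
    by (drule_tac bchoice) (elim exE, rule that)
  have "a \<le> sum C A * b ^ sum p A" if x: "x \<in> A" and q: "Q x a b" for x a b
  proof -
    have b: "b \<ge> 1" and a: "a \<le> C x * b ^ p x" and C0: "C x \<ge> 0" using Cp x q by simp_all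
    have "C x \<le> sum C A" using Cp by (intro member_le_sum x assms(1)) auto
    moreover have "p x \<le> sum p A" by (intro member_le_sum x assms(1)) auto
    then have "b ^ p x \<le> b ^ sum p A" using b by (intro power_increasing)
    ultimately have "C x * b ^ p x \<le> sum C A * b ^ sum p A" using C0 b by (intro mult_mono) auto
    then show ?thesis using a by linarith
  qed
  moreover have "sum C A \<ge> 0" using Cp by (intro sum_nonneg) auto
  ultimately show ?thesis by blast
qed

section \<open>Chains of jumps along a geodesic and comparison of norms\<close>

context chain_group
begin

abbreviation "cls \<equiv> close k R"
abbreviation "csc \<equiv> consec k R"

lemma prev_close:
  assumes "cls M t0 v0" "cls M t1 v1" "t0 < t1"
  obtains t v where "t0 \<le> t" "t < t1" "cls M t v" "t = t0 \<longrightarrow> v = v0" "csc M t t1"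
proof -
  define A where "A = {t. t0 \<le> t \<and> t < t1 \<and> (\<exists>v. cls M t v)}"
  have fA: "finite A" unfolding A_def by (rule finite_subset[of _ "{..<t1}"]) auto
  have t0A: "t0 \<in> A" using assms by (auto simp: A_def)
  define t where "t = Max A"
  have tA: "t \<in> A" unfolding t_def using fA t0A by (intro Max_in) auto
  have "csc M t t1"
    unfolding consec_def
  proof (intro conjI allI impI notI)
    show "t < t1" using tA by (simp add: A_def)
    fix s v assume s: "t < s" "s < t1" "cls M s v"
    have "t0 \<le> t" using tA by (simp add: A_def)
    then have "s \<in> A" using s by (auto simp: A_def)
    then have "s \<le> t" unfolding t_def using fA by (intro Max_ge)
    then show False using s(1) by simp
  qed
  moreover obtain v where "cls M t v" using tA by (auto simp: A_def)
  then obtain v' where "cls M t v'" "t = t0 \<longrightarrow> v' = v0" using assms(1) by (cases "t = t0") auto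
  moreover have "t0 \<le> t" "t < t1" using tA by (simp_all add: A_def)
  ultimately show thesis using that by simp
qed

lemma next_close:
  assumes "cls M t0 v0" "cls M t1 v1" "t0 < t1"
  obtains t v where "t0 < t" "t \<le> t1" "cls M t v" "t = t1 \<longrightarrow> v = v1" "csc M t0 t"
proof -
  define A where "A = {t. t0 < t \<and> t \<le> t1 \<and> (\<exists>v. cls M t v)}"
  have fA: "finite A" unfolding A_def by (rule finite_subset[of _ "{..t1}"]) auto
  have t1A: "t1 \<in> A" using assms by (auto simp: A_def)
  define t where "t = Min A"
  have tA: "t \<in> A" unfolding t_def using fA t1A by (intro Min_in) auto
  have "csc M t0 t"
    unfolding consec_def
  proof (intro conjI allI impI notI)
    show "t0 < t" using tA by (simp add: A_def)
    fix s v assume s: "t0 < s" "s < t" "cls M s v"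
    have "t \<le> t1" using tA by (simp add: A_def)
    then have "s \<in> A" using s by (auto simp: A_def)
    then have "t \<le> s" unfolding t_def using fA by (intro Min_le)
    then show False using s(2) by simp
  qed
  moreover obtain v where "cls M t v" using tA by (auto simp: A_def)
  then obtain v' where "cls M t v'" "t = t1 \<longrightarrow> v' = v1" using assms(2) by (cases "t = t1") auto
  moreover have "t0 < t" "t \<le> t1" using tA by (simp_all add: A_def)
  ultimately show thesis using that by simp
qed

text \<open>Strong induction on time, through the preceding close time. The step is available for
  every choice of close elements, so no particular chain has to be fixed.\<close>

lemma chain_forward:
  assumes c: "cls M t0 v0" "cls M t1 v1" "t0 < t1" and base: "P t0 v0"
    and step: "\<And>t v t' v'. t0 \<le> t \<Longrightarrow> t' \<le> t1 \<Longrightarrow> csc M t t' \<Longrightarrow> cls M t v \<Longrightarrow> cls M t' v' \<Longrightarrow> P t v \<Longrightarrow> P t' v'"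
  shows "P t1 v1"
proof -
  have "\<forall>v. t0 < t \<longrightarrow> t \<le> t1 \<longrightarrow> cls M t v \<longrightarrow> P t v" for t
  proof (induction t rule: less_induct)
    case (less t)
    show ?case
    proof (intro allI impI)
      fix v assume t: "t0 < t" "t \<le> t1" "cls M t v"
      obtain s w where s: "t0 \<le> s" "s < t" "cls M s w" "s = t0 \<longrightarrow> w = v0" "csc M s t" using prev_close[OF c(1) t(3,1)] .
      have "P s w"
      proof (cases "s = t0")
        case True then show ?thesis using s(4) base by simp
      next
        case False
        have "t0 < s" "s \<le> t1" using False s(1,2) t(2) by auto
        then show ?thesis using less[OF s(2)] s(3) by simp
      qed
      then show "P t v" by (rule step[OF s(1) t(2) s(5) s(3) t(3)])
    qed
  qed
  then show ?thesis using c by simp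
qed

lemma chain_backward:
  assumes c: "cls M t0 v0" "cls M t1 v1" "t0 < t1" and base: "P t1 v1"
    and step: "\<And>t v t' v'. t0 \<le> t \<Longrightarrow> t' \<le> t1 \<Longrightarrow> csc M t t' \<Longrightarrow> cls M t v \<Longrightarrow> cls M t' v' \<Longrightarrow> P t' v' \<Longrightarrow> P t v"
  shows "P t0 v0"
proof -
  have "\<forall>t v. t0 \<le> t \<longrightarrow> t < t1 \<longrightarrow> t1 - t = d \<longrightarrow> cls M t v \<longrightarrow> P t v" for d
  proof (induction d rule: less_induct)
    case (less d)
    show ?case
    proof (intro allI impI)
      fix t v assume t: "t0 \<le> t" "t < t1" "t1 - t = d" "cls M t v"
      obtain s w where s: "t < s" "s \<le> t1" "cls M s w" "s = t1 \<longrightarrow> w = v1" "csc M t s" using next_close[OF t(4) c(2) t(2)] .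
      have "P s w"
      proof (cases "s = t1")
        case True then show ?thesis using s(4) base by simp
      next
        case False
        have "t0 \<le> s" "s < t1" "t1 - s < d" using False s(1,2) t by auto
        then show ?thesis using less[of "t1 - s"] s(3) by simp
      qed
      then show "P t v" by (rule step[OF t(1) s(2) s(5) t(4) s(3)])
    qed
  qed
  then show ?thesis using c by simp
qed

lemma close_norm_ge:
  assumes "cls M t v" shows "norm (M ** dg (real t)) \<le> R * norm (v k)"
proof -
  have d: "det (v k) = 1" and n: "norm (inv2 (v k) ** M ** dg (real t)) \<le> R" using assms by (auto simp: close_def)
  have "norm (M ** dg (real t)) \<le> norm (inv2 (v k)) * norm (inv2 (v k) ** (M ** dg (real t)))"
    by (rule norm_mult2_ge') (simp add: det_inv2 d)
  also have "\<dots> \<le> norm (v k) * R" using n by (intro mult_mono) (auto simp: matrix_mul_assoc)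
  finally show ?thesis by (simp add: mult.commute)
qed

lemma close_pair_norm:
  assumes M: "det M = 1" and c: "cls M t v" "cls M t' v'" and t: "t \<le> t'"
  shows "norm (inv2 (v k) ** v' k) \<le> 2 * R\<^sup>2 * exp ((real t' - real t) / 2)"
proof -
  have n: "norm (inv2 (v k) ** M ** dg (real t)) \<le> R" "norm (inv2 (v' k) ** M ** dg (real t')) \<le> R" using c by (auto simp: close_def)
  have "norm (inv2 (v k) ** v' k) \<le> (norm (inv2 (v k) ** M ** dg (real t)) * norm (dg (real t' - real t))) * norm (inv2 (v' k) ** M ** dg (real t'))"
    by (rule norm_step_le[OF M])
  also have "\<dots> \<le> (R * (2 * exp ((real t' - real t) / 2))) * R"
  proof (intro mult_mono n)
    show "norm (dg (real t' - real t)) \<le> 2 * exp ((real t' - real t) / 2)" using norm_dg_le[of "real t' - real t"] t by simp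
  qed (use R in auto)
  finally show ?thesis by (simp add: power2_eq_square mult_ac)
qed

lemma geodesic:
  assumes g: "g \<in> \<Gamma>" "g' \<in> \<Gamma>"
  obtains M n s where "det M = 1" "cls M 0 g" "cls M n g'" "n > 0" "s \<ge> 0" "s \<le> real n" "real n \<le> s + 1"
    "exp (s / 2) \<le> 4 * norm (inv2 (g k) ** g' k)" "norm (g k) \<le> 2 * norm (M ** dg 0)" "norm (g' k) \<le> 8 * norm (M ** dg (real n))"
proof -
  have d: "det (inv2 (g k) ** g' k) = 1" using g by (simp add: det_mult1 det_inv2)
  obtain P K s where s: "s \<ge> 0" and PK: "det P = 1" "det K = 1" "norm P \<le> 2" "norm K \<le> 2" and eq: "inv2 (g k) ** g' k = P ** dg s ** K"
    by (rule polar_decomposition[OF d]) (rule that)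
  define M where "M = g k ** P"
  have dM: "det M = 1" unfolding M_def by (rule det_mult1) (simp_all add: g PK)
  \<comment> \<open>Positive even for s < 1; overshooting by at most 1 costs a factor 4 in the
    closeness of g'.\<close>
  define n where "n = nat \<lfloor>s\<rfloor> + 1"
  have n: "s \<le> real n" "real n \<le> s + 1" "n > 0" using s by (simp_all add: n_def) linarith
  have g'eq: "g' k = M ** dg s ** K"
  proof -
    have "g' k = g k ** (inv2 (g k) ** g' k)" by (rule inv2_cancel_left'[OF det_G[OF g(1)], symmetric])
    then show ?thesis unfolding eq M_def by (simp add: matrix_mul_assoc)
  qed
  have 1: "cls M 0 g"
  proof -
    have "inv2 (g k) ** M ** dg (real 0) = P"
      unfolding M_def using inv2_cancel_left[OF det_G[OF g(1)], of k P] by (simp add: matrix_mul_rid)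
    then show ?thesis using g PK(3) R by (simp add: close_def)
  qed
  have 2: "cls M n g'"
  proof -
    have dMs: "det (M ** dg s) = 1" by (rule det_mult1) (simp_all add: dM)
    have e: "M ** dg (real n) = (M ** dg s) ** dg (real n - s)" by (simp add: matrix_mul_assoc[symmetric] dg_add)
    have "inv2 (g' k) ** M ** dg (real n) = inv2 K ** (inv2 (M ** dg s) ** ((M ** dg s) ** dg (real n - s)))"
      unfolding matrix_mul_assoc[symmetric, of "inv2 (g' k)"] e unfolding g'eq inv2_mult[of "M ** dg s" K] by (simp add: matrix_mul_assoc)
    also have "\<dots> = inv2 K ** dg (real n - s)" unfolding inv2_cancel_left[OF dMs] ..
    finally have "norm (inv2 (g' k) ** M ** dg (real n)) \<le> norm (inv2 K) * norm (dg (real n - s))" using norm_mult2 by metis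
    also have "\<dots> \<le> 2 * 4" using PK(4) n by (intro mult_mono norm_dg_le4) auto
    finally show ?thesis using R g by (simp add: close_def)
  qed
  have 3: "exp (s / 2) \<le> 4 * norm (inv2 (g k) ** g' k)"
  proof -
    have "exp (s / 2) \<le> norm (dg s)" by (rule norm_dg_ge)
    also have "\<dots> \<le> norm P * norm (inv2 K) * norm (P ** dg s ** inv2 (inv2 K))"
      by (rule norm_conj_ge) (simp_all add: PK det_inv2)
    also have "\<dots> = (norm P * norm K) * norm (inv2 (g k) ** g' k)" unfolding eq by (simp add: inv2_inv2)
    also have "\<dots> \<le> (2 * 2) * norm (inv2 (g k) ** g' k)" using PK by (intro mult_right_mono mult_mono) auto
    finally show ?thesis by simp
  qed
  have 4: "norm (g k) \<le> 2 * norm (M ** dg 0)"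
  proof -
    have "norm (g k) \<le> norm (g k ** P) * norm P" by (rule norm_mult2_ge[OF PK(1)])
    also have "\<dots> \<le> norm (g k ** P) * 2" using PK(3) by (intro mult_left_mono) auto
    finally show ?thesis by (simp add: M_def matrix_mul_rid mult.commute)
  qed
  have 5: "norm (g' k) \<le> 8 * norm (M ** dg (real n))"
  proof -
    have "norm (g' k) \<le> norm (M ** dg s) * norm K" unfolding g'eq by (rule norm_mult2)
    also have "\<dots> \<le> (4 * norm (M ** dg (real n))) * 2" using PK(4) n by (intro mult_mono norm_mult_dg_near) auto
    finally show ?thesis by simp
  qed
  show thesis by (rule that[OF dM 1 2 n(3) s n(1,2) 3 4 5])
qed

lemma jumps_lower:
  assumes l: "l < r"
  shows "\<exists>C p. C \<ge> 0 \<and> (\<forall>(om, \<epsilon>)\<in>L. \<forall>u\<in>\<Gamma>. \<forall>n. u k = mpow (om k) n ** \<epsilon> k \<longrightarrow> norm (u l) \<le> C * norm (u k) ^ p)"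
proof -
  let ?Q = "\<lambda>(om, \<epsilon>) a b. \<exists>u\<in>\<Gamma>. \<exists>n. u k = mpow (om k) n ** \<epsilon> k \<and> a = norm (u l) \<and> b = norm (u k)"
  have "\<exists>C p. C \<ge> 0 \<and> (\<forall>x\<in>L. \<forall>a b. ?Q x a b \<longrightarrow> a \<le> C * b ^ p)"
  proof (rule finite_uniform_bound[OF L(1)])
    fix x assume x: "x \<in> L"
    obtain om \<epsilon> where xe: "x = (om, \<epsilon>)" by (cases x)
    have oe: "om \<in> \<Gamma>" "\<epsilon> \<in> \<Gamma>" "jump_type (om k)" using x L(2,3) unfolding xe by auto
    obtain C p where C: "C \<ge> 0" "\<forall>n. norm (mpow (om l) n) \<le> C * norm (mpow (om k) n) ^ p" using jump_lower[OF oe(1,3) l k] by blast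
    define C' where "C' = C * norm (\<epsilon> k) ^ p * norm (\<epsilon> l)"
    have "b \<ge> 1 \<and> a \<le> C' * b ^ p" if q: "?Q x a b" for a b
    proof -
      obtain u n where u: "u \<in> \<Gamma>" "u k = mpow (om k) n ** \<epsilon> k" "a = norm (u l)" "b = norm (u k)" using q unfolding xe by auto
      have wG: "(\<lambda>i. mpow (om i) n ** \<epsilon> i) \<in> \<Gamma>" by (rule mult_G[OF pow_G[OF oe(1)] oe(2)])
      then obtain s where s: "\<bar>s\<bar> = (1::real)" "u l = s *\<^sub>R (mpow (om l) n ** \<epsilon> l)"
        using jump_lift[OF u(1) wG, of k l] u(2) l k by auto
      have "norm (mpow (om k) n) \<le> norm (mpow (om k) n ** \<epsilon> k) * norm (\<epsilon> k)" by (rule norm_mult2_ge) (simp add: oe)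
      then have wk: "norm (mpow (om k) n) \<le> b * norm (\<epsilon> k)" using u by simp
      have "a = norm (mpow (om l) n ** \<epsilon> l)" using s u(3) by simp
      also have "\<dots> \<le> norm (mpow (om l) n) * norm (\<epsilon> l)" by (rule norm_mult2)
      also have "\<dots> \<le> (C * norm (mpow (om k) n) ^ p) * norm (\<epsilon> l)" using C(2) by (intro mult_right_mono) auto
      also have "\<dots> \<le> (C * (b * norm (\<epsilon> k)) ^ p) * norm (\<epsilon> l)" using wk C(1) by (intro mult_right_mono mult_left_mono power_mono) auto
      finally have "a \<le> C' * b ^ p" by (simp add: C'_def power_mult_distrib mult_ac)
      moreover have "b \<ge> 1" unfolding u(4) by (rule norm_ge1[OF det_G[OF u(1)]])
      ultimately show ?thesis by simp
    qed
    moreover have "C' \<ge> 0" using C(1) by (simp add: C'_def)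
    ultimately show "\<exists>C p. C \<ge> 0 \<and> (\<forall>a b. ?Q x a b \<longrightarrow> b \<ge> 1 \<and> a \<le> C * b ^ p)" by blast
  qed
  then obtain C p where C: "C \<ge> 0" "\<forall>x\<in>L. \<forall>a b. ?Q x a b \<longrightarrow> a \<le> C * b ^ p" by blast
  have "\<forall>(om, \<epsilon>)\<in>L. \<forall>u\<in>\<Gamma>. \<forall>n. u k = mpow (om k) n ** \<epsilon> k \<longrightarrow> norm (u l) \<le> C * norm (u k) ^ p"
  proof (clarify)
    fix om \<epsilon> u n assume "(om, \<epsilon>) \<in> L" "u \<in> \<Gamma>" "u k = mpow (om k) n ** \<epsilon> k"
    then have "?Q (om, \<epsilon>) (norm (u l)) (norm (u k))" by auto
    then show "norm (u l) \<le> C * norm (u k) ^ p" using C(2) \<open>(om, \<epsilon>) \<in> L\<close> by blast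
  qed
  then show ?thesis using C(1) by blast
qed

text \<open>A jump from time t to t' multiplies the norm in component l by at most exp (m (t' - t)).
  Along the geodesic to g these factors multiply to exp (m n), a power of \<open>norm (g k)\<close>
  up to a constant.\<close>

lemma norm_comparison:
  assumes l: "l < r"
  shows "\<exists>C p. C > 0 \<and> (\<forall>g\<in>\<Gamma>. norm (g l) \<le> C * norm (g k) ^ p)"
proof -
  obtain C p where C: "C \<ge> 0" and J: "\<forall>(om, \<epsilon>)\<in>L. \<forall>u\<in>\<Gamma>. \<forall>n. u k = mpow (om k) n ** \<epsilon> k \<longrightarrow> norm (u l) \<le> C * norm (u k) ^ p"
    using jumps_lower[OF l] by blast
  \<comment> \<open>Every jump lasts at least one unit of time, so the rate m can absorb the
    multiplicative constant of each jump.\<close>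
  obtain m :: nat where m: "(C + 1) * (2 * R\<^sup>2) ^ p * exp (real p / 2) \<le> exp (real m)"
  proof -
    define z where "z = (C + 1) * (2 * R\<^sup>2) ^ p * exp (real p / 2)"
    have "z \<le> exp (real (nat \<lceil>z\<rceil>))" using exp_ge_add_one_self[of "real (nat \<lceil>z\<rceil>)"] real_nat_ceiling_ge[of z] by linarith
    then show thesis using that unfolding z_def by blast
  qed
  have step: "norm (inv2 (v l) ** v' l) \<le> exp (real m * (real t' - real t))"
    if M: "det M = 1" and c: "csc M t t'" "cls M t v" "cls M t' v'" for M t t' v v'
  proof -
    have tt: "real t' - real t \<ge> 1" using c(1) by (auto simp: consec_def)
    define d where "d = real t' - real t"
    let ?u = "\<lambda>i. inv2 (v i) ** v' i"
    have u: "?u \<in> \<Gamma>" using c(2,3) by (auto simp: close_def intro: mult_G inv_G)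
    obtain om \<epsilon> n where "(om, \<epsilon>) \<in> L" "inv2 (v k) ** v' k = mpow (om k) n ** \<epsilon> k" using jump[OF M c] by blast
    then have "norm (?u l) \<le> C * norm (?u k) ^ p" using J u by fast
    also have "\<dots> \<le> C * (2 * R\<^sup>2 * exp (d / 2)) ^ p"
      unfolding d_def using c(1) by (intro mult_left_mono power_mono close_pair_norm[OF M c(2,3)] C) (auto simp: consec_def)
    also have "\<dots> = C * (2 * R\<^sup>2) ^ p * exp (real p / 2 * d)"
      by (simp add: power_mult_distrib exp_of_nat_mult[symmetric])
    also have "\<dots> \<le> ((C + 1) * (2 * R\<^sup>2) ^ p * exp (real p / 2)) * exp (real p / 2 * d - real p / 2)"
    proof -
      have "exp (real p / 2) * exp (real p / 2 * d - real p / 2) = exp (real p / 2 * d)" by (simp add: exp_add[symmetric])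
      then have "((C + 1) * (2 * R\<^sup>2) ^ p * exp (real p / 2)) * exp (real p / 2 * d - real p / 2) = (C + 1) * ((2 * R\<^sup>2) ^ p * exp (real p / 2 * d))"
        by (simp only: mult.assoc)
      moreover have "C * ((2 * R\<^sup>2) ^ p * exp (real p / 2 * d)) \<le> (C + 1) * ((2 * R\<^sup>2) ^ p * exp (real p / 2 * d))"
        by (intro mult_right_mono) auto
      ultimately show ?thesis by (simp only: mult.assoc)
    qed
    also have "\<dots> \<le> ((C + 1) * (2 * R\<^sup>2) ^ p * exp (real p / 2)) * exp (real m * (d - 1))"
    proof (intro mult_left_mono)
      have "1 \<le> (C + 1) * (2 * R\<^sup>2) ^ p"
      proof -
        have "1 \<le> R\<^sup>2" using R by (intro one_le_power) simp
        then have "1 \<le> (2 * R\<^sup>2) ^ p" by (intro one_le_power) simp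
        then have "1 * 1 \<le> (C + 1) * (2 * R\<^sup>2) ^ p" using C by (intro mult_mono) auto
        then show ?thesis by simp
      qed
      then have "1 * exp (real p / 2) \<le> (C + 1) * (2 * R\<^sup>2) ^ p * exp (real p / 2)" by (intro mult_right_mono) auto
      then have "exp (real p / 2) \<le> exp (real m)" using m by linarith
      then have "real p / 2 \<le> real m" by simp
      then have "(real p / 2) * (d - 1) \<le> real m * (d - 1)" using tt unfolding d_def by (intro mult_right_mono) auto
      then show "exp (real p / 2 * d - real p / 2) \<le> exp (real m * (d - 1))" by (simp add: right_diff_distrib)
    qed (use C in simp)
    also have "\<dots> \<le> exp (real m) * exp (real m * (d - 1))" using m by (intro mult_right_mono) auto
    also have "\<dots> = exp (real m * d)" by (simp add: exp_add[symmetric] right_diff_distrib)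
    finally show ?thesis unfolding d_def .
  qed
  have "norm (g l) \<le> (2 * exp (real m) * 4 ^ (2 * m)) * norm (g k) ^ (2 * m)" if g: "g \<in> \<Gamma>" for g
  proof -
    obtain M n s where M: "det M = 1" and c: "cls M 0 (\<lambda>i. mat 1)" "cls M n g" "n > 0" and s: "s \<ge> 0" "s \<le> real n" "real n \<le> s + 1"
      and e: "exp (s / 2) \<le> 4 * norm (inv2 (mat 1) ** g k)"
      by (rule geodesic[OF one_G g]) (rule that)
    have i1: "inv2 (mat 1) = (mat 1 :: mat2)" by (simp add: mat2_eq_iff)
    have "norm (g l) \<le> 2 * exp (real m * real n)"
    proof (rule chain_forward[OF c, where P = "\<lambda>t v. norm (v l) \<le> 2 * exp (real m * real t)"])
      show "norm (mat 1 :: mat2) \<le> 2 * exp (real m * real 0)" using pm1_norm[of "mat 1"] by (simp add: pm1_def)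
      fix t v t' v' assume a: "csc M t t'" "cls M t v" "cls M t' v'" "norm (v l) \<le> 2 * exp (real m * real t)"
      have "det (v l) = 1" using a(2) by (simp add: close_def)
      then have "v' l = v l ** (inv2 (v l) ** v' l)" by (rule inv2_cancel_left'[symmetric])
      then have "norm (v' l) \<le> norm (v l) * norm (inv2 (v l) ** v' l)" using norm_mult2 by metis
      also have "\<dots> \<le> (2 * exp (real m * real t)) * exp (real m * (real t' - real t))"
        by (intro mult_mono a(4) step[OF M a(1-3)]) auto
      also have "\<dots> = 2 * exp (real m * real t')" by (simp add: exp_add[symmetric] right_diff_distrib)
      finally show "norm (v' l) \<le> 2 * exp (real m * real t')" .
    qed
    also have "\<dots> \<le> 2 * exp (real m * (s + 1))" using s(3) by (intro mult_left_mono) (auto intro: mult_left_mono)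
    also have "\<dots> = 2 * exp (real m) * exp (s / 2) ^ (2 * m)"
      by (simp add: distrib_left exp_add exp_of_nat_mult[symmetric] mult.commute)
    also have "\<dots> \<le> 2 * exp (real m) * (4 * norm (g k)) ^ (2 * m)"
      using e by (intro mult_left_mono power_mono) (auto simp: i1 matrix_mul_lid)
    finally show ?thesis by (simp add: power_mult_distrib mult_ac)
  qed
  moreover have "2 * exp (real m) * 4 ^ (2 * m) > 0" by simp
  ultimately show ?thesis by blast
qed

end

section \<open>Visual size and the Hoelder estimate\<close>

context chain_group
begin

text \<open>At the index given by \<open>jump_nearest\<close> let al and ak be the norms in
  components l and k. Then \<open>vis\<close> is at most C0 / al in l and at least 1 / (C0 ak^2) in
  k, and ak is at most C3 al^p. Eliminating both norms gives the exponent 2 p.\<close>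

lemma jump_vis:
  assumes l: "l < r" and dl: "discrete_grp (proj l \<Gamma>)" and C3: "C3 > 0" and comp: "\<And>g. g \<in> \<Gamma> \<Longrightarrow> norm (g k) \<le> C3 * norm (g l) ^ p"
  shows "\<exists>C. C \<ge> 0 \<and> (\<forall>(om, \<epsilon>)\<in>L. \<forall>v\<in>\<Gamma>. \<forall>u\<in>\<Gamma>. \<forall>n. u k = mpow (om k) n ** \<epsilon> k \<longrightarrow> vis (v l) (u l) ^ (2 * p) \<le> C * vis (v k) (u k))"
proof -
  have one: "\<exists>C. C \<ge> 0 \<and> (\<forall>v\<in>\<Gamma>. \<forall>u\<in>\<Gamma>. \<forall>n. u k = mpow (fst x k) n ** snd x k \<longrightarrow> vis (v l) (u l) ^ (2 * p) \<le> C * vis (v k) (u k))"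
    if x: "x \<in> L" for x
  proof -
    obtain om \<epsilon> where xe: "x = (om, \<epsilon>)" by (cases x)
    have oe: "om \<in> \<Gamma>" "\<epsilon> \<in> \<Gamma>" "jump_type (om k)" using x L(2,3) unfolding xe by auto
    obtain C0 where C0: "C0 > 0" "\<forall>v\<in>\<Gamma>. \<forall>n. \<exists>i\<le>n.
      norm (v l ** mpow (om l) i) * norm (mpow (om l) n) \<le> C0 * (norm (v l) * norm (v l ** mpow (om l) n)) \<and>
      norm (v k) * norm (v k ** mpow (om k) n) \<le> C0 * ((norm (v k ** mpow (om k) i))\<^sup>2 * norm (mpow (om k) n))"
      using jump_nearest[OF oe(1,3) k l dl] by blast
    define D where "D = C0 * C3\<^sup>2 * C0 ^ (2 * p)"
    define C where "C = (norm (\<epsilon> l))\<^sup>2 ^ (2 * p) * D * (norm (\<epsilon> k))\<^sup>2"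
    have D0: "D \<ge> 0" using C0(1) by (simp add: D_def)
    have "vis (v l) (u l) ^ (2 * p) \<le> C * vis (v k) (u k)"
      if v: "v \<in> \<Gamma>" and u: "u \<in> \<Gamma>" "u k = mpow (om k) n ** \<epsilon> k" for v u n
    proof -
      obtain i where i: "norm (v l ** mpow (om l) i) * norm (mpow (om l) n) \<le> C0 * (norm (v l) * norm (v l ** mpow (om l) n))"
        "norm (v k) * norm (v k ** mpow (om k) n) \<le> C0 * ((norm (v k ** mpow (om k) i))\<^sup>2 * norm (mpow (om k) n))"
        using C0(2) v by blast
      define al ak where "al = norm (v l ** mpow (om l) i)" "ak = norm (v k ** mpow (om k) i)"
      define Pl Pk where "Pl = vis (v l) (mpow (om l) n)" "Pk = vis (v k) (mpow (om k) n)"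
      note ap = \<open>al = _\<close> \<open>ak = _\<close> \<open>Pl = _\<close> \<open>Pk = _\<close>
      have vw: "(\<lambda>q. v q ** mpow (om q) m) \<in> \<Gamma>" for m by (rule mult_G[OF v pow_G[OF oe(1)]])
      have pos: "norm (v q) > 0" "norm (v q ** mpow (om q) m) > 0" for q m
        using norm_ge1[OF det_G[OF v, of q]] norm_ge1[OF det_G[OF vw[of m], of q]] by linarith+
      have A: "al * Pl \<le> C0" using i(1) pos[of l] pos(2)[of l n] by (simp add: ap vis_def divide_simps)
      have B: "1 \<le> C0 * (ak\<^sup>2 * Pk)"
        using i(2) pos[of k] pos(2)[of k n] by (simp add: ap vis_def divide_simps)
      have P0: "Pl \<ge> 0" "Pk \<ge> 0" "al \<ge> 0" "ak \<ge> 0" by (simp_all add: ap vis_nonneg)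
      have cmp: "ak \<le> C3 * al ^ p" using comp[OF vw[of i]] by (simp add: ap)
      have "1 \<le> C0 * ((C3 * al ^ p)\<^sup>2 * Pk)"
      proof (rule order_trans[OF B])
        show "C0 * (ak\<^sup>2 * Pk) \<le> C0 * ((C3 * al ^ p)\<^sup>2 * Pk)"
          using cmp P0 C0(1) by (intro mult_left_mono mult_right_mono power_mono) auto
      qed
      then have "Pl ^ (2 * p) * 1 \<le> Pl ^ (2 * p) * (C0 * ((C3 * al ^ p)\<^sup>2 * Pk))" using P0 by (intro mult_left_mono) auto
      also have "\<dots> = (C0 * C3\<^sup>2) * ((al * Pl) ^ (2 * p) * Pk)"
        by (simp add: power_mult_distrib power_mult[symmetric] mult_ac)
      also have "\<dots> \<le> (C0 * C3\<^sup>2) * (C0 ^ (2 * p) * Pk)"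
        using A P0 C0(1) by (intro mult_left_mono mult_right_mono power_mono) auto
      finally have PD: "Pl ^ (2 * p) \<le> D * Pk" by (simp add: D_def mult_ac)
      have wG: "(\<lambda>i. mpow (om i) n ** \<epsilon> i) \<in> \<Gamma>" by (rule mult_G[OF pow_G[OF oe(1)] oe(2)])
      obtain s where s: "\<bar>s\<bar> = (1::real)" "u l = s *\<^sub>R (mpow (om l) n ** \<epsilon> l)"
        using jump_lift[OF u(1) wG, of k l] u(2) l k by auto
      have dw: "det (mpow (om q) n) = 1" for q using det_G[OF pow_G[OF oe(1)]] .
      have 1: "vis (v l) (u l) \<le> (norm (\<epsilon> l))\<^sup>2 * Pl"
        unfolding s(2) vis_scale[OF s(1)] ap by (rule vis_mult_le[OF det_G[OF v] dw det_G[OF oe(2)]])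
      have 2: "Pk \<le> (norm (\<epsilon> k))\<^sup>2 * vis (v k) (u k)"
        unfolding u(2) ap by (rule vis_mult_ge[OF det_G[OF v] dw det_G[OF oe(2)]])
      have "vis (v l) (u l) ^ (2 * p) \<le> ((norm (\<epsilon> l))\<^sup>2 * Pl) ^ (2 * p)" by (intro power_mono 1 vis_nonneg)
      also have "\<dots> = (norm (\<epsilon> l))\<^sup>2 ^ (2 * p) * Pl ^ (2 * p)" by (rule power_mult_distrib)
      also have "\<dots> \<le> (norm (\<epsilon> l))\<^sup>2 ^ (2 * p) * (D * Pk)" using PD by (intro mult_left_mono) auto
      also have "\<dots> \<le> (norm (\<epsilon> l))\<^sup>2 ^ (2 * p) * (D * ((norm (\<epsilon> k))\<^sup>2 * vis (v k) (u k)))"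
        using 2 D0 by (intro mult_left_mono) auto
      finally show ?thesis by (simp add: C_def mult_ac)
    qed
    moreover have "C \<ge> 0" using D0 by (simp add: C_def)
    ultimately show ?thesis unfolding xe by auto
  qed
  then have "\<forall>x\<in>L. \<exists>C. C \<ge> 0 \<and> (\<forall>v\<in>\<Gamma>. \<forall>u\<in>\<Gamma>. \<forall>n. u k = mpow (fst x k) n ** snd x k \<longrightarrow> vis (v l) (u l) ^ (2 * p) \<le> C * vis (v k) (u k))"
    by (intro ballI)
  then obtain C where C: "\<forall>x\<in>L. C x \<ge> 0 \<and> (\<forall>v\<in>\<Gamma>. \<forall>u\<in>\<Gamma>. \<forall>n. u k = mpow (fst x k) n ** snd x k \<longrightarrow> vis (v l) (u l) ^ (2 * p) \<le> C x * vis (v k) (u k))"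
    by (drule_tac bchoice) (elim exE, rule that)
  have "vis (v l) (u l) ^ (2 * p) \<le> sum C L * vis (v k) (u k)"
    if x: "(om, \<epsilon>) \<in> L" and v: "v \<in> \<Gamma>" and u: "u \<in> \<Gamma>" "u k = mpow (om k) n ** \<epsilon> k" for om \<epsilon> v u n
  proof -
    have "vis (v l) (u l) ^ (2 * p) \<le> C (om, \<epsilon>) * vis (v k) (u k)" using bspec[OF C x] v u by simp
    also have "\<dots> \<le> sum C L * vis (v k) (u k)"
      using C by (intro mult_right_mono member_le_sum x L(1) vis_nonneg) auto
    finally show ?thesis .
  qed
  moreover have "sum C L \<ge> 0" using C by (intro sum_nonneg) auto
  ultimately show ?thesis by (intro exI[of _ "sum C L"]) auto
qed

text \<open>The points g and g' are joined by a chain of jumps along a geodesic, and the visual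
  sizes of the jumps in component l are added up. They decay exponentially away from the point of
  the geodesic nearest to the origin, so each of the two halves is a geometric series dominated by
  the visual size of the whole.\<close>

lemma hoelder:
  assumes l: "l < r" and dl: "discrete_grp (proj l \<Gamma>)" and C3: "C3 > 0" and comp0: "\<And>g. g \<in> \<Gamma> \<Longrightarrow> norm (g k) \<le> C3 * norm (g l) ^ p0"
  shows "\<exists>D \<delta>. \<delta> > 0 \<and> (\<forall>g\<in>\<Gamma>. \<forall>g'\<in>\<Gamma>. cmod (orb (g l) - orb (g' l)) \<le> D * vis (g k) (inv2 (g k) ** g' k) powr \<delta>)"
proof -
  \<comment> \<open>Makes the exponent 1 / (2 p) meaningful for p0 = 0.\<close>
  define p where "p = Suc p0"
  have comp: "norm (g k) \<le> C3 * norm (g l) ^ p" if g: "g \<in> \<Gamma>" for g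
  proof -
    have "norm (g l) ^ p0 \<le> norm (g l) ^ p" unfolding p_def by (intro power_increasing norm_ge1 det_G g) simp
    then have "C3 * norm (g l) ^ p0 \<le> C3 * norm (g l) ^ p" using C3 by (intro mult_left_mono) auto
    then show ?thesis using comp0[OF g] by linarith
  qed
  obtain C where C: "C \<ge> 0" and J: "\<forall>(om, \<epsilon>)\<in>L. \<forall>v\<in>\<Gamma>. \<forall>u\<in>\<Gamma>. \<forall>n. u k = mpow (om k) n ** \<epsilon> k \<longrightarrow> vis (v l) (u l) ^ (2 * p) \<le> C * vis (v k) (u k)"
    using jump_vis[OF l dl C3 comp] by blast
  define \<delta> where "\<delta> = 1 / real (2 * p)"
  have \<delta>: "\<delta> > 0" by (simp add: \<delta>_def p_def)
  define D0 where "D0 = 4 * (C * (2 * R^4)) powr \<delta>"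
  have D0: "D0 \<ge> 0" by (simp add: D0_def)
  define N where "N M t = norm (M ** dg (real t))" for M :: mat2 and t :: nat
  \<comment> \<open>The visual size of the part of the geodesic between t and t', up to
    constants.\<close>
  define q where "q M t t' = exp ((real t' - real t) / 2) / (N M t * N M t')" for M t t'
  have Npos: "N M t > 0" if "det M = 1" for M t
  proof -
    have "norm (M ** dg (real t)) \<ge> 1" by (rule norm_ge1) (simp add: det_mult1 that)
    then show ?thesis unfolding N_def by linarith
  qed
  have step: "cmod (orb (v l) - orb (v' l)) \<le> D0 * q M t t' powr \<delta>"
    if M: "det M = 1" and c: "csc M t t'" "cls M t v" "cls M t' v'" for M t t' v v'
  proof -
    let ?u = "\<lambda>i. inv2 (v i) ** v' i"
    have vG: "v \<in> \<Gamma>" "v' \<in> \<Gamma>" using c(2,3) by (auto simp: close_def)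
    have u: "?u \<in> \<Gamma>" by (rule mult_G[OF inv_G[OF vG(1)] vG(2)])
    have tt: "t \<le> t'" using c(1) by (simp add: consec_def)
    obtain om \<epsilon> n where "(om, \<epsilon>) \<in> L" "inv2 (v k) ** v' k = mpow (om k) n ** \<epsilon> k" using jump[OF M c] by blast
    then have Jv: "vis (v l) (?u l) ^ (2 * p) \<le> C * vis (v k) (?u k)" using J u vG(1) by fast
    have "vis (v k) (?u k) = norm (inv2 (v k) ** v' k) / (norm (v k) * norm (v' k))"
      by (simp add: vis_def inv2_cancel_left' vG)
    also have "\<dots> \<le> (2 * R\<^sup>2 * exp ((real t' - real t) / 2)) / (norm (v k) * norm (v' k))"
      by (intro divide_right_mono close_pair_norm[OF M c(2,3) tt]) simp
    also have "\<dots> \<le> (2 * R\<^sup>2 * exp ((real t' - real t) / 2)) / ((N M t / R) * (N M t' / R))"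
    proof (intro divide_left_mono mult_mono)
      show "N M t / R \<le> norm (v k)" "N M t' / R \<le> norm (v' k)"
        using close_norm_ge[OF c(2)] close_norm_ge[OF c(3)] R by (simp_all add: N_def divide_le_eq mult.commute)
      have "norm (v k) > 0" "norm (v' k) > 0" using norm_ge1[OF det_G[OF vG(1), of k]] norm_ge1[OF det_G[OF vG(2), of k]] by linarith+
      then show "0 < norm (v k) * norm (v' k) * (N M t / R * (N M t' / R))" using Npos[OF M] R by simp
    qed (use Npos[OF M, of t'] R in \<open>auto intro: less_imp_le\<close>)
    also have "\<dots> = (2 * R^4) * q M t t'" using R by (simp add: q_def power2_eq_square power4_eq_xxxx)
    finally have "C * vis (v k) (?u k) \<le> (C * (2 * R^4)) * q M t t'" using C by (simp add: mult.assoc mult_left_mono)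
    then have V: "vis (v l) (?u l) ^ (2 * p) \<le> (C * (2 * R^4)) * q M t t'" using Jv by linarith
    have q0: "q M t t' \<ge> 0" using Npos[OF M, of t] Npos[OF M, of t'] by (simp add: q_def)
    have "vis (v l) (?u l) = (vis (v l) (?u l) ^ (2 * p)) powr \<delta>"
    proof (cases "vis (v l) (?u l) = 0")
      case False
      then have "vis (v l) (?u l) > 0" using vis_nonneg[of "v l" "?u l"] by linarith
      moreover have "real (2 * p) * \<delta> = 1" by (simp add: \<delta>_def p_def)
      ultimately show ?thesis by (simp add: powr_realpow[symmetric] powr_powr del: of_nat_mult)
    qed (simp add: p_def)
    also have "\<dots> \<le> ((C * (2 * R^4)) * q M t t') powr \<delta>"
      using V \<delta> by (intro powr_mono2) (auto simp: vis_nonneg)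
    also have "\<dots> = (C * (2 * R^4)) powr \<delta> * q M t t' powr \<delta>" using C q0 by (simp add: powr_mult)
    finally have "4 * vis (v l) (?u l) \<le> D0 * q M t t' powr \<delta>" by (simp add: D0_def)
    moreover have "cmod (orb (v l) - orb (v' l)) \<le> 4 * vis (v l) (?u l)" by (rule orb_diff_le_vis) (simp_all add: vG)
    ultimately show ?thesis by linarith
  qed
  \<comment> \<open>The sum of the geometric series with ratio exp (- \<open>\<delta>\<close>);
    \<open>KD\<close> is its recursion, used for each added jump.\<close>
  define K where "K = D0 / (1 - exp (- \<delta>))"
  have e1: "1 - exp (- \<delta>) > 0" using \<delta> by simp
  have K0: "K \<ge> 0" using e1 D0 by (simp add: K_def)
  have KD: "D0 + K * exp (- \<delta>) = K"
  proof -
    have "K * (1 - exp (- \<delta>)) = D0" using e1 by (simp add: K_def)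
    then show ?thesis by (simp add: right_diff_distrib)
  qed
  have "cmod (orb (g l) - orb (g' l)) \<le> (K * 2 powr \<delta> + D0 + K * 2 powr \<delta>) * 128 powr \<delta> * vis (g k) (inv2 (g k) ** g' k) powr \<delta>"
    if g: "g \<in> \<Gamma>" "g' \<in> \<Gamma>" for g g'
  proof -
    obtain M n s where M: "det M = 1" and c: "cls M 0 g" "cls M n g'" "n > 0" and s: "s \<ge> 0" "s \<le> real n" "real n \<le> s + 1"
      and e: "exp (s / 2) \<le> 4 * norm (inv2 (g k) ** g' k)" "norm (g k) \<le> 2 * norm (M ** dg 0)" "norm (g' k) \<le> 8 * norm (M ** dg (real n))"
      by (rule geodesic[OF g]) (rule that)
    define X Z where "X = (M$1$1)\<^sup>2 + (M$2$1)\<^sup>2" "Z = (M$1$2)\<^sup>2 + (M$2$2)\<^sup>2"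
    note XZ = this
    have XZ0: "X > 0" "Z > 0" using column_pos[OF M] by (simp_all add: XZ)
    have Nsq: "(N M t)\<^sup>2 = exp (real t) * X + exp (- real t) * Z" for t unfolding N_def XZ by (rule norm_mult_dg)
    define Q where "Q = q M 0 n"
    have q0: "q M t t' \<ge> 0" for t t' using Npos[OF M, of t] Npos[OF M, of t'] by (simp add: q_def)
    have qX: "q M t t' \<le> exp (- real t) / X" for t t'
    proof -
      have "(exp ((real t + real t') / 2) * X)\<^sup>2 = (exp (real t) * X) * (exp (real t') * X)"
        by (simp add: power2_eq_square exp_add[symmetric])
      also have "\<dots> \<le> (N M t)\<^sup>2 * (N M t')\<^sup>2" unfolding Nsq using XZ0 by (intro mult_mono) auto
      finally have "exp ((real t + real t') / 2) * X \<le> N M t * N M t'"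
        unfolding power_mult_distrib[symmetric] by (rule power2_le_imp_le) (use Npos[OF M] in \<open>simp add: less_imp_le\<close>)
      then have "q M t t' \<le> exp ((real t' - real t) / 2) / (exp ((real t + real t') / 2) * X)"
        unfolding q_def using XZ0 Npos[OF M] by (intro divide_left_mono) auto
      also have "\<dots> = exp ((real t' - real t) / 2 - (real t + real t') / 2) / X" by (simp add: exp_diff)
      also have "(real t' - real t) / 2 - (real t + real t') / 2 = - real t" by (simp add: field_simps)
      finally show ?thesis .
    qed
    have qZ: "q M t t' \<le> exp (real t') / Z" for t t'
    proof -
      have "(exp (- (real t + real t') / 2) * Z)\<^sup>2 = (exp (- real t) * Z) * (exp (- real t') * Z)"
        by (simp add: power2_eq_square exp_add[symmetric])
      also have "\<dots> \<le> (N M t)\<^sup>2 * (N M t')\<^sup>2" unfolding Nsq using XZ0 by (intro mult_mono) auto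
      finally have "exp (- (real t + real t') / 2) * Z \<le> N M t * N M t'"
        unfolding power_mult_distrib[symmetric] by (rule power2_le_imp_le) (use Npos[OF M] in \<open>simp add: less_imp_le\<close>)
      then have "q M t t' \<le> exp ((real t' - real t) / 2) / (exp (- (real t + real t') / 2) * Z)"
        unfolding q_def using XZ0 Npos[OF M] by (intro divide_left_mono) auto
      also have "\<dots> = exp ((real t' - real t) / 2 - (- (real t + real t') / 2)) / Z" by (simp only: exp_diff divide_divide_eq_left)
      also have "(real t' - real t) / 2 - (- (real t + real t') / 2) = real t'" by (simp add: field_simps)
      finally show ?thesis .
    qed
    have N0: "N M 0 \<le> exp (real t / 2) * N M t" for t
    proof (rule power2_le_imp_le)
      have "X + Z \<le> exp (2 * real t) * X + Z" using XZ0 by simp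
      also have "\<dots> = exp (real t) * (exp (real t) * X + exp (- real t) * Z)" by (simp add: distrib_left exp_add[symmetric] mult.assoc[symmetric])
      also have "\<dots> = (exp (real t / 2) * N M t)\<^sup>2"
        unfolding power_mult_distrib Nsq by (simp add: power2_eq_square exp_add[symmetric])
      finally show "(N M 0)\<^sup>2 \<le> (exp (real t / 2) * N M t)\<^sup>2" unfolding Nsq[of 0] by simp
    qed (use Npos[OF M, of t] in simp)
    have Nn: "N M n \<le> exp ((real n - real t) / 2) * N M t" if "t \<le> n" for t
    proof (rule power2_le_imp_le)
      have "exp (- real n) * Z \<le> exp (real n - 2 * real t) * Z" using that XZ0 by (intro mult_right_mono) auto
      then have "exp (real n) * X + exp (- real n) * Z \<le> exp (real n - real t) * (exp (real t) * X + exp (- real t) * Z)"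
        by (simp add: distrib_left exp_add[symmetric] mult.assoc[symmetric])
      also have "\<dots> = (exp ((real n - real t) / 2) * N M t)\<^sup>2"
        unfolding power_mult_distrib Nsq by (simp add: power2_eq_square exp_add[symmetric])
      finally show "(N M n)\<^sup>2 \<le> (exp ((real n - real t) / 2) * N M t)\<^sup>2" unfolding Nsq[of n] .
    qed (use Npos[OF M, of t] in simp)
    \<comment> \<open>No part of the geodesic looks larger from the origin than the whole.\<close>
    have qQ: "q M t t' \<le> Q" if "t' \<le> n" for t t'
    proof -
      have "N M 0 * N M n \<le> (exp (real t / 2) * N M t) * (exp ((real n - real t') / 2) * N M t')"
        using Npos[OF M] by (intro mult_mono N0 Nn that) (auto simp: less_imp_le)
      then have "exp ((real t' - real t) / 2) * (N M 0 * N M n) \<le> exp ((real t' - real t) / 2) * ((exp (real t / 2) * N M t) * (exp ((real n - real t') / 2) * N M t'))"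
        by (intro mult_left_mono) auto
      also have "\<dots> = exp ((real t' - real t) / 2 + real t / 2 + (real n - real t') / 2) * (N M t * N M t')" by (simp add: exp_add)
      also have "(real t' - real t) / 2 + real t / 2 + (real n - real t') / 2 = (real n - real 0) / 2" by (simp add: field_simps)
      finally show ?thesis unfolding Q_def q_def using Npos[OF M] by (simp add: divide_simps mult_ac)
    qed
    have qtt: "q M t t = 1 / (N M t)\<^sup>2" for t by (simp add: q_def power2_eq_square)
    have Qvis: "Q \<le> 128 * vis (g k) (inv2 (g k) ** g' k)"
    proof -
      have n4: "exp (real n / 2) \<le> 8 * norm (inv2 (g k) ** g' k)"
      proof -
        have "exp (real n / 2) \<le> exp (s / 2 + 1 / 2)" using s(3) by simp
        also have "\<dots> = exp (s / 2) * exp (1 / 2)" by (rule exp_add)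
        also have "\<dots> \<le> (4 * norm (inv2 (g k) ** g' k)) * 2" using e(1) exp_half_le2 by (intro mult_mono) auto
        finally show ?thesis by simp
      qed
      have gp: "norm (g k) > 0" "norm (g' k) > 0" using norm_ge1[OF det_G[OF g(1), of k]] norm_ge1[OF det_G[OF g(2), of k]] by linarith+
      have N0n: "norm (g k) * norm (g' k) \<le> 16 * (N M 0 * N M n)"
      proof -
        have "norm (g k) * norm (g' k) \<le> (2 * N M 0) * (8 * N M n)" using e(2,3) by (intro mult_mono) (auto simp: N_def)
        then show ?thesis by simp
      qed
      have "exp (real n / 2) * (norm (g k) * norm (g' k)) \<le> (8 * norm (inv2 (g k) ** g' k)) * (16 * (N M 0 * N M n))"
        by (rule mult_mono[OF n4 N0n]) auto
      then have "exp (real n / 2) / (N M 0 * N M n) \<le> 128 * (norm (inv2 (g k) ** g' k) / (norm (g k) * norm (g' k)))"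
        using gp Npos[OF M, of 0] Npos[OF M, of n] by (simp add: divide_simps mult_ac)
      then show ?thesis by (simp add: Q_def q_def vis_def inv2_cancel_left' g)
    qed
    have acc: "cmod (a - c) \<le> K * y powr \<delta>"
      if "cmod (a - b) \<le> D0 * e powr \<delta>" "cmod (b - c) \<le> K * y' powr \<delta>" "0 \<le> e" "e \<le> y" "0 \<le> y'" "y' \<le> y * exp (-1)" for a b c y y' e
    proof -
      have "y' powr \<delta> \<le> (y * exp (-1)) powr \<delta>" using that(5,6) \<delta> by (intro powr_mono2) auto
      also have "\<dots> = exp (- \<delta>) * y powr \<delta>" using that(3,4) by (simp add: powr_mult exp_powr_real mult.commute)
      finally have 1: "K * y' powr \<delta> \<le> K * (exp (- \<delta>) * y powr \<delta>)" using K0 by (rule mult_left_mono)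
      have "e powr \<delta> \<le> y powr \<delta>" using that(3,4) \<delta> by (intro powr_mono2) auto
      then have 2: "D0 * e powr \<delta> \<le> D0 * y powr \<delta>" using D0 by (rule mult_left_mono)
      have "cmod (a - c) \<le> cmod (a - b) + cmod (b - c)" using norm_triangle_ineq[of "a - b" "b - c"] by simp
      also have "\<dots> \<le> D0 * y powr \<delta> + K * (exp (- \<delta>) * y powr \<delta>)" using that(1,2) 1 2 by linarith
      also have "\<dots> = (D0 + K * exp (- \<delta>)) * y powr \<delta>" by (simp add: distrib_right)
      finally show ?thesis unfolding KD .
    qed
    have out: "cmod (orb (v l) - orb (v1 l)) \<le> K * (exp (- real t) / X) powr \<delta>"
      if c: "cls M t v" "cls M t1 v1" "t < t1" for t v t1 v1
    proof (rule chain_backward[OF c, where P = "\<lambda>t v. cmod (orb (v l) - orb (v1 l)) \<le> K * (exp (- real t) / X) powr \<delta>"])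
      show "cmod (orb (v1 l) - orb (v1 l)) \<le> K * (exp (- real t1) / X) powr \<delta>" using K0 by simp
      fix t v t' v' assume a: "csc M t t'" "cls M t v" "cls M t' v'" "cmod (orb (v' l) - orb (v1 l)) \<le> K * (exp (- real t') / X) powr \<delta>"
      have "real t + 1 \<le> real t'" using a(1) by (auto simp: consec_def)
      then have "exp (- real t') \<le> exp (- real t) * exp (-1)" by (simp add: exp_add[symmetric])
      then have "exp (- real t') / X \<le> exp (- real t) / X * exp (-1)" using XZ0 by (simp add: divide_right_mono)
      with XZ0 show "cmod (orb (v l) - orb (v1 l)) \<le> K * (exp (- real t) / X) powr \<delta>"
        by (intro acc[OF step[OF M a(1-3)] a(4) q0 qX]) simp_all
    qed
    have inn: "cmod (orb (v0 l) - orb (v l)) \<le> K * (exp (real t) / Z) powr \<delta>"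
      if c: "cls M t0 v0" "cls M t v" "t0 < t" for t v t0 v0
    proof (rule chain_forward[OF c, where P = "\<lambda>t v. cmod (orb (v0 l) - orb (v l)) \<le> K * (exp (real t) / Z) powr \<delta>"])
      show "cmod (orb (v0 l) - orb (v0 l)) \<le> K * (exp (real t0) / Z) powr \<delta>" using K0 by simp
      fix t v t' v' assume a: "csc M t t'" "cls M t v" "cls M t' v'" "cmod (orb (v0 l) - orb (v l)) \<le> K * (exp (real t) / Z) powr \<delta>"
      have "real t + 1 \<le> real t'" using a(1) by (auto simp: consec_def)
      then have "exp (real t) \<le> exp (real t') * exp (-1)" by (simp add: exp_add[symmetric])
      then have "exp (real t) / Z \<le> exp (real t') / Z * exp (-1)" using XZ0 by (simp add: divide_right_mono)
      with XZ0 show "cmod (orb (v0 l) - orb (v' l)) \<le> K * (exp (real t') / Z) powr \<delta>"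
        using step[OF M a(1-3)] a(4)
        unfolding norm_minus_commute[of "orb (v0 l)"] norm_minus_commute[of "orb (v l)" "orb (v' l)"]
        by (intro acc[OF _ _ q0 qZ]) simp_all
    qed
    have Q0: "Q \<ge> 0" unfolding Q_def by (rule q0)
    have two: "K * y powr \<delta> \<le> K * 2 powr \<delta> * Q powr \<delta>" if "0 \<le> y" "y \<le> 2 * Q" for y
    proof -
      have "y powr \<delta> \<le> (2 * Q) powr \<delta>" using that \<delta> by (intro powr_mono2) auto
      also have "\<dots> = 2 powr \<delta> * Q powr \<delta>" using Q0 by (simp add: powr_mult)
      finally have "K * y powr \<delta> \<le> K * (2 powr \<delta> * Q powr \<delta>)" using K0 by (rule mult_left_mono)
      then show ?thesis by simp
    qed
    have half: "1 / y \<le> 2 * Q" if "(N M t)\<^sup>2 \<le> 2 * y" "y > 0" "t \<le> n" for y t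
    proof -
      have "2 * (1 / (2 * y)) \<le> 2 * (1 / (N M t)\<^sup>2)" using that Npos[OF M, of t] by (intro mult_left_mono divide_left_mono) auto
      moreover have "1 / (N M t)\<^sup>2 \<le> Q" using qQ[OF that(3), of t] unfolding qtt .
      ultimately show ?thesis by simp
    qed
    have outQ: "exp (- real t) / X \<le> 2 * Q" if "exp (- real t) * Z \<le> exp (real t) * X" "t \<le> n" for t
    proof -
      have "1 / (exp (real t) * X) \<le> 2 * Q" by (rule half[OF _ _ that(2)]) (use that(1) XZ0 in \<open>simp_all add: Nsq mult.commute\<close>)
      then show ?thesis by (simp add: exp_minus field_simps)
    qed
    have inQ: "exp (real t) / Z \<le> 2 * Q" if "exp (real t) * X \<le> exp (- real t) * Z" "t \<le> n" for t
    proof -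
      have "1 / (exp (- real t) * Z) \<le> 2 * Q" by (rule half[OF _ _ that(2)]) (use that(1) XZ0 in \<open>simp_all add: Nsq mult.commute\<close>)
      then show ?thesis by (simp add: exp_minus field_simps)
    qed
    define B where "B = Q powr \<delta>"
    have B0: "B \<ge> 0" by (simp add: B_def)
    have KB: "K * 2 powr \<delta> * B \<ge> 0" "D0 * B \<ge> 0" using K0 D0 B0 by simp_all
    have outB: "cmod (orb (v l) - orb (g' l)) \<le> K * 2 powr \<delta> * B"
      if "cls M t v" "t < n" "exp (- real t) * Z \<le> exp (real t) * X" for t v
      unfolding B_def using out[OF that(1) c(2) that(2)] two[OF _ outQ[OF that(3)]] that(2) XZ0 by fastforce
    have inB: "cmod (orb (g l) - orb (v l)) \<le> K * 2 powr \<delta> * B"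
      if "cls M t v" "0 < t" "t \<le> n" "exp (real t) * X \<le> exp (- real t) * Z" for t v
      unfolding B_def using inn[OF c(1) that(1,2)] two[OF _ inQ[OF that(4,3)]] XZ0 by fastforce
    have stepB: "cmod (orb (v l) - orb (v' l)) \<le> D0 * B"
      if "csc M t t'" "cls M t v" "cls M t' v'" "t' \<le> n" for t t' v v'
    proof -
      have "q M t t' powr \<delta> \<le> B" unfolding B_def using qQ[OF that(4)] q0 \<delta> by (intro powr_mono2) auto
      then have "D0 * q M t t' powr \<delta> \<le> D0 * B" using D0 by (rule mult_left_mono)
      then show ?thesis using step[OF M that(1-3)] by linarith
    qed
    have main: "cmod (orb (g l) - orb (g' l)) \<le> (K * 2 powr \<delta> + D0 + K * 2 powr \<delta>) * B"
    proof (cases "exp (real 0) * X \<le> exp (- real 0) * Z")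
      case False
      then have "cmod (orb (g l) - orb (g' l)) \<le> K * 2 powr \<delta> * B" by (intro outB[OF c(1) c(3)]) simp
      then show ?thesis using KB unfolding distrib_right by linarith
    next
      case True
      \<comment> \<open>The close times up to the turning point, where exp t X = exp (- t) Z. Up to
        the last of them \<open>inn\<close> applies, from the next close time on \<open>out\<close>,
        and the single jump in between is bounded by \<open>qQ\<close>.\<close>
      define T where "T = {t. t \<le> n \<and> (\<exists>v. cls M t v) \<and> exp (real t) * X \<le> exp (- real t) * Z}"
      have fT: "finite T" unfolding T_def by (rule finite_subset[of _ "{..n}"]) auto
      have T0: "0 \<in> T" using True c(1) by (auto simp: T_def)
      define t where "t = Max T"
      have tT: "t \<in> T" unfolding t_def using fT T0 by (intro Max_in) auto
      have tM: "s \<le> t" if "s \<in> T" for s unfolding t_def using fT that by (rule Max_ge)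
      have t: "t \<le> n" "exp (real t) * X \<le> exp (- real t) * Z" using tT by (auto simp: T_def)
      obtain v where v: "cls M t v" "t = 0 \<longrightarrow> v = g" "t = n \<longrightarrow> v = g'"
      proof -
        obtain v0 where "cls M t v0" using tT by (auto simp: T_def)
        then show thesis using that[of g] that[of g'] that[of v0] c by (cases "t = 0"; cases "t = n") auto
      qed
      have i: "cmod (orb (g l) - orb (v l)) \<le> K * 2 powr \<delta> * B"
      proof (cases "t = 0")
        case True then show ?thesis using v(2) KB by simp
      next
        case False then show ?thesis using inB[OF v(1) _ t] by simp
      qed
      show ?thesis
      proof (cases "t = n")
        case True
        then have "cmod (orb (g l) - orb (g' l)) \<le> K * 2 powr \<delta> * B" using i v(3) by simp
        then show ?thesis using KB unfolding distrib_right by linarith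
      next
        case False
        then have tn: "t < n" using t(1) by simp
        obtain t' v' where t': "t < t'" "t' \<le> n" "cls M t' v'" "t' = n \<longrightarrow> v' = g'" "csc M t t'" using next_close[OF v(1) c(2) tn] .
        have st: "cmod (orb (v l) - orb (v' l)) \<le> D0 * B" by (rule stepB[OF t'(5) v(1) t'(3,2)])
        have o: "cmod (orb (v' l) - orb (g' l)) \<le> K * 2 powr \<delta> * B"
        proof (cases "t' = n")
          case True then show ?thesis using t'(4) KB by simp
        next
          case False
          have "t' \<notin> T" using tM[of t'] t'(1) by auto
          then have "exp (- real t') * Z \<le> exp (real t') * X" using t'(2,3) unfolding T_def by auto
          then show ?thesis using outB[OF t'(3)] False t'(2) by simp
        qed
        have "cmod (orb (g l) - orb (g' l)) \<le> cmod (orb (g l) - orb (v l)) + (cmod (orb (v l) - orb (v' l)) + cmod (orb (v' l) - orb (g' l)))"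
          using norm_triangle_ineq[of "orb (g l) - orb (v l)" "orb (v l) - orb (g' l)"]
            norm_triangle_ineq[of "orb (v l) - orb (v' l)" "orb (v' l) - orb (g' l)"] by simp
        then show ?thesis using i st o unfolding distrib_right by linarith
      qed
    qed
    have "B \<le> (128 * vis (g k) (inv2 (g k) ** g' k)) powr \<delta>" unfolding B_def using Qvis Q0 \<delta> by (intro powr_mono2) auto
    also have "\<dots> = 128 powr \<delta> * vis (g k) (inv2 (g k) ** g' k) powr \<delta>" by (simp add: powr_mult vis_nonneg)
    finally have "(K * 2 powr \<delta> + D0 + K * 2 powr \<delta>) * B \<le> (K * 2 powr \<delta> + D0 + K * 2 powr \<delta>) * (128 powr \<delta> * vis (g k) (inv2 (g k) ** g' k) powr \<delta>)"
      using K0 D0 by (intro mult_left_mono) auto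
    then show ?thesis using main by (simp only: mult.assoc)
  qed
  then show ?thesis using \<delta> by blast
qed

end

section \<open>The Furstenberg limit set\<close>

lemma compact_torus: "compact (torus r)"
proof -
  let ?S = "\<lambda>i. if i < r then sphere (0::complex) 1 else {0}"
  have "torus r = PiE UNIV ?S"
  proof (rule set_eqI)
    fix f
    have "f \<in> torus r \<longleftrightarrow> (\<forall>i. f i \<in> ?S i)" unfolding torus_def mem_Collect_eq
    proof (intro iffI allI conjI impI)
      fix i assume "(\<forall>i<r. f i \<in> sphere 0 1) \<and> (\<forall>i\<ge>r. f i = 0)"
      then show "f i \<in> ?S i" by (cases "i < r") auto
    next
      fix i assume f: "\<forall>i. f i \<in> ?S i" "i < r"
      then show "f i \<in> sphere 0 1" using f(1)[rule_format, of i] by simp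
    next
      fix i assume f: "\<forall>i. f i \<in> ?S i" "r \<le> i"
      then show "f i = 0" using f(1)[rule_format, of i] by simp
    qed
    then show "f \<in> torus r \<longleftrightarrow> f \<in> PiE UNIV ?S" unfolding PiE_UNIV_domain Pi_iff by simp
  qed
  moreover have "compactin (product_topology (\<lambda>i. euclidean) UNIV) (PiE UNIV ?S)"
    unfolding compactin_PiE by simp
  ultimately show ?thesis unfolding euclidean_product_topology by simp
qed

lemma tendsto_coordinate:
  fixes x :: "nat \<Rightarrow> nat \<Rightarrow> complex"
  assumes "x \<longlonglongrightarrow> l" shows "(\<lambda>n. x n i) \<longlonglongrightarrow> l i"
  using continuous_on_tendsto_compose[OF continuous_on_product_coordinates assms] by simp

lemma compact_lam: "compact (lam r G)"
proof -
  have "closed (lam r G)"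
    unfolding closed_sequential_limits
  proof (intro allI impI, elim conjE)
    fix x l assume x: "\<forall>n. x n \<in> lam r G" "x \<longlonglongrightarrow> l"
    have c: "(\<lambda>n. x n i) \<longlonglongrightarrow> l i" for i by (rule tendsto_coordinate[OF x(2)])
    have "closed (torus r)" by (rule compact_imp_closed[OF compact_torus])
    then have "l \<in> torus r" using x unfolding closed_sequential_limits lam_def by blast
    then show "l \<in> lam r G"
    proof (rule lam_approx)
      fix e :: real assume "e > 0"
      then have "\<forall>\<^sub>F n in sequentially. \<forall>i<r. cmod (x n i - l i) < e"
        using c by (intro eventually_all_less) (auto simp: tendsto_iff dist_norm)
      then obtain n where "\<forall>i<r. cmod (x n i - l i) < e" using eventually_happens[of _ sequentially] by auto
      then show "\<exists>\<eta>\<in>lam r G. \<forall>i<r. cmod (\<eta> i - l i) < e" using x(1) by blast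
    qed
  qed
  moreover have "lam r G = torus r \<inter> lam r G" by (auto simp: lam_def)
  ultimately show ?thesis using compact_Int_closed[OF compact_torus] by metis
qed

context zgroup
begin

lemma lam_accumulation:
  assumes g: "\<And>n. g n \<in> \<Gamma>" "\<And>i. i < r \<Longrightarrow> filterlim (\<lambda>n. norm (g n i)) at_top sequentially"
  obtains s \<zeta> where "strict_mono s" "\<zeta> \<in> lam r \<Gamma>" "\<And>i. i < r \<Longrightarrow> (\<lambda>n. orb (g (s n) i)) \<longlonglongrightarrow> \<zeta> i"
proof -
  have "bounded (range (\<lambda>n. orb (g n i)))" for i
    using cmod_orb_less1[OF det_G[OF g(1)]] by (intro boundedI[of _ 1]) (auto intro: less_imp_le)
  then obtain s l where s: "strict_mono s" and l: "\<forall>i<r. (\<lambda>n. orb (g (s n) i)) \<longlonglongrightarrow> l i"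
    using subseq_tendsto_finite[of r "\<lambda>n i. orb (g n i)"] by blast
  define \<zeta> where "\<zeta> i = (if i < r then l i else 0)" for i
  have \<zeta>: "(\<lambda>n. orb (g (s n) i)) \<longlonglongrightarrow> \<zeta> i" if "i < r" for i using l that by (simp add: \<zeta>_def)
  have "cmod (\<zeta> i) = 1" if i: "i < r" for i
    by (rule norm_limit_circle[OF _ filterlim_compose[OF g(2)[OF i] filterlim_subseq[OF s]] \<zeta>[OF i]]) (simp add: g)
  then have "\<zeta> \<in> torus r" by (simp add: torus_def \<zeta>_def)
  then have "\<zeta> \<in> lam r \<Gamma>" unfolding lam_seq using g(1) \<zeta> by (intro conjI exI[of _ "\<lambda>n. g (s n)"]) auto
  then show thesis using that s \<zeta> by blast
qed

lemma lam_nonempty: "\<exists>\<xi>. \<xi> \<in> lam r \<Gamma>"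
proof -
  obtain g where g: "\<forall>n. g n \<in> \<Gamma>" "\<forall>i<r. filterlim (\<lambda>n. norm (g n i)) at_top sequentially" using ex_unbounded_all by blast
  obtain s \<zeta> where "\<zeta> \<in> lam r \<Gamma>" by (rule lam_accumulation[of g]) (use g in auto)
  then show ?thesis by blast
qed

text \<open>Elements approximating x in component j may be bounded elsewhere. Multiplying on the
  right by f and by a sequence unbounded in all components repairs this without changing the limit
  in component j.\<close>

lemma lam_over_limset:
  assumes j: "j < r" and x: "x \<in> limset (proj j \<Gamma>)"
  shows "\<exists>\<zeta>\<in>lam r \<Gamma>. \<zeta> j = x"
proof -
  have x1: "cmod x = 1" and "x \<in> closure (orb ` proj j \<Gamma>)" using x by (auto simp: limset_def)
  then obtain y where y: "\<forall>n. y n \<in> orb ` proj j \<Gamma>" "y \<longlonglongrightarrow> x" unfolding closure_sequential by blast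
  have "\<forall>n. \<exists>g. g \<in> \<Gamma> \<and> y n = orb (g j)" using y(1) by (auto simp: proj_def)
  from choice[OF this] obtain g where g: "\<forall>n. g n \<in> \<Gamma> \<and> y n = orb (g n j)" ..
  then have gG: "g n \<in> \<Gamma>" for n by simp
  have "y = (\<lambda>n. orb (g n j))" using g by auto
  then have go: "(\<lambda>n. orb (g n j)) \<longlonglongrightarrow> x" using y(2) by simp
  obtain h where h: "\<forall>n. h n \<in> \<Gamma>" "\<forall>i<r. filterlim (\<lambda>n. norm (h n i)) at_top sequentially" using ex_unbounded_all by blast
  have hG: "h n \<in> \<Gamma>" for n using h(1) by simp
  obtain f s c where f: "f \<in> \<Gamma>" "strict_mono (s :: nat \<Rightarrow> nat)" "c > 0"
    "\<And>n m i. i < r \<Longrightarrow> norm (g (s n) i ** f i ** h (s m) i) \<ge> c * (norm (g (s n) i) * norm (h (s m) i))"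
    by (rule combine[of g h, OF gG hG]) (rule that)
  define u where "u n i = g (s n) i ** f i ** h (s n) i" for n i
  have uG: "u n \<in> \<Gamma>" for n unfolding u_def[abs_def] by (intro mult_G gG hG f(1))
  have n1: "1 \<le> norm (g n i)" "1 \<le> norm (h n i)" for n i using norm_ge1[OF det_G[OF gG]] norm_ge1[OF det_G[OF hG]] by auto
  have un: "filterlim (\<lambda>n. norm (u n i)) at_top sequentially" if i: "i < r" for i
  proof (rule filterlim_at_top_mono[OF _ always_eventually])
    have "filterlim (\<lambda>n. norm (h (s n) i)) at_top sequentially"
      using h(2) i by (intro filterlim_compose[OF _ filterlim_subseq[OF f(2)]]) auto
    then show "filterlim (\<lambda>n. c * norm (h (s n) i)) at_top sequentially"
      by (rule filterlim_tendsto_pos_mult_at_top[OF tendsto_const f(3)])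
    show "\<forall>n. c * norm (h (s n) i) \<le> norm (u n i)"
    proof
      fix n
      have "1 * norm (h (s n) i) \<le> norm (g (s n) i) * norm (h (s n) i)" by (intro mult_right_mono n1) simp
      then have "c * norm (h (s n) i) \<le> c * (norm (g (s n) i) * norm (h (s n) i))" using f(3) by (intro mult_left_mono) auto
      then show "c * norm (h (s n) i) \<le> norm (u n i)" using f(4)[OF i, of n n] unfolding u_def by linarith
    qed
  qed
  have gs: "(\<lambda>n. orb (g (s n) j)) \<longlonglongrightarrow> x" using LIMSEQ_subseq_LIMSEQ[OF go f(2)] by (simp add: o_def)
  have gn: "filterlim (\<lambda>n. norm (g (s n) j)) at_top sequentially"
    by (rule orb_limit_circle_at_top[OF _ gs x1]) (simp add: gG)
  have diff: "(\<lambda>n. orb (g (s n) j) - orb (u n j)) \<longlonglongrightarrow> 0"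
  proof (rule Lim_null_comparison[OF always_eventually])
    show "\<forall>n. cmod (orb (g (s n) j) - orb (u n j)) \<le> (4 * norm (f j) / c) / norm (g (s n) j)"
      unfolding u_def by (intro allI orb_product_diff f(4) j f(3) det_G gG f(1) hG)
    show "(\<lambda>n. (4 * norm (f j) / c) / norm (g (s n) j)) \<longlonglongrightarrow> 0"
      by (intro tendsto_divide_0[OF tendsto_const] filterlim_at_top_imp_at_infinity gn)
  qed
  have uo: "(\<lambda>n. orb (u n j)) \<longlonglongrightarrow> x" using tendsto_diff[OF gs diff] by simp
  obtain s' \<zeta> where \<zeta>: "strict_mono s'" "\<zeta> \<in> lam r \<Gamma>" "\<And>i. i < r \<Longrightarrow> (\<lambda>n. orb (u (s' n) i)) \<longlonglongrightarrow> \<zeta> i"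
    by (rule lam_accumulation[of u, OF uG un]) (assumption | rule that)+
  have "(\<lambda>n. orb (u (s' n) j)) \<longlonglongrightarrow> x" using LIMSEQ_subseq_LIMSEQ[OF uo \<zeta>(1)] by (simp add: o_def)
  then have "\<zeta> j = x" using LIMSEQ_unique[OF \<zeta>(3)[OF j]] by simp
  then show ?thesis using \<zeta>(2) by blast
qed

end

context agroup
begin

text \<open>The chain group at l supplies the comparison of norms, the one at j the Hoelder
  estimate. If the j-th coordinates agree, \<open>vis\<close> tends to 0 along approximating
  sequences, and so does the distance in component l.\<close>

lemma lam_discrete_determined:
  assumes fg: "fin_gen r \<Gamma>" and jl: "j < r" "l < r" and dj: "discrete_grp (proj j \<Gamma>)" and dl: "discrete_grp (proj l \<Gamma>)"
    and \<xi>: "\<xi> \<in> lam r \<Gamma>" "\<xi>' \<in> lam r \<Gamma>" and eq: "\<xi> j = \<xi>' j"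
  shows "\<xi> l = \<xi>' l"
proof -
  obtain R L where J: "chain_group r \<Gamma> j R L" using ex_chain_group[OF fg jl(1) dj] by blast
  obtain R' L' where L: "chain_group r \<Gamma> l R' L'" using ex_chain_group[OF fg jl(2) dl] by blast
  obtain C p where C: "C > 0" "\<forall>g\<in>\<Gamma>. norm (g j) \<le> C * norm (g l) ^ p" using chain_group.norm_comparison[OF L jl(1)] by blast
  have comp: "norm (g j) \<le> C * norm (g l) ^ p" if "g \<in> \<Gamma>" for g using C(2) that by blast
  obtain D \<delta> where D: "\<delta> > 0" "\<forall>g\<in>\<Gamma>. \<forall>g'\<in>\<Gamma>. cmod (orb (g l) - orb (g' l)) \<le> D * vis (g j) (inv2 (g j) ** g' j) powr \<delta>"
    using chain_group.hoelder[OF J jl(2) dl C(1) comp] by blast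
  obtain g where g: "\<forall>n. g n \<in> \<Gamma>" "\<forall>i<r. (\<lambda>n. orb (g n i)) \<longlonglongrightarrow> \<xi> i" and t: "\<xi> \<in> torus r" using \<xi>(1) unfolding lam_seq by blast
  obtain g' where g': "\<forall>n. g' n \<in> \<Gamma>" "\<forall>i<r. (\<lambda>n. orb (g' n i)) \<longlonglongrightarrow> \<xi>' i" using \<xi>(2) unfolding lam_seq by blast
  have gG: "g n \<in> \<Gamma>" "g' n \<in> \<Gamma>" for n using g(1) g'(1) by simp_all
  have o: "(\<lambda>n. orb (g n i)) \<longlonglongrightarrow> \<xi> i" "(\<lambda>n. orb (g' n i)) \<longlonglongrightarrow> \<xi>' i" if "i < r" for i using g(2) g'(2) that by simp_all
  have n1: "1 \<le> norm (g n j)" "1 \<le> norm (g' n j)" for n using norm_ge1[OF det_G[OF gG(1)]] norm_ge1[OF det_G[OF gG(2)]] by auto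
  have gn: "filterlim (\<lambda>n. norm (g n j)) at_top sequentially"
    by (rule orb_limit_circle_at_top[OF _ o(1)[OF jl(1)] torus_norm[OF t jl(1)]]) (simp add: gG)
  define V where "V n = vis (g n j) (inv2 (g n j) ** g' n j)" for n
  have "V \<longlonglongrightarrow> 0"
  proof (rule Lim_null_comparison[OF always_eventually])
    show "\<forall>n. norm (V n) \<le> 2 * cmod (orb (g n j) - orb (g' n j)) + 2 / norm (g n j)"
    proof
      fix n
      have "2 / (norm (g n j) * norm (g' n j)) \<le> 2 / (norm (g n j) * 1)"
      proof (intro divide_left_mono mult_left_mono n1)
        have "norm (g n j) > 0" "norm (g' n j) > 0" using n1[of n] by linarith+
        then show "0 < norm (g n j) * norm (g' n j) * (norm (g n j) * 1)" by simp
      qed simp_all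
      moreover have "V n \<le> 2 * cmod (orb (g n j) - orb (g' n j)) + 2 / (norm (g n j) * norm (g' n j))"
        unfolding V_def by (rule vis_le_orb_diff) (simp_all add: gG)
      moreover have "V n \<ge> 0" by (simp add: V_def vis_nonneg)
      ultimately show "norm (V n) \<le> 2 * cmod (orb (g n j) - orb (g' n j)) + 2 / norm (g n j)" by simp
    qed
    have "(\<lambda>n. 2 * cmod (orb (g n j) - orb (g' n j)) + 2 / norm (g n j)) \<longlonglongrightarrow> 2 * cmod (\<xi> j - \<xi>' j) + 0"
      by (intro tendsto_intros o jl(1) tendsto_divide_0[OF tendsto_const] filterlim_at_top_imp_at_infinity gn)
    then show "(\<lambda>n. 2 * cmod (orb (g n j) - orb (g' n j)) + 2 / norm (g n j)) \<longlonglongrightarrow> 0" using eq by simp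
  qed
  then have "(\<lambda>n. V n powr \<delta>) \<longlonglongrightarrow> 0"
    by (rule tendsto_zero_powrI[OF _ tendsto_const]) (auto simp: V_def vis_nonneg D(1) intro: always_eventually)
  then have z: "(\<lambda>n. D * V n powr \<delta>) \<longlonglongrightarrow> 0" by (rule tendsto_mult_right_zero)
  have "(\<lambda>n. orb (g n l) - orb (g' n l)) \<longlonglongrightarrow> 0"
    by (rule Lim_null_comparison[OF always_eventually z]) (use D(2) gG in \<open>simp add: V_def\<close>)
  moreover have "(\<lambda>n. orb (g n l) - orb (g' n l)) \<longlonglongrightarrow> \<xi> l - \<xi>' l" by (intro tendsto_diff o jl(2))
  ultimately show ?thesis using LIMSEQ_unique by fastforce
qed

lemma lam_saturated_set:
  assumes "finite J" "J \<subseteq> {i. i < r \<and> \<not> discrete_grp (proj i \<Gamma>)}" "\<xi> \<in> lam r \<Gamma>" "\<And>i. i \<in> J \<Longrightarrow> cmod (\<eta> i) = 1"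
  shows "(\<lambda>i. if i \<in> J then \<eta> i else \<xi> i) \<in> lam r \<Gamma>"
  using assms
proof (induction J rule: finite_induct)
  case empty
  then show ?case by simp
next
  case (insert a J)
  let ?z = "\<lambda>i. if i \<in> J then \<eta> i else \<xi> i"
  have "?z \<in> lam r \<Gamma>" using insert by auto
  then have "?z(a := \<eta> a) \<in> lam r \<Gamma>" using insert.prems by (intro lam_saturated) auto
  moreover have "?z(a := \<eta> a) = (\<lambda>i. if i \<in> insert a J then \<eta> i else \<xi> i)" by auto
  ultimately show ?case by simp
qed

lemma lam_full:
  assumes "\<And>i. i < r \<Longrightarrow> \<not> discrete_grp (proj i \<Gamma>)"
  shows "lam r \<Gamma> = torus r"
proof
  show "lam r \<Gamma> \<subseteq> torus r" by (auto simp: lam_def)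
  show "torus r \<subseteq> lam r \<Gamma>"
  proof
    fix \<eta> assume \<eta>: "\<eta> \<in> torus r"
    obtain \<xi> where \<xi>: "\<xi> \<in> lam r \<Gamma>" using lam_nonempty by blast
    have "(\<lambda>i. if i \<in> {..<r} then \<eta> i else \<xi> i) \<in> lam r \<Gamma>"
      using assms by (intro lam_saturated_set \<xi>) (auto intro: torus_norm[OF \<eta>])
    moreover have "(\<lambda>i. if i \<in> {..<r} then \<eta> i else \<xi> i) = \<eta>" using \<eta> \<xi> by (auto simp: lam_def torus_def)
    ultimately show "\<eta> \<in> lam r \<Gamma>" by simp
  qed
qed

lemma lam_homeomorphic:
  assumes fg: "fin_gen r \<Gamma>" and j: "j < r" and dj: "discrete_grp (proj j \<Gamma>)"
  shows "lam r \<Gamma> homeomorphic (limset (proj j \<Gamma>) \<times> torus (card {i. i < r \<and> \<not> discrete_grp (proj i \<Gamma>)}))"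
proof -
  define Nd where "Nd = {i. i < r \<and> \<not> discrete_grp (proj i \<Gamma>)}"
  have fN: "finite Nd" unfolding Nd_def by simp
  define m where "m = card Nd"
  obtain e where e: "bij_betw e {0..<m} Nd" unfolding m_def using ex_bij_betw_nat_finite[OF fN] by blast
  have eN: "e i \<in> Nd" if "i < m" for i using e that by (auto simp: bij_betw_def)
  have er: "e i < r" if "i < m" for i using eN[OF that] by (simp add: Nd_def)
  \<comment> \<open>The non-discrete coordinates are renumbered by e; the zeros match the convention
    of \<open>torus\<close>.\<close>
  define \<Psi> where "\<Psi> \<xi> = (\<xi> j, \<lambda>i. if i < m then \<xi> (e i) else (0::complex))" for \<xi> :: "nat \<Rightarrow> complex"
  have coord: "continuous_on S (\<lambda>\<xi>::nat \<Rightarrow> complex. \<xi> i)" for S i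
    by (rule continuous_on_subset[OF continuous_on_product_coordinates]) simp
  have "continuous_on (lam r \<Gamma>) \<Psi>"
    unfolding \<Psi>_def
  proof (intro continuous_on_Pair coord continuous_on_coordinatewise_then_product)
    fix i show "continuous_on (lam r \<Gamma>) (\<lambda>\<xi>. if i < m then \<xi> (e i) else 0)" by (cases "i < m") (simp_all add: coord)
  qed
  moreover have "\<Psi> ` lam r \<Gamma> = limset (proj j \<Gamma>) \<times> torus m"
  proof (intro subset_antisym subsetI)
    fix z assume "z \<in> \<Psi> ` lam r \<Gamma>"
    then obtain \<xi> where \<xi>: "\<xi> \<in> lam r \<Gamma>" "z = \<Psi> \<xi>" by blast
    obtain g where t: "\<xi> \<in> torus r" and g: "\<forall>n. g n \<in> \<Gamma>" "\<forall>i<r. (\<lambda>n. orb (g n i)) \<longlonglongrightarrow> \<xi> i" using \<xi>(1) unfolding lam_seq by blast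
    have "\<xi> j \<in> closure (orb ` proj j \<Gamma>)"
      unfolding closure_sequential using g j by (intro exI[of _ "\<lambda>n. orb (g n j)"]) (auto simp: proj_def)
    then have "\<xi> j \<in> limset (proj j \<Gamma>)" using torus_norm[OF t j] by (simp add: limset_def)
    moreover have "(\<lambda>i. if i < m then \<xi> (e i) else 0) \<in> torus m" using torus_norm[OF t er] by (simp add: torus_def)
    ultimately show "z \<in> limset (proj j \<Gamma>) \<times> torus m" by (simp add: \<xi>(2) \<Psi>_def)
  next
    fix z assume z: "z \<in> limset (proj j \<Gamma>) \<times> torus m"
    obtain x y where xy: "z = (x, y)" by (cases z)
    have x: "x \<in> limset (proj j \<Gamma>)" and y: "y \<in> torus m" using z xy by auto
    \<comment> \<open>The lift of x has uncontrolled non-discrete coordinates, which saturation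
      replaces by those of y. The index j is discrete, so x is kept.\<close>
    obtain \<zeta> where \<zeta>: "\<zeta> \<in> lam r \<Gamma>" "\<zeta> j = x" using lam_over_limset[OF j x] by blast
    define \<eta> where "\<eta> i = y (inv_into {0..<m} e i)" for i
    have inv: "inv_into {0..<m} e i < m" if "i \<in> Nd" for i
      using bij_betwE[OF bij_betw_inv_into[OF e]] that by auto
    have e1: "cmod (\<eta> i) = 1" if "i \<in> Nd" for i unfolding \<eta>_def by (rule torus_norm[OF y inv[OF that]])
    define \<xi> where "\<xi> i = (if i \<in> Nd then \<eta> i else \<zeta> i)" for i
    have "(\<lambda>i. if i \<in> Nd then \<eta> i else \<zeta> i) \<in> lam r \<Gamma>"
      by (rule lam_saturated_set[OF fN _ \<zeta>(1) e1]) (simp_all add: Nd_def)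
    then have "\<xi> \<in> lam r \<Gamma>" by (simp add: \<xi>_def[abs_def])
    moreover have "\<Psi> \<xi> = z"
    proof -
      have "\<xi> j = x" using dj \<zeta>(2) by (simp add: \<xi>_def Nd_def)
      moreover have "(if i < m then \<xi> (e i) else 0) = y i" for i
      proof (cases "i < m")
        case True
        have "inv_into {0..<m} e (e i) = i" using bij_betw_inv_into_left[OF e] True by simp
        then show ?thesis using True eN[OF True] by (simp add: \<xi>_def \<eta>_def)
      next
        case False
        then show ?thesis using y by (simp add: torus_def)
      qed
      ultimately show ?thesis by (simp add: \<Psi>_def xy fun_eq_iff)
    qed
    ultimately show "z \<in> \<Psi> ` lam r \<Gamma>" by blast
  qed
  moreover have "inj_on \<Psi> (lam r \<Gamma>)"
  proof (rule inj_onI)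
    fix \<xi> \<xi>' assume \<xi>: "\<xi> \<in> lam r \<Gamma>" "\<xi>' \<in> lam r \<Gamma>" "\<Psi> \<xi> = \<Psi> \<xi>'"
    have ej: "\<xi> j = \<xi>' j" using arg_cong[OF \<xi>(3), of fst] by (simp add: \<Psi>_def)
    have ee: "\<xi> (e i) = \<xi>' (e i)" if "i < m" for i
      using fun_cong[OF arg_cong[OF \<xi>(3), of snd], of i] that unfolding \<Psi>_def snd_conv by simp
    have "\<xi> i = \<xi>' i" for i
    proof -
      consider "i \<ge> r" | "i \<in> Nd" | "i < r" "discrete_grp (proj i \<Gamma>)" unfolding Nd_def by force
      then show ?thesis
      proof cases
        case 1
        then show ?thesis using \<xi>(1,2) by (simp add: lam_def torus_def)
      next
        case 2
        then obtain a where "a < m" "i = e a" using bij_betw_imp_surj_on[OF e] by auto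
        then show ?thesis using ee[of a] by simp
      next
        case 3
        show ?thesis by (rule lam_discrete_determined[OF fg j 3(1) dj 3(2) \<xi>(1,2) ej])
      qed
    qed
    then show "\<xi> = \<xi>'" by (rule ext)
  qed
  ultimately have "lam r \<Gamma> homeomorphic (limset (proj j \<Gamma>) \<times> torus m)"
    by (rule homeomorphic_compact[OF compact_lam])
  then show ?thesis unfolding m_def Nd_def .
qed

end

theorem theorem3p2:
  fixes r :: nat and \<Gamma> :: "(nat \<Rightarrow> mat2) set"
  assumes "r \<ge> 2"
    and "psub r \<Gamma>" and "fin_gen r \<Gamma>" and "zariski_dense r \<Gamma>"
    and "\<exists>\<Delta>. irr_arith r \<Delta> \<and> \<Gamma> \<subseteq> \<Delta>"
  defines "m \<equiv> card {i. i < r \<and> \<not> discrete_grp (proj i \<Gamma>)}"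
  shows "(\<forall>j<r. discrete_grp (proj j \<Gamma>) \<longrightarrow>
            furst_limset r \<Gamma> homeomorphic (limset (proj j \<Gamma>) \<times> torus m)) \<and>
         ((\<forall>i<r. \<not> discrete_grp (proj i \<Gamma>)) \<longrightarrow> furst_limset r \<Gamma> = torus r)"
proof -
  interpret agroup r \<Gamma> by unfold_locales (use assms in auto)
  have "furst_limset r \<Gamma> = lam r \<Gamma>" using furst_subset_lam lam_subset_furst assms(1) by auto
  then show ?thesis using lam_homeomorphic[OF assms(3)] lam_full unfolding m_def by simp
qed

end
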